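(* Consider the ellipsoid-constrained mixed integer quadratic programming problem (E-MIQP) $$\min\ x^{\mathsf T} H x + h^{\mathsf T} x \quad \text{s.t.}\quad (x-c)^{\mathsf T} Q (x-c) \le 1,\quad x \in \mathbb{Z}^p \times \mathbb{R}^{n-p},$$ where $H \in \mathbb{Q}^{n\times n}$ is symmetric, $Q \in \mathbb{Q}^{n \times n}$ is symmetric positive definite, $h, c \in \mathbb{Q}^n$, and $p \in \{0,\dots,n\}$. There is an algorithm which, for any $\epsilon \in (0,1]$, either finds an $\epsilon$-approximate solution to (E-MIQP), or correctly detects that the feasible region is empty. The running time of the algorithm is polynomial in the size of (E-MIQP) and in $1/\epsilon$, provided that the number $p$ of integer variables is fixed.
   Context: For an optimization problem $\inf\{f(x) : x \in \mathcal{S}\}$, let $f_{\inf}$ and $f_{\sup}$ denote the infimum and supremum of $f$ on $\mathcal{S}$. For $\epsilon \in [0,1]$, a point $x^\diamond \in \mathcal{S}$ is an $\epsilon$-approximate solution if $f(x^\diamond) - f_{\inf} \le \epsilon \cdot (f_{\sup} - f_{\inf})$. The size (bit size) of rational numbers, vectors, matrices, constraints, and optimization problems is the standard one in mathematical programming: essentially the number of bits required to encode the object (rationals being encoded by binary numerator and denominator). "Provided that $p$ is fixed" means that $p$ is treated as a constant in the running time bound (the number $n-p$ of continuous variables is not fixed). *)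

theory Defs
  imports Complex_Main "HOL-Library.Log_Nat" "Jordan_Normal_Form.Matrix"
begin

section \<open>Approximate solutions\<close>

text \<open>
  \<open>Inf\<close> and \<open>Sup\<close> on the reals are meaningful only for a nonempty set and a bounded function.
  Here \<open>f\<close> is always a continuous function on a compact ellipsoidal set, and \<open>x \<in> S\<close> makes
  \<open>S\<close> nonempty.
\<close>

definition approx_solution :: "real \<Rightarrow> ('a \<Rightarrow> real) \<Rightarrow> 'a set \<Rightarrow> 'a \<Rightarrow> bool" where
  "approx_solution \<epsilon> f S x \<longleftrightarrow>
     x \<in> S \<and> f x - (INF y\<in>S. f y) \<le> \<epsilon> * ((SUP y\<in>S. f y) - (INF y\<in>S. f y))"


section \<open>Ellipsoid-constrained mixed integer quadratic programs\<close>

abbreviation real_mat :: "rat mat \<Rightarrow> real mat" where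
  "real_mat \<equiv> map_mat real_of_rat"

abbreviation real_vec :: "rat vec \<Rightarrow> real vec" where
  "real_vec \<equiv> map_vec real_of_rat"

definition symmetric_mat :: "'a mat \<Rightarrow> bool" where
  "symmetric_mat A \<longleftrightarrow> transpose_mat A = A"

definition pos_def_mat :: "real mat \<Rightarrow> bool" where
  "pos_def_mat A \<longleftrightarrow>
     (\<forall>x \<in> carrier_vec (dim_row A). x \<noteq> 0\<^sub>v (dim_row A) \<longrightarrow> 0 < x \<bullet> (A *\<^sub>v x))"

text \<open>The first \<open>nints\<close> of the \<open>nvars\<close> variables are the integer ones.\<close>

record emiqp =
  nvars :: nat
  nints :: nat
  obj_mat :: "rat mat"
  obj_vec :: "rat vec"
  ell_mat :: "rat mat"
  ell_center :: "rat vec"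

definition wf_emiqp :: "emiqp \<Rightarrow> bool" where
  "wf_emiqp I \<longleftrightarrow>
     nints I \<le> nvars I \<and>
     obj_mat I \<in> carrier_mat (nvars I) (nvars I) \<and> symmetric_mat (obj_mat I) \<and>
     obj_vec I \<in> carrier_vec (nvars I) \<and>
     ell_mat I \<in> carrier_mat (nvars I) (nvars I) \<and> symmetric_mat (ell_mat I) \<and>
     pos_def_mat (real_mat (ell_mat I)) \<and>
     ell_center I \<in> carrier_vec (nvars I)"

definition objective :: "emiqp \<Rightarrow> real vec \<Rightarrow> real" where
  "objective I x = x \<bullet> (real_mat (obj_mat I) *\<^sub>v x) + real_vec (obj_vec I) \<bullet> x"

definition feasible_set :: "emiqp \<Rightarrow> real vec set" where
  "feasible_set I =
     {x \<in> carrier_vec (nvars I).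
        (\<forall>i < nints I. x $ i \<in> \<int>) \<and>
        (x - real_vec (ell_center I)) \<bullet>
          (real_mat (ell_mat I) *\<^sub>v (x - real_vec (ell_center I))) \<le> 1}"


section \<open>Bit sizes\<close>

text \<open>
  For an integer \<open>k\<close>, \<open>bits k\<close> is the length of the binary expansion of its absolute value,
  i.e. \<open>\<lceil>log 2 (\<bar>k\<bar> + 1)\<rceil>\<close>; the extra 1 in \<open>rat_size\<close> is for the sign. Since
  \<open>quotient_of\<close> is in lowest terms, these are the sizes used by Schrijver.
\<close>

definition bits :: "int \<Rightarrow> nat" where
  "bits k = floorlog 2 (nat \<bar>k\<bar>)"

definition rat_size :: "rat \<Rightarrow> nat" where
  "rat_size r = 1 + bits (fst (quotient_of r)) + bits (snd (quotient_of r))"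

definition vec_size :: "rat vec \<Rightarrow> nat" where
  "vec_size v = dim_vec v + (\<Sum>i < dim_vec v. rat_size (v $ i))"

definition mat_size :: "rat mat \<Rightarrow> nat" where
  "mat_size A = dim_row A * dim_col A +
     (\<Sum>i < dim_row A. \<Sum>j < dim_col A. rat_size (A $$ (i, j)))"

definition emiqp_size :: "emiqp \<Rightarrow> nat" where
  "emiqp_size I = mat_size (obj_mat I) + vec_size (obj_vec I) +
     mat_size (ell_mat I) + vec_size (ell_center I)"


section \<open>Algorithms and their running time\<close>

text \<open>
  Algorithms are programs of a random access machine with integer memory cells, integer addresses
  and the logarithmic cost criterion: every evaluation step is charged for the bit length of the
  integer it produces, so addresses and operands are charged as well. All memory
  cells except finitely many are 0 initially. This machine and the multitape Turing machine simulate
  each other with polynomial overhead.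

  \<open>Div\<close> is floor division, with result 0 for divisor 0.
\<close>

datatype aexp =
    Const int
  | Load aexp
  | Add aexp aexp
  | Sub aexp aexp
  | Mul aexp aexp
  | Div aexp aexp

datatype prog =
    Skip
  | Store aexp aexp
  | Seq prog prog
  | IfPos aexp prog prog
  | WhilePos aexp prog

type_synonym memory = "int \<Rightarrow> int"

fun aval :: "aexp \<Rightarrow> memory \<Rightarrow> int" where
  "aval (Const k) m = k"
| "aval (Load a) m = m (aval a m)"
| "aval (Add a b) m = aval a m + aval b m"
| "aval (Sub a b) m = aval a m - aval b m"
| "aval (Mul a b) m = aval a m * aval b m"
| "aval (Div a b) m = aval a m div aval b m"

fun acost :: "aexp \<Rightarrow> memory \<Rightarrow> nat" where
  "acost (Const k) m = 1 + bits k"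
| "acost (Load a) m = acost a m + 1 + bits (aval (Load a) m)"
| "acost (Add a b) m = acost a m + acost b m + 1 + bits (aval (Add a b) m)"
| "acost (Sub a b) m = acost a m + acost b m + 1 + bits (aval (Sub a b) m)"
| "acost (Mul a b) m = acost a m + acost b m + 1 + bits (aval (Mul a b) m)"
| "acost (Div a b) m = acost a m + acost b m + 1 + bits (aval (Div a b) m)"

text \<open>
  \<open>exec P m t m'\<close>: started in memory \<open>m\<close>, the program \<open>P\<close> halts after time \<open>t\<close> in
  memory \<open>m'\<close>. In \<open>Store a b\<close> the address is \<open>a\<close> and the stored value is \<open>b\<close>; the
  guards of \<open>IfPos\<close> and \<open>WhilePos\<close> test for a positive value.
\<close>

inductive exec :: "prog \<Rightarrow> memory \<Rightarrow> nat \<Rightarrow> memory \<Rightarrow> bool" where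
  Skip: "exec Skip m 1 m"
| Store: "exec (Store a b) m (1 + acost a m + acost b m) (m(aval a m := aval b m))"
| Seq: "exec P m t m' \<Longrightarrow> exec Q m' u m'' \<Longrightarrow> exec (Seq P Q) m (t + u) m''"
| IfTrue: "0 < aval a m \<Longrightarrow> exec P m t m' \<Longrightarrow> exec (IfPos a P Q) m (1 + acost a m + t) m'"
| IfFalse: "\<not> 0 < aval a m \<Longrightarrow> exec Q m t m' \<Longrightarrow> exec (IfPos a P Q) m (1 + acost a m + t) m'"
| WhileFalse: "\<not> 0 < aval a m \<Longrightarrow> exec (WhilePos a P) m (1 + acost a m) m"
| WhileTrue: "0 < aval a m \<Longrightarrow> exec P m t m' \<Longrightarrow> exec (WhilePos a P) m' u m'' \<Longrightarrow>
    exec (WhilePos a P) m (1 + acost a m + t + u) m''"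

inductive_cases SkipE: "exec Skip m t m'"
inductive_cases StoreE: "exec (Store a b) m t m'"
inductive_cases SeqE: "exec (Seq P Q) m t m'"
inductive_cases IfPosE: "exec (IfPos a P Q) m t m'"
inductive_cases WhilePosE: "exec (WhilePos a P) m t m'"

text \<open>Hence the final memory and the running time are functions of the program and its input.\<close>

lemma exec_deterministic:
  assumes "exec P m t m'" and "exec P m u m''"
  shows "u = t \<and> m'' = m'"
  using assms
proof (induction arbitrary: u m'' rule: exec.induct)
  case (Skip m)
  from Skip.prems show ?case by (rule SkipE) simp
next
  case (Store a b m)
  from Store.prems show ?case by (rule StoreE) simp
next
  case (Seq P m t m' Q v m3)
  from Seq.prems show ?case
  proof (rule SeqE)
    fix t1 m1 t2
    assume "u = t1 + t2" and P: "exec P m t1 m1" and Q: "exec Q m1 t2 m''"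
    moreover from Seq.IH(1)[OF P] have "t1 = t" "m1 = m'" by simp_all
    moreover from Q \<open>m1 = m'\<close> have "exec Q m' t2 m''" by simp
    then have "t2 = v \<and> m'' = m3" by (rule Seq.IH(2))
    ultimately show ?thesis by simp
  qed
next
  case (IfTrue a m P t m' Q)
  from IfTrue.prems show ?case
  proof (rule IfPosE)
    fix t1
    assume "u = Suc (acost a m + t1)" and "exec P m t1 m''"
    then show ?thesis using IfTrue.IH[of t1 m''] by simp
  qed (use IfTrue.hyps in simp)
next
  case (IfFalse a m Q t m' P)
  from IfFalse.prems show ?case
  proof (rule IfPosE)
    fix t1
    assume "u = Suc (acost a m + t1)" and "exec Q m t1 m''"
    then show ?thesis using IfFalse.IH[of t1 m''] by simp
  qed (use IfFalse.hyps in simp)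
next
  case (WhileFalse a m P)
  from WhileFalse.prems show ?case
    by (rule WhilePosE) (use WhileFalse.hyps in simp_all)
next
  case (WhileTrue a m P t m' v m3)
  from WhileTrue.prems show ?case
  proof (rule WhilePosE)
    fix t1 m1 t2
    assume "u = Suc (acost a m + t1 + t2)" and P: "exec P m t1 m1"
      and W: "exec (WhilePos a P) m1 t2 m''"
    moreover from WhileTrue.IH(1)[OF P] have "t1 = t" "m1 = m'" by simp_all
    moreover from W \<open>m1 = m'\<close> have "exec (WhilePos a P) m' t2 m''" by simp
    then have "t2 = v \<and> m'' = m3" by (rule WhileTrue.IH(2))
    ultimately show ?thesis by simp
  qed (use WhileTrue.hyps in simp)
qed


section \<open>Input and output conventions\<close>

text \<open>
  A real number cannot be an input, so the accuracy \<open>\<epsilon>\<close> is passed to the algorithm as the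
  integer \<open>\<lceil>1 / \<epsilon>\<rceil>\<close>; the required accuracy is \<open>\<epsilon>\<close> itself. Rationals are passed as
  numerator and (positive) denominator in lowest terms, matrices row by row.
\<close>

definition rat_cells :: "rat \<Rightarrow> int list" where
  "rat_cells r = [fst (quotient_of r), snd (quotient_of r)]"

definition vec_cells :: "rat vec \<Rightarrow> int list" where
  "vec_cells v = concat (map rat_cells (list_of_vec v))"

definition mat_cells :: "rat mat \<Rightarrow> int list" where
  "mat_cells A = concat (map vec_cells (rows A))"

definition input_cells :: "emiqp \<Rightarrow> real \<Rightarrow> int list" where
  "input_cells I \<epsilon> =
     [int (nvars I), int (nints I), \<lceil>1 / \<epsilon>\<rceil>] @
     mat_cells (obj_mat I) @ vec_cells (obj_vec I) @ mat_cells (ell_mat I) @ vec_cells (ell_center I)"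

definition input_memory :: "emiqp \<Rightarrow> real \<Rightarrow> memory" where
  "input_memory I \<epsilon> a =
     (if 0 \<le> a \<and> nat a < length (input_cells I \<epsilon>) then input_cells I \<epsilon> ! nat a else 0)"

text \<open>
  On halting, cell 0 holds 0 to report that the feasible set is empty, and 1 to report that a
  solution was found, whose \<open>i\<close>-th coordinate (counted from 0) then has its numerator in cell
  \<open>2 * i + 1\<close> and its denominator in cell \<open>2 * i + 2\<close>. The fraction need not be reduced.
\<close>

definition output_point :: "nat \<Rightarrow> memory \<Rightarrow> real vec" where
  "output_point n m = vec n (\<lambda>i. real_of_int (m (2 * int i + 1)) / real_of_int (m (2 * int i + 2)))"

definition correct_output :: "emiqp \<Rightarrow> real \<Rightarrow> memory \<Rightarrow> bool" where
  "correct_output I \<epsilon> m \<longleftrightarrow>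
     m 0 = 0 \<and> feasible_set I = {} \<or>
     m 0 = 1 \<and> (\<forall>i < nvars I. 0 < m (2 * int i + 2)) \<and>
       approx_solution \<epsilon> (objective I) (feasible_set I) (output_point (nvars I) m)"

end

theory Submission
 imports Defs "Jordan_Normal_Form.Determinant" "HOL-Library.Function_Algebras"
begin

text \<open>
 The ellipsoid norm makes \<open>\<int>\<^sup>p\<close>, with the continuous variables projected out, a lattice of dimension \<open>p\<close>; let its
 basis be LLL-reduced. A feasible point lies in a slice of the ellipsoid on which the last few lattice coordinates
 are fixed. Passing to a smaller slice as long as the last free basis vector is long compared to the radius,
 one reaches a slice all of whose free lattice vectors are short, and since the basis is reduced there are only
 polynomially many such slices for fixed \<open>p\<close>. On such a slice integrality costs little: minimise over the
 continuous ball, shrink slightly and round. The minimum is approximated by a stationary point of the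
 Lagrangian with its multiplier on a grid, after a perturbation that excludes the hard case. Enumerating all
 slices, multipliers and perturbations and comparing the feasible points exactly gives the algorithm. All
 linear algebra is fraction-free; its running time on the machine is bounded through a calculus of families
 of integers that are computable in polynomial time.
\<close>

text \<open>Optimality is stated without infimum and supremum until the very end. With
  \<open>K\<close> the ceiling of \<open>1 / ep\<close>, every feasible \<open>x0\<close> is shown
  to admit a feasible \<open>x'\<close> with \<open>K * (f x - f x0) <= f x' - f x\<close>. This
  form survives the comparison of candidates and needs no attained minimum; suprema and infima are
  only nearly attained, the loss being absorbed by constants such as 7/8. One program must serve all
  \<open>p\<close>, so its running time is not polynomial in the input size. It is bounded in a
  measure \<open>sz\<close> that contains the factors exponential in \<open>p\<close>; everything is
  polynomial in that measure, and \<open>p\<close> becomes a constant only in the last step.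
  Whatever analysis would compute (extremal direction, critical multiplier, scale of the objective,
  slice) is guessed from a finite list, so no square root or eigenvalue is ever evaluated. Every
  guess, good or bad, must therefore produce a point with positive denominator and the required
  integrality; only the ellipsoid constraint and the objective value are tested.\<close>

type_synonym ivec = "nat => int"
type_synonym imat = "nat => nat => int"

notation scaleR (infixr "*R" 75)

section \<open>Bit lengths\<close>

lemma bits_le_iff: "bits x <= k \<longleftrightarrow> \<bar>x\<bar> < 2 ^ k"
proof -
 have "bits x <= k \<longleftrightarrow> nat \<bar>x\<bar> < 2 ^ k" unfolding bits_def by (simp add: floorlog_le_iff)
 also have "... \<longleftrightarrow> \<bar>x\<bar> < 2 ^ k" by (simp add: nat_less_iff)
 finally show ?thesis .
qed

lemma abs_less_bits: "\<bar>x\<bar> < 2 ^ bits x" using bits_le_iff[of x "bits x"] by simp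

lemma bits_minus [simp]: "bits (- x) = bits x" by (simp add: bits_def)

lemma bits_add: "bits (x + y) <= bits x + bits y + 1"
proof -
 have "\<bar>x + y\<bar> < 2 ^ bits x + 2 ^ bits y" using abs_less_bits[of x] abs_less_bits[of y] by linarith
 also have "... <= 2 ^ (bits x + bits y) + 2 ^ (bits x + bits y)" by (intro add_mono power_increasing) auto
 finally show ?thesis by (simp add: bits_le_iff)
qed

lemma bits_diff: "bits (x - y) <= bits x + bits y + 1" using bits_add[of x "- y"] by simp

lemma bits_mult: "bits (x * y) <= bits x + bits y"
proof -
 have "\<bar>x * y\<bar> < 2 ^ bits x * 2 ^ bits y"
  using abs_less_bits[of x] abs_less_bits[of y] by (simp add: abs_mult mult_strict_mono')
 thus ?thesis by (simp add: bits_le_iff power_add)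
qed

text \<open>Division by a positive number is compared with division by 1; for a negative dividend
  the comparison reverses and the quotient stays negative. Negative divisors reduce to positive ones
  by negating both arguments.\<close>

lemma abs_div_le: "\<bar>x div y\<bar> <= \<bar>x\<bar>" for x y :: int
proof (cases "y = 0")
 case False
 have *: "\<bar>a div b\<bar> <= \<bar>a\<bar>" if "b > 0" for a b :: int proof (cases "a >= 0")
  case True
  have "a div b >= 0" using True that by (simp add: pos_imp_zdiv_nonneg_iff)
  moreover have "a div b <= a div 1" using True that by (intro zdiv_mono2) auto
  ultimately show ?thesis using True by simp
 next
  case False
  have "a div 1 <= a div b" using False that by (intro zdiv_mono2_neg) auto
  moreover have "a div b < 0" using False that by (simp add: div_neg_pos_less0)
  ultimately show ?thesis using False by simp
 qed
 show ?thesis proof (cases "y > 0")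
  case True thus ?thesis by (rule *)
 next
  case False
  hence "- y > 0" using \<open>y ~= 0\<close> by simp
  from *[OF this, of "- x"] show ?thesis by simp
 qed
qed simp

lemma bits_mono: "\<bar>x\<bar> <= \<bar>y\<bar> ==> bits x <= bits y" using abs_less_bits[of y] by (simp add: bits_le_iff)

lemma bits_div: "bits (x div y) <= bits x" by (rule bits_mono) (rule abs_div_le)

lemma bits_of_nat: "bits (int n) <= n" by (simp add: bits_le_iff)

section \<open>Environments\<close>

abbreviation "fst2 z == fst (fst z)"
abbreviation "fst3 z == fst (fst2 z)"

text \<open>An injective pairing of nonnegative integers: pairs with sum \<open>s\<close> are sent
  into the interval from \<open>s^2\<close> to \<open>s^2 + s\<close>, and these intervals are
  disjoint. Being a polynomial, it is evaluated by the machine without division.\<close>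

definition pr :: "int => int => int" where
 "pr a b = (a + b) * (a + b) + b"

lemma pr_inj:
 assumes "a >= 0" "b >= 0" "c >= 0" "d >= 0" "pr a b = pr c d"
 shows "a = c & b = d"
proof -
 have *: "x + y <= u + v" if "x >= 0" "y >= 0" "u >= 0" "v >= 0" "pr x y = pr u v" for x y u v :: int
 proof (rule ccontr)
  assume "~ ?thesis"
  hence "x + y >= u + v + 1" by simp
  hence "(x + y) * (x + y) >= (u + v + 1) * (u + v + 1)" using that by (intro mult_mono) auto
  thus False using that by (simp add: pr_def algebra_simps)
 qed
 have "a + b = c + d" using *[of a b c d] *[of c d a b] assms by simp
 thus ?thesis using assms(5) by (simp add: pr_def)
qed

lemma pr_nonneg: "a >= 0 ==> b >= 0 ==> pr a b >= 0" by (simp add: pr_def)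

text \<open>Work arrays live at negative addresses, which leaves the nonnegative cells to the input
  and, at the end, to the output.\<close>

definition adr :: "nat => imat" where
 "adr k i j = - 1 - pr (int k) (pr (int i) (int j))"

lemma adr_neg: "adr k i j < 0" using pr_nonneg[of "int k" "pr (int i) (int j)"] pr_nonneg[of "int i" "int j"]
 by (simp add: adr_def)

lemma adr_neq_nonneg: "0 <= x ==> adr k i j ~= x" "0 <= x ==> x ~= adr k i j" using adr_neg[of k i j] by auto

lemma adr_inj [simp]: "adr k i j = adr k' i' j' \<longleftrightarrow> k = k' & i = i' & j = j'"
 using pr_inj[of "int k" "pr (int i) (int j)" "int k'" "pr (int i') (int j')"]
  pr_inj[of "int i" "int j" "int i'" "int j'"] by (auto simp: adr_def pr_nonneg)

text \<open>An environment speaks about all inputs of one uniform program at once.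
  \<open>lev\<close> counts the tables that already lie in memory, \<open>tab\<close> gives their
  contents, and \<open>None\<close> marks cells about which nothing is promised.\<close>

record 'x env =
 edom :: "'x set"
 sz :: "'x => nat"
 inp :: "'x => memory"
 lev :: nat
 tab :: "'x => nat => nat => nat => int option"

text \<open>
 A family of values indexed by the instances \<open>x \<in> edom E\<close> is small if it is bounded by a fixed
 power of the measure \<open>sz E x + 2\<close>; \<open>sbits\<close> requires this of the bit length only.
\<close>

definition small :: "'x env => ('x => nat) => bool" where
 "small E f \<longleftrightarrow> (EX a. ALL x:edom E. f x <= (sz E x + 2) ^ a)"

definition sbits :: "'x env => ('x => int) => bool" where
 "sbits E f \<longleftrightarrow> small E (%x. bits (f x))"

text \<open>The array \<open>k\<close> of the environment is located at the array \<open>ro k\<close> of the machine.\<close>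

definition agr :: "'x env => (nat => nat) => 'x => memory => bool" where
 "agr E ro x m \<longleftrightarrow> (ALL a>=0. m a = inp E x a) &
  (ALL k<lev E. ALL i j v. tab E x k i j = Some v --> m (adr (ro k) i j) = v)"

text \<open>The frame condition of a stack discipline: \<open>b\<close> is the first free array, and
  \<open>V\<close> collects the arrays below it that a loop uses as its own variables.\<close>

definition chg :: "nat => nat set => memory => memory => bool" where
 "chg b V m m' \<longleftrightarrow> (ALL a>=0. m' a = m a) &
  (ALL k<b. k \<notin> V --> (ALL i j. m' (adr k i j) = m (adr k i j)))"

text \<open>
 \<open>cmp E f\<close>: one program computes \<open>f x\<close> in polynomial time from any memory that agrees with
 the environment at \<open>x\<close>, wherever the tables of the environment are located, and uses only the
 arrays from \<open>b\<close> upwards as work space.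
\<close>

definition runs :: "'x env => (nat => nat) => nat => prog => ('x => int) => ('x => nat) => bool" where
 "runs E ro b c f T \<longleftrightarrow> (ALL x:edom E. ALL m. agr E ro x m -->
  (EX t m'. exec c m t m' & chg b {} m m' & m' (adr b 0 0) = f x & t <= T x))"

definition cmp :: "'x env => ('x => int) => bool" where
 "cmp E f \<longleftrightarrow> sbits E f &
  (ALL ro b. (ALL k<lev E. ro k < b) --> (EX c T. small E T & runs E ro b c f T))"

abbreviation cmpn :: "'x env => ('x => nat) => bool" where
 "cmpn E f == cmp E (%x. int (f x))"

text \<open>A loop of \<open>N x\<close> rounds: the counter joins the instance, so that a family
  over the extended domain is a family of loop bodies. In memory the counter is a new one-cell
  table. The measure remains that of the outer instance.\<close>

definition idx :: "'x env => ('x => nat) => ('x \<times> nat) env" where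
 "idx E N = \<lparr>edom = {z. fst z \<in> edom E & snd z < N (fst z)}, sz = (%z. sz E (fst z)),
  inp = (%z. inp E (fst z)), lev = Suc (lev E),
  tab = (%z k i j. if k < lev E then tab E (fst z) k i j
    else if i = 0 & j = 0 then Some (int (snd z)) else None)\<rparr>"

text \<open>The instances stay the same; only the promise about the memory grows by one table that
  later programs may read.\<close>

definition tbl :: "'x env => ('x => nat) => ('x => nat) => ('x => imat) => 'x env" where
 "tbl E n m S = E\<lparr>lev := Suc (lev E),
  tab := (%x k i j. if k < lev E then tab E x k i j
    else if i < n x & j < m x then Some (S x i j) else None)\<rparr>"

text \<open>Hides the level at which a table is stored and bundles it with a bound on its bit
  lengths; later proofs access tables only in this way.\<close>

definition has :: "'x env => ('x => nat) => ('x => nat) => ('x => imat) => bool" where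
 "has E n m S \<longleftrightarrow>
  (EX a. ALL x:edom E. ALL i<n x. ALL j<m x. bits (S x i j) <= (sz E x + 2) ^ a) &
  (EX k<lev E. ALL x:edom E. ALL i<n x. ALL j<m x. tab E x k i j = Some (S x i j))"

subsection \<open>Small families\<close>

lemma smallI: "(!!x. x \<in> edom E ==> f x <= (sz E x + 2) ^ a) ==> small E f" by (auto simp: small_def)

lemma small_mono: "small E g ==> (!!x. x \<in> edom E ==> f x <= g x) ==> small E f"
 unfolding small_def by (meson order_trans)

lemma small_const: "small E (%x. k)"
proof (rule smallI)
 fix x
 have "k <= 2 ^ k" by (simp add: less_imp_le)
 also have "... <= (sz E x + 2) ^ k" by (rule power_mono) auto
 finally show "k <= (sz E x + 2) ^ k" .
qed

lemma small_sz: "small E (sz E)" by (rule smallI[of _ _ 1]) simp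

lemma small_mult:
 assumes "small E f" "small E g" shows "small E (%x. f x * g x)"
proof -
 obtain a b where "!!x. x \<in> edom E ==> f x <= (sz E x + 2) ^ a"
  "!!x. x \<in> edom E ==> g x <= (sz E x + 2) ^ b" using assms unfolding small_def by blast
 thus ?thesis by (intro smallI[of _ _ "a + b"]) (simp add: power_add mult_mono)
qed

lemma small_add:
 assumes "small E f" "small E g" shows "small E (%x. f x + g x)"
proof -
 have "small E (%x. 2 * ((f x + 1) * (g x + 1)))" if "small E (%x. f x + 1)" "small E (%x. g x + 1)"
  using that by (intro small_mult small_const)
 moreover have "small E (%x. h x + 1)" if h: "small E h" for h proof -
  obtain a where a: "!!x. x \<in> edom E ==> h x <= (sz E x + 2) ^ a" using h unfolding small_def by blast
  show ?thesis proof (rule smallI)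
   fix x assume "x \<in> edom E"
   have "h x + 1 <= (sz E x + 2) ^ a + (sz E x + 2) ^ a" using a[OF \<open>x \<in> edom E\<close>] by (intro add_mono) auto
   also have "... <= (sz E x + 2) ^ (a + 1)" by simp
   finally show "h x + 1 <= (sz E x + 2) ^ (a + 1)" .
  qed
 qed
 ultimately show ?thesis using assms by (auto intro: small_mono simp: algebra_simps)
qed

lemma small_Suc: "small E f ==> small E (%x. Suc (f x))" using small_add[OF _ small_const[of E 1], of f] by simp

lemma small_diff: "small E f ==> small E (%x. f x - g x)" by (erule small_mono) simp

lemma small_power: "small E f ==> small E (%x. f x ^ k)" by (induction k) (auto intro: small_mult small_const)

lemmas small_intros = small_const small_sz small_mult small_add small_Suc small_power small_diff

lemma env_idx_simps [simp]:
 "edom (idx E N) = {z. fst z \<in> edom E & snd z < N (fst z)}"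
 "sz (idx E N) = (%z. sz E (fst z))" "lev (idx E N) = Suc (lev E)"
 "inp (idx E N) = (%z. inp E (fst z))" by (simp_all add: idx_def)

lemma env_tbl_simps [simp]:
 "edom (tbl E n m S) = edom E" "sz (tbl E n m S) = sz E" "lev (tbl E n m S) = Suc (lev E)"
 "inp (tbl E n m S) = inp E" by (simp_all add: tbl_def)

lemma small_idx: "small E f ==> small (idx E N) (%z. f (fst z))" by (auto simp: small_def)

lemma small_tbl: "small (tbl E n m S) f = small E f" by (simp add: small_def)

text \<open>A bound in the extended environment is a power of the outer measure alone, hence uniform
  in the loop counter.\<close>

lemma small_idx_bound:
 assumes "small (idx E N) (%z. T z)"
 obtains T' where "small E T'" "!!x k. x \<in> edom E ==> k < N x ==> T (x, k) <= T' x"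
proof -
 obtain a where "!!z. z \<in> edom (idx E N) ==> T z <= (sz (idx E N) z + 2) ^ a" using assms unfolding small_def by blast
 hence "!!x k. x \<in> edom E ==> k < N x ==> T (x, k) <= (sz E x + 2) ^ a" by force
 moreover have "small E (%x. (sz E x + 2) ^ a)" by (rule smallI[of _ _ a]) simp
 ultimately show thesis using that by blast
qed

lemma small_idx_var: "small E N ==> small (idx E N) snd"
 unfolding small_def by (auto intro: order_trans[OF less_imp_le])

lemma sbits_idx: "sbits E f ==> sbits (idx E N) (%z. f (fst z))" unfolding sbits_def by (rule small_idx)

lemma sbits_nat: "small E f ==> sbits E (%x. int (f x))" unfolding sbits_def by (erule small_mono) (rule bits_of_nat)

lemma sbits_const: "sbits E (%x. k)" unfolding sbits_def by (rule small_const)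

lemma sbits_add: "sbits E f ==> sbits E g ==> sbits E (%x. f x + g x)"
 unfolding sbits_def by (rule small_mono[where g="%x. bits (f x) + bits (g x) + 1"]) (auto intro!: small_intros simp: bits_add[simplified])

lemma sbits_diff: "sbits E f ==> sbits E g ==> sbits E (%x. f x - g x)"
 unfolding sbits_def by (rule small_mono[where g="%x. bits (f x) + bits (g x) + 1"]) (auto intro!: small_intros simp: bits_diff[simplified])

lemma sbits_mult: "sbits E f ==> sbits E g ==> sbits E (%x. f x * g x)"
 unfolding sbits_def by (rule small_mono[where g="%x. bits (f x) + bits (g x)"]) (auto intro!: small_intros bits_mult)

lemma sbits_div: "sbits E f ==> sbits E (%x. f x div g x)" unfolding sbits_def by (erule small_mono) (rule bits_div)

lemma sbits_mono: "sbits E g ==> (!!x. x \<in> edom E ==> \<bar>f x\<bar> <= \<bar>g x\<bar>) ==> sbits E f"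
 unfolding sbits_def by (erule small_mono) (auto intro: bits_mono)

lemma sbits_pow2: "small E f ==> sbits E (%x. 2 ^ f x)"
 unfolding sbits_def by (rule small_mono[OF small_Suc]) (auto simp: bits_le_iff)

lemma sbits_power: "sbits E f ==> small E k ==> sbits E (%x. f x ^ k x)"
proof -
 assume f: "sbits E f" and k: "small E k"
 have "\<bar>f x ^ k x\<bar> <= \<bar>2 ^ (bits (f x) * k x)\<bar>" for x
  using abs_less_bits[of "f x"] by (simp add: power_abs power_mult power_mono)
 thus ?thesis using f[unfolded sbits_def] k by (intro sbits_mono[OF sbits_pow2[OF small_mult]])
qed

subsection \<open>Agreement\<close>

lemma chg_refl: "chg b V m m" by (simp add: chg_def)

lemma chg_trans:
 "chg b V m m' ==> chg b' V' m' m'' ==> c <= b ==> c <= b' ==> V \<inter> {..<c} \<subseteq> W ==> V' \<inter> {..<c} \<subseteq> W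
 ==> chg c W m m''"
 unfolding chg_def by (simp add: subset_iff) (metis less_le_trans)

lemma chg_mono: "chg b V m m' ==> c <= b ==> V \<inter> {..<c} \<subseteq> W ==> chg c W m m'"
 by (rule chg_trans[OF _ chg_refl[where V="{}"]]) auto

lemma chg_upd: "b <= k \<or> k \<in> V ==> chg b V m (m(adr k i j := v))" using adr_neg[of k i j] by (auto simp: chg_def)

lemma chg_adr: "chg b V m m' ==> k < b ==> k \<notin> V ==> m' (adr k i j) = m (adr k i j)" by (auto simp: chg_def)

lemma agr_chg: "agr E ro x m ==> chg b V m m' ==> (!!k. k < lev E ==> ro k < b & ro k \<notin> V) ==> agr E ro x m'"
 by (auto simp: agr_def chg_def)

lemma agr_cong: "(!!k. k < lev E ==> ro k = ro' k) ==> agr E ro x m = agr E ro' x m" by (auto simp: agr_def)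

lemma agr_idx: "agr (idx E N) ro z m \<longleftrightarrow> agr E ro (fst z) m & m (adr (ro (lev E)) 0 0) = int (snd z)"
 by (auto simp: agr_def idx_def less_Suc_eq)

lemma agr_tbl: "agr (tbl E n l S) ro x m \<longleftrightarrow>
  agr E ro x m & (ALL i<n x. ALL j<l x. m (adr (ro (lev E)) i j) = S x i j)"
 by (auto simp: agr_def tbl_def less_Suc_eq)

subsection \<open>Arithmetic\<close>

lemma cmpD: "cmp E f ==> ALL k<lev E. ro k < b ==> EX c T. small E T & runs E ro b c f T" unfolding cmp_def by blast

lemma runsD: "runs E ro b c f T ==> x \<in> edom E ==> agr E ro x m ==>
  EX t m'. exec c m t m' & chg b {} m m' & m' (adr b 0 0) = f x & t <= T x"
 unfolding runs_def by blast

lemma execI: "exec c m t m' ==> chg b {} m m' ==> m' (adr b 0 0) = v ==> t <= T ==>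
  EX t m'. exec c m t m' & chg b {} m m' & m' (adr b 0 0) = v & t <= T"
 by blast

lemma cmp_sbits: "cmp E f ==> sbits E f" by (simp add: cmp_def)

lemma sbits_smallD: "sbits E f ==> small E (%x. bits (f x))" by (simp add: sbits_def)

lemma cmpI:
 assumes "sbits E f"
  and "!!ro b. ALL k<lev E. ro k < b ==> EX c T. small E T & runs E ro b c f T"
 shows "cmp E f" using assms unfolding cmp_def by blast

lemma cmp_const: "cmp E (%x. k)"
proof (rule cmpI)
 fix ro :: "nat => nat" and b :: nat
 let ?c = "Store (Const (adr b 0 0)) (Const k)"
 have "EX t m'. exec ?c m t m' & chg b {} m m' & m' (adr b 0 0) = k &
   t <= 3 + bits (adr b 0 0) + bits k" for m
  using Store[of "Const (adr b 0 0)" "Const k" m] by (intro exI conjI, assumption) (auto simp: chg_upd)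
 thus "EX c T. small E T & runs E ro b c (%x. k) T" unfolding runs_def
  using small_const[of E "3 + bits (adr b 0 0) + bits k"] by blast
qed (rule sbits_const)

text \<open>The first operand waits in array \<open>b\<close> while the second is computed with base
  \<open>Suc b\<close>; the frame condition protects it. Nested expressions thus use the arrays as a
  stack.\<close>

lemma cmp_binop:
 assumes f: "cmp E f" and h: "cmp E h" and s: "sbits E (%x. g (f x) (h x))"
  and av: "!!u v m. aval (F u v) m = g (aval u m) (aval v m)"
  and ac: "!!u v m. acost (F u v) m = acost u m + acost v m + 1 + bits (g (aval u m) (aval v m))"
 shows "cmp E (%x. g (f x) (h x))"
proof (rule cmpI[OF s])
 fix ro :: "nat => nat" and b :: nat
 assume ro: "ALL k<lev E. ro k < b"
 obtain c1 T1 where 1: "small E T1" "runs E ro b c1 f T1" using cmpD[OF f ro] by blast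
 obtain c2 T2 where 2: "small E T2" "runs E ro (Suc b) c2 h T2"
  using cmpD[OF h, of ro "Suc b"] ro by (auto simp: less_Suc_eq)
 let ?s = "Store (Const (adr b 0 0)) (F (Load (Const (adr b 0 0))) (Load (Const (adr (Suc b) 0 0))))"
 let ?T = "%x. T1 x + (T2 x + (10 + bits (adr b 0 0) + bits (adr b 0 0) + bits (adr (Suc b) 0 0)
   + bits (f x) + bits (h x) + bits (g (f x) (h x))))"
 have "EX t m'. exec (Seq c1 (Seq c2 ?s)) m t m' & chg b {} m m' & m' (adr b 0 0) = g (f x) (h x) &
   t <= ?T x" if x: "x \<in> edom E" and m: "agr E ro x m" for x m
 proof -
  obtain t1 m1 where e1: "exec c1 m t1 m1" "chg b {} m m1" "m1 (adr b 0 0) = f x" "t1 <= T1 x"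
   using runsD[OF 1(2) x m] by blast
  have "agr E ro x m1" using agr_chg[OF m e1(2)] ro by auto
  then obtain t2 m2 where e2: "exec c2 m1 t2 m2" "chg (Suc b) {} m1 m2"
    "m2 (adr (Suc b) 0 0) = h x" "t2 <= T2 x" using runsD[OF 2(2) x] by blast
  have fx: "m2 (adr b 0 0) = f x" using chg_adr[OF e2(2), of b] e1(3) by simp
  let ?m3 = "m2(adr b 0 0 := g (f x) (h x))"
  have "exec ?s m2 (1 + acost (Const (adr b 0 0)) m2 + acost (F (Load (Const (adr b 0 0))) (Load (Const (adr (Suc b) 0 0)))) m2) ?m3"
   using Store[of "Const (adr b 0 0)" "F (Load (Const (adr b 0 0))) (Load (Const (adr (Suc b) 0 0)))" m2]
   by (simp add: av fx e2(3))
  hence "exec (Seq c1 (Seq c2 ?s)) m (t1 + (t2 + (1 + acost (Const (adr b 0 0)) m2 + acost (F (Load (Const (adr b 0 0))) (Load (Const (adr (Suc b) 0 0)))) m2))) ?m3"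
   using e1(1) e2(1) by (intro exec.Seq)
  moreover have "chg b {} m ?m3"
   by (rule chg_trans[OF chg_trans[OF e1(2) e2(2), of b "{}"] chg_upd[of b b "{}"]]) auto
  ultimately show ?thesis by (rule execI) (use e1(4) e2(4) in "auto simp: ac fx e2(3)")
 qed
 moreover have "small E ?T"
  using 1(1) 2(1) sbits_smallD[OF cmp_sbits[OF f]] sbits_smallD[OF cmp_sbits[OF h]] sbits_smallD[OF s]
  by (intro small_intros)
 ultimately show "EX c T. small E T & runs E ro b c (%x. g (f x) (h x)) T" unfolding runs_def
  by blast
qed

lemma cmp_add: "cmp E f ==> cmp E g ==> cmp E (%x. f x + g x)"
 by (rule cmp_binop[of _ _ _ "(+)" Add]) (auto intro: sbits_add cmp_sbits)

lemma cmp_diff: "cmp E f ==> cmp E g ==> cmp E (%x. f x - g x)"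
 by (rule cmp_binop[of _ _ _ "(-)" Sub]) (auto intro: sbits_diff cmp_sbits)

lemma cmp_mult: "cmp E f ==> cmp E g ==> cmp E (%x. f x * g x)"
 by (rule cmp_binop[of _ _ _ "(*)" Mul]) (auto intro: sbits_mult cmp_sbits)

lemma cmp_div: "cmp E f ==> cmp E g ==> cmp E (%x. f x div g x)"
 by (rule cmp_binop[of _ _ _ "(div)" Div]) (auto intro: sbits_div cmp_sbits)

lemma cmp_cong: "cmp E g ==> (!!x. x \<in> edom E ==> f x = g x) ==> cmp E f"
 unfolding cmp_def runs_def sbits_def small_def by simp

text \<open>Indirect addressing: the address is itself a computable family. It may depend on
  \<open>ro\<close>, because the place of a table is known only after the layout has been
  fixed.\<close>

lemma cmp_load:
 assumes s: "sbits E f"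
  and ld: "!!ro. EX g. cmp E g & (ALL x m. x \<in> edom E --> agr E ro x m --> m (g x) = f x)"
 shows "cmp E f"
proof (rule cmpI[OF s])
 fix ro :: "nat => nat" and b :: nat
 assume ro: "ALL k<lev E. ro k < b"
 obtain g where g: "cmp E g" and m: "!!x m. x \<in> edom E ==> agr E ro x m ==> m (g x) = f x" using ld by blast
 obtain c T where 1: "small E T" "runs E ro b c g T" using cmpD[OF g ro] by blast
 let ?s = "Store (Const (adr b 0 0)) (Load (Load (Const (adr b 0 0))))"
 let ?T = "%x. T x + (10 + bits (adr b 0 0) + bits (adr b 0 0) + bits (g x) + bits (f x))"
 have "EX t m'. exec (Seq c ?s) m t m' & chg b {} m m' & m' (adr b 0 0) = f x &
   t <= ?T x" if x: "x \<in> edom E" and m: "agr E ro x m" for x m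
 proof -
  obtain t1 m1 where e1: "exec c m t1 m1" "chg b {} m m1" "m1 (adr b 0 0) = g x" "t1 <= T x"
   using runsD[OF 1(2) x m] by blast
  have "agr E ro x m1" using agr_chg[OF m e1(2)] ro by auto
  hence l: "m1 (g x) = f x" using \<open>!!x m. x \<in> edom E ==> agr E ro x m ==> m (g x) = f x\<close> x by blast
  have "exec ?s m1 (1 + acost (Const (adr b 0 0)) m1 + acost (Load (Load (Const (adr b 0 0)))) m1) (m1(adr b 0 0 := f x))"
   using Store[of "Const (adr b 0 0)" "Load (Load (Const (adr b 0 0)))" m1] by (simp add: e1(3) l)
  hence "exec (Seq c ?s) m (t1 + (1 + acost (Const (adr b 0 0)) m1 + acost (Load (Load (Const (adr b 0 0)))) m1)) (m1(adr b 0 0 := f x))"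
   using e1(1) by (intro exec.Seq)
  moreover have "chg b {} m (m1(adr b 0 0 := f x))" by (rule chg_trans[OF e1(2) chg_upd[of b b "{}"]]) auto
  ultimately show ?thesis by (rule execI) (use e1(4) in "auto simp: l e1(3)")
 qed
 moreover have "small E ?T" using 1(1) sbits_smallD[OF cmp_sbits[OF g]] sbits_smallD[OF s] by (intro small_intros)
 ultimately show "EX c T. small E T & runs E ro b c f T" unfolding runs_def
  by blast
qed

lemma cmpn_add: "cmpn E f ==> cmpn E g ==> cmpn E (%x. f x + g x)" by (simp add: cmp_add)

lemma cmpn_Suc: "cmpn E f ==> cmpn E (%x. Suc (f x))" using cmp_add[OF cmp_const[of E 1], of "%x. int (f x)"] by simp

lemma cmpn_mult: "cmpn E f ==> cmpn E g ==> cmpn E (%x. f x * g x)" by (simp add: cmp_mult)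

lemma cmpn_const: "cmpn E (%x. k)" by (rule cmp_const)

lemma cmp_adr:
 assumes "cmpn E i" "cmpn E j" shows "cmp E (%x. adr k (i x) (j x))"
 unfolding adr_def pr_def by (intro cmp_add cmp_diff cmp_mult cmp_const assms)

lemma cmp_has:
 assumes h: "has E n m S" and ij: "cmpn E i" "cmpn E j"
  and b: "!!x. x \<in> edom E ==> i x < n x & j x < m x"
 shows "cmp E (%x. S x (i x) (j x))"
proof (rule cmp_load)
 obtain a where "!!x i j. x\<in>edom E ==> i<n x ==> j<m x ==> bits (S x i j) <= (sz E x + 2) ^ a"
  using h unfolding has_def by blast
 thus "sbits E (%x. S x (i x) (j x))" unfolding sbits_def using b by (intro smallI) blast
 fix ro :: "nat => nat"
 obtain k where k: "k < lev E" "!!x i j. x\<in>edom E ==> i<n x ==> j<m x ==> tab E x k i j = Some (S x i j)"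
  using h unfolding has_def by blast
 show "EX g. cmp E g & (ALL x m. x \<in> edom E --> agr E ro x m --> m (g x) = S x (i x) (j x))"
  using k b by (intro exI[of _ "%x. adr (ro k) (i x) (j x)"]) (auto simp: agr_def cmp_adr ij)
qed

lemma cmp_inp:
 assumes "cmp E g" "!!x. x \<in> edom E ==> 0 <= g x" "sbits E (%x. inp E x (g x))"
 shows "cmp E (%x. inp E x (g x))"
 by (rule cmp_load[OF assms(3)], rule exI[of _ g]) (use assms in "auto simp: agr_def")

lemma cmp_snd: "small E N ==> cmpn (idx E N) snd"
proof (rule cmp_load)
 fix ro :: "nat => nat"
 show "EX g. cmp (idx E N) g & (ALL x m. x \<in> edom (idx E N) --> agr (idx E N) ro x m --> m (g x) = int (snd x))"
  by (rule exI[of _ "%x. adr (ro (lev E)) 0 0"]) (auto simp: agr_idx intro!: cmp_const)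
qed (intro sbits_nat small_idx_var)

text \<open>Each branch of a conditional need only be computable where it is taken.\<close>

definition sub :: "'x env => ('x => bool) => 'x env" where
 "sub E P = E\<lparr>edom := {x \<in> edom E. P x}\<rparr>"

lemma env_sub_simps [simp]:
 "edom (sub E P) = {x \<in> edom E. P x}" "sz (sub E P) = sz E" "lev (sub E P) = lev E"
 "inp (sub E P) = inp E" "tab (sub E P) = tab E" "agr (sub E P) = agr E" by (auto simp: sub_def agr_def fun_eq_iff)

lemma cmp_sub: "cmp E f ==> cmp (sub E P) f"
proof -
 assume a: "cmp E f"
 show ?thesis proof (rule cmpI)
  show "sbits (sub E P) f" using cmp_sbits[OF a] by (auto simp: sbits_def small_def)
  fix ro b assume "ALL k<lev (sub E P). ro k < (b::nat)"
  then obtain c T where "small E T" "runs E ro b c f T" using cmpD[OF a, of ro b] by auto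
  thus "EX c T. small (sub E P) T & runs (sub E P) ro b c f T"
   by (intro exI[of _ c] exI[of _ T]) (auto simp: runs_def small_def)
 qed
qed

lemma has_sub: "has E n m S ==> has (sub E P) n m S" unfolding has_def by auto

lemma has_idx: "has E n m S ==> has (idx E N) (%z. n (fst z)) (%z. m (fst z)) (%z. S (fst z))"
 unfolding has_def by (auto simp: idx_def less_Suc_eq)

lemma has_tbl: "has E n m S ==> has (tbl E n' m' S') n m S" unfolding has_def by (auto simp: tbl_def less_Suc_eq)

lemma has_new:
 assumes "sbits (idx (idx E n) (%z. m (fst z))) (%z. S (fst2 z) (snd (fst z)) (snd z))"
 shows "has (tbl E n m S) n m S"
proof -
 from assms obtain a where "!!x i j. x \<in> edom E ==> i < n x ==> j < m x ==> bits (S x i j) <= (sz E x + 2) ^ a"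
  by (fastforce simp: sbits_def small_def)
 thus ?thesis unfolding has_def by (auto simp: tbl_def)
qed

lemma cmp_idx: "cmp E f ==> cmp (idx E N) (%z. f (fst z))"
proof (rule cmpI)
 assume f: "cmp E f"
 show "sbits (idx E N) (%z. f (fst z))" using sbits_idx[OF cmp_sbits[OF f]] .
 fix ro b assume "ALL k<lev (idx E N). ro k < (b::nat)"
 then obtain c T where "small E T" "runs E ro b c f T" using cmpD[OF f, of ro b] by (auto simp: less_Suc_eq)
 thus "EX c T. small (idx E N) T & runs (idx E N) ro b c (%x. f (fst x)) T"
  using small_idx[of E T N] by (intro exI[of _ c] exI[of _ "%z. T (fst z)"]) (auto simp: runs_def agr_idx)
qed

lemma cmp_tbl: "cmp E f ==> cmp (tbl E n m S) f"
proof (rule cmpI)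
 assume f: "cmp E f"
 show "sbits (tbl E n m S) f" using cmp_sbits[OF f] by (simp add: sbits_def small_tbl)
 fix ro b assume "ALL k<lev (tbl E n m S). ro k < (b::nat)"
 then obtain c T where "small E T" "runs E ro b c f T" using cmpD[OF f, of ro b] by (auto simp: less_Suc_eq)
 thus "EX c T. small (tbl E n m S) T & runs (tbl E n m S) ro b c f T"
  by (intro exI[of _ c] exI[of _ "T"]) (auto simp: runs_def agr_tbl small_tbl)
qed

lemma cmp_if:
 assumes f: "cmp E f" and g: "cmp (sub E (%x. 0 < f x)) g" and h: "cmp (sub E (%x. ~ 0 < f x)) h"
 shows "cmp E (%x. if 0 < f x then g x else h x)"
proof (rule cmpI)
 obtain a a' where "!!x. x \<in> edom E ==> 0 < f x ==> bits (g x) <= (sz E x + 2) ^ a"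
  "!!x. x \<in> edom E ==> ~ 0 < f x ==> bits (h x) <= (sz E x + 2) ^ a'"
  using cmp_sbits[OF g] cmp_sbits[OF h] unfolding sbits_def small_def by auto
 \<comment> \<open>The two bounds hold on complementary parts of the domain, so their sum serves on
   all of it.\<close>
 hence *: "bits (if 0 < f x then g x else h x) <= (sz E x + 2) ^ a + (sz E x + 2) ^ a'"
  if "x \<in> edom E" for x using that by (auto intro: trans_le_add1 trans_le_add2)
 have **: "small E (%x. (sz E x + 2) ^ a + (sz E x + 2) ^ a')" by (intro small_intros)
 show "sbits E (%x. if 0 < f x then g x else h x)" unfolding sbits_def by (rule small_mono[OF ** *])
 fix ro :: "nat => nat" and b :: nat
 assume ro: "ALL k<lev E. ro k < b"
 obtain c1 T1 where 1: "small E T1" "runs E ro b c1 f T1" using cmpD[OF f ro] by blast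
 obtain c2 T2 where 2: "small (sub E (%x. 0 < f x)) T2" "runs (sub E (%x. 0 < f x)) ro b c2 g T2"
  using cmpD[OF g, of ro b] ro by auto
 obtain c3 T3 where 3: "small (sub E (%x. ~ 0 < f x)) T3" "runs (sub E (%x. ~ 0 < f x)) ro b c3 h T3"
  using cmpD[OF h, of ro b] ro by auto
 obtain a2 where a2: "!!x. x \<in> edom E ==> 0 < f x ==> T2 x <= (sz E x + 2) ^ a2" using 2(1) by (auto simp: small_def)
 obtain a3 where a3: "!!x. x \<in> edom E ==> ~ 0 < f x ==> T3 x <= (sz E x + 2) ^ a3"
  using 3(1) by (auto simp: small_def)
 let ?G = "Load (Const (adr b 0 0))"
 let ?T = "%x. T1 x + (10 + bits (adr b 0 0) + bits (f x) + (sz E x + 2) ^ a2 + (sz E x + 2) ^ a3)"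
 have "EX t m'. exec (Seq c1 (IfPos ?G c2 c3)) m t m' & chg b {} m m' &
   m' (adr b 0 0) = (if 0 < f x then g x else h x) & t <= ?T x"
  if x: "x \<in> edom E" and m: "agr E ro x m" for x m proof -
  obtain t1 m1 where e1: "exec c1 m t1 m1" "chg b {} m m1" "m1 (adr b 0 0) = f x" "t1 <= T1 x"
   using runsD[OF 1(2) x m] by blast
  have m1: "agr E ro x m1" using agr_chg[OF m e1(2)] ro by auto
  show ?thesis proof (cases "0 < f x")
   case True
   obtain t2 m2 where e2: "exec c2 m1 t2 m2" "chg b {} m1 m2"
    "m2 (adr b 0 0) = g x" "t2 <= T2 x" using runsD[OF 2(2), of x m1] x m1 True by auto
   have "exec (Seq c1 (IfPos ?G c2 c3)) m (t1 + (1 + acost ?G m1 + t2)) m2"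
    by (rule exec.Seq[OF e1(1) IfTrue[OF _ e2(1)]]) (use True e1(3) in simp)
   moreover have "chg b {} m m2" by (rule chg_trans[OF e1(2) e2(2)]) auto
   ultimately show ?thesis by (rule execI) (use e1 e2 a2[OF x True] True in auto)
  next
   case False
   obtain t2 m2 where e2: "exec c3 m1 t2 m2" "chg b {} m1 m2"
    "m2 (adr b 0 0) = h x" "t2 <= T3 x" using runsD[OF 3(2), of x m1] x m1 False by auto
   have "exec (Seq c1 (IfPos ?G c2 c3)) m (t1 + (1 + acost ?G m1 + t2)) m2"
    by (rule exec.Seq[OF e1(1) IfFalse[OF _ e2(1)]]) (use False e1(3) in simp)
   moreover have "chg b {} m m2" by (rule chg_trans[OF e1(2) e2(2)]) auto
   ultimately show ?thesis by (rule execI) (use e1 e2 a3[OF x False] False in auto)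
  qed
 qed
 moreover have "small E ?T" using 1(1) sbits_smallD[OF cmp_sbits[OF f]] by (intro small_intros)
 ultimately show "EX c T. small E T & runs E ro b c (%x. if 0 < f x then g x else h x) T" unfolding runs_def
  by blast
qed

subsection \<open>Loops\<close>

text \<open>\<open>k\<close> is a ghost counter carried by the invariant; the guard only has to be
  decided by it, whatever the program really tests.\<close>

lemma exec_while:
 assumes body: "!!k m. k < N ==> I k m ==> EX t m'. exec c m t m' & I (Suc k) m' & t <= T"
  and guard: "!!k m. k <= N ==> I k m ==> (0 < aval g m \<longleftrightarrow> k < N) & acost g m <= G"
  and k: "k <= N" and init: "I k m"
 shows "EX t m'. exec (WhilePos g c) m t m' & I N m' & t <= (N - k) * (T + G + 1) + G + 1" using k init
proof (induction "N - k" arbitrary: k m)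
 case 0
 hence "k = N" by simp
 thus ?case using guard[of N m] 0 WhileFalse[of g m c] by (intro exI[of _ "1 + acost g m"] exI[of _ m]) auto
next
 case (Suc d)
 hence k: "k < N" by simp
 obtain t m' where 1: "exec c m t m'" "I (Suc k) m'" "t <= T" using body[OF k Suc.prems(2)] by blast
 obtain t2 m2 where 2: "exec (WhilePos g c) m' t2 m2" "I N m2" "t2 <= (N - Suc k) * (T + G + 1) + G + 1"
  using Suc.hyps(1)[of "Suc k", OF _ _ 1(2)] Suc.hyps(2) k by fastforce
 have "exec (WhilePos g c) m (1 + acost g m + t + t2) m2"
  using guard[of k m] k Suc.prems 1 2 by (intro WhileTrue) auto
 moreover have "1 + acost g m + t + t2 <= (N - k) * (T + G + 1) + G + 1" proof -
  have "1 + acost g m + t <= T + G + 1" using guard[of k m] k Suc.prems(2) 1(3) by auto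
  moreover have "(N - k) * (T + G + 1) = (T + G + 1) + (N - Suc k) * (T + G + 1)"
   using k by (simp add: Suc_diff_Suc[symmetric])
  ultimately show ?thesis using 2(3) by linarith
 qed
 ultimately show ?case using 2(2) by blast
qed

definition forp :: "nat => nat => prog => prog" where
 "forp rk rN c = Seq (Store (Const (adr rk 0 0)) (Const 0))
  (WhilePos (Sub (Load (Const (adr rN 0 0))) (Load (Const (adr rk 0 0))))
   (Seq c (Store (Const (adr rk 0 0)) (Add (Load (Const (adr rk 0 0))) (Const 1)))))"

text \<open>A deliberately generous closed form. The bit length of the counter is estimated by
  \<open>N\<close> itself, which is harmless because \<open>N\<close> is small wherever it is
  used.\<close>

definition fort :: "nat => nat => nat => nat => nat" where
 "fort rk rN N T = (N + 2) * (T + 10 * N + 20 * (bits (adr rk 0 0) + bits (adr rN 0 0) + 1))"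

lemma exec_forp:
 assumes body: "!!k m. k < N ==> J k m ==> m (adr rk 0 0) = int k ==>
   EX t m'. exec c m t m' & J (Suc k) m' & m' (adr rk 0 0) = int k & t <= T"
  and upd: "!!k m v. k <= N ==> J k m ==> J k (m(adr rk 0 0 := v))"
  and N: "!!k m. k <= N ==> J k m ==> m (adr rN 0 0) = int N"
  and init: "J 0 m"
 shows "EX t m'. exec (forp rk rN c) m t m' & J N m' & t <= fort rk rN N T"
proof -
 let ?a = "adr rk 0 0" let ?b = "adr rN 0 0"
 let ?g = "Sub (Load (Const ?b)) (Load (Const ?a))"
 let ?s = "Store (Const ?a) (Add (Load (Const ?a)) (Const 1))"
 let ?I = "%k m. J k m & m ?a = int k"
 let ?T = "T + (10 + 2 * bits ?a + 2 * N)" let ?G = "5 + bits ?b + bits ?a + 3 * N"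
 let ?m0 = "m(?a := 0)"
 have I0: "?I 0 ?m0" using upd init by auto
 have "EX t m'. exec (WhilePos ?g (Seq c ?s)) ?m0 t m' & ?I N m' & t <= (N - 0) * (?T + ?G + 1) + ?G + 1"
 proof (rule exec_while)
  fix k m assume k: "k < N" and I: "?I k m"
  obtain t m' where 1: "exec c m t m'" "J (Suc k) m'" "m' ?a = int k" "t <= T" using body[of k m] k I by blast
  have "exec ?s m' (1 + acost (Const ?a) m' + acost (Add (Load (Const ?a)) (Const 1)) m') (m'(?a := int k + 1))"
   using Store[of "Const ?a" "Add (Load (Const ?a)) (Const 1)" m'] by (simp add: 1)
  moreover have "?I (Suc k) (m'(?a := int k + 1))" using upd[OF _ 1(2)] k by auto
  moreover have "1 + acost (Const ?a) m' + acost (Add (Load (Const ?a)) (Const 1)) m' <= 10 + 2 * bits ?a + 2 * N"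
   using bits_of_nat[of k] bits_of_nat[of "Suc k"] bits_of_nat[of 1] k by (auto simp: 1 add.commute)
  ultimately show "EX t m'. exec (Seq c ?s) m t m' & ?I (Suc k) m' & t <= ?T"
   using exec.Seq[OF 1(1)] 1(4) by (meson add_mono)
 next
  fix k m assume k: "k <= N" and I: "?I k m"
  hence "m ?b = int N" using N by blast
  moreover have "bits (int N - int k) <= N" using bits_of_nat[of "N - k"] k by (simp add: of_nat_diff)
  ultimately show "(0 < aval ?g m) = (k < N) & acost ?g m <= ?G" using I k bits_of_nat[of k] bits_of_nat[of N] by auto
 next
  show "?I 0 ?m0" by (rule I0)
 qed simp
 then obtain t m' where 1: "exec (WhilePos ?g (Seq c ?s)) ?m0 t m'" "?I N m'" "t <= N * (?T + ?G + 1) + ?G + 1"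
  by auto
 have "exec (Store (Const ?a) (Const 0)) m (1 + acost (Const ?a) m + acost (Const 0) m) ?m0"
  using Store[of "Const ?a" "Const 0" m] by simp
 hence "exec (forp rk rN c) m (1 + acost (Const ?a) m + acost (Const 0) m + t) m'"
  unfolding forp_def by (rule exec.Seq[OF _ 1(1)])
 moreover have "1 + acost (Const ?a) m + acost (Const 0) m + t <= fort rk rN N T"
  using 1(3) bits_of_nat[of 0] unfolding fort_def by (auto simp: algebra_simps)
 ultimately show ?thesis using 1(2) by blast
qed

lemma small_fort: "small E N ==> small E T ==> small E (%x. fort rk rN (N x) (T x))"
 unfolding fort_def by (intro small_intros)

text \<open>\<open>c\<close> fills array \<open>q\<close>; \<open>r1\<close>, \<open>r2\<close> are the loop counters, \<open>rn\<close>, \<open>rm\<close> hold the bounds.\<close>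

definition fills :: "'x env => (nat => nat) => nat => nat => nat => nat => nat => nat =>
  ('x => nat) => ('x => nat) => ('x => imat) => prog => ('x => nat) => bool" where
 "fills E ro s r1 r2 q rn rm n l f c T \<longleftrightarrow>
  (ALL x:edom E. ALL m. agr E ro x m --> m (adr rn 0 0) = int (n x) --> m (adr rm 0 0) = int (l x) -->
  (EX t m'. exec c m t m' & chg s {r1, r2, q} m m' & (ALL i<n x. ALL j<l x. m' (adr q i j) = f x i j) & t <= T x))"

lemma fillsD: "fills E ro s r1 r2 q rn rm n l f c T ==> x \<in> edom E ==> agr E ro x m ==>
  m (adr rn 0 0) = int (n x) ==> m (adr rm 0 0) = int (l x) ==>
  EX t m'. exec c m t m' & chg s {r1, r2, q} m m' & (ALL i<n x. ALL j<l x. m' (adr q i j) = f x i j) & t <= T x"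
 unfolding fills_def by blast

text \<open>For each entry the value goes to array \<open>s\<close> and its target address to array
  \<open>Suc s\<close>; an indirect store finishes. The counters \<open>r1\<close> and
  \<open>r2\<close> double as the index tables that \<open>f\<close> expects at the two topmost
  levels.\<close>

lemma fill_runs:
 fixes E :: "'x env"
 assumes f: "cmp (idx (idx E n) (%z. l (fst z))) (%z. f (fst2 z) (snd (fst z)) (snd z))"
  and n: "small E n" and l: "small E l"
  and ro: "ALL k<lev E. ro k < s & ro k \<notin> {r1, r2, q}"
  and s: "r1 < s" "r2 < s" "q < s" "rn < s" "rm < s"
  and d: "distinct [r1, r2, q, rn, rm]"
 shows "EX c T. small E T & fills E ro s r1 r2 q rn rm n l f c T"
proof -
 let ?E = "idx (idx E n) (%z. l (fst z))"
 define ro' where "ro' = ro(lev E := r1, Suc (lev E) := r2)"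
 have ag: "agr ?E ro' ((x, i), j) m \<longleftrightarrow> agr E ro x m & m (adr r1 0 0) = int i & m (adr r2 0 0) = int j" for x i j m
 proof -
  have "agr E ro' x m = agr E ro x m" by (rule agr_cong) (auto simp: ro'_def)
  thus ?thesis by (simp add: agr_idx) (simp add: ro'_def)
 qed
 have ro's: "ALL k<lev ?E. ro' k < s" using ro s by (auto simp: ro'_def less_Suc_eq)
 obtain c1 T1 where c1: "small ?E T1" "runs ?E ro' s c1 (%z. f (fst2 z) (snd (fst z)) (snd z)) T1"
  using cmpD[OF f ro's] by blast
 have "cmp ?E (%z. adr q (snd (fst z)) (snd z))"
  using n l by (intro cmp_adr cmp_idx[of _ "%z. int (snd z)"] cmp_snd small_idx)
 moreover have "ALL k<lev ?E. ro' k < Suc s" using ro's by auto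
 ultimately obtain c2 T2 where c2: "small ?E T2" "runs ?E ro' (Suc s) c2 (%z. adr q (snd (fst z)) (snd z)) T2"
  using cmpD by blast
 let ?st = "Store (Load (Const (adr (Suc s) 0 0))) (Load (Const (adr s 0 0)))"
 let ?c = "Seq c1 (Seq c2 ?st)"
 define T3 where "T3 z = T1 z + (T2 z + (10 + bits (adr s 0 0) + bits (adr (Suc s) 0 0) +
  bits (f (fst2 z) (snd (fst z)) (snd z)) + bits (adr q (snd (fst z)) (snd z))))" for z
 have T3: "small ?E T3" unfolding T3_def using c1(1) c2(1) sbits_smallD[OF cmp_sbits[OF f]]
   sbits_smallD[OF cmp_sbits[OF \<open>cmp ?E (%z. adr q (snd (fst z)) (snd z))\<close>]] by (intro small_intros)
 obtain T4 where T4: "small (idx E n) T4" "!!x j. x \<in> edom (idx E n) ==> j < l (fst x) ==> T3 (x, j) <= T4 x"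
  using small_idx_bound[OF T3] by blast
 obtain T5 where T5: "small E T5" "!!x i. x \<in> edom E ==> i < n x ==> T4 (x, i) <= T5 x"
  using small_idx_bound[OF T4(1)] by blast
 have step: "EX t m'. exec ?c m t m' & chg s {q} m m' & m' (adr q i j) = f x i j &
   (ALL i' j'. (i', j') ~= (i, j) --> m' (adr q i' j') = m (adr q i' j')) & t <= T5 x"
  if x: "x \<in> edom E" "i < n x" "j < l x" and m: "agr E ro x m" "m (adr r1 0 0) = int i" "m (adr r2 0 0) = int j"
  for x i j m proof -
  have z: "((x, i), j) \<in> edom ?E" using x by simp
  obtain t1 m1 where e1: "exec c1 m t1 m1" "chg s {} m m1" "m1 (adr s 0 0) = f x i j" "t1 <= T1 ((x, i), j)"
   using runsD[OF c1(2) z] m ag by fastforce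
  have "agr ?E ro' ((x, i), j) m1" using agr_chg[OF m(1) e1(2)] chg_adr[OF e1(2)] s ro m by (auto simp: ag)
  then obtain t2 m2 where e2: "exec c2 m1 t2 m2" "chg (Suc s) {} m1 m2" "m2 (adr (Suc s) 0 0) = adr q i j"
    "t2 <= T2 ((x, i), j)" using runsD[OF c2(2) z] by fastforce
  have fx: "m2 (adr s 0 0) = f x i j" using chg_adr[OF e2(2), of s] e1(3) by simp
  have e3: "exec ?st m2 (1 + acost (Load (Const (adr (Suc s) 0 0))) m2 + acost (Load (Const (adr s 0 0))) m2) (m2(adr q i j := f x i j))"
   using Store[of "Load (Const (adr (Suc s) 0 0))" "Load (Const (adr s 0 0))" m2] by (simp add: e2(3) fx)
  have c12: "chg s {} m m2" by (rule chg_trans[OF e1(2) e2(2)]) auto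
  have "chg s {q} m (m2(adr q i j := f x i j))" by (rule chg_trans[OF c12 chg_upd[of s q "{q}"]]) auto
  moreover have "t1 + (t2 + (1 + acost (Load (Const (adr (Suc s) 0 0))) m2 + acost (Load (Const (adr s 0 0))) m2)) <= T5 x"
  proof -
   have "T3 ((x, i), j) <= T5 x" using T4(2)[of "(x, i)" j] T5(2)[of x i] x by simp
   thus ?thesis using e1(4) e2(4) by (simp add: T3_def fx e2(3))
  qed
  moreover have "ALL i' j'. (i', j') ~= (i, j) --> (m2(adr q i j := f x i j)) (adr q i' j') = m (adr q i' j')"
   using chg_adr[OF c12 s(3)] by auto
  ultimately show ?thesis
   by (intro exI[of _ "t1 + (t2 + (1 + acost (Load (Const (adr (Suc s) 0 0))) m2 + acost (Load (Const (adr s 0 0))) m2))"]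
     exI[of _ "m2(adr q i j := f x i j)"]) (use exec.Seq[OF e1(1) exec.Seq[OF e2(1) e3]] in auto)
 qed
 let ?p = "forp r1 rn (forp r2 rm ?c)"
 let ?T = "%x. fort r1 rn (n x) (fort r2 rm (l x) (T5 x))"
 have "EX t m'. exec ?p m t m' & chg s {r1, r2, q} m m' & (ALL i<n x. ALL j<l x. m' (adr q i j) = f x i j) & t <= ?T x"
  if x: "x \<in> edom E" and m: "agr E ro x m" "m (adr rn 0 0) = int (n x)" "m (adr rm 0 0) = int (l x)" for x m proof -
  let ?J = "%i M. chg s {r1, r2, q} m M & (ALL i'<i. ALL j<l x. M (adr q i' j) = f x i' j)"
  have base: "agr E ro x M & M (adr rn 0 0) = int (n x) & M (adr rm 0 0) = int (l x)"
   if M: "chg s {r1, r2, q} m M" for M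
   using agr_chg[OF m(1) M] chg_adr[OF M, of rn] chg_adr[OF M, of rm] s d m ro by auto
  have "EX t m'. exec ?p m t m' & ?J (n x) m' & t <= ?T x" proof (rule exec_forp[where J="?J"])
   fix i M assume i: "i < n x" and J: "?J i M" and Mi: "M (adr r1 0 0) = int i"
   let ?K = "%j M. chg s {r1, r2, q} m M & (ALL i'<i. ALL j<l x. M (adr q i' j) = f x i' j) &
    (ALL j'<j. M (adr q i j') = f x i j') & M (adr r1 0 0) = int i"
   have "EX t m'. exec (forp r2 rm ?c) M t m' & ?K (l x) m' & t <= fort r2 rm (l x) (T5 x)"
   proof (rule exec_forp[where J="?K"])
    fix j M' assume j: "j < l x" and K: "?K j M'" and Mj: "M' (adr r2 0 0) = int j"
    obtain t m' where 1: "exec ?c M' t m'" "chg s {q} M' m'" "m' (adr q i j) = f x i j"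
     "ALL i' j'. (i', j') ~= (i, j) --> m' (adr q i' j') = M' (adr q i' j')" "t <= T5 x"
     using step[OF x i j, of M'] K base Mj by blast
    have "chg s {r1, r2, q} m m'" by (rule chg_trans[OF conjunct1[OF K] 1(2)]) auto
    moreover have "m' (adr r1 0 0) = int i" "m' (adr r2 0 0) = int j"
     using chg_adr[OF 1(2), of r1] chg_adr[OF 1(2), of r2] s d K Mj by auto
    ultimately show "EX t m'. exec ?c M' t m' & ?K (Suc j) m' & m' (adr r2 0 0) = int j & t <= T5 x"
     using 1 K by (intro exI[of _ t] exI[of _ m']) (auto simp: less_Suc_eq)
   next
    fix j M' v assume "?K j M'"
    thus "?K j (M'(adr r2 0 0 := v))"
     using chg_trans[OF _ chg_upd[of s r2 "{r1,r2,q}"], of s "{r1,r2,q}" m M' s "{r1,r2,q}"] d by auto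
   next
    fix j M' assume "?K j M'" thus "M' (adr rm 0 0) = int (l x)" using base by blast
   qed (use J Mi in auto)
   then obtain t m' where 1: "exec (forp r2 rm ?c) M t m'" "?K (l x) m'" "t <= fort r2 rm (l x) (T5 x)" by blast
   hence "?J (Suc i) m'" by (simp add: less_Suc_eq)
   with 1 show "EX t m'. exec (forp r2 rm ?c) M t m' & ?J (Suc i) m' & m' (adr r1 0 0) = int i & t <= fort r2 rm (l x) (T5 x)"
    by blast
  next
   fix i M v assume "?J i M"
   thus "?J i (M(adr r1 0 0 := v))"
    using chg_trans[OF _ chg_upd[of s r1 "{r1,r2,q}"], of s "{r1,r2,q}" m M s "{r1,r2,q}"] d by auto
  next
   fix i M assume "?J i M" thus "M (adr rn 0 0) = int (n x)" using base by blast
  qed (auto simp: chg_refl)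
  then obtain t m' where 1: "exec ?p m t m'" "?J (n x) m'" "t <= ?T x" by blast
  thus ?thesis by (intro exI[of _ t] exI[of _ m']) simp
 qed
 moreover have "small E ?T" by (intro small_fort n l T5)
 ultimately show ?thesis unfolding fills_def by blast
qed

text \<open>
 The loop keeps \<open>S x k\<close> in array \<open>b + 1\<close> while \<open>S x (Suc k)\<close> is assembled in array \<open>b + 4\<close>.
\<close>

theorem cmp_rec:
 fixes E :: "'x env"
 assumes N: "cmpn E N" "small E N" and n: "cmpn E n" "small E n" and l: "cmpn E l" "small E l"
  and bnd: "small (idx (idx (idx E (%x. Suc (N x))) (%z. n (fst z))) (%z. l (fst2 z)))
   (%z. bits (S (fst3 z) (snd (fst2 z)) (snd (fst z)) (snd z)))"
  and base: "cmp (idx (idx E n) (%z. l (fst z))) (%z. S (fst2 z) 0 (snd (fst z)) (snd z))"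
  and step: "has (tbl (idx E N) (%z. n (fst z)) (%z. l (fst z)) (%z. S (fst z) (snd z)))
     (%z. n (fst z)) (%z. l (fst z)) (%z. S (fst z) (snd z)) ==>
   cmp (idx (idx (tbl (idx E N) (%z. n (fst z)) (%z. l (fst z)) (%z. S (fst z) (snd z)))
     (%z. n (fst z))) (%z. l (fst2 z)))
   (%z. S (fst3 z) (Suc (snd (fst2 z))) (snd (fst z)) (snd z))"
  and body: "has (tbl E n l (%x. S x (N x))) n l (%x. S x (N x)) ==> cmp (tbl E n l (%x. S x (N x))) f"
 shows "cmp E f"
proof -
 obtain a where a: "!!x k i j. x \<in> edom E ==> k <= N x ==> i < n x ==> j < l x ==> bits (S x k i j) <= (sz E x + 2) ^ a"
  using bnd unfolding small_def by (fastforce simp: less_Suc_eq_le)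
 let ?S = "%z. S (fst z) (snd z)" and ?S' = "%z. S (fst z) (Suc (snd z))"
 let ?n = "%z. n (fst z)" and ?l = "%z. l (fst z)"
 let ?Es = "tbl (idx E N) ?n ?l ?S" and ?Ec = "tbl (idx E N) ?n ?l ?S'"
 have hs: "has ?Es ?n ?l ?S" "has ?Ec ?n ?l ?S'" "has (tbl E n l (%x. S x (N x))) n l (%x. S x (N x))"
  by (auto intro!: has_new smallI[of _ _ a] a[simplified] simp: sbits_def)
 note step = step[OF hs(1)] and body = body[OF hs(3)]
 have copy: "cmp (idx (idx ?Ec ?n) (%z. l (fst2 z))) (%z. S (fst3 z) (Suc (snd (fst2 z))) (snd (fst z)) (snd z))"
 proof -
  have "small ?Ec ?n" "small (idx ?Ec ?n) (%z. l (fst2 z))"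
   using n(2) l(2) by (auto simp: small_tbl intro!: small_idx[of _ "%z. l (fst z)"] small_idx[of E])
  thus ?thesis by (intro cmp_has[OF has_idx[OF has_idx[OF hs(2)]]] cmp_idx[of _ "%z. int (snd z)"] cmp_snd) auto
 qed
 show ?thesis proof (rule cmpI)
  show "sbits E f" using cmp_sbits[OF body] by (simp add: sbits_def small_tbl)
  fix ro :: "nat => nat" and b :: nat
  assume ro: "ALL k<lev E. ro k < b"
  let ?L = "lev E" and ?s = "b + 8"
  let ?r = "[b, b + 1, b + 2, b + 3, b + 4]"
  have rob: "ALL k<?L. ro k < b + 5" "ALL k<?L. ro k < b + 6" "ALL k<?L. ro k < b + 7" using ro by auto
  obtain c1 T1 where c1: "small E T1" "runs E ro (b + 5) c1 (%x. int (N x)) T1" using cmpD[OF N(1) rob(1)] by blast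
  obtain c2 T2 where c2: "small E T2" "runs E ro (b + 6) c2 (%x. int (n x)) T2" using cmpD[OF n(1) rob(2)] by blast
  obtain c3 T3 where c3: "small E T3" "runs E ro (b + 7) c3 (%x. int (l x)) T3" using cmpD[OF l(1) rob(3)] by blast
  have ro1: "ALL k<lev E. ro k < ?s & ro k \<notin> {b + 2, b + 3, b + 1}" using ro by fastforce
  obtain c4 T4 where c4: "small E T4" "fills E ro ?s (b + 2) (b + 3) (b + 1) (b + 6) (b + 7) n l (%x. S x 0) c4 T4"
   using fill_runs[where f="%x. S x 0", OF base n(2) l(2) ro1, of "b + 6" "b + 7"] by auto
  \<comment> \<open>Three layouts of the tables: \<open>ro2\<close> reads the current state from
    array \<open>b + 1\<close>, \<open>ro3\<close> reads the next state from array
    \<open>b + 4\<close> while it is copied back, and \<open>ro4\<close> presents the final state to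
    \<open>f\<close>, now without a loop counter.\<close>
  define ro2 where "ro2 = ro(?L := b, Suc ?L := b + 1)"
  define ro3 where "ro3 = ro(?L := b, Suc ?L := b + 4)"
  define ro4 where "ro4 = ro(?L := b + 1)"
  have ag: "agr E ro2 x m = agr E ro x m" "agr E ro3 x m = agr E ro x m" "agr E ro4 x m = agr E ro x m" for x m
   by (auto intro!: agr_cong simp: ro2_def ro3_def ro4_def)
  have ro2l: "ALL k<lev ?Es. ro2 k < ?s & ro2 k \<notin> {b + 2, b + 3, b + 4}" using ro by (fastforce simp: less_Suc_eq ro2_def)
  have ro3l: "ALL k<lev ?Ec. ro3 k < ?s & ro3 k \<notin> {b + 2, b + 3, b + 1}" using ro by (fastforce simp: less_Suc_eq ro3_def)
  have sm: "small ?Es ?n" "small ?Es ?l" "small ?Ec ?n" "small ?Ec ?l"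
   using n(2) l(2) by (auto simp: small_tbl intro!: small_idx)
  obtain c5 T5 where c5: "small ?Es T5" "fills ?Es ro2 ?s (b + 2) (b + 3) (b + 4) (b + 6) (b + 7) ?n ?l ?S' c5 T5"
   using fill_runs[where f="?S'", OF step sm(1,2) ro2l, of "b + 6" "b + 7"] by auto
  obtain c6 T6 where c6: "small ?Ec T6" "fills ?Ec ro3 ?s (b + 2) (b + 3) (b + 1) (b + 6) (b + 7) ?n ?l ?S' c6 T6"
   using fill_runs[where f="?S'", OF copy sm(3,4) ro3l, of "b + 6" "b + 7"] by auto
  have "ALL k<lev (tbl E n l (%x. S x (N x))). ro4 k < ?s" proof (intro allI impI)
   fix k assume "k < lev (tbl E n l (%x. S x (N x)))"
   thus "ro4 k < ?s" using ro[rule_format, of k] by (auto simp: less_Suc_eq ro4_def)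
  qed
  from cmpD[OF body this] obtain c7 T7 where c7: "small (tbl E n l (%x. S x (N x))) T7" "runs (tbl E n l (%x. S x (N x))) ro4 ?s c7 f T7"
   by blast
  have "small (idx E N) (%z. T5 z + T6 z)" using c5(1) c6(1) by (intro small_intros) (simp_all add: small_tbl)
  then obtain T8 where T8: "small E T8" "!!x k. x \<in> edom E ==> k < N x ==> T5 (x, k) + T6 (x, k) <= T8 x"
   using small_idx_bound by blast
  let ?lp = "forp b (b + 5) (Seq c5 c6)"
  let ?cp = "Store (Const (adr b 0 0)) (Load (Const (adr ?s 0 0)))"
  let ?c = "Seq c1 (Seq c2 (Seq c3 (Seq c4 (Seq ?lp (Seq c7 ?cp)))))"
  let ?T = "%x. T1 x + (T2 x + (T3 x + (T4 x + (fort b (b + 5) (N x) (T8 x) + (T7 x +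
   (10 + bits (adr b 0 0) + bits (adr ?s 0 0) + bits (f x)))))))"
  have "EX t m'. exec ?c m t m' & chg b {} m m' & m' (adr b 0 0) = f x & t <= ?T x"
   if x: "x \<in> edom E" and m: "agr E ro x m" for x m proof -
   obtain t1 m1 where e1: "exec c1 m t1 m1" "chg (b + 5) {} m m1" "m1 (adr (b + 5) 0 0) = int (N x)" "t1 <= T1 x"
    using runsD[OF c1(2) x m] by blast
   have m1: "agr E ro x m1" using agr_chg[OF m e1(2)] rob(1) by auto
   obtain t2 m2 where e2: "exec c2 m1 t2 m2" "chg (b + 6) {} m1 m2" "m2 (adr (b + 6) 0 0) = int (n x)" "t2 <= T2 x"
    using runsD[OF c2(2) x m1] by blast
   have m2: "agr E ro x m2" using agr_chg[OF m1 e2(2)] rob(2) by auto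
   obtain t3 m3 where e3: "exec c3 m2 t3 m3" "chg (b + 7) {} m2 m3" "m3 (adr (b + 7) 0 0) = int (l x)" "t3 <= T3 x"
    using runsD[OF c3(2) x m2] by blast
   have m3: "agr E ro x m3" using agr_chg[OF m2 e3(2)] rob(3) by auto
   have v3: "m3 (adr (b + 5) 0 0) = int (N x)" "m3 (adr (b + 6) 0 0) = int (n x)"
    using chg_adr[OF e2(2), of "b + 5"] chg_adr[OF e3(2), of "b + 5"] chg_adr[OF e3(2), of "b + 6"] e1(3) e2(3) by auto
   obtain t4 m4 where e4: "exec c4 m3 t4 m4" "chg ?s {b + 2, b + 3, b + 1} m3 m4"
     "ALL i<n x. ALL j<l x. m4 (adr (b + 1) i j) = S x 0 i j" "t4 <= T4 x" using fillsD[OF c4(2) x m3 v3(2) e3(3)] by blast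
   let ?J = "%k M. chg ?s (set ?r) m3 M & (ALL i<n x. ALL j<l x. M (adr (b + 1) i j) = S x k i j)"
   have bs: "agr E ro x M & M (adr (b + 5) 0 0) = int (N x) & M (adr (b + 6) 0 0) = int (n x) & M (adr (b + 7) 0 0) = int (l x)"
    if M: "chg ?s (set ?r) m3 M" for M proof -
    have "agr E ro x M" by (rule agr_chg[OF m3 M]) (use ro in fastforce)
    thus ?thesis
     using chg_adr[OF M, of "b + 5"] chg_adr[OF M, of "b + 6"] chg_adr[OF M, of "b + 7"] v3 e3(3) by auto
   qed
   have "EX t M. exec ?lp m4 t M & ?J (N x) M & t <= fort b (b + 5) (N x) (T8 x)" proof (rule exec_forp[where J="?J"])
    fix k M assume k: "k < N x" and J: "?J k M" and Mk: "M (adr b 0 0) = int k"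
    have z: "(x, k) \<in> edom ?Es" "(x, k) \<in> edom ?Ec" using x k by auto
    have 1: "agr ?Es ro2 (x, k) M" using bs[OF conjunct1[OF J]] J Mk ag(1)[of x M]
     by (simp add: agr_tbl agr_idx) (simp add: ro2_def)
    obtain t5 M5 where e5: "exec c5 M t5 M5" "chg ?s {b + 2, b + 3, b + 4} M M5"
      "ALL i<n x. ALL j<l x. M5 (adr (b + 4) i j) = S x (Suc k) i j" "t5 <= T5 (x, k)"
     using fillsD[OF c5(2) z(1) 1] bs[OF conjunct1[OF J]] by auto
    have J5: "chg ?s (set ?r) m3 M5" by (rule chg_trans[OF conjunct1[OF J] e5(2)]) auto
    have Mk5: "M5 (adr b 0 0) = int k" using chg_adr[OF e5(2), of b] Mk by auto
    have 2: "agr ?Ec ro3 (x, k) M5" using bs[OF J5] e5(3) Mk5 ag(2)[of x M5]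
     by (simp add: agr_tbl agr_idx) (simp add: ro3_def)
    obtain t6 M6 where e6: "exec c6 M5 t6 M6" "chg ?s {b + 2, b + 3, b + 1} M5 M6"
      "ALL i<n x. ALL j<l x. M6 (adr (b + 1) i j) = S x (Suc k) i j" "t6 <= T6 (x, k)"
     using fillsD[OF c6(2) z(2) 2] bs[OF J5] by auto
    have J6: "chg ?s (set ?r) m3 M6" by (rule chg_trans[OF J5 e6(2)]) auto
    have Mk6: "M6 (adr b 0 0) = int k" using chg_adr[OF e6(2), of b] Mk5 by auto
    have "t5 + t6 <= T8 x" using T8(2)[OF x k] e5(4) e6(4) by linarith
    thus "EX t m'. exec (Seq c5 c6) M t m' & ?J (Suc k) m' & m' (adr b 0 0) = int k & t <= T8 x"
     using exec.Seq[OF e5(1) e6(1)] J6 Mk6 e6(3) by blast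
   next
    fix k M v assume J: "?J k M"
    thus "?J k (M(adr b 0 0 := v))"
     using chg_trans[OF conjunct1[OF J] chg_upd[of ?s b "set ?r"], of ?s "set ?r"] by auto
   next
    fix k M assume "?J k M" thus "M (adr (b + 5) 0 0) = int (N x)" using bs by blast
   next
    show "?J 0 m4" using e4(3) chg_mono[OF e4(2), of ?s "set ?r"] by auto
   qed
   then obtain t5 m5 where e5: "exec ?lp m4 t5 m5" "chg ?s (set ?r) m3 m5"
    "ALL i<n x. ALL j<l x. m5 (adr (b + 1) i j) = S x (N x) i j" "t5 <= fort b (b + 5) (N x) (T8 x)" by blast
   have "agr (tbl E n l (%x. S x (N x))) ro4 x m5" using bs[OF e5(2)] e5(3) ag(3)[of x m5]
    by (simp add: agr_tbl) (simp add: ro4_def)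
   then obtain t6 m6 where e6: "exec c7 m5 t6 m6" "chg ?s {} m5 m6" "m6 (adr ?s 0 0) = f x" "t6 <= T7 x"
    using runsD[OF c7(2)] x by fastforce
   have e7: "exec ?cp m6 (1 + acost (Const (adr b 0 0)) m6 + acost (Load (Const (adr ?s 0 0))) m6) (m6(adr b 0 0 := f x))"
    using Store[of "Const (adr b 0 0)" "Load (Const (adr ?s 0 0))" m6] by (simp add: e6(3))
   have k1: "chg b {} m m1" by (rule chg_mono[OF e1(2)]) auto
   have k2: "chg b {} m m2" by (rule chg_trans[OF k1 e2(2)]) auto
   have k3: "chg b {} m m3" by (rule chg_trans[OF k2 e3(2)]) auto
   have k5: "chg b {} m m5" by (rule chg_trans[OF k3 e5(2)]) auto
   have k6: "chg b {} m m6" by (rule chg_trans[OF k5 e6(2)]) auto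
   have k7: "chg b {} m (m6(adr b 0 0 := f x))" by (rule chg_trans[OF k6 chg_upd[of b b "{}"]]) auto
   show ?thesis
    by (rule execI[OF exec.Seq[OF e1(1) exec.Seq[OF e2(1) exec.Seq[OF e3(1) exec.Seq[OF e4(1) exec.Seq[OF e5(1) exec.Seq[OF e6(1) e7]]]]]] k7])
     (use e1(4) e2(4) e3(4) e4(4) e5(4) e6(4) in "auto simp: e6(3)")
  qed
  moreover have "small E ?T" using c1(1) c2(1) c3(1) c4(1) c7(1) sbits_smallD[OF cmp_sbits[OF body]] T8(1) N(2)
   by (intro small_intros small_fort) (simp_all add: small_tbl)
  ultimately show "EX c T. small E T & runs E ro b c f T" unfolding runs_def
  by blast
 qed
qed

subsection \<open>Derived constructions\<close>

lemma cmp_empty: "edom E = {} ==> cmp E f" by (rule cmp_cong[OF cmp_const]) auto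

text \<open>Repeated halving. The number of rounds is the unknown itself, so this is a bare while
  loop; everything else uses counted loops. It is needed because the working precision depends on
  the bit length of the input.\<close>

lemma cmp_bits:
 assumes f: "cmp E f" shows "cmpn E (%x. bits (f x))"
proof (rule cmpI)
 show "sbits E (%x. int (bits (f x)))" by (intro sbits_nat sbits_smallD cmp_sbits f)
 fix ro :: "nat => nat" and b :: nat
 assume ro: "ALL k<lev E. ro k < b"
 obtain c T where c: "small E T" "runs E ro b c f T" using cmpD[OF f ro] by blast
 let ?a = "adr b 0 0" and ?d = "adr (Suc b) 0 0"
 let ?A = "Const ?a" and ?D = "Const ?d"
 let ?abs = "IfPos (Sub (Const 0) (Load ?A)) (Store ?A (Sub (Const 0) (Load ?A))) Skip"
 let ?w = "Seq (Store ?A (Div (Load ?A) (Const 2))) (Store ?D (Add (Load ?D) (Const 1)))"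
 let ?c = "Seq c (Seq ?abs (Seq (Store ?D (Const 0)) (Seq (WhilePos (Load ?A) ?w) (Store ?A (Load ?D)))))"
 let ?Tw = "%x. 20 + 2 * bits ?a + 2 * bits ?d + 5 * bits (f x)" and ?G = "%x. 5 + bits ?a + bits (f x)"
 let ?T = "%x. T x + ((20 + 4 * bits ?a + 4 * bits (f x)) + ((10 + bits ?d) +
  ((bits (f x) * (?Tw x + ?G x + 1) + ?G x + 1) + (10 + bits ?a + bits ?d + bits (f x)))))"
 have k0: "bits 0 = 0" "bits 1 = 1" "bits 2 = 2" by (simp_all add: bits_def floorlog_def)
 have "EX t m'. exec ?c m t m' & chg b {} m m' & m' ?a = int (bits (f x)) & t <= ?T x"
  if x: "x \<in> edom E" and m: "agr E ro x m" for x m proof -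
  obtain t1 m1 where e1: "exec c m t1 m1" "chg b {} m m1" "m1 ?a = f x" "t1 <= T x" using runsD[OF c(2) x m] by blast
  let ?m2 = "m1(?a := \<bar>f x\<bar>)"
  have e2: "EX t. exec ?abs m1 t ?m2 & t <= 20 + 4 * bits ?a + 4 * bits (f x)" proof (cases "f x < 0")
   case True
   have "exec ?abs m1 (1 + acost (Sub (Const 0) (Load ?A)) m1 + (1 + acost ?A m1 + acost (Sub (Const 0) (Load ?A)) m1)) ?m2"
    using Store[of ?A "Sub (Const 0) (Load ?A)" m1] True by (intro IfTrue) (auto simp: e1(3))
   thus ?thesis by - (intro exI conjI, assumption, simp add: e1(3) k0)
  next
   case False
   hence "?m2 = m1" using e1(3) by (auto simp: fun_eq_iff)
   hence "exec ?abs m1 (1 + acost (Sub (Const 0) (Load ?A)) m1 + 1) ?m2"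
    using exec.Skip[of m1] False by (intro IfFalse) (auto simp: e1(3))
   thus ?thesis by - (intro exI conjI, assumption, simp add: e1(3) k0)
  qed
  then obtain t2 where e2: "exec ?abs m1 t2 ?m2" "t2 <= 20 + 4 * bits ?a + 4 * bits (f x)" by blast
  let ?m3 = "?m2(?d := 0)"
  have e3: "exec (Store ?D (Const 0)) ?m2 (1 + acost ?D ?m2 + acost (Const 0) ?m2) ?m3"
   using Store[of ?D "Const 0" ?m2] by simp
  let ?I = "%k M. M ?a = \<bar>f x\<bar> div 2 ^ k & M ?d = int k & chg b {} m M"
  have "EX t M. exec (WhilePos (Load ?A) ?w) ?m3 t M & ?I (bits (f x)) M & t <= (bits (f x) - 0) * (?Tw x + ?G x + 1) + ?G x + 1"
  proof (rule exec_while[where I = ?I])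
   fix k M assume k: "k < bits (f x)" and I: "?I k M"
   let ?M1 = "M(?a := \<bar>f x\<bar> div 2 ^ Suc k)" let ?M2 = "?M1(?d := int (Suc k))"
   have v: "M ?a div 2 = \<bar>f x\<bar> div 2 ^ Suc k" using I by (simp add: zdiv_zmult2_eq[symmetric] mult.commute)
   have "exec (Store ?A (Div (Load ?A) (Const 2))) M (1 + acost ?A M + acost (Div (Load ?A) (Const 2)) M) ?M1"
    using Store[of ?A "Div (Load ?A) (Const 2)" M] v by simp
   moreover have "exec (Store ?D (Add (Load ?D) (Const 1))) ?M1 (1 + acost ?D ?M1 + acost (Add (Load ?D) (Const 1)) ?M1) ?M2"
    using Store[of ?D "Add (Load ?D) (Const 1)" ?M1] I by (simp add: add.commute)
   ultimately have ex: "exec ?w M ((1 + acost ?A M + acost (Div (Load ?A) (Const 2)) M) + (1 + acost ?D ?M1 + acost (Add (Load ?D) (Const 1)) ?M1)) ?M2"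
    by (rule exec.Seq)
   have b1: "bits (\<bar>f x\<bar> div 2 ^ k) <= bits (f x)" for k using bits_div[of "\<bar>f x\<bar>"] by (simp add: bits_def)
   have "bits (int k) <= bits (f x)" "bits (int k + 1) <= bits (f x)"
    using bits_of_nat[of k] bits_of_nat[of "Suc k"] k by (auto simp: add.commute)
   hence "(1 + acost ?A M + acost (Div (Load ?A) (Const 2)) M) + (1 + acost ?D ?M1 + acost (Add (Load ?D) (Const 1)) ?M1) <= ?Tw x"
    using I b1[of k] b1[of "Suc k"] v by (simp add: k0)
   moreover have "chg b {} m ?M2"
    using chg_trans[OF chg_trans[OF _ chg_upd[of b b "{}"]] chg_upd[of b "Suc b" "{}"], of b "{}" m M b "{}"] I by auto
   ultimately show "EX t m'. exec ?w M t m' & ?I (Suc k) m' & t <= ?Tw x"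
    using ex by (intro exI[of _ "(1 + acost ?A M + acost (Div (Load ?A) (Const 2)) M) + (1 + acost ?D ?M1 + acost (Add (Load ?D) (Const 1)) ?M1)"] exI[of _ ?M2]) simp
  next
   fix k M assume I: "?I k M"
   have "0 < \<bar>f x\<bar> div 2 ^ k \<longleftrightarrow> ~ \<bar>f x\<bar> < 2 ^ k" using pos_imp_zdiv_pos_iff[of "2 ^ k" "\<bar>f x\<bar>"] by auto
   hence "(0 < M ?a) = (k < bits (f x))" using I bits_le_iff[of "f x" k] by auto
   moreover have "bits (M ?a) <= bits (f x)" using I bits_div[of "\<bar>f x\<bar>" "2 ^ k"] by (simp add: bits_def)
   ultimately show "(0 < aval (Load ?A) M) = (k < bits (f x)) & acost (Load ?A) M <= ?G x" by simp
  next
   have "chg b {} m ?m3"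
    by (rule chg_trans[OF chg_trans[OF e1(2) chg_upd[of b b "{}"], of b "{}"] chg_upd[of b "Suc b" "{}"]]) auto
   thus "?I 0 ?m3" by simp
  qed simp
  then obtain t4 m4 where e4: "exec (WhilePos (Load ?A) ?w) ?m3 t4 m4" "m4 ?d = int (bits (f x))" "chg b {} m m4"
   "t4 <= bits (f x) * (?Tw x + ?G x + 1) + ?G x + 1" by auto
  have e5: "exec (Store ?A (Load ?D)) m4 (1 + acost ?A m4 + acost (Load ?D) m4) (m4(?a := int (bits (f x))))"
   using Store[of ?A "Load ?D" m4] e4(2) by simp
  have "chg b {} m (m4(?a := int (bits (f x))))" by (rule chg_trans[OF e4(3) chg_upd[of b b "{}"]]) auto
  thus ?thesis by (rule execI[OF exec.Seq[OF e1(1) exec.Seq[OF e2(1) exec.Seq[OF e3 exec.Seq[OF e4(1) e5]]]]])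
    (use e1(4) e2(2) e4(4) bits_of_nat[of "bits (f x)"] in "auto simp: k0 e4(2) simp del: mult_Suc_right intro!: add_mono")
 qed
 moreover have "small E ?T" using c(1) sbits_smallD[OF cmp_sbits[OF f]] by (intro small_intros)
 ultimately show "EX c T. small E T & runs E ro b c (%x. int (bits (f x))) T" unfolding runs_def
  by blast
qed

text \<open>A recursion with zero rounds, whose initial state is the table to be shared.\<close>

lemma cmp_let:
 assumes n: "cmpn E n" "small E n" and l: "cmpn E l" "small E l"
  and S: "cmp (idx (idx E n) (%z. l (fst z))) (%z. S (fst2 z) (snd (fst z)) (snd z))"
  and body: "has (tbl E n l S) n l S ==> cmp (tbl E n l S) f"
 shows "cmp E f"
proof (rule cmp_rec[where S="%x k. S x" and N="%x. 0", OF _ _ n l _ S])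
 obtain a where "!!x i j. x \<in> edom E ==> i < n x ==> j < l x ==> bits (S x i j) <= (sz E x + 2) ^ a"
  using sbits_smallD[OF cmp_sbits[OF S]] by (fastforce simp: small_def)
 thus "small (idx (idx (idx E (%x. Suc 0)) (%z. n (fst z))) (%z. l (fst2 z)))
  (%z. bits (S (fst3 z) (snd (fst z)) (snd z)))"
  by (intro smallI[of _ _ a]) auto
qed (auto intro: body cmp_const small_const cmp_empty)

text \<open>As in \<open>cmp_rec\<close>, a size bound for all intermediate values is a hypothesis:
  polynomially many cheap steps can still build numbers of exponential length, for instance by
  repeated squaring.\<close>

lemma cmp_iter:
 assumes N: "cmpn E N" "small E N"
  and bnd: "sbits (idx E (%x. Suc (N x))) (%z. F (fst z) (snd z))"
  and base: "cmp E (%x. F x 0)"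
  and step: "has (tbl (idx E N) (%z. 1) (%z. 1) (%z i j. F (fst z) (snd z)))
     (%z. 1) (%z. 1) (%z i j. F (fst z) (snd z)) ==>
   cmp (tbl (idx E N) (%z. 1) (%z. 1) (%z i j. F (fst z) (snd z))) (%z. F (fst z) (Suc (snd z)))"
 shows "cmp E (%x. F x (N x))"
proof (rule cmp_rec[where S="%x k i j. F x k" and n="%x. 1" and l="%x. 1", OF N])
 obtain a where "!!x k. x \<in> edom E ==> k < Suc (N x) ==> bits (F x k) <= (sz E x + 2) ^ a"
  using bnd by (fastforce simp: small_def sbits_def)
 thus "small (idx (idx (idx E (%x. Suc (N x))) (%z. 1)) (%z. 1)) (%z. bits (F (fst3 z) (snd (fst2 z))))"
  by (intro smallI[of _ _ a]) auto
next
 show "cmp (idx (idx E (%x. 1)) (%z. 1)) (%z. F (fst2 z) 0)"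
  by (intro cmp_idx[of _ "%z. F (fst z) 0"] cmp_idx[of _ "%x. F x 0"] base)
next
 assume "has (tbl (idx E N) (%z. 1) (%z. 1) (%z i j. F (fst z) (snd z))) (%z. 1) (%z. 1) (%z i j. F (fst z) (snd z))"
 from step[OF this]
 show "cmp (idx (idx (tbl (idx E N) (%z. 1) (%z. 1) (%z i j. F (fst z) (snd z))) (%z. 1)) (%z. 1))
  (%z. F (fst3 z) (Suc (snd (fst2 z))))"
  by (intro cmp_idx[of _ "%z. F (fst2 z) (Suc (snd (fst z)))"] cmp_idx[of _ "%z. F (fst z) (Suc (snd z))"])
next
 assume "has (tbl E (%x. 1) (%x. 1) (%x i j. F x (N x))) (%x. 1) (%x. 1) (%x i j. F x (N x))"
 from cmp_has[OF this cmpn_const[of _ 0] cmpn_const[of _ 0]]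
 show "cmp (tbl E (%x. 1) (%x. 1) (%x i j. F x (N x))) (%x. F x (N x))" by simp
qed (auto intro: cmp_const small_const)

lemma cmp_iter_prev:
 assumes "has (tbl (idx E N) (%z. 1) (%z. 1) (%z i j. F (fst z) (snd z)))
     (%z. 1) (%z. 1) (%z i j. F (fst z) (snd z))"
 shows "cmp (tbl (idx E N) (%z. 1) (%z. 1) (%z i j. F (fst z) (snd z))) (%z. F (fst z) (snd z))"
 using cmp_has[OF assms cmpn_const[of _ 0] cmpn_const[of _ 0]] by simp

lemma cmp_sum:
 assumes N: "cmpn E N" "small E N" and f: "cmp (idx E N) (%z. f (fst z) (snd z))"
 shows "cmp E (%x. \<Sum>i<N x. f x i)"
proof (rule cmp_iter[where F="%x k. \<Sum>i<k. f x i", OF N])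
 obtain T where T: "small E T" "!!x k. x \<in> edom E ==> k < N x ==> bits (f x k) <= T x"
  using small_idx_bound[OF sbits_smallD[OF cmp_sbits[OF f]]] by auto
 show "sbits (idx E (%x. Suc (N x))) (%z. \<Sum>i<snd z. f (fst z) i)"
 proof (rule sbits_mono[where g="%z. int (N (fst z)) * 2 ^ T (fst z)"])
  show "sbits (idx E (%x. Suc (N x))) (%z. int (N (fst z)) * 2 ^ T (fst z))"
   by (intro sbits_mult sbits_nat sbits_pow2 small_idx N T)
  fix z assume z: "z \<in> edom (idx E (%x. Suc (N x)))"
  have "\<bar>\<Sum>i<snd z. f (fst z) i\<bar> <= (\<Sum>i<snd z. \<bar>f (fst z) i\<bar>)" by (rule sum_abs)
  also have "... <= (\<Sum>i<snd z. 2 ^ T (fst z))"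
   using T(2) z by (intro sum_mono less_imp_le) (auto simp flip: bits_le_iff)
  also have "... <= int (N (fst z)) * 2 ^ T (fst z)" using z by (auto intro!: mult_right_mono)
  finally show "\<bar>\<Sum>i<snd z. f (fst z) i\<bar> <= \<bar>int (N (fst z)) * 2 ^ T (fst z)\<bar>" by simp
 qed
next
 assume h: "has (tbl (idx E N) (%z. 1) (%z. 1) (%z i j. \<Sum>i<snd z. f (fst z) i)) (%z. 1) (%z. 1) (%z i j. \<Sum>i<snd z. f (fst z) i)"
 show "cmp (tbl (idx E N) (%z. 1) (%z. 1) (%z i j. \<Sum>i<snd z. f (fst z) i)) (%z. \<Sum>i<Suc (snd z). f (fst z) i)"
  using cmp_add[OF cmp_iter_prev[where F="%x k. \<Sum>i<k. f x i", OF h] cmp_tbl[OF f]] by simp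
qed (simp add: cmp_const)

lemma cmp_prod:
 assumes N: "cmpn E N" "small E N" and f: "cmp (idx E N) (%z. f (fst z) (snd z))"
 shows "cmp E (%x. \<Prod>i<N x. f x i)"
proof (rule cmp_iter[where F="%x k. \<Prod>i<k. f x i", OF N])
 obtain T where T: "small E T" "!!x k. x \<in> edom E ==> k < N x ==> bits (f x k) <= T x"
  using small_idx_bound[OF sbits_smallD[OF cmp_sbits[OF f]]] by auto
 show "sbits (idx E (%x. Suc (N x))) (%z. \<Prod>i<snd z. f (fst z) i)"
 proof (rule sbits_mono[where g="%z. 2 ^ (T (fst z) * N (fst z))"])
  show "sbits (idx E (%x. Suc (N x))) (%z. 2 ^ (T (fst z) * N (fst z)))"
   by (intro sbits_pow2 small_mult small_idx N T)
  fix z assume z: "z \<in> edom (idx E (%x. Suc (N x)))"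
  have *: "\<bar>\<Prod>i<k. f (fst z) i\<bar> = (\<Prod>i<k. \<bar>f (fst z) i\<bar>)" for k by (induction k) (auto simp: abs_mult)
  have "\<bar>\<Prod>i<snd z. f (fst z) i\<bar> = (\<Prod>i<snd z. \<bar>f (fst z) i\<bar>)" by (rule *)
  also have "... <= (\<Prod>i<snd z. 2 ^ T (fst z))" proof (rule prod_mono)
   fix i assume "i \<in> {..<snd z}"
   hence "bits (f (fst z) i) <= T (fst z)" using T(2) z by auto
   thus "0 <= \<bar>f (fst z) i\<bar> & \<bar>f (fst z) i\<bar> <= 2 ^ T (fst z)" by (simp add: bits_le_iff)
  qed
  also have "... <= 2 ^ (T (fst z) * N (fst z))" using z by (auto simp flip: power_mult intro!: power_increasing)
  finally show "\<bar>\<Prod>i<snd z. f (fst z) i\<bar> <= \<bar>2 ^ (T (fst z) * N (fst z))\<bar>" by simp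
 qed
next
 assume h: "has (tbl (idx E N) (%z. 1) (%z. 1) (%z i j. \<Prod>i<snd z. f (fst z) i)) (%z. 1) (%z. 1) (%z i j. \<Prod>i<snd z. f (fst z) i)"
 show "cmp (tbl (idx E N) (%z. 1) (%z. 1) (%z i j. \<Prod>i<snd z. f (fst z) i)) (%z. \<Prod>i<Suc (snd z). f (fst z) i)"
  using cmp_mult[OF cmp_iter_prev[where F="%x k. \<Prod>i<k. f x i", OF h] cmp_tbl[OF f]] by simp
qed (simp add: cmp_const)

lemma cmp_power:
 assumes "cmpn E k" "small E k" "cmp E f" shows "cmp E (%x. f x ^ k x)"
 using cmp_prod[OF assms(1,2), of "%x i. f x"] cmp_idx[OF assms(3)] by simp

lemma cmp_powc: "cmp E f ==> cmp E (%x. f x ^ k)" by (induction k) (auto intro: cmp_const cmp_mult)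

lemma cmp_minus: "cmp E f ==> cmp E (%x. - f x)" using cmp_diff[OF cmp_const[of E 0], of f] by simp

lemma cmp_mod: "cmp E f ==> cmp E g ==> cmp E (%x. f x mod g x)"
 unfolding minus_mult_div_eq_mod[symmetric] by (intro cmp_diff cmp_mult cmp_div)

lemma cmpn_div: "cmpn E f ==> cmpn E g ==> cmpn E (%x. f x div g x)" by (simp add: zdiv_int cmp_div)

lemma cmpn_mod: "cmpn E f ==> cmpn E g ==> cmpn E (%x. f x mod g x)" by (simp add: zmod_int cmp_mod)

lemma cmpn_power: "cmpn E k ==> small E k ==> cmpn E f ==> cmpn E (%x. f x ^ k x)" by (simp add: cmp_power)

definition dec :: "'x env => ('x => bool) => bool" where
 "dec E P \<longleftrightarrow> cmp E (%x. if P x then 1 else 0)"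

lemma cmp_ite:
 assumes "dec E P" "cmp (sub E P) g" "cmp (sub E (%x. ~ P x)) h"
 shows "cmp E (%x. if P x then g x else h x)"
proof -
 have [simp]: "0 < (if P x then 1 else 0 :: int) \<longleftrightarrow> P x" for x by simp
 show ?thesis using cmp_if[of E "%x. if P x then 1 else 0" g h] assms by (simp add: dec_def)
qed

lemma cmp_ite': "dec E P ==> cmp E g ==> cmp E h ==> cmp E (%x. if P x then g x else h x)" by (intro cmp_ite cmp_sub)

lemma cmpn_ite: "dec E P ==> cmpn E g ==> cmpn E h ==> cmpn E (%x. if P x then g x else h x)"
 using cmp_ite'[of E P "%x. int (g x)" "%x. int (h x)"] by (simp add: if_distrib cong: if_cong)

lemma dec_less: "cmp E f ==> cmp E g ==> dec E (%x. f x < g x)"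
 using cmp_if[of E "%x. g x - f x" "%x. 1" "%x. 0"] cmp_diff[of E g f] by (simp add: dec_def cmp_const)

lemma dec_not: "dec E P ==> dec E (%x. ~ P x)"
 unfolding dec_def by (rule cmp_cong[OF cmp_diff[OF cmp_const[of E 1], of "%x. if P x then 1 else 0"]]) auto

lemma dec_conj: "dec E P ==> dec E Q ==> dec E (%x. P x & Q x)"
 unfolding dec_def using cmp_mult[of E "%x. if P x then 1 else 0" "%x. if Q x then 1 else 0"] by (rule cmp_cong) auto

lemma dec_disj: "dec E P ==> dec E Q ==> dec E (%x. P x \<or> Q x)"
 using dec_not[OF dec_conj[OF dec_not[of E P] dec_not[of E Q]]] by simp

lemma dec_le: "cmp E f ==> cmp E g ==> dec E (%x. f x <= g x)"
 using dec_not[OF dec_less[of E g f]] by (simp add: not_less)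

lemma dec_eq: "cmp E f ==> cmp E g ==> dec E (%x. f x = g x)"
 using dec_conj[OF dec_le[of E f g] dec_le[of E g f]] by (simp add: eq_iff)

lemma decn_less: "cmpn E f ==> cmpn E g ==> dec E (%x. f x < g x)"
 using dec_less[of E "%x. int (f x)" "%x. int (g x)"] by simp

lemma decn_le: "cmpn E f ==> cmpn E g ==> dec E (%x. f x <= g x)"
 using dec_le[of E "%x. int (f x)" "%x. int (g x)"] by simp

lemma decn_eq: "cmpn E f ==> cmpn E g ==> dec E (%x. f x = g x)"
 using dec_eq[of E "%x. int (f x)" "%x. int (g x)"] by simp

lemma cmpn_diff: "cmpn E f ==> cmpn E g ==> cmpn E (%x. f x - g x)"
 using cmp_ite'[OF decn_less[of E g f] cmp_diff[of E "%x. int (f x)" "%x. int (g x)"] cmp_const[of E 0]]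
 by (rule cmp_cong) (auto simp: of_nat_diff)

lemma small_sub: "small E f ==> small (sub E P) f" by (auto simp: small_def)

text \<open>The output overwrites the input, on which all results depend. Therefore the results are
  first collected in array 2, at negative addresses, and only then copied to the cells
  \<open>0, ..., N x - 1\<close>.\<close>

lemma cmp_top:
 assumes lev: "lev E = 0" and N: "cmpn E N" "small E N" and R: "cmp (idx E N) (%z. R (fst z) (snd z))"
 shows "EX c T. small E T & (ALL x:edom E. EX t m. exec c (inp E x) t m & (ALL j<N x. m (int j) = R x j) & t <= T x)"
proof -
 let ?ro = "%k. 0 :: nat"
 have ag: "agr E ?ro x m \<longleftrightarrow> (ALL a>=0. m a = inp E x a)" for x m by (simp add: agr_def lev)
 obtain c1 T1 where c1: "small E T1" "runs E ?ro 4 c1 (%x. int (N x)) T1" using cmpD[OF N(1), of ?ro 4] lev by auto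
 have sm1: "small E (%x. 1)" by (rule small_const)
 \<comment> \<open>\<open>fill_runs\<close> expects a matrix, so a dummy row index is inserted. As
   \<open>lev E = 0\<close>, it occupies level 0 and pushes the column index to level 1, whence
   \<open>ro \<circ> Suc\<close>.\<close>
 have R': "cmp (idx (idx E (%x. 1)) (%z. N (fst z))) (%z. R (fst2 z) (snd z))" proof (rule cmpI)
  show "sbits (idx (idx E (%x. 1)) (%z. N (fst z))) (%z. R (fst2 z) (snd z))"
   using cmp_sbits[OF R] by (fastforce simp: sbits_def small_def)
  fix ro b assume ro: "ALL k<lev (idx (idx E (%x. 1)) (%z. N (fst z))). ro k < (b::nat)"
  hence "ALL k<lev (idx E N). (ro \<circ> Suc) k < b" by (simp add: lev)
  from cmpD[OF R this] obtain c T where c: "small (idx E N) T" "runs (idx E N) (ro \<circ> Suc) b c (%z. R (fst z) (snd z)) T"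
   by blast
  have "small (idx (idx E (%x. 1)) (%z. N (fst z))) (%z. T (fst2 z, snd z))"
   using c(1) by (fastforce simp: small_def)
  moreover have "EX t m'. exec c m t m' & chg b {} m m' & m' (adr b 0 0) = R (fst2 z) (snd z) & t <= T (fst2 z, snd z)"
   if "z \<in> edom (idx (idx E (%x. 1)) (%z. N (fst z)))" "agr (idx (idx E (%x. 1)) (%z. N (fst z))) ro z m" for z m
   using runsD[OF c(2), of "(fst2 z, snd z)" m] that by (auto simp: agr_idx lev) (auto simp: agr_def lev)
  ultimately show "EX c T. small (idx (idx E (%x. 1)) (%z. N (fst z))) T & runs (idx (idx E (%x. 1)) (%z. N (fst z))) ro b c (%x. R (fst2 x) (snd x)) T" unfolding runs_def
   by (intro exI[of _ c] exI[of _ "%z. T (fst2 z, snd z)"]) blast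
 qed
 obtain c2 T2 where c2: "small E T2" "fills E ?ro 5 0 1 2 3 4 (%x. 1) N (%x i. R x) c2 T2"
  using fill_runs[where f="%x i. R x" and ro="?ro", OF R' sm1 N(2), of 5 0 1 2 3 4] lev by auto
 \<comment> \<open>\<open>?p\<close> evaluates to \<open>pr 0 k\<close>, hence \<open>?ad\<close> to
   \<open>adr 2 0 k\<close>, the cell of the collected result.\<close>
 let ?k = "Load (Const (adr 1 0 0))"
 let ?p = "Add (Mul ?k ?k) ?k"
 let ?ad = "Sub (Const (- 1)) (Add (Mul (Add (Const 2) ?p) (Add (Const 2) ?p)) ?p)"
 let ?st = "Store ?k (Load ?ad)"
 let ?c = "Seq c1 (Seq (Store (Const (adr 3 0 0)) (Const 1)) (Seq c2 (forp 1 4 ?st)))"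
 let ?pv = "%z. int (snd z) * int (snd z) + int (snd z)"
 define T3 where "T3 z = 100 + 30 * bits (adr 1 0 0) + 30 * bits (int (snd z)) + 10 * bits (int (snd z) * int (snd z)) +
  10 * bits (?pv z) + 10 * bits (2 + ?pv z) + bits ((2 + ?pv z) * (2 + ?pv z)) + bits ((2 + ?pv z) * (2 + ?pv z) + ?pv z)
  + bits (- 1 - ((2 + ?pv z) * (2 + ?pv z) + ?pv z)) + bits (R (fst z) (snd z)) + 10 * bits 2 + bits (- 1)" for z :: "'a \<times> nat"
 have v: "sbits (idx E N) (%z. int (snd z))" by (intro sbits_nat small_idx_var N)
 have "small (idx E N) T3" unfolding T3_def
  by (intro small_add small_mult small_const sbits_smallD sbits_add sbits_mult sbits_diff sbits_const v cmp_sbits[OF R])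
 then obtain T4 where T4: "small E T4" "!!x j. x \<in> edom E ==> j < N x ==> T3 (x, j) <= T4 x"
  using small_idx_bound by blast
 let ?T = "%x. T1 x + ((10 + bits (adr 3 0 0)) + (T2 x + fort 1 4 (N x) (T4 x)))"
 have "EX t m. exec ?c (inp E x) t m & (ALL j<N x. m (int j) = R x j) & t <= ?T x" if x: "x \<in> edom E" for x proof -
  obtain t1 m1 where e1: "exec c1 (inp E x) t1 m1" "chg 4 {} (inp E x) m1" "m1 (adr 4 0 0) = int (N x)" "t1 <= T1 x"
   using runsD[OF c1(2) x, of "inp E x"] ag by auto
  let ?m2 = "m1(adr 3 0 0 := 1)"
  have e2: "exec (Store (Const (adr 3 0 0)) (Const 1)) m1 (1 + acost (Const (adr 3 0 0)) m1 + acost (Const 1) m1) ?m2"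
   using Store[of "Const (adr 3 0 0)" "Const 1" m1] by simp
  have "agr E ?ro x ?m2" using e1(2) adr_neg[of 3 0 0] by (auto simp: ag chg_def)
  then obtain t3 m3 where e3: "exec c2 ?m2 t3 m3" "chg 5 {0, 1, 2} ?m2 m3" "ALL j<N x. m3 (adr 2 0 j) = R x j" "t3 <= T2 x"
   using fillsD[OF c2(2) x, of ?m2] e1(3) by auto
  have m34: "m3 (adr 4 0 0) = int (N x)" using chg_adr[OF e3(2), of 4] e1(3) by simp
  let ?J = "%k M. (ALL j<k. M (int j) = R x j) & (ALL j<N x. M (adr 2 0 j) = R x j) & M (adr 4 0 0) = int (N x)"
  have "EX t M. exec (forp 1 4 ?st) m3 t M & ?J (N x) M & t <= fort 1 4 (N x) (T4 x)"
  proof (rule exec_forp[where J="?J"])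
   fix k M assume k: "k < N x" and J: "?J k M" and Mk: "M (adr 1 0 0) = int k"
   have a: "aval ?ad M = adr 2 0 k" by (simp only: aval.simps Mk) (simp add: adr_def pr_def)
   have ak: "aval ?k M = int k" by (simp only: aval.simps Mk)
   have al: "aval (Load ?ad) M = R x k" using J k unfolding aval.simps(2)[of ?ad] a by simp
   have "exec ?st M (1 + acost ?k M + acost (Load ?ad) M) (M(int k := R x k))"
    using Store[of ?k "Load ?ad" M] unfolding ak al .
   moreover have "1 + acost ?k M + acost (Load ?ad) M <= T4 x" proof -
    have "acost (Load ?ad) M = acost ?ad M + 1 + bits (R x k)" unfolding acost.simps(2)[of ?ad] al ..
    hence "1 + acost ?k M + acost (Load ?ad) M <= T3 (x, k)"
     by (simp only: T3_def acost.simps aval.simps Mk fst_conv snd_conv)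
    thus ?thesis using T4(2)[OF x k] by linarith
   qed
   moreover have "?J (Suc k) (M(int k := R x k))"
    using J k adr_neg[of 2 0] adr_neg[of 4 0 0] by (auto simp: less_Suc_eq adr_neq_nonneg)
   moreover have "(M(int k := R x k)) (adr 1 0 0) = int k" using Mk by (auto simp: adr_neq_nonneg)
   ultimately show "EX t m'. exec ?st M t m' & ?J (Suc k) m' & m' (adr 1 0 0) = int k & t <= T4 x" by blast
  next
   fix k M v assume "?J k M" thus "?J k (M(adr 1 0 0 := v))" by (auto simp: adr_neq_nonneg)
  qed (use e3(3) m34 in auto)
  then obtain t4 m4 where e4: "exec (forp 1 4 ?st) m3 t4 m4" "?J (N x) m4" "t4 <= fort 1 4 (N x) (T4 x)" by blast
  have "bits 1 <= 1" using bits_of_nat[of 1] by simp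
  thus ?thesis using exec.Seq[OF e1(1) exec.Seq[OF e2 exec.Seq[OF e3(1) e4(1)]]] e1(4) e3(4) e4
   by (intro exI[of _ "t1 + ((1 + acost (Const (adr 3 0 0)) m1 + acost (Const 1) m1) + (t3 + t4))"] exI[of _ m4] conjI) auto
 qed
 moreover have "small E ?T" by (intro small_intros small_fort N c1 c2 T4)
 ultimately show ?thesis by blast
qed

section \<open>Fraction-free elimination\<close>

definition lead :: "imat => nat => int mat" where
 "lead A k = mat k k (%(i, j). A i j)"

lemma lead_carrier [simp]: "lead A k \<in> carrier_mat k k" by (simp add: lead_def)

lemma lead_dim [simp]: "dim_row (lead A k) = k" "dim_col (lead A k) = k" by (simp_all add: lead_def)

text \<open>Cramer's rule in adjugate form, by left multiplication with \<open>adj_mat\<close>. It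
  shows that the determinant times a solution is an integer combination of the right-hand side, also
  for a singular matrix.\<close>

lemma lead_adj:
 fixes x b :: "nat => real"
 assumes eq: "!!i. i < k ==> (\<Sum>l<k. of_int (A i l) * x l) = b i" and l: "l < k"
 shows "of_int (det (lead A k)) * x l = (\<Sum>i<k. of_int (adj_mat (lead A k) $$ (l, i)) * b i)"
proof -
 let ?M = "lead A k" let ?J = "adj_mat ?M"
 have J: "?J \<in> carrier_mat k k" and JM: "?J * ?M = det ?M \<cdot>\<^sub>m 1\<^sub>m k" using adj_mat[of ?M k] by auto
 have e: "(\<Sum>i<k. ?J $$ (l, i) * A i l') = (if l = l' then det ?M else 0)" if "l' < k" for l' proof -
  have "(?J * ?M) $$ (l, l') = (\<Sum>i<k. ?J $$ (l, i) * ?M $$ (i, l'))"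
   using J l that by (simp add: scalar_prod_def lessThan_atLeast0)
  moreover have "(?J * ?M) $$ (l, l') = (if l = l' then det ?M else 0)" using that l by (simp add: JM)
  moreover have "(\<Sum>i<k. ?J $$ (l, i) * ?M $$ (i, l')) = (\<Sum>i<k. ?J $$ (l, i) * A i l')"
   using that by (intro sum.cong) (auto simp: lead_def)
  ultimately show ?thesis by simp
 qed
 have "(\<Sum>i<k. of_int (?J $$ (l, i)) * b i) = (\<Sum>i<k. \<Sum>l'<k. of_int (?J $$ (l, i)) * (of_int (A i l') * x l'))"
  using eq by (simp add: sum_distrib_left[symmetric])
 also have "... = (\<Sum>l'<k. \<Sum>i<k. of_int (?J $$ (l, i)) * (of_int (A i l') * x l'))" by (rule sum.swap)
 also have "... = (\<Sum>l'<k. (if l = l' then of_int (det ?M) * x l' else 0))" proof (rule sum.cong[OF refl])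
  fix l' assume l': "l' \<in> {..<k}"
  have "(\<Sum>i<k. of_int (?J $$ (l, i)) * (of_int (A i l') * x l')) = of_int (\<Sum>i<k. ?J $$ (l, i) * A i l') * x l'"
   by (simp add: sum_distrib_right mult.assoc)
  also have "... = of_int (if l = l' then det ?M else 0) * x l'" using e l' by simp
  finally show "(\<Sum>i<k. of_int (?J $$ (l, i)) * (of_int (A i l') * x l')) = (if l = l' then of_int (det ?M) * x l' else 0)"
   by simp
 qed
 also have "... = of_int (det ?M) * x l" using l by simp
 finally show ?thesis by simp
qed

lemma adj_lead_last: "adj_mat (lead A (Suc k)) $$ (k, k) = det (lead A k)"
proof -
 have "mat_delete (lead A (Suc k)) k k = lead A k" by (rule eq_matI) (auto simp: mat_delete_def lead_def)
 thus ?thesis by (simp add: adj_mat_def cofactor_def)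
qed

lemma det_bound:
 fixes M :: "int mat"
 assumes M: "M \<in> carrier_mat n n" and a: "!!i j. i < n ==> j < n ==> \<bar>M $$ (i, j)\<bar> <= a" and a1: "1 <= a"
 shows "\<bar>det M\<bar> <= fact n * a ^ n"
proof -
 have "\<bar>det M\<bar> <= (\<Sum>p | p permutes {0..<n}. \<bar>signof p * (\<Prod>i = 0..<n. M $$ (i, p i))\<bar>)" using M by (simp add: det_def)
 also have "... <= (\<Sum>p | p permutes {0..<n}. a ^ n)" proof (rule sum_mono)
  fix p assume "p \<in> {p. p permutes {0..<n}}"
  hence p: "p permutes {0..<n}" by simp
  have s: "\<bar>signof p :: int\<bar> = 1" by (simp add: sign_def)
  have "\<bar>\<Prod>i = 0..<k. M $$ (i, p i)\<bar> <= a ^ k" if "k <= n" for k using that proof (induction k)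
   case (Suc k)
   have "p k < n" using p Suc.prems permutes_in_image[OF p, of k] by auto
   hence "\<bar>M $$ (k, p k)\<bar> <= a" using a Suc.prems by auto
   hence "\<bar>\<Prod>i = 0..<k. M $$ (i, p i)\<bar> * \<bar>M $$ (k, p k)\<bar> <= a ^ k * a" using Suc a1 by (intro mult_mono) auto
   thus ?case by (simp add: abs_mult mult.commute)
  qed simp
  thus "\<bar>signof p * (\<Prod>i = 0..<n. M $$ (i, p i))\<bar> <= a ^ n" using s by (simp add: abs_mult)
 qed
 also have "... = fact n * a ^ n" by (simp add: card_permutations[OF refl])
 finally show ?thesis .
qed

lemma adj_lead_bound:
 assumes a: "!!i j. i < k ==> j < k ==> \<bar>A i j\<bar> <= a" and a1: "1 <= a" and il: "i < k" "l < k"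
 shows "\<bar>adj_mat (lead A k) $$ (l, i)\<bar> <= fact k * a ^ k"
proof -
 let ?D = "mat_delete (lead A k) i l"
 have "\<bar>adj_mat (lead A k) $$ (l, i)\<bar> = \<bar>det ?D\<bar>"
  using il by (simp add: adj_mat_def lead_def cofactor_def abs_mult power_abs)
 also have "... <= fact (k - 1) * a ^ (k - 1)" proof (rule det_bound)
  show "?D \<in> carrier_mat (k - 1) (k - 1)" by (simp add: lead_def mat_delete_def)
  fix i' j' assume "i' < k - 1" "j' < k - 1"
  thus "\<bar>?D $$ (i', j')\<bar> <= a" by (auto simp: mat_delete_def lead_def intro!: a)
 qed (rule a1)
 also have "... <= fact k * a ^ k" using a1 by (intro mult_mono power_increasing fact_mono) auto
 finally show ?thesis .
qed

text \<open>The value 0 in row \<open>N\<close> is absorbing; this is how a failed elimination is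
  recognised later.\<close>

definition bstep :: "nat => nat => imat => imat" where
 "bstep N k S i j =
  (if S N 0 <= 0 \<or> S k k <= 0 then (if i = N then 0 else S i j)
  else if i = N then S k k
  else if i = k then S i j
  else (S k k * S i j - S i k * S k j) div S N 0)"

primrec bst :: "imat => nat => nat => imat" where
 "bst A N 0 = (%i j. if i < N then A i j else 1)"
| "bst A N (Suc k) = bstep N k (bst A N k)"

declare bstep_def [simp]

text \<open>
 Bareiss elimination of \<open>[A | ...]\<close> in Gauss-Jordan form; row \<open>N\<close> holds the previous pivot. After \<open>k\<close>
 steps the entries are \<open>det (lead A k)\<close> times those of rational Gauss-Jordan elimination, hence
 integers by Cramer's rule. The elimination freezes at the first pivot that is not positive.
\<close>

definition rsd :: "imat => nat => (nat => nat => real) => nat => nat => real" where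
 "rsd A k X i j = of_int (A i j) - (\<Sum>l<k. of_int (A i l) * X l j)"

text \<open>\<open>X\<close> stands for the entries of rational Gauss-Jordan elimination, described
  implicitly: on the first \<open>k\<close> rows, column \<open>j\<close> is the combination of the
  first \<open>k\<close> columns with coefficients \<open>X l j\<close>. What remains in the lower
  rows is the Schur complement \<open>rsd\<close>. No rational elimination has to be carried
  out.\<close>

definition good :: "imat => nat => nat => (nat => nat => real) => bool" where
 "good A N k X \<longleftrightarrow> bst A N k N 0 = det (lead A k) & 0 < det (lead A k) &
  (ALL i<k. ALL j. rsd A k X i j = 0) &
  (ALL i<k. ALL j. of_int (bst A N k i j) = of_int (det (lead A k)) * X i j) &
  (ALL i. k <= i --> i < N --> (ALL j. of_int (bst A N k i j) = of_int (det (lead A k)) * rsd A k X i j))"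

lemma good_0: "good A N 0 X" by (simp add: good_def lead_def rsd_def)

text \<open>The vector with last entry 1 and other entries \<open>- X l k\<close> is mapped by
  \<open>lead A (Suc k)\<close> to a multiple of the last unit vector. Cramer's rule for its last
  coordinate relates consecutive minors, since the corner cofactor is
  \<open>det (lead A k)\<close>.\<close>

lemma pivot_det:
 assumes "!!i. i < k ==> rsd A k X i k = 0"
 shows "of_int (det (lead A (Suc k))) = of_int (det (lead A k)) * rsd A k X k k"
proof -
 let ?u = "%l. if l = k then 1 else - X l k"
 have r: "(\<Sum>l<Suc k. of_int (A i l) * ?u l) = rsd A k X i k" for i by (simp add: rsd_def sum_negf)
 have "(\<Sum>l<Suc k. of_int (A i l) * ?u l) = (if i = k then rsd A k X k k else 0)" if "i < Suc k" for i
  unfolding r using that assms by auto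
 from lead_adj[OF this, where l=k] show ?thesis by (simp add: adj_lead_last if_distrib[of "(*) _"] cong: if_cong)
qed

text \<open>\<open>X'\<close> is one rational elimination step. Its coefficients and residuals,
  multiplied by the new minor, are integers by \<open>lead_adj\<close>; hence the floor division in
  \<open>bstep\<close> is exact.\<close>

lemma good_Suc:
 assumes g: "good A N k X" and k: "k < N" and piv: "0 < bst A N k k k"
 shows "EX X'. good A N (Suc k) X'" and "bst A N k k k = det (lead A (Suc k))"
proof -
 let ?S = "bst A N k" let ?d = "det (lead A k)" let ?R = "rsd A k X" let ?d' = "det (lead A (Suc k))"
 have d: "?S N 0 = ?d" "0 < ?d" and R0: "!!i j. i < k ==> ?R i j = 0"
  and S1: "!!i j. i < k ==> of_int (?S i j) = of_int ?d * X i j"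
  and S2: "!!i j. k <= i ==> i < N ==> of_int (?S i j) = of_int ?d * ?R i j" using g by (auto simp: good_def)
 have Skk: "real_of_int (?S k k) = of_int ?d'" using pivot_det[OF R0] S2[of k k] k by simp
 thus pd: "?S k k = ?d'" by linarith
 have Rkk: "?R k k > 0" using S2[of k k] piv d k by (metis le_refl of_int_0_less_iff zero_less_mult_pos)
 define c where "c j = ?R k j / ?R k k" for j
 have cR: "?R k k * c j = ?R k j" for j using Rkk by (simp add: c_def)
 define X' where "X' = (%l j. if l = k then c j else X l j - X l k * c j)"
 have R': "rsd A (Suc k) X' i j = ?R i j - ?R i k * c j" for i j proof -
  have "(\<Sum>l<k. of_int (A i l) * X' l j) = (\<Sum>l<k. of_int (A i l) * X l j) - (\<Sum>l<k. of_int (A i l) * X l k) * c j"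
   by (simp add: X'_def sum_subtractf sum_distrib_left sum_distrib_right algebra_simps)
  thus ?thesis by (simp add: rsd_def X'_def algebra_simps)
 qed
 have R'0: "rsd A (Suc k) X' i j = 0" if "i < Suc k" for i j
  using that R0 Rkk by (cases "i = k") (auto simp: R' c_def)
 have sol: "EX z. of_int ?d' * X' l j = real_of_int z" if "l < Suc k" for l j proof -
  have "(\<Sum>l<Suc k. of_int (A i l) * X' l j) = of_int (A i j)" if "i < Suc k" for i
   using R'0[OF that, of j] by (simp add: rsd_def)
  from lead_adj[OF this that]
  have "of_int ?d' * X' l j = real_of_int (\<Sum>i<Suc k. adj_mat (lead A (Suc k)) $$ (l, i) * A i j)" by simp
  thus ?thesis by blast
 qed
 have res: "EX z. of_int ?d' * rsd A (Suc k) X' i j = real_of_int z" for i j proof -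
  have "ALL l. EX z. l < Suc k --> of_int ?d' * X' l j = real_of_int z" using sol by blast
  then obtain z where "ALL l. l < Suc k --> of_int ?d' * X' l j = real_of_int (z l)" by (rule choice[THEN exE])
  hence z: "!!l. l < Suc k ==> of_int ?d' * X' l j = real_of_int (z l)" by blast
  have "of_int ?d' * rsd A (Suc k) X' i j = of_int (?d' * A i j) - (\<Sum>l<Suc k. of_int (A i l) * (of_int ?d' * X' l j))"
   by (simp add: rsd_def algebra_simps sum_distrib_left)
  also have "... = of_int (?d' * A i j) - (\<Sum>l<Suc k. of_int (A i l) * of_int (z l))"
   using z by (intro arg_cong2[of _ _ _ _ "(-)"] sum.cong) auto
  finally have "of_int ?d' * rsd A (Suc k) X' i j = of_int (?d' * A i j - (\<Sum>l<Suc k. A i l * z l))" by simp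
  thus ?thesis by blast
 qed
 have quot: "real_of_int ((?S k k * ?S i j - ?S i k * ?S k j) div ?d) = v"
  if vz: "EX z. v = real_of_int z" and vd: "of_int ?d * v = of_int (?S k k) * of_int (?S i j) - of_int (?S i k) * of_int (?S k j)" for i j v
 proof -
  obtain z where z: "v = real_of_int z" using vz by blast
  hence "real_of_int (?d * z) = real_of_int (?S k k * ?S i j - ?S i k * ?S k j)" using vd by simp
  hence "?S k k * ?S i j - ?S i k * ?S k j = ?d * z" by linarith
  thus ?thesis using z d by simp
 qed
 have d': "of_int ?d' = of_int ?d * ?R k k" using pivot_det[OF R0] by simp
 have 1: "bst A N (Suc k) N 0 = ?d'" using d piv by (simp add: pd)
 have 2: "of_int (bst A N (Suc k) i j) = of_int ?d' * X' i j" if "i < Suc k" for i j proof (cases "i = k")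
  case True
  thus ?thesis using k d piv Rkk S2[of k j] by (simp add: X'_def d' c_def)
 next
  case False
  hence "i < k" "i ~= N" using that k by auto
  moreover have "real_of_int ((?S k k * ?S i j - ?S i k * ?S k j) div ?d) = of_int ?d' * X' i j"
  proof (rule quot[OF sol[OF that]])
   have "of_int ?d * (of_int ?d' * X' i j) = of_int ?d * ?R k k * (of_int ?d * X i j) - of_int ?d * X i k * (of_int ?d * (?R k k * c j))"
    using \<open>i < k\<close> by (simp add: X'_def d' algebra_simps)
   thus "of_int ?d * (of_int ?d' * X' i j) = of_int (?S k k) * of_int (?S i j) - of_int (?S i k) * of_int (?S k j)"
    unfolding cR using \<open>i < k\<close> k by (simp only: S1 S2 le_refl)
  qed
  ultimately show ?thesis using d piv by simp
 qed
 have 3: "of_int (bst A N (Suc k) i j) = of_int ?d' * rsd A (Suc k) X' i j" if "Suc k <= i" "i < N" for i j proof -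
  have "real_of_int ((?S k k * ?S i j - ?S i k * ?S k j) div ?d) = of_int ?d' * rsd A (Suc k) X' i j"
  proof (rule quot[OF res])
   have "of_int ?d * (of_int ?d' * rsd A (Suc k) X' i j) = of_int ?d * ?R k k * (of_int ?d * ?R i j) - of_int ?d * ?R i k * (of_int ?d * (?R k k * c j))"
    by (simp add: R' d' algebra_simps)
   moreover have "k <= i" using that by simp
   ultimately show "of_int ?d * (of_int ?d' * rsd A (Suc k) X' i j) = of_int (?S k k) * of_int (?S i j) - of_int (?S i k) * of_int (?S k j)"
    unfolding cR using \<open>i < N\<close> k by (simp only: S2 le_refl)
  qed
  thus ?thesis using that d piv by simp
 qed
 have "good A N (Suc k) X'" unfolding good_def using 1 2 3 R'0 piv pd by auto
 thus "EX X'. good A N (Suc k) X'" by blast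
qed

text \<open>A frozen table is a good table of an earlier step, apart from row \<open>N\<close>. Size
  bounds for good tables thus cover arbitrary matrices.\<close>

lemma bst_inv:
 assumes "k <= N"
 shows "(EX X. good A N k X) \<or>
  bst A N k N 0 = 0 & (EX k'<=k. EX X. good A N k' X & (ALL i<N. ALL j. bst A N k i j = bst A N k' i j))"
 using assms
proof (induction k)
 case 0
 thus ?case using good_0 by blast
next
 case (Suc k)
 hence k: "k < N" by simp
 from Suc consider (g) X where "good A N k X" | (b) "bst A N k N 0 = 0"
   "EX k'<=k. EX X. good A N k' X & (ALL i<N. ALL j. bst A N k i j = bst A N k' i j)" by auto
 thus ?case proof cases
  case g
  show ?thesis proof (cases "0 < bst A N k k k")
   case True thus ?thesis using good_Suc(1)[OF g k] by blast
  next
   case False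
   thus ?thesis using g k by (intro disjI2 conjI exI[of _ k] exI[of _ X]) auto
  qed
 next
  case b
  then obtain k' X where "k' <= k" "good A N k' X" "ALL i<N. ALL j. bst A N k i j = bst A N k' i j" by blast
  thus ?thesis using b k by (intro disjI2 conjI exI[of _ k'] exI[of _ X]) auto
 qed
qed

definition posdef :: "imat => nat => bool" where
 "posdef A N \<longleftrightarrow> (ALL u :: nat => real. (EX i<N. u i ~= 0) -->
  0 < (\<Sum>i<N. u i * (\<Sum>j<N. of_int (A i j) * u j)))"

lemma posdefD: "posdef A N ==> EX i<N. u i ~= (0 :: real) ==>
  0 < (\<Sum>i<N. u i * (\<Sum>j<N. of_int (A i j) * u j))"
 by (simp add: posdef_def)

lemma posdef_mono: "posdef A N ==> k <= N ==> posdef A k"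
proof -
 assume p: "posdef A N" and k: "k <= N"
 show ?thesis unfolding posdef_def proof (intro allI impI)
  fix u :: "nat => real" assume "EX i<k. u i ~= 0"
  let ?w = "%i. if i < k then u i else 0"
  from \<open>EX i<k. u i ~= 0\<close> obtain i where "i < k" "u i ~= 0" by blast
  hence "i < N & ?w i ~= 0" using k by simp
  hence "EX i<N. ?w i ~= 0" by (rule exI)
  hence "0 < (\<Sum>i<N. ?w i * (\<Sum>j<N. of_int (A i j) * ?w j))" by (rule posdefD[OF p])
  also have "(%i. \<Sum>j<N. of_int (A i j) * ?w j) = (%i. \<Sum>j<k. of_int (A i j) * u j)"
   by (rule ext, rule sum.mono_neutral_cong_right) (use k in auto)
  also have "(\<Sum>i<N. ?w i * (\<Sum>j<k. of_int (A i j) * u j)) = (\<Sum>i<k. u i * (\<Sum>j<k. of_int (A i j) * u j))"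
   by (rule sum.mono_neutral_cong_right) (use k in auto)
  finally show "0 < (\<Sum>i<k. u i * (\<Sum>j<k. of_int (A i j) * u j))" .
 qed
qed

text \<open>The residual pivot is the value of the quadratic form at the vector with entries
  \<open>- X l k\<close> and last entry 1.\<close>

lemma good_posdef:
 assumes p: "posdef A N" and g: "good A N k X" and k: "k < N"
 shows "0 < rsd A k X k k" "0 < bst A N k k k"
proof -
 let ?u = "%l. if l = k then 1 else - X l k"
 have r: "(\<Sum>l<Suc k. of_int (A i l) * ?u l) = rsd A k X i k" for i by (simp add: rsd_def sum_negf)
 have "posdef A (Suc k)" using posdef_mono[OF p] k by simp
 have "EX i<Suc k. ?u i ~= 0" by (rule exI[of _ k]) simp
 have "0 < (\<Sum>i<Suc k. ?u i * (\<Sum>j<Suc k. of_int (A i j) * ?u j))" by (rule posdefD) fact+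
 also have "... = rsd A k X k k" unfolding r using g by (simp add: good_def)
 finally show 1: "0 < rsd A k X k k" .
 have "of_int (bst A N k k k) = of_int (det (lead A k)) * rsd A k X k k" "0 < det (lead A k)"
  using g k by (auto simp: good_def)
 thus "0 < bst A N k k k" using 1 by (metis mult_pos_pos of_int_0_less_iff)
qed

lemma good_all: "posdef A N ==> k <= N ==> EX X. good A N k X"
proof (induction k)
 case (Suc k)
 then obtain X where "good A N k X" by auto
 thus ?case using good_Suc(1)[of A N k X] good_posdef(2)[of A N k X] Suc.prems by auto
qed (use good_0 in blast)

text \<open>The last pivot, equal to the leading minor of order \<open>N\<close> if all pivots were
  positive, and 0 if the elimination froze.\<close>

definition dlt :: "imat => nat => int" where
 "dlt A N = bst A N N N 0"

lemma bst_sol: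
 assumes "0 < dlt A N" and i: "i < N"
 shows "(\<Sum>l<N. A i l * bst A N N l j) = dlt A N * A i j"
proof -
 obtain X where X: "good A N N X" using bst_inv[of N N A] assms by (auto simp: dlt_def)
 hence d: "dlt A N = det (lead A N)" by (simp add: good_def dlt_def)
 have "real_of_int (\<Sum>l<N. A i l * bst A N N l j) = (\<Sum>l<N. of_int (A i l) * (of_int (det (lead A N)) * X l j))"
  using X by (simp add: good_def)
 also have "... = of_int (det (lead A N)) * (\<Sum>l<N. of_int (A i l) * X l j)"
  by (simp add: sum_distrib_left algebra_simps)
 also have "(\<Sum>l<N. of_int (A i l) * X l j) = of_int (A i j)" using X i by (simp add: good_def rsd_def)
 finally have "real_of_int (\<Sum>l<N. A i l * bst A N N l j) = of_int (det (lead A N) * A i j)" by simp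
 thus ?thesis unfolding d of_int_eq_iff .
qed

lemma dlt_posdef: "posdef A N ==> 0 < dlt A N" "posdef A N ==> dlt A N = det (lead A N)"
 using good_all[of A N N] by (auto simp: good_def dlt_def)

lemma dlt_0 [simp]: "dlt A 0 = 1" by (simp add: dlt_def)

text \<open>Cramer's rule writes a coefficient as an adjugate row times a column, and a residual
  needs one more such product; this explains the exponent \<open>N + 2\<close>. Indefinite matrices
  must be covered, since bad guesses of the multiplier produce them.\<close>

lemma bst_bound:
 assumes a: "!!i j. i < N ==> j <= N ==> \<bar>A i j\<bar> <= a" and a1: "1 <= a"
  and k: "k <= N" and ij: "i <= N" "j <= N" "i = N ==> j = 0"
 shows "\<bar>bst A N k i j\<bar> <= (int N + 1) ^ 2 * fact N * a ^ (N + 2)"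
proof -
 let ?F = "fact N * a ^ N"
 have F0: "0 <= ?F" using a1 by simp
 have mono: "fact k * a ^ k <= ?F" if "k <= N" for k
  using that a1 by (intro mult_mono power_increasing fact_mono) auto
 have big: "x * ?F * a ^ e <= (int N + 1) ^ 2 * fact N * a ^ (N + 2)" if "0 <= x" "x <= (int N + 1) ^ 2" "e <= 2" for x e
 proof -
  have "x * ?F * a ^ e <= (int N + 1) ^ 2 * ?F * a ^ 2" using that a1 F0 by (intro mult_mono power_increasing) auto
  thus ?thesis by (simp add: power_add power2_eq_square mult_ac)
 qed
 have *: "\<bar>bst A N k i j\<bar> <= (int N + 1) ^ 2 * fact N * a ^ (N + 2)"
  if g: "good A N k X" and k: "k <= N" and ij: "i < N" "j <= N" for k X i j proof -
  let ?d = "det (lead A k)"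
  have d: "\<bar>?d\<bar> <= ?F" proof -
   have "\<bar>?d\<bar> <= fact k * a ^ k" using k by (intro det_bound[of _ k a]) (auto simp: lead_def intro!: a a1)
   thus ?thesis using mono[OF k] by linarith
  qed
  have sx: "\<bar>of_int ?d * X l j\<bar> <= of_int (int N * ?F * a)" if l: "l < k" for l proof -
   have "(\<Sum>l<k. of_int (A i l) * X l j) = of_int (A i j)" if "i < k" for i
    using g that by (simp add: good_def rsd_def)
   from lead_adj[OF this l]
   have "of_int ?d * X l j = real_of_int (\<Sum>i<k. adj_mat (lead A k) $$ (l, i) * A i j)" by simp
   moreover have "\<bar>\<Sum>i<k. adj_mat (lead A k) $$ (l, i) * A i j\<bar> <= (\<Sum>i<k. ?F * a)"
   proof (rule order_trans[OF sum_abs sum_mono])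
    fix i assume i: "i \<in> {..<k}"
    have "\<bar>adj_mat (lead A k) $$ (l, i)\<bar> <= fact k * a ^ k" using i l k by (intro adj_lead_bound a a1) auto
    hence "\<bar>adj_mat (lead A k) $$ (l, i)\<bar> <= ?F" using mono[OF k] by linarith
    thus "\<bar>adj_mat (lead A k) $$ (l, i) * A i j\<bar> <= ?F * a"
     using a[of i j] i k ij F0 by (simp add: abs_mult mult_mono)
   qed
   moreover have "(\<Sum>i<k. ?F * a) <= int N * ?F * a" using k a1 F0 by (simp add: mult.assoc mult_right_mono)
   ultimately show ?thesis by linarith
  qed
  show ?thesis proof (cases "i < k")
   case True
   hence "real_of_int (bst A N k i j) = of_int ?d * X i j" using g by (simp add: good_def)
   with sx[OF True] have "\<bar>bst A N k i j\<bar> <= int N * ?F * a" by linarith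
   also have "... <= (int N + 1) ^ 2 * fact N * a ^ (N + 2)"
    using big[of "int N" 1] by (simp add: power2_eq_square algebra_simps)
   finally show ?thesis .
  next
   case False
   hence "real_of_int (bst A N k i j) = of_int ?d * rsd A k X i j" using g ij by (simp add: good_def)
   also have "... = of_int (?d * A i j) - (\<Sum>l<k. of_int (A i l) * (of_int ?d * X l j))"
    by (simp add: rsd_def algebra_simps sum_distrib_left)
   finally have e: "real_of_int (bst A N k i j) = ..." .
   have 1: "\<bar>?d * A i j\<bar> <= ?F * a" using d a[OF ij] F0 by (simp add: abs_mult mult_mono)
   have "\<bar>\<Sum>l<k. of_int (A i l) * (of_int ?d * X l j)\<bar> <= (\<Sum>l<k. of_int (a * (int N * ?F * a)))"
   proof (rule order_trans[OF sum_abs sum_mono])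
    fix l assume l: "l \<in> {..<k}"
    have "\<bar>real_of_int (A i l)\<bar> <= of_int a" using a[of i l] ij l k by simp
    thus "\<bar>of_int (A i l) * (of_int ?d * X l j)\<bar> <= of_int (a * (int N * ?F * a))"
     using sx[of l] l unfolding abs_mult of_int_mult[of a] by (intro mult_mono) auto
   qed
   also have "... = of_int (int k * (a * (int N * ?F * a)))" by simp
   also have "... <= of_int (int N * (a * (int N * ?F * a)))"
    unfolding of_int_le_iff using k a1 F0 by (intro mult_right_mono) auto
   finally have 2: "\<bar>\<Sum>l<k. of_int (A i l) * (of_int ?d * X l j)\<bar> <= of_int (int N * (a * (int N * ?F * a)))" .
   have "\<bar>bst A N k i j\<bar> <= ?F * a + int N * (a * (int N * ?F * a))" using e 1 2 by linarith
   also have "... <= ?F * a ^ 2 + int N * (a * (int N * ?F * a))"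
    using a1 F0 by (simp add: power2_eq_square mult_left_mono)
   also have "... = (1 + int N * int N) * ?F * a ^ 2" by (simp add: power2_eq_square algebra_simps)
   also have "... <= (int N + 1) ^ 2 * fact N * a ^ (N + 2)"
    using big[of "1 + int N * int N" 2] by (simp add: power2_eq_square algebra_simps)
   finally show ?thesis .
  qed
 qed
 have dd: "\<bar>det (lead A k)\<bar> <= (int N + 1) ^ 2 * fact N * a ^ (N + 2)" proof -
  have "\<bar>det (lead A k)\<bar> <= fact k * a ^ k" using k by (intro det_bound[of _ k a]) (auto simp: lead_def intro!: a a1)
  also have "... <= ?F" by (rule mono[OF k])
  also have "... <= (int N + 1) ^ 2 * fact N * a ^ (N + 2)"
   using big[of 1 0] by (simp add: power2_eq_square algebra_simps)
  finally show ?thesis .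
 qed
 have pos: "0 <= (int N + 1) ^ 2 * fact N * a ^ (N + 2)" using a1 by simp
 show ?thesis proof (cases "i = N")
  case True
  thus ?thesis using bst_inv[OF k, of A] ij dd pos by (auto simp: good_def)
 next
  case False
  thus ?thesis using bst_inv[OF k, of A] ij k * by (metis le_neq_implies_less order_trans)
 qed
qed

subsection \<open>Elimination in polynomial time\<close>

lemma small_tblI: "small E f ==> small (tbl E n m S) f" by (simp add: small_tbl)

lemmas env_intros = cmp_idx cmp_tbl cmp_sub cmp_snd small_idx small_tblI small_sub has_idx has_tbl has_sub

lemma bst_last: "bst A N k N j = bst A N k N 0" by (induction k) auto

lemma sbits_fact: "small E f ==> sbits E (%x. fact (f x))"
proof (rule sbits_mono[where g="%x. int (f x) ^ f x"])
 fix x show "\<bar>fact (f x) :: int\<bar> <= \<bar>int (f x) ^ f x\<bar>" using fact_le_power[of "f x", where 'a=int] by simp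
qed (intro sbits_power sbits_nat)

lemma sbits_bst:
 assumes h: "has E n w A" and N: "small E N" and b: "!!x. x \<in> edom E ==> N x <= n x & N x < w x"
  and kij: "!!x. x \<in> edom E ==> k x <= N x & i x <= N x & j x <= N x"
 shows "sbits E (%x. bst (A x) (N x) (k x) (i x) (j x))"
proof -
 obtain a where a: "!!x i j. x \<in> edom E ==> i < n x ==> j < w x ==> bits (A x i j) <= (sz E x + 2) ^ a"
  using h unfolding has_def by blast
 let ?a = "%x. 2 ^ ((sz E x + 2) ^ a) :: int"
 let ?g = "%x. (int (N x) + 1) ^ 2 * fact (N x) * ?a x ^ (N x + 2)"
 have "sbits E ?g"
  by (intro sbits_mult sbits_power sbits_fact sbits_pow2 sbits_add sbits_nat sbits_const small_intros N)
 thus ?thesis proof (rule sbits_mono)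
  fix x assume x: "x \<in> edom E"
  \<comment> \<open>Row \<open>N\<close> is constant, so its column index may be replaced by 0 to
    meet the hypothesis of \<open>bst_bound\<close>.\<close>
  have "\<bar>bst (A x) (N x) (k x) (i x) (if i x = N x then 0 else j x)\<bar> <= ?g x" proof (rule bst_bound)
   fix i j assume "i < N x" "j <= N x"
   hence "bits (A x i j) <= (sz E x + 2) ^ a" using b[OF x] by (intro a[OF x]) auto
   thus "\<bar>A x i j\<bar> <= ?a x" by (simp add: bits_le_iff)
  qed (use kij[OF x] in auto)
  thus "\<bar>bst (A x) (N x) (k x) (i x) (j x)\<bar> <= \<bar>?g x\<bar>" by (cases "i x = N x") (auto, metis bst_last)
 qed
qed

lemma cmp_bst:
 assumes h: "has E n w A" and N: "cmpn E N" "small E N" and b: "!!x. x \<in> edom E ==> N x <= n x & N x < w x"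
  and ij: "cmpn E i" "cmpn E j" "!!x. x \<in> edom E ==> i x <= N x & j x <= N x"
 shows "cmp E (%x. bst (A x) (N x) (N x) (i x) (j x))"
proof (rule cmp_rec[where S="%x k. bst (A x) (N x) k" and N=N and n="%x. Suc (N x)" and l="%x. Suc (N x)"])
 have sN: "small E (%x. Suc (N x))" by (intro small_Suc N)
 show "small (idx (idx (idx E (%x. Suc (N x))) (%z. Suc (N (fst z)))) (%z. Suc (N (fst2 z))))
  (%z. bits (bst (A (fst3 z)) (N (fst3 z)) (snd (fst2 z)) (snd (fst z)) (snd z)))"
  by (intro sbits_smallD sbits_bst[OF has_idx[OF has_idx[OF has_idx[OF h]]]] small_idx[of _ "%z. N (fst2 z)"]
    small_idx[of _ "%z. N (fst z)"] small_idx[of _ N] N) (use b in auto)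
 show "cmp (idx (idx E (%x. Suc (N x))) (%z. Suc (N (fst z)))) (%z. bst (A (fst2 z)) (N (fst2 z)) 0 (snd (fst z)) (snd z))"
  unfolding bst.simps proof (intro cmp_ite decn_less)
  let ?E = "sub (idx (idx E (%x. Suc (N x))) (%z. Suc (N (fst z)))) (%z. snd (fst z) < N (fst2 z))"
  have "has ?E (%z. n (fst2 z)) (%z. w (fst2 z)) (%z. A (fst2 z))" by (intro env_intros h)
  thus "cmp ?E (%z. A (fst2 z) (snd (fst z)) (snd z))"
   by (rule cmp_has) (intro env_intros sN | use b in force)+
 qed (intro env_intros sN N cmp_const)+
 show "cmp (tbl E (%x. Suc (N x)) (%x. Suc (N x)) (%x. bst (A x) (N x) (N x))) (%x. bst (A x) (N x) (N x) (i x) (j x))"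
  if "has (tbl E (%x. Suc (N x)) (%x. Suc (N x)) (%x. bst (A x) (N x) (N x))) (%x. Suc (N x)) (%x. Suc (N x)) (%x. bst (A x) (N x) (N x))"
  by (rule cmp_has[OF that]) (intro env_intros ij | use ij(3) in "force simp: less_Suc_eq_le")+
 let ?Et = "tbl (idx E N) (%z. Suc (N (fst z))) (%z. Suc (N (fst z))) (%z. bst (A (fst z)) (N (fst z)) (snd z))"
 let ?E = "idx (idx ?Et (%z. Suc (N (fst z)))) (%z. Suc (N (fst2 z)))"
 assume hs: "has ?Et (%z. Suc (N (fst z))) (%z. Suc (N (fst z))) (%z. bst (A (fst z)) (N (fst z)) (snd z))"
 let ?N = "%z. N (fst3 z)" and ?k = "%z. snd (fst2 z)" and ?i = "%z. snd (fst z)" and ?j = "%z. snd z"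
 let ?S = "%z. bst (A (fst3 z)) (N (fst3 z)) (snd (fst2 z))"
 have h2: "has ?E (%z. Suc (N (fst3 z))) (%z. Suc (N (fst3 z))) ?S"
  by (rule has_idx[OF has_idx[OF hs]])
 have s1: "small ?Et (%z. Suc (N (fst z)))" "small (idx ?Et (%z. Suc (N (fst z)))) (%z. Suc (N (fst2 z)))"
  by (intro env_intros sN small_idx[of _ "%z. Suc (N (fst z))"] small_idx[of _ "%z. Suc (N z)"])+
 have vN: "cmpn ?E ?N" by (intro cmp_idx[of _ "%z. int (N (fst2 z))"] cmp_idx[of _ "%z. int (N (fst z))"] cmp_tbl cmp_idx[of _ "%z. int (N z)"] N)
 have vk: "cmpn ?E ?k" by (intro cmp_idx[of _ "%z. int (snd (fst z))"] cmp_idx[of _ "%z. int (snd z)"] cmp_tbl cmp_snd N)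
 have vi: "cmpn ?E ?i" by (intro cmp_idx[of _ "%z. int (snd z)"] cmp_snd s1)
 have vj: "cmpn ?E ?j" by (intro cmp_snd s1)
 have S: "cmp ?E (%z. ?S z (a z) (c z))" if "cmpn ?E a" "cmpn ?E c" "!!z. z \<in> edom ?E ==> a z <= ?N z & c z <= ?N z" for a c
  using that by (intro cmp_has[OF h2]) (auto simp: less_Suc_eq_le)
 have 0: "cmpn ?E (%z. 0)" by (rule cmpn_const)
 have ed: "!!z. z \<in> edom ?E ==> ?k z <= ?N z & ?i z <= ?N z & ?j z <= ?N z" by auto
 show "cmp ?E (%z. bst (A (fst3 z)) (N (fst3 z)) (Suc (snd (fst2 z))) (snd (fst z)) (snd z))"
  unfolding bst.simps bstep_def
  by (intro cmp_ite' dec_disj dec_le decn_eq cmp_div cmp_diff cmp_mult cmp_const S vN vk vi vj 0) (use ed in auto)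
qed (intro small_Suc cmpn_Suc N)+

section \<open>Quadratic functions on a ball\<close>

definition sform :: "('v::real_vector => 'v => real) => bool" where
 "sform a \<longleftrightarrow> (ALL x y. a x y = a y x) & (ALL x y z. a (x + y) z = a x z + a y z) &
  (ALL c x y. a (c *R x) y = c * a x y)"

lemma sform_sym: "sform a ==> a x y = a y x" by (auto simp: sform_def)

lemma sform_simps:
 assumes "sform a"
 shows "a (x + y) z = a x z + a y z" "a z (x + y) = a z x + a z y"
  "a (c *R x) y = c * a x y" "a x (c *R y) = c * a x y"
  "a (x - y) z = a x z - a y z" "a z (x - y) = a z x - a z y"
  "a (- x) y = - a x y" "a x (- y) = - a x y"
  "a 0 x = 0" "a x 0 = 0"
proof -
 show add: "a (x + y) z = a x z + a y z" for x y z using assms by (auto simp: sform_def)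
 thus add2: "a z (x + y) = a z x + a z y" using sform_sym[OF assms] by metis
 show sc: "a (c *R x) y = c * a x y" for c x y using assms by (auto simp: sform_def)
 thus "a x (c *R y) = c * a x y" using sform_sym[OF assms] by metis
 show mi: "a (- x) y = - a x y" for x y using sc[of "-1" x y] by simp
 thus "a x (- y) = - a x y" using sform_sym[OF assms] by metis
 show di: "a (x - y) z = a x z - a y z" for x y z using add[of x "- y" z] mi by simp
 thus "a z (x - y) = a z x - a z y" using sform_sym[OF assms] by metis
 show z: "a 0 x = 0" for x using sc[of 0 x x] by simp
 thus "a x 0 = 0" using sform_sym[OF assms] by metis
qed

lemma sform_sum: "sform a ==> a (\<Sum>i\<in>I. f i) y = (\<Sum>i\<in>I. a (f i) y)"
 by (induction I rule: infinite_finite_induct) (auto simp: sform_simps)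

lemma sform_sum2: "sform a ==> a y (\<Sum>i\<in>I. f i) = (\<Sum>i\<in>I. a y (f i))"
 by (induction I rule: infinite_finite_induct) (auto simp: sform_simps)

lemma sform_plus: "sform a ==> sform q ==> sform (%x y. a x y + c * q x y)" by (auto simp: sform_def algebra_simps)

text \<open>The usual discriminant argument along \<open>x + t * y\<close>. If
  \<open>a y y = 0\<close>, the expression is affine in \<open>t\<close> and bounded below, which
  forces \<open>a x y = 0\<close>.\<close>

lemma sform_cauchy:
 assumes a: "sform a" and V: "subspace V" and psd: "!!u. u \<in> V ==> 0 <= a u u" and xy: "x \<in> V" "y \<in> V"
 shows "(a x y)\<^sup>2 <= a x x * a y y"
proof -
 have e: "0 <= a x x + 2 * t * a x y + t\<^sup>2 * a y y" for t proof -
  have "x + t *R y \<in> V" using V xy by (simp add: subspace_add subspace_scale)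
  from psd[OF this] show ?thesis
   using sform_sym[OF a, of y x] by (simp add: sform_simps[OF a] power2_eq_square algebra_simps)
 qed
 show ?thesis proof (cases "a y y = 0")
  case True
  have "a x y = 0" proof (rule ccontr)
   assume n: "a x y ~= 0"
   have "0 <= a x x + 2 * (- (a x x + 1) / a x y) * a x y" using e[of "- (a x x + 1) / a x y"] True by simp
   hence "0 <= a x x - 2 * (a x x + 1)" using n by simp
   thus False using psd[OF xy(1)] by simp
  qed
  thus ?thesis using True by simp
 next
  case False
  hence p: "0 < a y y" using psd[OF xy(2)] by simp
  have "0 <= a x x + 2 * (- a x y / a y y) * a x y + (- a x y / a y y)\<^sup>2 * a y y" by (rule e)
  also have "... = a x x - (a x y)\<^sup>2 / a y y" using p by (simp add: power2_eq_square field_simps)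
  finally show ?thesis using p by (simp add: field_simps)
 qed
qed

lemma sform_cauchy_sqrt:
 assumes "sform a" "subspace V" "!!u. u \<in> V ==> 0 <= a u u" "x \<in> V" "y \<in> V"
 shows "\<bar>a x y\<bar> <= sqrt (a x x) * sqrt (a y y)"
 using real_sqrt_le_mono[OF sform_cauchy[OF assms]] by (simp add: real_sqrt_mult)

lemma sform_triangle:
 assumes a: "sform a" and V: "subspace V" and psd: "!!u. u \<in> V ==> 0 <= a u u" and xy: "x \<in> V" "y \<in> V"
 shows "sqrt (a (x + y) (x + y)) <= sqrt (a x x) + sqrt (a y y)"
proof -
 have "a (x + y) (x + y) = a x x + 2 * a x y + a y y" using sform_sym[OF a, of y x] by (simp add: sform_simps[OF a])
 also have "... <= a x x + 2 * (sqrt (a x x) * sqrt (a y y)) + a y y" using sform_cauchy_sqrt[OF assms] by linarith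
 also have "... = (sqrt (a x x) + sqrt (a y y))\<^sup>2" using psd[OF xy(1)] psd[OF xy(2)] by (simp add: power2_sum)
 finally show ?thesis using psd[OF xy(1)] psd[OF xy(2)] by (intro real_le_lsqrt) auto
qed

text \<open>Strict convexity on \<open>V\<close> of the Lagrangian with multiplier
  \<open>c\<close>.\<close>

abbreviation "posq V a q c == ALL u:V. u ~= 0 --> 0 < a u u + c * q u u"

text \<open>\<open>f\<close> is the perturbed linear term that determines the stationary points,
  \<open>b\<close> the original one for which they must be nearly optimal on the ball. All
  stationary points are covered, so the property applies to whichever one the linear solver
  returns.\<close>

abbreviation "opts V a q b c f r e == ALL y:V. (ALL v:V. a y v + c * q y v = - f v / 2) -->
 q y y <= r\<^sup>2 & (ALL v:V. q v v <= r\<^sup>2 --> a y y + b y <= a v v + b v + (e::real))"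

text \<open>Any sufficiently small spacing \<open>s\<close> of the multipliers is allowed, so that a
  power of two can be taken later.\<close>

abbreviation "trs V a q b f r ka om N == ALL s. 0 < s & s <= ka ^ 3 * om / (96 * real N) -->
 (EX l::nat. real l * s <= 3 * om & posq V a q (real l * s) & opts V a q b (real l * s) f r (3 * ka * (om * r\<^sup>2)))"

text \<open>
 An approximate solution of the trust region problem is found among the stationary points of the
 Lagrangian with multipliers on an arithmetic progression, once the linear term has been perturbed so
 that it has a substantial component along an (almost) extremal direction of the quadratic term.
\<close>

lemma trust_region:
 fixes a q :: "'v::real_vector => 'v => real" and bt :: "'v => real"
 assumes V: "subspace V" and sa: "sform a" and sq: "sform q" and lb: "linear bt"
  and pd: "!!u. u \<in> V ==> u ~= 0 ==> 0 < q u u"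
  and ba: "!!u v. u \<in> V ==> v \<in> V ==> \<bar>a u v\<bar> <= om * (sqrt (q u u) * sqrt (q v v))"
  and bb: "!!u. u \<in> V ==> \<bar>bt u\<bar> <= om * r / 2 * sqrt (q u u)"
  and om: "0 < om" and r: "0 < r"
  and g: "!!i. i < N ==> g i \<in> V & g i ~= 0"
  and par: "!!u. u \<in> V ==> q u u <= (\<Sum>i<N. (q (g i) u)\<^sup>2 / q (g i) (g i))"
  and nz: "EX u:V. u ~= 0"
  and solv: "!!lam bt'. linear bt' ==> (!!u. u \<in> V ==> u ~= 0 ==> 0 < a u u + lam * q u u) ==>
    EX y:V. ALL v:V. a y v + lam * q y v = - bt' v / 2"
  and ka: "0 < ka" "ka <= 1 / 4"
 shows "EX i<N. ALL ta0>0. ka * om * r / 2 <= ta0 * sqrt (q (g i) (g i)) & ta0 * sqrt (q (g i) (g i)) <= ka * om * r -->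
  (EX ta:{ta0, - ta0}. trs V a q bt (%v. bt v + ta * q (g i) v) r ka om N)"
proof -
 let ?n = "%u. sqrt (q u u)"
 have q0: "0 <= q u u" if "u \<in> V" for u using pd[OF that] by (cases "u = 0") (auto simp: sform_simps[OF sq])
 have n0: "0 <= ?n u" "(?n u)\<^sup>2 = q u u" if "u \<in> V" for u using q0[OF that] by auto
 have npos: "0 < ?n u" if "u \<in> V" "u ~= 0" for u using pd[OF that] by simp
 have lba: "bt (x + y) = bt x + bt y" "bt (c *R x) = c * bt x" "bt (x - y) = bt x - bt y" for x y c
  using lb by (simp_all add: linear_add linear_cmul linear_diff)
 obtain u1 where u1: "u1 \<in> V" "u1 ~= 0" using nz by blast
 have N: "0 < N" proof (rule ccontr)
  assume "~ ?thesis" hence "q u1 u1 <= 0" using par[OF u1(1)] by simp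
  thus False using pd[OF u1] by simp
 qed
 \<comment> \<open>The curvature that the Lagrangian will turn out to have along the near-extremal
   direction \<open>us\<close>. The bound on \<open>s\<close> in \<open>trs\<close> is
   \<open>ka * c0 / 12\<close>.\<close>
 define c0 where "c0 = ka\<^sup>2 * om / (8 * real N)"
 have c0: "0 < c0" using ka om N by (simp add: c0_def)
 define U where "U = {u \<in> V. q u u = 1}"
 let ?A = "(%u. a u u) ` U"
 have low: "- om <= a u u" if "u \<in> U" for u using ba[of u u] that by (auto simp: U_def)
 have "(1 / ?n u1) *R u1 \<in> U"
  using u1 npos[OF u1] n0[OF u1(1)] V by (auto simp: U_def subspace_scale sform_simps[OF sq] power2_eq_square field_simps)
 hence ne: "?A ~= {}" by blast
 have bdd: "bdd_below ?A" using low by (auto simp: bdd_below_def)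
 \<comment> \<open>An eigenvector of the least eigenvalue would require compactness; a unit vector
   within \<open>c0 / 2\<close> of the infimum is enough.\<close>
 obtain us where us: "us \<in> U" "a us us < Inf ?A + c0 / 2" using cInf_lessD[OF ne, of "Inf ?A + c0 / 2"] c0 by auto
 have usV: "us \<in> V" "q us us = 1" using us by (auto simp: U_def)
 have near: "(a us us - c0 / 2) * q u u <= a u u" if u: "u \<in> V" for u proof (cases "u = 0")
  case False
  let ?w = "(1 / ?n u) *R u"
  have "?w \<in> U" using u npos[OF u False] n0[OF u] V
   by (auto simp: U_def subspace_scale sform_simps[OF sq] power2_eq_square field_simps)
  hence "Inf ?A <= a ?w ?w" by (intro cInf_lower[OF _ bdd]) auto
  also have "a ?w ?w = a u u / q u u" using n0[OF u] by (simp add: sform_simps[OF sa] power2_eq_square)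
  finally have "a us us - c0 / 2 <= a u u / q u u" using us(2) by linarith
  thus ?thesis using pd[OF u False] by (simp add: field_simps)
 qed (simp add: sform_simps[OF sa] sform_simps[OF sq])
 \<comment> \<open>By Parseval the squared cosines of \<open>us\<close> with the \<open>N\<close>
   directions sum to at least 1, so one of them is at least \<open>1 / N\<close>.\<close>
 have "EX i<N. 1 / real N <= (q (g i) us)\<^sup>2 / q (g i) (g i)" proof (rule ccontr)
  assume "~ ?thesis"
  hence "(\<Sum>i<N. (q (g i) us)\<^sup>2 / q (g i) (g i)) < (\<Sum>i<N. 1 / real N)"
   using N by (intro sum_strict_mono) (auto simp: not_le)
  thus False using par[OF usV(1)] usV(2) N by simp
 qed
 then obtain i where i: "i < N" "1 / real N <= (q (g i) us)\<^sup>2 / q (g i) (g i)" by blast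
 have gV: "g i \<in> V" "0 < q (g i) (g i)" using g[OF i(1)] pd by auto
 show ?thesis proof (intro exI[of _ i] conjI i(1) allI impI)
  fix ta0 :: real
  assume ta0: "0 < ta0" and "ka * om * r / 2 <= ta0 * ?n (g i) & ta0 * ?n (g i) <= ka * om * r"
  hence t1: "ka * om * r / 2 <= ta0 * ?n (g i)" and t2: "ta0 * ?n (g i) <= ka * om * r" by auto
  \<comment> \<open>The sign is chosen so that the perturbation cannot cancel the component of
    \<open>bt\<close> along \<open>us\<close>.\<close>
  define ta where "ta = (if 0 <= bt us * q (g i) us then ta0 else - ta0)"
  have abt: "\<bar>ta\<bar> = ta0" using ta0 by (simp add: ta_def)
  define b where "b v = bt v + ta * q (g i) v" for v
  have linb: "linear b" unfolding b_def by (rule linearI) (simp_all add: lba sform_simps[OF sq] algebra_simps)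
  have dev: "\<bar>ta * q (g i) v\<bar> <= ka * om * r * ?n v" if v: "v \<in> V" for v proof -
   have "\<bar>q (g i) v\<bar> <= ?n (g i) * ?n v" by (rule sform_cauchy_sqrt[OF sq V q0 gV(1) v])
   hence "\<bar>ta * q (g i) v\<bar> <= ta0 * ?n (g i) * ?n v" using ta0 by (simp add: abs_mult abt)
   also have "... <= ka * om * r * ?n v" using t2 n0(1)[OF v] by (intro mult_right_mono)
   finally show ?thesis .
  qed
  have bsz: "\<bar>b v\<bar> <= 3 / 4 * (om * r) * ?n v" if v: "v \<in> V" for v proof -
   have "\<bar>b v\<bar> <= om * r / 2 * ?n v + ka * om * r * ?n v" using dev[OF v] bb[OF v] unfolding b_def by linarith
   also have "ka * om * r * ?n v <= 1 / 4 * om * r * ?n v" using ka om r n0(1)[OF v] by (intro mult_right_mono) auto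
   finally show ?thesis by (simp add: algebra_simps)
  qed
  have bus: "ka\<^sup>2 * om\<^sup>2 * r\<^sup>2 / (4 * real N) <= (b us)\<^sup>2" proof -
   have abs_add: "\<bar>y\<bar> <= \<bar>x + y\<bar>" if "0 <= x * y" for x y :: real using that by (auto simp: zero_le_mult_iff)
   have "0 <= bt us * (ta * q (g i) us)" proof (cases "0 <= bt us * q (g i) us")
    case True
    hence "0 <= ta0 * (bt us * q (g i) us)" by (rule mult_nonneg_nonneg[OF less_imp_le[OF ta0]])
    moreover have "bt us * (ta * q (g i) us) = ta0 * (bt us * q (g i) us)"
     using True by (simp add: ta_def mult.left_commute)
    ultimately show ?thesis by linarith
   next
    case False
    hence "0 <= - (bt us * q (g i) us)" by simp
    hence "0 <= ta0 * (- (bt us * q (g i) us))" by (rule mult_nonneg_nonneg[OF less_imp_le[OF ta0]])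
    moreover have "bt us * (ta * q (g i) us) = ta0 * (- (bt us * q (g i) us))"
     using False by (simp add: ta_def mult.left_commute)
    ultimately show ?thesis by linarith
   qed
   hence "\<bar>ta * q (g i) us\<bar> <= \<bar>b us\<bar>" unfolding b_def by (rule abs_add)
   hence "(ta * q (g i) us)\<^sup>2 <= (b us)\<^sup>2" by (simp add: abs_le_square_iff)
   moreover have "(ka * om * r / 2)\<^sup>2 * (1 / real N) <= (ta0 * ?n (g i))\<^sup>2 * ((q (g i) us)\<^sup>2 / q (g i) (g i))"
    using t1 ka om r i(2) by (intro mult_mono power_mono) auto
   moreover have "(ta0 * ?n (g i))\<^sup>2 * ((q (g i) us)\<^sup>2 / q (g i) (g i)) = (ta * q (g i) us)\<^sup>2"
    using gV(2) by (simp add: power_mult_distrib ta_def)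
   ultimately show ?thesis by (simp add: power_mult_distrib power_divide)
  qed
  show "EX ta:{ta0, - ta0}. trs V a q bt (%v. bt v + ta * q (g i) v) r ka om N"
  proof (intro bexI[of _ ta] allI impI)
   fix s assume "0 < s & s <= ka ^ 3 * om / (96 * real N)"
   hence s: "0 < s" "s <= ka * (c0 / 2) / 6" by (auto simp: c0_def power3_eq_cube power2_eq_square)
   have sc: "s <= (c0 / 2) / 24" proof -
    have "ka * (c0 / 2) <= 1 / 4 * (c0 / 2)" using ka c0 by (intro mult_right_mono) auto
    thus ?thesis using s(2) by linarith
   qed
   have cw: "c0 / 2 <= om" proof -
    have "ka\<^sup>2 <= (1/4)\<^sup>2" using ka by (intro power_mono) auto
    hence "ka\<^sup>2 * om <= 1 * om" using om by (intro mult_right_mono) (auto simp: power2_eq_square)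
    also have "1 * om <= om * (8 * real N)" using om N by simp
    finally have "c0 <= om" unfolding c0_def using N by (simp add: field_simps)
    thus ?thesis using c0 by linarith
   qed
   define D where "D l x y = a x y + real l * s * q x y" for l x y
   have sD: "sform (D l)" for l unfolding D_def by (rule sform_plus[OF sa sq])
   define PD where "PD l \<longleftrightarrow> (ALL u:V. u ~= 0 --> 0 < D l u u)" for l
   define sol where "sol l y \<longleftrightarrow> y \<in> V & (ALL v:V. D l y v = - b v / 2)" for l y
   define P where "P l \<longleftrightarrow> PD l & (ALL y. sol l y --> q y y <= r\<^sup>2)" for l
   have Dyy: "D l y y <= 3 / 8 * (om * r) * ?n y" if "sol l y" for l y using that bsz[of y] by (auto simp: sol_def)
   define l0 where "l0 = nat \<lceil>2 * om / s\<rceil>"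
   have "2 * om / s <= real l0" "real l0 <= 2 * om / s + 1" using om s by (auto simp: l0_def)
   hence l0: "2 * om <= real l0 * s" "real l0 * s <= 2 * om + s" using s by (auto simp: field_simps)
   have D0: "om * q u u <= D l0 u u" if u: "u \<in> V" for u proof -
    have "\<bar>a u u\<bar> <= om * q u u" using ba[OF u u] n0[OF u] by (simp add: power2_eq_square)
    moreover have "2 * om * q u u <= real l0 * s * q u u" using l0 q0[OF u] by (intro mult_right_mono) auto
    ultimately show ?thesis unfolding D_def by linarith
   qed
   have "P l0" unfolding P_def PD_def proof (intro conjI ballI impI allI)
    fix u assume u: "u \<in> V" "u ~= 0"
    show "0 < D l0 u u" using D0[OF u(1)] mult_pos_pos[OF om pd[OF u]] by linarith
   next
    fix y assume y: "sol l0 y"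
    hence yV: "y \<in> V" by (simp add: sol_def)
    have "om * (?n y * ?n y) <= om * (3 / 8 * r * ?n y)"
     using D0[OF yV] Dyy[OF y] n0[OF yV] by (simp add: power2_eq_square algebra_simps)
    hence "?n y * ?n y <= 3 / 8 * r * ?n y" using om by simp
    hence "?n y <= r" proof (cases "?n y = 0")
     case False
     hence "0 < ?n y" using n0(1)[OF yV] by linarith
     with \<open>?n y * ?n y <= 3 / 8 * r * ?n y\<close> have "?n y <= 3 / 8 * r" by (rule mult_right_le_imp_le)
     thus ?thesis using r by linarith
    qed (use r in linarith)
    hence "(?n y)\<^sup>2 <= r\<^sup>2" using n0[OF yV] by (intro power_mono) auto
    thus "q y y <= r\<^sup>2" using n0[OF yV] by simp
   qed
   define l where "l = (LEAST l. P l)"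
   have Pl: "P l" unfolding l_def by (rule LeastI[of P, OF \<open>P l0\<close>])
   have "l <= l0" unfolding l_def by (rule Least_le[of P, OF \<open>P l0\<close>])
   hence lam: "real l * s <= 3 * om" proof -
    have "real l * s <= real l0 * s" using \<open>l <= l0\<close> s by (intro mult_right_mono) auto
    thus ?thesis using l0 sc cw c0 om by linarith
   qed
   have PDl: "PD l" using Pl by (simp add: P_def)
   have psd: "0 <= D l u u" if "u \<in> V" for u
    using PDl that by (cases "u = 0") (auto simp: PD_def sform_simps[OF sD] less_imp_le)
   obtain y0 where y0: "sol l y0" using solv[OF linb, of "real l * s"] PDl unfolding sol_def PD_def D_def by blast
   \<comment> \<open>Here the perturbation excludes the hard case. Stationarity of
     \<open>y0\<close>, paired with \<open>us\<close>, and the Cauchy-Schwarz inequality turn a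
     substantial \<open>b us\<close> into curvature at least \<open>c0\<close> along
     \<open>us\<close>; as \<open>us\<close> is nearly extremal, at least \<open>c0 / 2\<close>
     remains in every direction.\<close>
   have strong: "c0 / 2 * q u u <= D l u u" if u: "u \<in> V" for u proof -
    have y0V: "y0 \<in> V" "q y0 y0 <= r\<^sup>2" using y0 Pl by (auto simp: sol_def P_def)
    have "?n y0 <= r" using y0V(2) r by (simp add: real_le_lsqrt)
    have "(b us / 2)\<^sup>2 = (D l us y0)\<^sup>2"
     using y0 usV(1) sform_sym[OF sD, of l us y0] by (simp add: sol_def power2_eq_square)
    also have "... <= D l us us * D l y0 y0" by (rule sform_cauchy[OF sD V psd usV(1) y0V(1)])
    also have "... <= D l us us * (3 / 8 * (om * r) * r)" proof (rule mult_left_mono[OF order_trans[OF Dyy[OF y0]]])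
     show "3 / 8 * (om * r) * ?n y0 <= 3 / 8 * (om * r) * r" using \<open>?n y0 <= r\<close> om r by (intro mult_left_mono) auto
    qed (rule psd[OF usV(1)])
    finally have "(b us)\<^sup>2 <= D l us us * (3 / 2 * (om * r\<^sup>2))" by (simp add: power2_eq_square)
    hence "ka\<^sup>2 * om\<^sup>2 * r\<^sup>2 / (4 * real N) <= D l us us * (3 / 2 * (om * r\<^sup>2))" using bus by linarith
    hence "(ka\<^sup>2 * om / (6 * real N)) * (3 / 2 * (om * r\<^sup>2)) <= D l us us * (3 / 2 * (om * r\<^sup>2))"
     using N by (simp add: power2_eq_square)
    moreover have "0 < 3 / 2 * (om * r\<^sup>2)" using om r by simp
    ultimately have "ka\<^sup>2 * om / (6 * real N) <= D l us us" by (rule mult_right_le_imp_le)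
    moreover have "c0 <= ka\<^sup>2 * om / (6 * real N)" unfolding c0_def using om N by (intro divide_left_mono) auto
    ultimately have "c0 <= a us us + real l * s" using usV(2) by (simp add: D_def)
    hence "c0 / 2 * q u u <= (a us us - c0 / 2 + real l * s) * q u u"
     using q0[OF u] by (intro mult_right_mono) auto
    also have "... <= D l u u" using near[OF u] by (simp add: D_def algebra_simps)
    finally show ?thesis .
   qed
   show "EX l::nat. real l * s <= 3 * om & posq V a q (real l * s) &
    (opts V a q bt (real l * s) (%v. bt v + ta * q (g i) v) r (3 * ka * (om * r\<^sup>2)))"
   proof (intro exI[of _ l] conjI lam)
    show "posq V a q (real l * s)" using PDl by (simp add: PD_def D_def)
    show "opts V a q bt (real l * s) (%v. bt v + ta * q (g i) v) r (3 * ka * (om * r\<^sup>2))"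
    proof (intro ballI impI)
     fix y assume yV: "y \<in> V" and "ALL v:V. a y v + real l * s * q y v = - (bt v + ta * q (g i) v) / 2"
     hence y: "sol l y" by (simp add: sol_def D_def b_def)
     hence yr: "q y y <= r\<^sup>2" using Pl by (simp add: P_def)
     hence nyr: "?n y <= r" using r by (simp add: real_le_lsqrt)
     \<comment> \<open>Approximate complementary slackness. If the multiplier is positive, the
       preceding grid point fails; by \<open>strong\<close> it still gives a convex Lagrangian, so
       it has a stationary point \<open>w\<close> outside the ball. The curvature makes
       \<open>w - y\<close> short compared with \<open>w\<close>, hence \<open>y\<close> is close to
       the sphere.\<close>
     have gap: "real l * s * (r\<^sup>2 - q y y) <= ka * (om * r\<^sup>2)" proof (cases l)
      case 0
      thus ?thesis using ka om by simp
     next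
      case (Suc k)
      have "~ P k" using not_less_Least[of k P] Suc unfolding l_def by simp
      have Dk: "D l u v = D k u v + s * q u v" for u v by (simp add: D_def Suc algebra_simps)
      have "PD k" unfolding PD_def proof (intro ballI impI)
       fix u assume u: "u \<in> V" "u ~= 0"
       have "s * q u u < c0 / 2 * q u u" using sc c0 pd[OF u] by (intro mult_strict_right_mono) auto
       thus "0 < D k u u" using strong[OF u(1)] Dk[of u u] by linarith
      qed
      then obtain w where w: "sol k w" "r\<^sup>2 < q w w" using \<open>~ P k\<close> by (auto simp: P_def not_le)
      hence wV: "w \<in> V" by (simp add: sol_def)
      let ?e = "w - y"
      have eV: "?e \<in> V" using V wV yV by (simp add: subspace_diff)
      have "D l ?e ?e = s * q w ?e" proof -
       have "D l w ?e = - b ?e / 2 + s * q w ?e" using Dk w eV by (simp add: sol_def)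
       moreover have "D l y ?e = - b ?e / 2" using y eV by (simp add: sol_def)
       ultimately show ?thesis using sform_simps(5)[OF sD, of l w y ?e] by simp
      qed
      hence "c0 / 2 * (?n ?e * ?n ?e) <= s * (?n w * ?n ?e)"
       using strong[OF eV] sform_cauchy_sqrt[OF sq V q0 wV eV] s n0[OF eV]
       by (smt (verit, best) mult_left_mono power2_eq_square)
      hence "c0 / 2 * ?n ?e <= s * ?n w" proof (cases "?n ?e = 0")
       case True
       thus ?thesis using n0(1)[OF wV] s by simp
      next
       case False
       hence p: "0 < ?n ?e" using n0(1)[OF eV] by linarith
       have "(c0 / 2 * ?n ?e) * ?n ?e <= (s * ?n w) * ?n ?e"
        using \<open>c0 / 2 * (?n ?e * ?n ?e) <= s * (?n w * ?n ?e)\<close> by (simp only: mult.assoc)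
       thus ?thesis using p by (rule mult_right_le_imp_le)
      qed
      hence "?n ?e <= s / (c0 / 2) * ?n w" using c0 by (simp add: field_simps)
      moreover have "?n w <= ?n ?e + ?n y" using sform_triangle[OF sq V q0 eV yV] by simp
      ultimately have "(1 - s / (c0 / 2)) * ?n w <= ?n y" by (simp add: algebra_simps)
      define \<theta> where "\<theta> = s / (c0 / 2)"
      have th: "0 <= \<theta>" "\<theta> <= ka / 6" "\<theta> <= 1 / 24" using s c0 sc by (auto simp: \<theta>_def field_simps)
      have "r < ?n w" using w(2) r by (simp add: real_less_rsqrt)
      hence "(1 - \<theta>) * r <= (1 - \<theta>) * ?n w" using th by (intro mult_left_mono) auto
      hence "(1 - \<theta>) * r <= ?n y" using \<open>(1 - s / (c0 / 2)) * ?n w <= ?n y\<close> by (simp add: \<theta>_def)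
      hence "((1 - \<theta>) * r)\<^sup>2 <= (?n y)\<^sup>2" using th r by (intro power_mono) auto
      hence "(1 - \<theta>)\<^sup>2 * r\<^sup>2 <= q y y" using n0[OF yV] by (simp add: power_mult_distrib)
      moreover have "(1 - 2 * \<theta>) * r\<^sup>2 <= (1 - \<theta>)\<^sup>2 * r\<^sup>2"
       by (intro mult_right_mono) (auto simp: power2_eq_square algebra_simps)
      ultimately have "r\<^sup>2 - q y y <= 2 * \<theta> * r\<^sup>2" by (simp add: algebra_simps)
      hence "real l * s * (r\<^sup>2 - q y y) <= 3 * om * (2 * \<theta> * r\<^sup>2)" by (rule mult_mono[OF lam]) (use om yr in auto)
      also have "... = 6 * \<theta> * (om * r\<^sup>2)" by simp
      also have "... <= ka * (om * r\<^sup>2)" using th om by (intro mult_right_mono) auto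
      finally show ?thesis .
     qed
     show "q y y <= r\<^sup>2 & (ALL v:V. q v v <= r\<^sup>2 --> a y y + bt y <= a v v + bt v + 3 * ka * (om * r\<^sup>2))"
     proof (intro conjI ballI impI yr)
      fix v assume v: "v \<in> V" and vr: "q v v <= r\<^sup>2"
      have nvr: "?n v <= r" using vr r by (simp add: real_le_lsqrt)
      have vy: "v - y \<in> V" using V v yV by (simp add: subspace_diff)
      have "0 <= D l (v - y) (v - y)" by (rule psd[OF vy])
      also have "... = D l v v - 2 * D l y v + D l y y"
       using sform_sym[OF sD, of l v y] by (simp add: sform_simps[OF sD])
      also have "... = D l v v + b v - (D l y y + b y)" using y v yV by (simp add: sol_def)
      finally have "a y y + b y <= a v v + b v + real l * s * (q v v - q y y)" by (simp add: D_def algebra_simps)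
      moreover have "real l * s * (q v v - q y y) <= real l * s * (r\<^sup>2 - q y y)"
       using vr s by (intro mult_left_mono) auto
      ultimately have "a y y + b y <= a v v + b v + ka * (om * r\<^sup>2)" using gap by linarith
      \<comment> \<open>One \<open>ka\<close> pays for the slackness, two more for exchanging the
        perturbed linear term for the original one at \<open>v\<close> and at
        \<open>y\<close>.\<close>
      moreover have dv: "\<bar>ta * q (g i) x\<bar> <= ka * (om * r\<^sup>2)" if "x \<in> V" "?n x <= r" for x proof -
       have "ka * om * r * ?n x <= ka * om * r * r" using that ka om r by (intro mult_left_mono) auto
       thus ?thesis using dev[OF that(1)] by (simp add: power2_eq_square)
      qed
      ultimately show "a y y + bt y <= a v v + bt v + 3 * ka * (om * r\<^sup>2)"
       using dv[OF v nvr] dv[OF yV nyr] unfolding b_def by linarith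
     qed
    qed
   qed
  qed (simp add: ta_def)
 qed
qed

section \<open>Orthogonalisation\<close>

text \<open>Vectors are functions on all natural numbers, so vectors of all dimensions share one
  type; the dimension enters only through the subspace \<open>Vn n\<close>.\<close>

instantiation "fun" :: (type, real_vector) real_vector
begin

definition scaleR_fun :: "real => ('a => 'b) => 'a => 'b" where
 "scaleR_fun c f = (%x. c *R f x)"

instance by standard (auto simp: scaleR_fun_def fun_eq_iff scaleR_add_right scaleR_add_left)

end

lemma fun_sum_apply: "(\<Sum>i\<in>I. f i) x = (\<Sum>i\<in>I. f i x)" for f :: "'a => 'b => 'c::comm_monoid_add"
 by (induction I rule: infinite_finite_induct) auto

lemma fun_scaleR_apply [simp]: "(c *R f) x = c *R f x" by (simp add: scaleR_fun_def)

definition sp :: "(nat => 'v::real_vector) => nat => 'v set" where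
 "sp v k = span (v ` {..<k})"

lemma sp_subspace: "subspace (sp v k)" by (simp add: sp_def)

lemma sp_mono: "i <= k ==> sp v i \<subseteq> sp v k" unfolding sp_def by (rule span_mono) auto

lemma sp_base: "i < k ==> v i \<in> sp v k" unfolding sp_def by (rule span_base) auto

lemma sp_Suc: "sp v (Suc k) = {x. EX c. x - c *R v k \<in> sp v k}"
 unfolding sp_def by (simp add: lessThan_Suc span_insert)

lemma sp_0 [simp]: "sp v 0 = {0}" by (simp add: sp_def)

lemma sp_sum: "k <= n ==> (\<Sum>i<k. c i *R v i) \<in> sp v n"
 by (intro subspace_sum sp_subspace subspace_scale sp_base) auto

lemma sp_sub: "subspace V ==> (!!i. i < k ==> v i \<in> V) ==> sp v k \<subseteq> V" unfolding sp_def by (rule span_minimal) auto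

lemma sp_ex: "x \<in> sp v k ==> EX c. x = (\<Sum>i<k. c i *R v i)"
proof (induction k arbitrary: x)
 case (Suc k)
 then obtain t where "x - t *R v k \<in> sp v k" by (auto simp: sp_Suc)
 from Suc.IH[OF this] obtain c where c: "x - t *R v k = (\<Sum>i<k. c i *R v i)" by blast
 have "x = (\<Sum>i<Suc k. (c(k := t)) i *R v i)" using c by (simp add: algebra_simps)
 thus ?case by blast
qed auto

text \<open>Gram-Schmidt vectors are characterised by their properties instead of being computed.
  One system \<open>g\<close> can then serve all bases that differ by unitriangular changes, and
  uniqueness identifies it with the output of the elimination.\<close>

definition gsys :: "('v::real_vector => 'v => real) => (nat => 'v) => (nat => 'v) => nat => bool" where
 "gsys q v g n \<longleftrightarrow> (ALL k<n. g k - v k \<in> sp v k & (ALL u:sp v k. q (g k) u = 0) & 0 < q (g k) (g k))"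

context
 fixes q :: "'v::real_vector => 'v => real" and v g :: "nat => 'v" and n :: nat
 assumes sq: "sform q" and gs: "gsys q v g n"
begin

lemma gsD: "k < n ==> g k - v k \<in> sp v k" "k < n ==> u \<in> sp v k ==> q (g k) u = 0"
 "k < n ==> 0 < q (g k) (g k)" using gs by (auto simp: gsys_def)

lemma gs_in: "k < n ==> g k \<in> sp v (Suc k)" using gsD(1)[of k] by (auto simp: sp_Suc intro!: exI[of _ 1])

lemma gs_in': "k < N ==> N <= n ==> g k \<in> sp v N" using gs_in[of k] sp_mono[of "Suc k" N v] by auto

lemma gs_orth: "i < n ==> k < n ==> i ~= k ==> q (g i) (g k) = 0"
proof -
 have *: "q (g k) (g i) = 0" if "i < k" "k < n" for i k using gsD(2)[OF that(2), of "g i"] gs_in'[of i k] that by auto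
 show "i < n ==> k < n ==> i ~= k ==> q (g i) (g k) = 0"
  using *[of i k] *[of k i] sform_sym[OF sq] by (metis linorder_neqE_nat)
qed

lemma gs_self: "k < n ==> q (g k) (v k) = q (g k) (g k)"
 using gsD(2)[OF _ gsD(1), of k] by (simp add: sform_simps[OF sq])

lemma gs_coeff: "k < n ==> u - c *R v k \<in> sp v k ==> q (g k) u = c * q (g k) (g k)"
 using gsD(2)[of k "u - c *R v k"] gs_self[of k] by (simp add: sform_simps[OF sq])

lemma gs_red: "k < n ==> u \<in> sp v (Suc k) ==> u - (q (g k) u / q (g k) (g k)) *R g k \<in> sp v k"
proof -
 assume k: "k < n" and "u \<in> sp v (Suc k)"
 then obtain c where c: "u - c *R v k \<in> sp v k" by (auto simp: sp_Suc)
 have "q (g k) u / q (g k) (g k) = c" using gs_coeff[OF k c] gsD(3)[OF k] by simp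
 moreover have "u - c *R g k = (u - c *R v k) - c *R (g k - v k)" by (simp add: algebra_simps)
 moreover have "(u - c *R v k) - c *R (g k - v k) \<in> sp v k"
  by (rule subspace_diff[OF sp_subspace c subspace_scale[OF sp_subspace gsD(1)[OF k]]])
 ultimately show ?thesis by (simp only:)
qed

lemma gs_parseval: "N <= n ==> u \<in> sp v N ==> q u u = (\<Sum>i<N. (q (g i) u)\<^sup>2 / q (g i) (g i))"
proof (induction N arbitrary: u)
 case 0
 thus ?case by (simp add: sform_simps[OF sq])
next
 case (Suc N)
 define c where "c = q (g N) u / q (g N) (g N)"
 define w where "w = u - c *R g N"
 have N: "N < n" using Suc by simp
 have w: "w \<in> sp v N" unfolding w_def c_def by (rule gs_red[OF N Suc.prems(2)])
 have gw: "q (g i) w = q (g i) u" if "i < N" for i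
  using gs_orth[of i N] that N by (simp add: w_def sform_simps[OF sq])
 have "u = w + c *R g N" by (simp add: w_def)
 moreover have "q (w + c *R g N) (w + c *R g N) = q w w + 2 * (c * q (g N) w) + c * (c * q (g N) (g N))"
  using sform_sym[OF sq, of w "g N"] by (simp add: sform_simps[OF sq] algebra_simps)
 moreover have "q (g N) w = 0" using gsD(2)[OF N w] .
 ultimately have "q u u = q w w + c * (c * q (g N) (g N))" by simp
 also have "c * (c * q (g N) (g N)) = (q (g N) u)\<^sup>2 / q (g N) (g N)"
  using gsD(3)[OF N] by (simp add: c_def power2_eq_square)
 finally have "q u u = q w w + (q (g N) u)\<^sup>2 / q (g N) (g N)" .
 thus ?case using Suc.IH[OF _ w] N gw by simp
qed

lemma gs_pd: "N <= n ==> u \<in> sp v N ==> u ~= 0 ==> 0 < q u u"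
proof (induction N arbitrary: u)
 case (Suc N)
 have N: "N < n" using Suc by simp
 show ?case proof (cases "q (g N) u = 0")
  case True
  hence "u \<in> sp v N" using gs_red[OF N Suc.prems(2)] by simp
  thus ?thesis using Suc by simp
 next
  case False
  have "(q (g N) u)\<^sup>2 / q (g N) (g N) <= (\<Sum>i<Suc N. (q (g i) u)\<^sup>2 / q (g i) (g i))"
   using gsD(3) N by (intro member_le_sum) (auto intro!: divide_nonneg_nonneg less_imp_le[OF gsD(3)])
  moreover have "0 < (q (g N) u)\<^sup>2 / q (g N) (g N)" using False gsD(3)[OF N] by simp
  ultimately show ?thesis using gs_parseval[OF Suc.prems(1,2)] by linarith
 qed
qed auto

lemma gs_norm_comb:
 assumes "finite I" "I \<subseteq> {..<n}"
 shows "q (\<Sum>i\<in>I. t i *R g i) (\<Sum>i\<in>I. t i *R g i) = (\<Sum>i\<in>I. (t i)\<^sup>2 * q (g i) (g i))"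
proof -
 have "q (g i) (\<Sum>j\<in>I. t j *R g j) = t i * q (g i) (g i)" if "i \<in> I" for i proof -
  have "q (g i) (\<Sum>j\<in>I. t j *R g j) = (\<Sum>j\<in>I. if j = i then t i * q (g i) (g i) else 0)"
   unfolding sform_sum2[OF sq] sform_simps(4)[OF sq] proof (rule sum.cong[OF refl])
   fix j assume "j \<in> I"
   thus "t j * q (g i) (g j) = (if j = i then t i * q (g i) (g i) else 0)"
    using gs_orth[of i j] assms that by auto
  qed
  thus ?thesis using that assms by simp
 qed
 thus ?thesis by (simp add: sform_sum[OF sq] sform_simps[OF sq] power2_eq_square mult.assoc)
qed

lemma gs_indep: "(\<Sum>i<n. c i *R v i) = 0 ==> i < n ==> c i = 0"
proof -
 have "(\<Sum>i<N. c i *R v i) = 0 ==> N <= n ==> ALL i<N. c i = 0" for N proof (induction N)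
  case (Suc N)
  have "(\<Sum>i<N. c i *R v i) = 0 - c N *R v N" using Suc.prems(1) by (simp add: algebra_simps eq_neg_iff_add_eq_0)
  hence "0 - c N *R v N \<in> sp v N" by (metis sp_sum order_refl)
  hence "q (g N) 0 = c N * q (g N) (g N)" using Suc.prems(2) by (intro gs_coeff) auto
  hence "c N = 0" using gsD(3)[of N] Suc.prems(2) by (simp add: sform_simps[OF sq])
  thus ?case using Suc by (auto simp: less_Suc_eq)
 qed simp
 thus "(\<Sum>i<n. c i *R v i) = 0 ==> i < n ==> c i = 0" by blast
qed

end

text \<open>The difference of the two vectors lies in the span to which both are orthogonal.\<close>

lemma gs_unique:
 assumes sq: "sform q" and g: "gsys q v g n" and g': "gsys q v' g' n'"
  and k: "k < n" "k < n'" and s: "sp v k = sp v' k" and d: "v k - v' k \<in> sp v k"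
 shows "g k = g' k"
proof (rule ccontr)
 let ?w = "g k - g' k"
 assume "g k ~= g' k"
 hence "?w ~= 0" by simp
 have "?w = (g k - v k) - (g' k - v' k) + (v k - v' k)" by simp
 hence w: "?w \<in> sp v k" using gsD(1)[OF sq g k(1)] gsD(1)[OF sq g' k(2)] d s sp_subspace[of v k]
  by (metis subspace_add subspace_diff)
 hence "q ?w ?w = 0" using gsD(2)[OF sq g k(1) w] gsD(2)[OF sq g' k(2), of ?w] s by (simp add: sform_simps[OF sq])
 thus False using gs_pd[OF sq g, of k ?w] w \<open>?w ~= 0\<close> k by simp
qed

section \<open>Integer matrices and their quadratic forms\<close>

definition vn :: "nat => ivec => nat => real" where
 "vn n z = (%l. if l < n then of_int (z l) else 0)"

definition Vn :: "nat => (nat => real) set" where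
 "Vn n = {x. ALL l>=n. x l = 0}"

lemma Vn_subspace: "subspace (Vn n)" by (auto simp: Vn_def subspace_def)

lemma vn_Vn [simp]: "vn n z \<in> Vn n" by (simp add: vn_def Vn_def)

definition bf :: "nat => imat => (nat => real) => (nat => real) => real" where
 "bf n M x y = (\<Sum>i<n. \<Sum>j<n. of_int (M i j) * x i * y j)"

definition symn :: "nat => imat => bool" where
 "symn n M \<longleftrightarrow> (ALL i<n. ALL j<n. M i j = M j i)"

lemma sform_bf: "symn n M ==> sform (bf n M)"
proof -
 assume s: "symn n M"
 have "bf n M x y = bf n M y x" for x y proof -
  have "bf n M x y = (\<Sum>j<n. \<Sum>i<n. of_int (M i j) * x i * y j)" unfolding bf_def by (rule sum.swap)
  also have "... = bf n M y x" unfolding bf_def using s by (intro sum.cong refl) (auto simp: symn_def mult_ac)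
  finally show ?thesis .
 qed
 moreover have "bf n M (x + y) z = bf n M x z + bf n M y z" for x y z by (simp add: bf_def algebra_simps sum.distrib)
 moreover have "bf n M (c *R x) y = c * bf n M x y" for c x y by (simp add: bf_def algebra_simps sum_distrib_left)
 ultimately show ?thesis unfolding sform_def by blast
qed

lemma bf_posdef:
 assumes p: "posdef M n" and x: "x \<in> Vn n" "x ~= 0" shows "0 < bf n M x x"
proof -
 have "EX i<n. x i ~= 0" proof (rule ccontr)
  assume "~ ?thesis"
  hence "x = 0" using x(1) by (auto simp: Vn_def fun_eq_iff) (meson not_less)
  thus False using x(2) by simp
 qed
 from posdefD[OF p this] show ?thesis by (simp add: bf_def sum_distrib_left mult_ac)
qed

definition gram :: "nat => imat => ivec => ivec => int" where
 "gram n M y z = (\<Sum>i<n. \<Sum>j<n. M i j * y i * z j)"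

lemma bf_vn: "bf n M (vn n y) (vn n z) = of_int (gram n M y z)" by (simp add: bf_def gram_def vn_def)

text \<open>The Gram matrix of the rows of \<open>B\<close>, augmented by the column of inner products with \<open>c\<close>.\<close>

definition gc :: "nat => imat => ivec => imat => imat" where
 "gc n Q c B i j = gram n Q (B i) (if j < n then B j else c)"

text \<open>\<open>gn G j\<close> are the coordinates of \<open>dlt G j\<close> times the \<open>j\<close>-th Gram-Schmidt vector.\<close>

definition gn :: "imat => imat" where
 "gn G j l = (if l < j then - bst G j j l j else if l = j then dlt G j else 0)"

definition gv :: "imat => (nat => 'v::real_vector) => nat => 'v" where
 "gv G v j = (\<Sum>l<Suc j. (of_int (gn G j l) / of_int (dlt G j)) *R v l)"

lemma gram_posdef:
 assumes sq: "sform q" and pd: "!!u. u \<in> sp v n ==> u ~= 0 ==> 0 < q u u"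
  and ind: "!!c i. (\<Sum>i<n. c i *R v i) = 0 ==> i < n ==> c i = 0"
  and G: "!!i j. i < n ==> j < n ==> of_int (G i j) = q (v i) (v j)"
 shows "posdef G n" unfolding posdef_def
proof (intro allI impI)
 fix u :: "nat => real" assume u: "EX i<n. u i ~= 0"
 let ?x = "\<Sum>i<n. u i *R v i"
 have "?x ~= 0" using ind[of u] u by blast
 hence "0 < q ?x ?x" using pd sp_sum[of n n u v] by simp
 also have "q ?x ?x = (\<Sum>i<n. u i * (\<Sum>j<n. of_int (G i j) * u j))"
  unfolding sform_sum[OF sq] sform_sum2[OF sq] sform_simps(3,4)[OF sq]
  by (simp add: G sum_distrib_left mult_ac sform_sym[OF sq])
 finally show "0 < (\<Sum>i<n. u i * (\<Sum>j<n. of_int (G i j) * u j))" .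
qed

text \<open>Orthogonality to the first \<open>k\<close> vectors is a system of normal equations,
  which elimination on the leading Gram block solves for the right-hand side in column
  \<open>k\<close>. The squared norm is the residual pivot, a ratio of consecutive minors.\<close>

lemma gsys_gv:
 assumes sq: "sform q" and p: "posdef G n"
  and G: "!!i j. i < n ==> j < n ==> of_int (G i j) = q (v i) (v j)"
 shows "gsys q v (gv G v) n"
  and "k < n ==> q (gv G v k) (gv G v k) = of_int (dlt G (Suc k)) / of_int (dlt G k)"
proof -
 have d: "0 < dlt G k" "dlt G k = det (lead G k)" if "k <= n" for k
  using dlt_posdef[OF posdef_mono[OF p that]] by auto
 have e: "gv G v k = v k - (\<Sum>l<k. (of_int (bst G k k l k) / of_int (dlt G k)) *R v l)" if "k < n" for k
  using d[of k] that by (simp add: gv_def gn_def sum_negf)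
 let ?X = "%k l (j::nat). of_int (bst G k k l k) / of_int (dlt G k) :: real"
 have r: "q (v i) (gv G v k) = rsd G k (?X k) i k" if "k < n" "i < n" for i k
  using that unfolding e[OF that(1)] rsd_def by (simp add: sform_simps[OF sq] sform_sum2[OF sq] G mult.commute)
 have r0: "rsd G k (?X k) i k = 0" if "k < n" "i < k" for i k proof -
  have "(\<Sum>l<k. of_int (G i l) * ?X k l k) = of_int (\<Sum>l<k. G i l * bst G k k l k) / of_int (dlt G k)"
   by (simp add: sum_divide_distrib)
  also have "... = of_int (G i k)" using bst_sol[OF d(1) that(2), of k] d(1)[of k] that by simp
  finally show ?thesis by (simp add: rsd_def)
 qed
 have orth: "q (gv G v k) u = 0" if k: "k < n" and u: "u \<in> sp v k" for k u proof -
  obtain c where c: "u = (\<Sum>i<k. c i *R v i)" using sp_ex[OF u] by blast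
  have "q (v i) (gv G v k) = 0" if "i < k" for i using r[OF k] r0[OF k that] that k by simp
  hence "q u (gv G v k) = 0" unfolding c by (simp add: sform_sum[OF sq] sform_simps[OF sq])
  thus ?thesis using sform_sym[OF sq] by metis
 qed
 have dif: "gv G v k - v k \<in> sp v k" if "k < n" for k proof -
  have "gv G v k - v k = (\<Sum>l<k. (- (of_int (bst G k k l k) / of_int (dlt G k))) *R v l)"
   by (simp add: e[OF that] sum_negf)
  thus ?thesis by (metis sp_sum order_refl)
 qed
 have nrm: "q (gv G v k) (gv G v k) = of_int (dlt G (Suc k)) / of_int (dlt G k)" if k: "k < n" for k proof -
  have "q (gv G v k) (gv G v k) = q (gv G v k) (v k) + q (gv G v k) (gv G v k - v k)"
   by (simp add: sform_simps[OF sq])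
  also have "... = rsd G k (?X k) k k" using orth[OF k dif[OF k]] r[OF k k] sform_sym[OF sq] by simp
  finally have "q (gv G v k) (gv G v k) = rsd G k (?X k) k k" .
  moreover have "of_int (dlt G (Suc k)) = of_int (dlt G k) * rsd G k (?X k) k k"
   using pivot_det[of k G "?X k", OF r0[OF k]] d(2)[of k] d(2)[of "Suc k"] k by simp
  ultimately show ?thesis using d(1)[of k] k by simp
 qed
 thus "k < n ==> q (gv G v k) (gv G v k) = of_int (dlt G (Suc k)) / of_int (dlt G k)" by blast
 show "gsys q v (gv G v) n" unfolding gsys_def using dif orth nrm d(1) by (auto simp: Suc_leI)
qed

text \<open>Coordinates are bounded by the norm: pair with the dual basis vector \<open>Q\<^sup>-\<^sup>1 e\<^sub>l\<close>.\<close>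

definition dq :: "nat => int => int" where
 "dq n a = (int n + 1) ^ 2 * fact n * a ^ (n + 2)"

lemma coord_bound:
 assumes s: "symn n Q" and p: "posdef Q n" and a: "!!i j. i < n ==> j < n ==> \<bar>Q i j\<bar> <= a" "1 <= a"
  and x: "x \<in> Vn n" and l: "l < n"
 shows "(x l)\<^sup>2 <= of_int (dq n a) * bf n Q x x"
proof -
 let ?q = "bf n Q"
 note sq = sform_bf[OF s]
 \<comment> \<open>Column \<open>n\<close> holds the unit vector with index \<open>l\<close>, so the
   elimination returns a multiple of the dual vector of the coordinate \<open>l\<close>.\<close>
 define A where "A i j = (if j < n then Q i j else if i = l then 1 else 0)" for i j
 have "(\<Sum>j<n. of_int (A i j) * u j) = (\<Sum>j<n. of_int (Q i j) * u j)" for i and u :: "nat => real"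
  by (rule sum.cong) (auto simp: A_def)
 hence "posdef A n" using p by (simp add: posdef_def)
 hence d: "0 < dlt A n" by (rule dlt_posdef)
 let ?S = "%k. bst A n n k n"
 let ?w = "(1 / of_int (dlt A n)) *R vn n ?S"
 have sol: "(\<Sum>k<n. Q i k * ?S k) = (if i = l then dlt A n else 0)" if "i < n" for i
  using bst_sol[OF d that, of n] by (simp add: A_def)
 have dual: "?q y ?w = y l" if "y \<in> Vn n" for y proof -
  have "?q y (vn n ?S) = (\<Sum>i<n. y i * of_int (\<Sum>k<n. Q i k * ?S k))"
   by (simp add: bf_def vn_def sum_distrib_left mult_ac)
  also have "... = (\<Sum>i<n. if i = l then y l * of_int (dlt A n) else 0)" by (intro sum.cong) (auto simp: sol)
  finally have "?q y (vn n ?S) = y l * of_int (dlt A n)" using l by simp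
  thus ?thesis using d by (simp add: sform_simps[OF sq])
 qed
 have w: "?w \<in> Vn n" by (simp add: Vn_subspace subspace_scale)
 have psd: "0 <= ?q u u" if "u \<in> Vn n" for u
  using bf_posdef[OF p that] by (cases "u = 0") (auto simp: sform_simps[OF sq])
 have "(x l)\<^sup>2 = (?q x ?w)\<^sup>2" using dual[OF x] by simp
 also have "... <= ?q x x * ?q ?w ?w" by (rule sform_cauchy[OF sq Vn_subspace psd x w])
 also have "?q ?w ?w = of_int (?S l) / of_int (dlt A n)" using dual[OF w] l by (simp add: vn_def)
 also have "?q x x * (of_int (?S l) / of_int (dlt A n)) <= ?q x x * of_int (dq n a)"
 proof (rule mult_left_mono[OF _ psd[OF x]])
  have "\<bar>?S l\<bar> <= dq n a" unfolding dq_def by (rule bst_bound) (use a l in "auto simp: A_def")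
  hence "real_of_int (?S l) <= of_int (dq n a)" "0 <= real_of_int (dq n a)" by linarith+
  moreover have "1 <= real_of_int (dlt A n)" using d by linarith
  ultimately show "of_int (?S l) / of_int (dlt A n) <= real_of_int (dq n a)"
   using d mult_left_mono[of 1 "real_of_int (dlt A n)" "real_of_int (dq n a)"] by (simp add: pos_divide_le_eq)
 qed
 finally show ?thesis by (simp add: mult.commute)
qed

section \<open>Successive rounding\<close>

text \<open>
 A table \<open>S\<close> represents the point with coordinates \<open>S l / S n\<close>. Step \<open>j\<close> moves it along the
 \<open>j\<close>-th Gram-Schmidt vector so that its \<open>j\<close>-th coordinate becomes the nearest integer plus \<open>s j\<close>.
\<close>

definition babstep :: "nat => imat => nat => ivec => ivec => nat => int" where
 "babstep n G j s S l = (if l = n then S n * dlt G j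
  else S l * dlt G j + (S n * ((2 * S j + S n) div (2 * S n) + s j) - S j) * gn G j l)"

text \<open>Babai's nearest-plane rounding, from coordinate \<open>hi - 1\<close> downwards: a move
  along a Gram-Schmidt vector leaves the coordinates already fixed unchanged. The offsets
  \<open>s\<close> turn rounding into enumeration.\<close>

primrec bab :: "nat => imat => nat => ivec => ivec => imat" where
 "bab n G hi s X 0 = X"
| "bab n G hi s X (Suc t) = babstep n G (hi - Suc t) s (bab n G hi s X t)"

definition co :: "nat => ivec => nat => real" where
 "co n S l = of_int (S l) / of_int (S n)"

definition xv :: "nat => (nat => 'v::real_vector) => ivec => 'v" where
 "xv n v S = (\<Sum>l<n. co n S l *R v l)"

definition rnd :: "nat => ivec => nat => int" where
 "rnd n S j = (2 * S j + S n) div (2 * S n)"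

lemma rnd_co: "0 < S n ==> \<bar>of_int (rnd n S j) - co n S j\<bar> <= 1 / 2"
proof -
 assume p: "0 < S n"
 let ?a = "2 * S j + S n" and ?b = "2 * S n"
 have "?a div ?b * ?b <= ?a" "?a < (?a div ?b + 1) * ?b" proof -
  have b: "0 < ?b" using p by simp
  show "?a div ?b * ?b <= ?a" using pos_mod_sign[OF b, of ?a] div_mult_mod_eq[of ?a ?b] by linarith
  have "?a < ?a div ?b * ?b + ?b" using pos_mod_bound[OF b, of ?a] div_mult_mod_eq[of ?a ?b] by linarith
  thus "?a < (?a div ?b + 1) * ?b" by (simp only: distrib_right mult_1)
 qed
 hence "rnd n S j * ?b <= ?a" "?a <= (rnd n S j + 1) * ?b" unfolding rnd_def by (auto intro: less_imp_le)
 hence "real_of_int (rnd n S j * ?b) <= of_int ?a" "real_of_int ?a <= of_int ((rnd n S j + 1) * ?b)"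
  unfolding of_int_le_iff .
 hence "\<bar>of_int (rnd n S j) * of_int (S n) - of_int (S j)\<bar> <= real_of_int (S n) / 2"
  by (intro abs_leI) (simp_all add: algebra_simps)
 hence "\<bar>of_int (rnd n S j) * of_int (S n) - of_int (S j)\<bar> / of_int (S n) <= real_of_int (S n) / 2 / of_int (S n)"
  by (rule divide_right_mono) (use p in simp)
 moreover have "of_int (rnd n S j) - co n S j = (of_int (rnd n S j) * of_int (S n) - of_int (S j)) / real_of_int (S n)"
  using p by (simp add: co_def field_simps)
 ultimately show ?thesis using p by (simp only: abs_divide) simp
qed

lemma babstep_co:
 assumes "0 < S n" "0 < dlt G j" "l < n"
 shows "co n (babstep n G j s S) l = co n S l + (of_int (rnd n S j + s j) - co n S j) * (of_int (gn G j l) / of_int (dlt G j))"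
 using assms by (simp add: co_def babstep_def rnd_def field_simps)

lemma gv_extend: "j < n ==> gv G v j = (\<Sum>l<n. (of_int (gn G j l) / of_int (dlt G j)) *R v l)"
 unfolding gv_def by (rule sum.mono_neutral_left) (auto simp: gn_def)

lemma babstep_xv:
 assumes "0 < S n" "0 < dlt G j" "j < n"
 shows "xv n v (babstep n G j s S) = xv n v S + (of_int (rnd n S j + s j) - co n S j) *R gv G v j"
 using assms(1,2) unfolding xv_def gv_extend[OF assms(3)]
 by (simp add: babstep_co scaleR_add_left sum.distrib scaleR_sum_right mult_ac)

lemma babstep_pos: "0 < S n ==> 0 < dlt G j ==> 0 < babstep n G j s S n" by (simp add: babstep_def)

context
 fixes X :: ivec and n :: nat and G :: imat and hi :: nat
 assumes X: "0 < X n" and G: "ALL j<n. 0 < dlt G j" and hi: "hi <= n"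
begin

lemma bab_pos: "t <= hi ==> 0 < bab n G hi s X t n" using X G hi by (induction t) (auto simp: babstep_pos)

lemma bab_step_coords:
 assumes t: "t < hi"
 shows "hi - Suc t < l ==> l < n ==> co n (bab n G hi s X (Suc t)) l = co n (bab n G hi s X t) l"
  and "co n (bab n G hi s X (Suc t)) (hi - Suc t) = of_int (rnd n (bab n G hi s X t) (hi - Suc t) + s (hi - Suc t))"
proof -
 have j: "hi - Suc t < n" using t hi by simp
 have P: "0 < bab n G hi s X t n" using bab_pos[of t s] t by simp
 note c = babstep_co[where S="bab n G hi s X t" and n=n, OF P G[rule_format, OF j]]
 show "hi - Suc t < l ==> l < n ==> co n (bab n G hi s X (Suc t)) l = co n (bab n G hi s X t) l"
  using t by (simp add: c gn_def)
 show "co n (bab n G hi s X (Suc t)) (hi - Suc t) = of_int (rnd n (bab n G hi s X t) (hi - Suc t) + s (hi - Suc t))"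
  using t j G[rule_format, OF j] by (simp add: c gn_def)
qed

lemma bab_high:
 assumes t: "t <= hi" and l: "hi <= l" "l < n"
 shows "co n (bab n G hi s X t) l = co n X l" using t
proof (induction t)
 case (Suc t)
 thus ?case using bab_step_coords(1)[ of t l s] l by simp
qed simp

lemma bab_int:
 assumes t: "t <= hi" and l: "hi - t <= l" "l < hi"
 shows "co n (bab n G hi s X t) l \<in> \<int>" using t l
proof (induction t)
 case (Suc t)
 show ?case proof (cases "l = hi - Suc t")
  case True
  thus ?thesis using bab_step_coords(2)[ of t s] Suc by simp
 next
  case False
  thus ?thesis using bab_step_coords(1)[ of t l s] Suc hi by simp
 qed
qed simp

lemma bab_xv:
 assumes t: "t <= hi"
 shows "EX ta. xv n v (bab n G hi s X t) = xv n v X + (\<Sum>j\<in>{hi - t..<hi}. ta j *R gv G v j) &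
  (s = (%_. 0) --> (ALL j. \<bar>ta j\<bar> <= 1 / 2))"
 using t
proof (induction t)
 case 0
 show ?case by (rule exI[of _ "%_. 0"]) simp
next
 case (Suc t)
 then obtain ta where ta: "xv n v (bab n G hi s X t) = xv n v X + (\<Sum>j\<in>{hi - t..<hi}. ta j *R gv G v j)"
  "s = (%_. 0) --> (ALL j. \<bar>ta j\<bar> <= 1 / 2)" by auto
 let ?j = "hi - Suc t" let ?S = "bab n G hi s X t"
 let ?c = "of_int (rnd n ?S ?j + s ?j) - co n ?S ?j"
 have j: "?j < n" using Suc.prems hi by simp
 have P: "0 < ?S n" using bab_pos[of t s] Suc.prems by simp
 have I: "{?j..<hi} = insert ?j {hi - t..<hi}" "?j \<notin> {hi - t..<hi}" using Suc.prems by auto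
 have "xv n v (bab n G hi s X (Suc t)) = xv n v X + (\<Sum>j\<in>{?j..<hi}. (ta(?j := ?c)) j *R gv G v j)"
  using babstep_xv[where S="?S" and n=n and v=v and s=s, OF P G[rule_format, OF j] j] I ta(1) by (simp add: algebra_simps) (intro sum.cong, auto)
 moreover have "s = (%_. 0) --> (ALL j. \<bar>(ta(?j := ?c)) j\<bar> <= 1 / 2)"
  using ta(2) rnd_co[where S="?S" and n=n and j="?j", OF P] by auto
 ultimately show ?case by blast
qed

end

text \<open>The steps taken so far have read only the offsets of coordinates already treated, so
  offsets may be chosen one after the other.\<close>

lemma bab_cong: "(!!j. hi - t <= j ==> j < hi ==> s j = s' j) ==> t <= hi ==> bab n G hi s X t = bab n G hi s' X t"
proof (induction t)
 case (Suc t)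
 have "bab n G hi s X t = bab n G hi s' X t" using Suc by (intro Suc.IH) auto
 moreover have "s (hi - Suc t) = s' (hi - Suc t)" using Suc.prems by auto
 ultimately show ?case by (simp add: babstep_def fun_eq_iff)
qed simp

section \<open>Lattice reduction\<close>

text \<open>
 The rows of \<open>B\<close> are a basis; rows \<open>m, ..., n - 1\<close> span the lattice \<open>\<int>\<^sup>p \<times> 0\<close>, \<open>p = n - m\<close>, and rows
 \<open>0, ..., m - 1\<close> are the unit vectors of the continuous variables. Orthogonalising in this order projects
 out the continuous variables.
\<close>

definition gx :: "nat => imat => imat" where
 "gx n G i l = (if l = n then dlt G i else gn G i l)"

text \<open>Size reduction. Not the row but its Gram-Schmidt vector is rounded; its coordinate at
  \<open>i\<close> is 1, and the result is that vector plus earlier ones with coefficients at most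
  1/2. The possibly fractional coordinates along rows below \<open>m\<close> are dropped, which
  leaves an integer vector of the lattice.\<close>

definition srow :: "nat => nat => imat => imat => imat" where
 "srow n m G B i l = (if i < m then B i l else
  \<Sum>k<n. if m <= k then (bab n G i (%_. 0) (gx n G i) (i - m) k div bab n G i (%_. 0) (gx n G i) (i - m) n) * B k l else 0)"

text \<open>Squared Gram-Schmidt norms are ratios of consecutive minors, so the test says that they
  drop by more than a factor 2 from \<open>k - 1\<close> to \<open>k\<close>. The value 0 means that
  no exchange is due; it cannot be an index because of \<open>m < k\<close>.\<close>

primrec lsw :: "imat => nat => nat => nat" where
 "lsw G m 0 = 0"
| "lsw G m (Suc k) = (if 0 < lsw G m k then lsw G m k
  else if m < k & 2 * dlt G (Suc k) * dlt G (k - 1) < dlt G k * dlt G k then k else 0)"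

definition trp :: "nat => nat => nat" where
 "trp i k = (if k = i & 0 < i then i - 1 else if Suc k = i then i else k)"

text \<open>All rows are size-reduced before every exchange, so that each intermediate basis has
  bounded entries. If \<open>lsw\<close> is 0, \<open>trp\<close> is the identity.\<close>

definition lstep :: "nat => nat => imat => ivec => imat => imat" where
 "lstep n m Q c B i = srow n m (gc n Q c B) B (trp (lsw (gc n Q c B) m n) i)"

text \<open>The integer variables come first in the problem but last in the basis, hence the
  permuted unit vectors at the start.\<close>

primrec lll :: "nat => nat => imat => ivec => nat => imat" where
 "lll n m Q c 0 = (%i l. if l = (if i < m then n - m + i else i - m) then 1 else 0)"
| "lll n m Q c (Suc k) = lstep n m Q c (lll n m Q c k)"

lemma lsw_spec:
 "(lsw G m n = 0 --> (ALL k<n. m < k --> ~ 2 * dlt G (Suc k) * dlt G (k - 1) < dlt G k * dlt G k)) &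
 (0 < lsw G m n --> lsw G m n < n & m < lsw G m n &
  2 * dlt G (Suc (lsw G m n)) * dlt G (lsw G m n - 1) < dlt G (lsw G m n) * dlt G (lsw G m n))"
 by (induction n) (auto simp: less_Suc_eq)

definition inZ :: "nat => nat => imat => ivec => bool" where
 "inZ n m B z \<longleftrightarrow> (EX t. ALL l<n - m. z l = (\<Sum>k\<in>{m..<n}. t k * B k l))"

lemma inZ_add: "inZ n m B y ==> inZ n m B z ==> inZ n m B (%l. y l + z l)"
proof -
 assume "inZ n m B y" "inZ n m B z"
 then obtain t u where "ALL l<n - m. y l = (\<Sum>k\<in>{m..<n}. t k * B k l)" "ALL l<n - m. z l = (\<Sum>k\<in>{m..<n}. u k * B k l)"
  unfolding inZ_def by blast
 thus ?thesis unfolding inZ_def by (intro exI[of _ "%k. t k + u k"]) (simp add: distrib_right sum.distrib)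
qed

lemma inZ_mult: "inZ n m B z ==> inZ n m B (%l. c * z l)"
proof -
 assume "inZ n m B z"
 then obtain u where "ALL l<n - m. z l = (\<Sum>k\<in>{m..<n}. u k * B k l)" unfolding inZ_def by blast
 thus ?thesis unfolding inZ_def by (intro exI[of _ "%k. c * u k"]) (simp add: sum_distrib_left mult.assoc)
qed

lemma inZ_row: "m <= k ==> k < n ==> inZ n m B (B k)"
 unfolding inZ_def by (rule exI[of _ "%i. if i = k then 1 else 0"]) (simp add: if_distrib[of "%x. x * _"] cong: if_cong)

lemma inZ_cong: "inZ n m B z ==> (!!l. l < n - m ==> z l = y l) ==> inZ n m B y" by (auto simp: inZ_def)

lemma inZ_sum: "(!!i. i \<in> I ==> inZ n m B (f i)) ==> inZ n m B (%l. \<Sum>i\<in>I. f i l)"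
proof (induction I rule: infinite_finite_induct)
 case (insert x F)
 thus ?case using inZ_add[of n m B "f x" "%l. \<Sum>i\<in>F. f i l"] by simp
qed (auto simp: inZ_def intro: exI[of _ "%_. 0"])

lemma inZ_trans: "inZ n m B z ==> (!!k. m <= k ==> k < n ==> inZ n m B' (B k)) ==> inZ n m B' z"
proof -
 assume "inZ n m B z" and r: "!!k. m <= k ==> k < n ==> inZ n m B' (B k)"
 then obtain t where t: "ALL l<n - m. z l = (\<Sum>k\<in>{m..<n}. t k * B k l)" unfolding inZ_def by blast
 have "inZ n m B' (%l. \<Sum>k\<in>{m..<n}. t k * B k l)" by (intro inZ_sum inZ_mult r) auto
 thus ?thesis by (rule inZ_cong) (use t in auto)
qed

text \<open>The last conjunct says that rows \<open>m, ..., n - 1\<close> generate all of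
  \<open>\<int>\<^sup>p\<close>; unimodularity is expressed in this way instead of through a
  determinant.\<close>

definition bas :: "nat => nat => imat => bool" where
 "bas n m B \<longleftrightarrow> (ALL k<m. ALL l. B k l = (if l = n - m + k then 1 else 0)) &
  (ALL k. m <= k --> k < n --> (ALL l. n - m <= l --> B k l = 0)) & (ALL z. inZ n m B z)"

lemma sp_cong_tri:
 assumes "!!i. i < k ==> v' i - v i \<in> sp v i" shows "sp v' k = sp v k" using assms
proof (induction k)
 case (Suc k)
 hence IH: "sp v' k = sp v k" and d: "v' k - v k \<in> sp v k" by auto
 have "(x - c *R v' k \<in> sp v k) = (x - c *R v k \<in> sp v k)" for x c proof -
  have 1: "x - c *R v k = (x - c *R v' k) + c *R (v' k - v k)"
   and 2: "x - c *R v' k = (x - c *R v k) - c *R (v' k - v k)" by (simp_all add: algebra_simps)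
  show ?thesis using subspace_add[OF sp_subspace _ subspace_scale[OF sp_subspace d, of c], of "x - c *R v' k"]
    subspace_diff[OF sp_subspace _ subspace_scale[OF sp_subspace d, of c], of "x - c *R v k"] 1 2 by metis
 qed
 thus ?case by (simp add: sp_Suc IH)
qed simp

lemma gsys_tri:
 assumes sq: "sform q" and g: "gsys q v g n" and d: "!!i. i < n ==> v' i - v i \<in> sp v i"
 shows "gsys q v' g n" unfolding gsys_def
proof (intro allI impI)
 fix k assume k: "k < n"
 have s: "sp v' k = sp v k" by (rule sp_cong_tri) (use d k in auto)
 have "(g k - v k) - (v' k - v k) \<in> sp v k" by (rule subspace_diff[OF sp_subspace gsD(1)[OF sq g k] d[OF k]])
 thus "g k - v' k \<in> sp v' k & (ALL u:sp v' k. q (g k) u = 0) & 0 < q (g k) (g k)"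
  using gsD(2,3)[OF sq g k] by (simp add: s)
qed

text \<open>An exchange of neighbours changes only two Gram-Schmidt vectors: \<open>h\<close> is the
  component of \<open>v i\<close> orthogonal to the first \<open>j\<close> vectors, and the other is
  the component of \<open>g j\<close> orthogonal to \<open>h\<close>. The product of their squared
  norms is invariant.\<close>

lemma gsys_swap:
 fixes v :: "nat => 'v::real_vector"
 assumes sq: "sform q" and g: "gsys q v g n" and ij: "i = Suc j" and i: "i < n"
 defines "\<mu> == q (g j) (v i) / q (g j) (g j)"
 defines "h == g i + \<mu> *R g j"
 defines "g' == g(j := h, i := g j - (\<mu> * q (g j) (g j) / q h h) *R h)"
 shows "gsys q (%k. v (trp i k)) g' n"
  and "q h h = q (g i) (g i) + \<mu>\<^sup>2 * q (g j) (g j)"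
  and "q (g' i) (g' i) * q h h = q (g j) (g j) * q (g i) (g i)"
proof -
 let ?a = "q (g j) (g j)" and ?b = "q (g i) (g i)"
 let ?v = "%k. v (trp i k)"
 have j: "j < n" "Suc j = i" "j ~= i" using i ij by auto
 have a: "0 < ?a" and b: "0 < ?b" using gsD(3)[OF sq g] i j by auto
 have o: "q (g j) (g i) = 0" "q (g i) (g j) = 0" using gs_orth[OF sq g] i j by auto
 show hh: "q h h = ?b + \<mu>\<^sup>2 * ?a" by (simp add: h_def sform_simps[OF sq] o power2_eq_square)
 hence hp: "0 < q h h" using a b by (simp add: add_pos_nonneg)
 have hj: "q h (g j) = \<mu> * ?a" "q (g j) h = \<mu> * ?a" by (simp_all add: h_def sform_simps[OF sq] o)
 let ?c = "\<mu> * ?a / q h h"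
 have gi: "g' i = g j - ?c *R h" and gj: "g' j = h" using j by (simp_all add: g'_def)
 have gih: "q (g' i) h = 0" using hp by (simp add: gi sform_simps[OF sq] hj)
 have "q (g' i) (g j - ?c *R h) = q (g' i) (g j)" by (simp add: sform_simps(4,6)[OF sq] gih)
 hence "q (g' i) (g' i) = q (g' i) (g j)" by (simp only: gi[symmetric])
 also have "... = ?a - ?c * (\<mu> * ?a)" by (simp add: gi sform_simps[OF sq] hj)
 finally have gg: "q (g' i) (g' i) * q h h = ?a * q h h - \<mu>\<^sup>2 * ?a * ?a"
  using hp by (simp add: field_simps power2_eq_square)
 thus gg': "q (g' i) (g' i) * q h h = ?a * ?b" by (simp add: hh algebra_simps)
 have gip: "0 < q (g' i) (g' i)" using gg' hp a b by (metis mult_pos_pos zero_less_mult_pos2)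
 have s1: "sp ?v k = sp v k" if "k < i" for k
  unfolding sp_def using that by (intro arg_cong[where f=span] image_cong) (auto simp: trp_def ij)
 have im: "?v ` {..<k} = v ` {..<k}" if "i < k" for k proof -
  have "trp i ` {..<k} = {..<k}" proof
   show "trp i ` {..<k} \<subseteq> {..<k}" using that by (auto simp: trp_def ij)
   show "{..<k} \<subseteq> trp i ` {..<k}" proof
    fix x assume "x \<in> {..<k}"
    hence "trp i x \<in> {..<k}" "trp i (trp i x) = x" using that i by (auto simp: trp_def ij)
    thus "x \<in> trp i ` {..<k}" by (metis imageI)
   qed
  qed
  thus ?thesis by (metis image_image)
 qed
 have s2: "sp ?v k = sp v k" if "i < k" for k unfolding sp_def im[OF that] ..
 have vj: "?v j = v i" and vi: "?v i = v j" using i by (auto simp: trp_def ij)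
 have lowi: "h - v i \<in> sp v j" proof -
  have "v i - g i \<in> sp v i" using gsD(1)[OF sq g i] subspace_neg[OF sp_subspace] by (metis minus_diff_eq)
  hence "v i - g i \<in> sp v (Suc j)" using j by simp
  from gs_red[OF sq g j(1) this] have "v i - g i - (q (g j) (v i - g i) / ?a) *R g j \<in> sp v j" .
  also have "q (g j) (v i - g i) / ?a = \<mu>" by (simp add: \<mu>_def sform_simps[OF sq] o)
  finally have "- (v i - g i - \<mu> *R g j) \<in> sp v j" by (rule subspace_neg[OF sp_subspace])
  thus ?thesis by (simp add: h_def algebra_simps)
 qed
 have lowj: "g j - v j \<in> sp v j" by (rule gsD(1)[OF sq g j(1)])
 have oi: "q (g i) u = 0" "q (g j) u = 0" if "u \<in> sp v j" for u
  using gsD(2)[OF sq g i, of u] gsD(2)[OF sq g j(1) that] that sp_mono[of j i v] ij by auto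
 have oh: "q h u = 0" if "u \<in> sp v j" for u using oi[OF that] by (simp add: h_def sform_simps[OF sq])
 have spi: "sp ?v i = {x. EX c. x - c *R v i \<in> sp v j}" using sp_Suc[of ?v j] j s1[of j] vj by simp
 show "gsys q ?v g' n" unfolding gsys_def proof (intro allI impI)
  fix k assume k: "k < n"
  consider "k < j" | "k = j" | "k = i" | "i < k" using j by linarith
  thus "g' k - ?v k \<in> sp ?v k & (ALL u:sp ?v k. q (g' k) u = 0) & 0 < q (g' k) (g' k)" proof cases
   case 1
   hence "g' k = g k" "?v k = v k" "sp ?v k = sp v k" using s1[of k] by (auto simp: g'_def trp_def ij)
   thus ?thesis using gsD[OF sq g k] by auto
  next
   case 2
   thus ?thesis using lowi oh hp s1[of j] j by (simp add: gj vj)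
  next
   case 3
   have "h \<in> sp ?v i" unfolding spi using lowi by (auto intro!: exI[of _ 1])
   moreover have "g j - v j \<in> sp ?v i" unfolding spi using lowj by (auto intro!: exI[of _ 0])
   ultimately have "(g j - v j) - ?c *R h \<in> sp ?v i"
    using subspace_diff[OF sp_subspace _ subspace_scale[OF sp_subspace]] by blast
   hence "g' i - ?v i \<in> sp ?v i" by (simp only: gi vi) (simp add: algebra_simps)
   moreover have "q (g' i) u = 0" if u: "u \<in> sp ?v i" for u proof -
    obtain c where c: "u - c *R v i \<in> sp v j" using u spi by auto
    have e: "u - c *R h = (u - c *R v i) - c *R (h - v i)" by (simp add: algebra_simps)
    have w: "u - c *R h \<in> sp v j"
     unfolding e by (rule subspace_diff[OF sp_subspace c subspace_scale[OF sp_subspace lowi]])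
    have "q (g' i) u = q (g' i) (u - c *R h) + c * q (g' i) h" by (simp add: sform_simps[OF sq])
    thus ?thesis using oi[OF w] oh[OF w] gih by (simp add: gi sform_simps[OF sq])
   qed
   ultimately show ?thesis using 3 gip by auto
  next
   case 4
   hence "g' k = g k" "?v k = v k" "sp ?v k = sp v k" using s2[of k] by (auto simp: g'_def trp_def ij)
   thus ?thesis using gsD[OF sq g k] by auto
  qed
 qed
qed

section \<open>Lattice reduction: invariants, entry bounds and potential\<close>

locale lattice =
 fixes n m :: nat and Q :: imat and c :: ivec and a :: int
 assumes mn: "m <= n" and sy: "symn n Q" and pdQ: "posdef Q n"
  and aQ: "!!i j. i < n ==> j < n ==> \<bar>Q i j\<bar> <= a" and a1: "1 <= a"
begin

abbreviation q :: "(nat => real) => (nat => real) => real" where "q == bf n Q"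
abbreviation vv :: "imat => nat => nat => real" where "vv B == %k. vn n (B k)"
abbreviation GG :: "imat => imat" where "GG B == gc n Q c B"
abbreviation nq :: "(nat => real) => real" where "nq x == q x x"

lemma sq: "sform q" by (rule sform_bf[OF sy])

lemma GG: "i < n ==> j < n ==> of_int (GG B i j) = q (vv B i) (vv B j)" by (simp add: gc_def bf_vn)

lemma sp_Vn: "sp (vv B) k \<subseteq> Vn n" by (rule sp_sub[OF Vn_subspace]) simp

lemma nq_pos: "u \<in> Vn n ==> u ~= 0 ==> 0 < nq u" by (rule bf_posdef[OF pdQ])

lemma nq_nonneg: "u \<in> Vn n ==> 0 <= nq u" using nq_pos[of u] by (cases "u = 0") (auto simp: sform_simps[OF sq])

context
 fixes B g
 assumes gs: "gsys q (vv B) g n"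
begin

lemma gs_posdef: "posdef (GG B) n"
proof (rule gram_posdef[where v="vv B" and G="GG B", OF sq _ _ GG])
 show "u \<in> sp (vv B) n ==> u ~= 0 ==> 0 < q u u" for u using nq_pos sp_Vn by blast
 show "(\<Sum>i<n. c i *R vv B i) = 0 ==> i < n ==> c i = 0" for c i by (rule gs_indep[OF sq gs])
qed

lemma gs_dlt_pos: "k <= n ==> 0 < dlt (GG B) k" by (rule dlt_posdef[OF posdef_mono[OF gs_posdef]])

lemma gs_gv: "k < n ==> gv (GG B) (vv B) k = g k"
 by (rule gs_unique[OF sq gsys_gv(1)[where v="vv B" and G="GG B", OF sq gs_posdef GG] gs]) (auto simp: sp_subspace subspace_0)

lemma gs_gamma: "k < n ==> nq (g k) = of_int (dlt (GG B) (Suc k)) / of_int (dlt (GG B) k)"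
 using gsys_gv(2)[where v="vv B" and G="GG B", OF sq gs_posdef GG] gs_gv by metis

lemma gs_dlt_prod: "k <= n ==> of_int (dlt (GG B) k) = (\<Prod>l<k. nq (g l))"
proof (induction k)
 case (Suc k)
 have "real_of_int (dlt (GG B) (Suc k)) = of_int (dlt (GG B) k) * nq (g k)"
  using gs_gamma[of k] gs_dlt_pos[of k] Suc.prems by simp
 thus ?case using Suc by simp
qed simp

end

text \<open>\<open>g\<close> is carried along because size reduction changes the basis but not
  \<open>g\<close>. The bound by \<open>a\<close> on the lattice part holds initially, survives
  exchanges and controls the entries of the basis.\<close>

definition linv :: "imat => (nat => nat => real) => bool" where
 "linv B g \<longleftrightarrow> bas n m B & gsys q (vv B) g n & (ALL k. m <= k --> k < n --> nq (g k) <= a)"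

text \<open>The part of the usual reducedness conditions that the enumeration relies on: norms decay
  by at most a factor 2 per index.\<close>

definition siegel :: "(nat => nat => real) => bool" where
 "siegel g \<longleftrightarrow> (ALL k. m <= k --> Suc k < n --> nq (g k) <= 2 * nq (g (Suc k)))"

text \<open>The product of the Gram minors of orders \<open>m + 1, ..., n - 1\<close>; these are
  positive integers, so it never falls below 1.\<close>

definition pot :: "(nat => nat => real) => real" where
 "pot g = (\<Prod>k\<in>{Suc m..<n}. \<Prod>l<k. nq (g l))"

text \<open>\<open>coord_bound\<close> for vectors of squared norm at most
  \<open>(n + 1) * a\<close>, which is what size reduction guarantees.\<close>

definition ebd :: int where "ebd = dq n a * (int n + 1) * a"

lemma ebd1: "1 <= ebd"
proof -
 have "1 * 1 <= (int n + 1) ^ 2 * (fact n :: int)" by (intro mult_mono) auto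
 moreover have "1 <= a ^ (n + 2)" by (rule one_le_power[OF a1])
 ultimately have "1 * 1 <= dq n a" unfolding dq_def using a1 by (intro mult_mono) auto
 hence "1 * 1 * 1 <= ebd" unfolding ebd_def using a1 by (intro mult_mono) auto
 thus ?thesis by simp
qed

lemma srow_spec:
 assumes inv: "linv B g" and i: "m <= i" "i < n"
 shows "EX ta \<xi> z. (ALL j. \<bar>ta j\<bar> <= 1 / 2) &
  (\<Sum>l<n. \<xi> l *R vv B l) = g i + (\<Sum>j\<in>{m..<i}. ta j *R g j) &
  (ALL k. m <= k --> k < n --> \<xi> k = of_int (z k)) & z i = 1 & (ALL k. i < k --> k < n --> z k = 0) &
  (ALL l. srow n m (GG B) B i l = (\<Sum>k\<in>{m..<n}. z k * B k l))"
proof -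
 have gs: "gsys q (vv B) g n" using inv by (simp add: linv_def)
 let ?X = "gx n (GG B) i" let ?S = "bab n (GG B) i (%_. 0) ?X (i - m)"
 have G: "ALL j<n. 0 < dlt (GG B) j" using gs_dlt_pos[OF gs] by simp
 have X: "0 < ?X n" using G i by (simp add: gx_def)
 have hi: "i <= n" and t: "i - m <= i" using i by auto
 note bx = bab_xv[where X="?X" and n=n, OF X G hi t] and bh = bab_high[where X="?X" and n=n, OF X G hi t]
  and bi = bab_int[where X="?X" and n=n, OF X G hi t] and bp = bab_pos[where X="?X" and n=n, OF X G hi t]
 have coX: "co n ?X l = of_int (gn (GG B) i l) / of_int (dlt (GG B) i)" if "l < n" for l
  using that by (simp add: co_def gx_def)
 obtain ta where ta: "xv n (vv B) ?S = xv n (vv B) ?X + (\<Sum>j\<in>{i - (i - m)..<i}. ta j *R gv (GG B) (vv B) j)" "ALL j. \<bar>ta j\<bar> <= 1 / 2"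
  using bx[of "vv B" "%_. 0"] by auto
 have "xv n (vv B) ?X = gv (GG B) (vv B) i"
  unfolding gv_extend[OF i(2)] xv_def by (intro sum.cong) (simp_all add: coX)
 also have "... = g i" by (rule gs_gv[OF gs i(2)])
 finally have 1: "(\<Sum>l<n. co n ?S l *R vv B l) = g i + (\<Sum>j\<in>{m..<i}. ta j *R g j)"
  using ta(1) i gs_gv[OF gs] by (simp add: xv_def)
 have Sint: "co n ?S k \<in> \<int>" if "m <= k" "k < n" for k proof (cases "k < i")
  case True
  thus ?thesis using bi[of k] that i by simp
 next
  case False
  thus ?thesis using bh[of k] that i G coX[of k] by (auto simp: gn_def)
 qed
 define z where "z k = ?S k div ?S n" for k
 have z: "co n ?S k = of_int (z k)" if k: "m <= k" "k < n" for k proof -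
  obtain y where y: "co n ?S k = of_int y" using Sint[OF k] by (auto elim: Ints_cases)
  hence "real_of_int (?S k) = of_int (y * ?S n)" using bp[of "%_. 0"] by (simp add: co_def field_simps)
  hence "?S k = y * ?S n" by linarith
  hence "z k = y" using bp[of "%_. 0"] by (simp add: z_def)
  thus ?thesis using y by simp
 qed
 have "co n ?S i = 1" using bh[of i] i G coX[of i] by (auto simp: gn_def)
 hence 2: "z i = 1" using z[OF i] by simp
 have 3: "z k = 0" if "i < k" "k < n" for k using z[of k] bh[of k] that i coX[of k] by (simp add: gn_def)
 have 4: "srow n m (GG B) B i l = (\<Sum>k\<in>{m..<n}. z k * B k l)" for l proof -
  have "srow n m (GG B) B i l = (\<Sum>k<n. if m <= k then z k * B k l else 0)" unfolding srow_def z_def using i by simp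
  also have "... = (\<Sum>k\<in>{k. k < n & m <= k}. z k * B k l)" by (simp add: sum.If_cases lessThan_def Collect_conj_eq)
  also have "{k. k < n & m <= k} = {m..<n}" by auto
  finally show ?thesis .
 qed
 show ?thesis by (rule exI[of _ ta], rule exI[of _ "co n ?S"], rule exI[of _ z]) (use 1 2 3 4 z ta(2) in auto)
qed

lemma bas_low: "bas n m B ==> k < m ==> l < n - m ==> B k l = 0" by (auto simp: bas_def)

lemma srow_sized:
 assumes inv: "linv B g"
 defines "B' == srow n m (GG B) B"
 shows "linv B' g"
  and "i < n ==> (B' i l)\<^sup>2 <= ebd"
  and "m <= j ==> Suc j < n ==> \<bar>q (g j) (vv B' (Suc j))\<bar> <= nq (g j) / 2"
proof -
 have bas: "bas n m B" and gs: "gsys q (vv B) g n" and ga: "!!k. m <= k ==> k < n ==> nq (g k) <= a"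
  using inv by (auto simp: linv_def)
 have low: "B' i = B i" if "i < m" for i using that by (auto simp: B'_def srow_def fun_eq_iff)
 have vB': "vv B' i = (\<Sum>k\<in>{m..<n}. of_int (z k) *R vv B k)" if "!!l. B' i l = (\<Sum>k\<in>{m..<n}. z k * B k l)" for z i
  by (auto simp: fun_eq_iff vn_def that fun_sum_apply)
 have split: "(\<Sum>l<n. \<xi> l *R vv B l) = (\<Sum>l<m. \<xi> l *R vv B l) + (\<Sum>l\<in>{m..<n}. \<xi> l *R vv B l)" for \<xi>
  using sum.atLeastLessThan_concat[of 0 m n "%l. \<xi> l *R vv B l"] mn by (simp add: lessThan_atLeast0)
 have tri: "vv B' i - vv B i \<in> sp (vv B) i" if i: "i < n" for i proof (cases "i < m")
  case True
  thus ?thesis by (simp add: low sp_subspace subspace_0)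
 next
  case False
  hence mi: "m <= i" by simp
  from srow_spec[OF inv mi i] obtain ta \<xi> z where z: "z i = 1" "ALL k. i < k --> k < n --> z k = 0"
   "ALL l. srow n m (GG B) B i l = (\<Sum>k\<in>{m..<n}. z k * B k l)" by (elim exE conjE)
  have "vv B' i = (\<Sum>k\<in>{m..<n}. of_int (z k) *R vv B k)" by (rule vB') (simp add: B'_def z(3))
  also have "{m..<n} = insert i ({m..<i} \<union> {Suc i..<n})" using mi i by auto
  also have "(\<Sum>k\<in>insert i ({m..<i} \<union> {Suc i..<n}). of_int (z k) *R vv B k) =
    vv B i + ((\<Sum>k\<in>{m..<i}. of_int (z k) *R vv B k) + (\<Sum>k\<in>{Suc i..<n}. of_int (z k) *R vv B k))"
   by (subst sum.insert) (auto simp: z(1) intro!: sum.union_disjoint)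
  also have "(\<Sum>k\<in>{Suc i..<n}. of_int (z k) *R vv B k) = 0" by (intro sum.neutral) (auto simp: z(2))
  finally have "vv B' i - vv B i = (\<Sum>k\<in>{m..<i}. of_int (z k) *R vv B k)"
   by (simp only: add_0_right add_diff_cancel_left')
  also have "... \<in> sp (vv B) i" by (intro subspace_sum sp_subspace subspace_scale sp_base) auto
  finally show ?thesis .
 qed
 have gs': "gsys q (vv B') g n" by (rule gsys_tri[OF sq gs tri])
 \<comment> \<open>A unitriangular change of rows is inverted from the first row upwards, so the new
   rows generate the same lattice.\<close>
 have rows: "inZ n m B' (B i)" if "m <= i" "i < n" for i using that proof (induction i rule: less_induct)
  case (less i)
  from srow_spec[OF inv less.prems] obtain ta \<xi> z where z: "z i = 1" "ALL k. i < k --> k < n --> z k = 0"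
   "ALL l. srow n m (GG B) B i l = (\<Sum>k\<in>{m..<n}. z k * B k l)" by (elim exE conjE)
  have e: "B i l = B' i l + (- 1) * (\<Sum>k\<in>{m..<i}. z k * B k l)" for l proof -
   have I: "{m..<n} = insert i ({m..<i} \<union> {Suc i..<n})" using less.prems by auto
   have "B' i l = (\<Sum>k\<in>insert i ({m..<i} \<union> {Suc i..<n}). z k * B k l)" unfolding B'_def z(3)[rule_format] I ..
   also have "... = B i l + ((\<Sum>k\<in>{m..<i}. z k * B k l) + (\<Sum>k\<in>{Suc i..<n}. z k * B k l))"
    by (subst sum.insert) (auto simp: z(1) intro!: sum.union_disjoint)
   also have "(\<Sum>k\<in>{Suc i..<n}. z k * B k l) = 0" by (intro sum.neutral) (auto simp: z(2))
   finally show ?thesis by simp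
  qed
  have "inZ n m B' (%l. B' i l + (- 1) * (\<Sum>k\<in>{m..<i}. z k * B k l))"
   using less by (intro inZ_add inZ_row inZ_mult inZ_sum) auto
  thus ?case by (rule inZ_cong) (simp add: e)
 qed
 have high: "B' i l = 0" if "m <= i" "i < n" "n - m <= l" for i l proof -
  from srow_spec[OF inv that(1,2)] obtain z where "ALL l. srow n m (GG B) B i l = (\<Sum>k\<in>{m..<n}. z k * B k l)"
   by (elim exE conjE)
  hence z: "srow n m (GG B) B i l = (\<Sum>k\<in>{m..<n}. z k * B k l)" by blast
  show ?thesis unfolding B'_def z by (rule sum.neutral) (use bas that in "auto simp: bas_def")
 qed
 have "bas n m B'" unfolding bas_def proof (intro conjI allI impI)
  fix k l assume "k < m" thus "B' k l = (if l = n - m + k then 1 else 0)" using low bas by (auto simp: bas_def)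
 next
  fix z show "inZ n m B' z" by (rule inZ_trans[of n m B]) (use bas rows in "auto simp: bas_def")
 qed (rule high)
 thus "linv B' g" using gs' ga by (simp add: linv_def)
 \<comment> \<open>The rounded real vector \<open>x\<close> and the integer row differ only along
   continuous unit vectors. Hence they agree in the integer coordinates and have equal products with
   every \<open>g j\<close> for \<open>j >= m\<close>, and estimates for \<open>x\<close> carry over
   to the row.\<close>
 have pair: "EX ta x. (ALL j. \<bar>ta j\<bar> <= 1 / 2) & x = g i + (\<Sum>j\<in>{m..<i}. ta j *R g j) & (ALL l<n - m. of_int (B' i l) = x l)
   & x - vv B' i \<in> sp (vv B) m" if i: "m <= i" "i < n" for i
 proof -
  from srow_spec[OF inv i] obtain ta \<xi> z where ta: "ALL j. \<bar>ta j\<bar> <= 1 / 2" and x: "(\<Sum>l<n. \<xi> l *R vv B l) = g i + (\<Sum>j\<in>{m..<i}. ta j *R g j)"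
   and z: "ALL k. m <= k --> k < n --> \<xi> k = of_int (z k)"
   "ALL l. srow n m (GG B) B i l = (\<Sum>k\<in>{m..<n}. z k * B k l)" by (elim exE conjE)
  have v: "vv B' i = (\<Sum>k\<in>{m..<n}. \<xi> k *R vv B k)" by (subst vB'[of i z]) (auto simp: B'_def z)
  let ?x = "\<Sum>l<n. \<xi> l *R vv B l"
  have s: "?x = (\<Sum>l<m. \<xi> l *R vv B l) + vv B' i" unfolding split v ..
  have "of_int (B' i l) = ?x l" if l: "l < n - m" for l proof -
   have "(\<Sum>l<m. \<xi> l *R vv B l) l = 0"
    using bas_low[OF bas _ l] by (auto simp: fun_sum_apply vn_def intro!: sum.neutral)
   thus ?thesis using s l by (simp add: vn_def)
  qed
  moreover have "?x - vv B' i \<in> sp (vv B) m" unfolding s by (simp add: sp_sum)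
  ultimately show ?thesis using ta x by blast
 qed
 show "(B' i l)\<^sup>2 <= ebd" if i: "i < n" proof (cases "m <= i & l < n - m")
  case False
  hence "B' i l \<in> {0, 1}" using low[of i] high[of i l] bas i by (cases "i < m") (auto simp: bas_def)
  thus ?thesis using ebd1 by auto
 next
  case True
  hence mi: "m <= i" and l: "l < n - m" by auto
  obtain ta x where ta: "ALL j. \<bar>ta j\<bar> <= 1 / 2" and x: "x = g i + (\<Sum>j\<in>{m..<i}. ta j *R g j)"
   and xl: "of_int (B' i l) = x l" using pair[OF mi i] l by blast
  let ?t = "ta(i := 1)"
  have x2: "x = (\<Sum>j\<in>{m..<Suc i}. ?t j *R g j)"
   unfolding x using mi by (subst sum.atLeastLessThan_Suc) (auto simp: add.commute intro!: sum.cong)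
  have gV: "g j \<in> Vn n" if "j < n" for j using gs_in[OF sq gs that] sp_Vn by blast
  have xV: "x \<in> Vn n" unfolding x2 using i by (intro subspace_sum Vn_subspace subspace_scale gV) auto
  have "nq x = (\<Sum>j\<in>{m..<Suc i}. (?t j)\<^sup>2 * nq (g j))" unfolding x2 using i by (intro gs_norm_comb[OF sq gs]) auto
  also have "... <= (\<Sum>j\<in>{m..<Suc i}. 1 * of_int a)" proof (rule sum_mono)
   fix j assume j: "j \<in> {m..<Suc i}"
   have "\<bar>?t j\<bar> <= 1" using spec[OF ta, of j] by auto
   hence "(?t j)\<^sup>2 <= 1" by (simp add: abs_square_le_1)
   thus "(?t j)\<^sup>2 * nq (g j) <= 1 * of_int a" using ga[of j] j i nq_nonneg[OF gV, of j] by (intro mult_mono) auto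
  qed
  also have "... <= of_int ((int n + 1) * a)" using i mi a1 by (simp add: mult_right_mono)
  finally have nx: "nq x <= of_int ((int n + 1) * a)" .
  have dq0: "0 <= dq n a" using a1 by (simp add: dq_def)
  have "of_int ((B' i l)\<^sup>2) = (x l)\<^sup>2" using xl by simp
  also have "... <= of_int (dq n a) * nq x" using l mn by (intro coord_bound sy pdQ aQ a1 xV) auto
  also have "... <= of_int (dq n a) * of_int ((int n + 1) * a)" using nx dq0 by (intro mult_left_mono) auto
  also have "... = of_int ebd" by (simp add: ebd_def)
  finally show ?thesis by linarith
 qed
 show "\<bar>q (g j) (vv B' (Suc j))\<bar> <= nq (g j) / 2" if j: "m <= j" "Suc j < n" proof -
  obtain ta x where ta: "ALL j. \<bar>ta j\<bar> <= 1 / 2" and x: "x = g (Suc j) + (\<Sum>j\<in>{m..<Suc j}. ta j *R g j)"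
   and d: "x - vv B' (Suc j) \<in> sp (vv B) m" using pair[of "Suc j"] j by auto
  have "q (g j) (x - vv B' (Suc j)) = 0"
   using gsD(2)[OF sq gs, of j] d sp_mono[OF j(1)] j by (meson Suc_lessD subsetD)
  hence "q (g j) (vv B' (Suc j)) = q (g j) x" by (simp add: sform_simps[OF sq])
  also have "... = q (g j) (g (Suc j)) + (\<Sum>l\<in>{m..<Suc j}. ta l * q (g j) (g l))"
   unfolding x by (simp only: sform_simps(2,4)[OF sq] sform_sum2[OF sq])
  also have "(\<Sum>l\<in>{m..<Suc j}. ta l * q (g j) (g l)) = (\<Sum>l\<in>{m..<Suc j}. if l = j then ta j * nq (g j) else 0)"
   using gs_orth[OF sq gs, of j] j by (intro sum.cong) auto
  also have "q (g j) (g (Suc j)) = 0" using gs_orth[OF sq gs, of j "Suc j"] j by simp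
  finally have "q (g j) (vv B' (Suc j)) = ta j * nq (g j)" using j by simp
  moreover have "0 < nq (g j)" using gsD(3)[OF sq gs, of j] j by simp
  ultimately show ?thesis using spec[OF ta, of j] by (simp add: abs_mult mult_right_mono)
 qed
qed

text \<open>An exchange alters a single factor of the potential, the minor of order
  \<open>Suc j\<close>; all others contain both changed norms or neither.\<close>

lemma pot_drop:
 assumes j: "m <= j" "Suc j < n" and pos: "!!k. k < n ==> 0 < f k"
  and o: "!!k. k ~= j ==> k ~= Suc j ==> f' k = f k" and pr: "f' j * f' (Suc j) = f j * f (Suc j)"
  and dr: "0 <= f' j" "f' j <= 3 / 4 * f j"
 shows "(\<Prod>k\<in>{Suc m..<n}. \<Prod>l<k. f' l) <= 3 / 4 * (\<Prod>k\<in>{Suc m..<n}. \<Prod>l<k. f l :: real)"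
proof -
 have 1: "(\<Prod>l<k. f' l) = (\<Prod>l<k. f l)" if "k <= j" for k using that o by (intro prod.cong) auto
 have 2: "(\<Prod>l<Suc (Suc (j + d)). f' l) = (\<Prod>l<Suc (Suc (j + d)). f l)" for d proof (induction d)
  case 0
  show ?case using 1[of j] pr by (simp add: mult.assoc)
 next
  case (Suc d)
  thus ?case using o[of "Suc (Suc (j + d))"] by simp
 qed
 have 3: "(\<Prod>l<k. f' l) = (\<Prod>l<k. f l)" if "k ~= Suc j" for k proof (cases "k <= j")
  case False
  hence "Suc j < k" using that by simp
  then obtain d where "k = Suc (Suc j + d)" using less_imp_Suc_add by blast
  thus ?thesis using 2[of d] by simp
 qed (rule 1)
 have P: "0 < (\<Prod>l<k. f l)" if "k <= n" for k using that pos by (intro prod_pos) auto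
 have 4: "(\<Prod>l<Suc j. f' l) <= 3 / 4 * (\<Prod>l<Suc j. f l)"
  using 1[of j] dr mult_left_mono[OF dr(2), of "\<Prod>l<j. f l"] P[of j] j by (simp add: mult.commute)
 have S: "(\<Prod>k\<in>{Suc m..<n}. F k) = F (Suc j) * (\<Prod>k\<in>{Suc m..<n} - {Suc j}. F k)" for F :: "nat => real"
  using j by (intro prod.remove) auto
 have "(\<Prod>k\<in>{Suc m..<n}. \<Prod>l<k. f' l) = (\<Prod>l<Suc j. f' l) * (\<Prod>k\<in>{Suc m..<n} - {Suc j}. \<Prod>l<k. f' l)" by (rule S)
 also have "(\<Prod>k\<in>{Suc m..<n} - {Suc j}. \<Prod>l<k. f' l) = (\<Prod>k\<in>{Suc m..<n} - {Suc j}. \<Prod>l<k. f l)"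
  by (rule prod.cong) (auto simp: 3)
 also have "(\<Prod>l<Suc j. f' l) * (\<Prod>k\<in>{Suc m..<n} - {Suc j}. \<Prod>l<k. f l)
   <= 3 / 4 * (\<Prod>l<Suc j. f l) * (\<Prod>k\<in>{Suc m..<n} - {Suc j}. \<Prod>l<k. f l)"
 proof (rule mult_right_mono[OF 4 prod_nonneg])
  fix k assume "k \<in> {Suc m..<n} - {Suc j}"
  thus "0 <= (\<Prod>l<k. f l)" using P[of k] by auto
 qed
 also have "... = 3 / 4 * (\<Prod>k\<in>{Suc m..<n}. \<Prod>l<k. f l)" by (subst S) simp
 finally show ?thesis .
qed

lemma lstep_inv:
 assumes inv: "linv B g"
 shows "EX g'. linv (lstep n m Q c B) g' & (ALL i<n. ALL l. (lstep n m Q c B i l)\<^sup>2 <= ebd) &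
  (if siegel g then g' = g else pot g' <= 3 / 4 * pot g)"
proof -
 have bas: "bas n m B" and gs: "gsys q (vv B) g n" and ga: "!!k. m <= k ==> k < n ==> nq (g k) <= a"
  using inv by (auto simp: linv_def)
 let ?r = "lsw (GG B) m n" let ?B = "srow n m (GG B) B" let ?B' = "lstep n m Q c B"
 have B': "?B' i = ?B (trp ?r i)" for i by (simp add: lstep_def)
 note S = srow_sized[OF inv]
 have d: "0 < dlt (GG B) k" if "k <= n" for k using gs_dlt_pos[OF gs that] .
 have viol: "2 * dlt (GG B) (Suc (Suc k)) * dlt (GG B) k < dlt (GG B) (Suc k) * dlt (GG B) (Suc k) \<longleftrightarrow> 2 * nq (g (Suc k)) < nq (g k)"
  if "Suc k < n" for k proof -
  let ?d = "%k. real_of_int (dlt (GG B) k)"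
  have p: "0 < ?d k" "0 < ?d (Suc k)" using d[of k] d[of "Suc k"] that by auto
  have "2 * nq (g (Suc k)) < nq (g k) \<longleftrightarrow> 2 * ?d (Suc (Suc k)) * ?d k < ?d (Suc k) * ?d (Suc k)"
   using p that by (simp add: gs_gamma[OF gs] field_simps)
  also have "... \<longleftrightarrow> real_of_int (2 * dlt (GG B) (Suc (Suc k)) * dlt (GG B) k) < of_int (dlt (GG B) (Suc k) * dlt (GG B) (Suc k))"
   by simp
  finally show ?thesis by linarith
 qed
 show ?thesis proof (cases "?r = 0")
  case True
  hence e: "?B' = ?B" by (auto simp: fun_eq_iff lstep_def trp_def)
  have "siegel g" unfolding siegel_def proof (intro allI impI)
   fix k assume k: "m <= k" "Suc k < n"
   hence "~ 2 * dlt (GG B) (Suc (Suc k)) * dlt (GG B) k < dlt (GG B) (Suc k) * dlt (GG B) (Suc k)"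
    using lsw_spec[of "GG B" m n] True by (auto dest: spec[of _ "Suc k"])
   thus "nq (g k) <= 2 * nq (g (Suc k))" using viol[OF k(2)] by linarith
  qed
  thus ?thesis using S(1,2) unfolding e by auto
 next
  case False
  hence r: "?r < n" "m < ?r" "2 * dlt (GG B) (Suc ?r) * dlt (GG B) (?r - 1) < dlt (GG B) ?r * dlt (GG B) ?r"
   using lsw_spec[of "GG B" m n] by auto
  define j where "j = ?r - 1"
  have j: "?r = Suc j" "m <= j" "Suc j < n" using r(1,2) by (auto simp: j_def)
  have v: "2 * nq (g (Suc j)) < nq (g j)" using r(3) viol[OF j(3)] by (simp add: j(1))
  have gsB: "gsys q (vv ?B) g n" using S(1) by (simp add: linv_def)
  define \<mu> where "\<mu> = q (g j) (vv ?B (Suc j)) / nq (g j)"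
  define h where "h = g (Suc j) + \<mu> *R g j"
  define g' where "g' = g(j := h, Suc j := g j - (\<mu> * nq (g j) / nq h) *R h)"
  note W = gsys_swap[OF sq gsB refl j(3), folded \<mu>_def, folded h_def, folded g'_def]
  have gp: "0 < nq (g k)" if "k < n" for k using gsD(3)[OF sq gs that] .
  have gp': "0 < nq (g' k)" if "k < n" for k using gsD(3)[OF sq W(1) that] .
  have "\<bar>\<mu>\<bar> <= 1 / 2" unfolding \<mu>_def using S(3)[OF j(2,3)] gp[of j] j by (simp add: abs_divide field_simps)
  hence "\<mu>\<^sup>2 <= (1 / 2)\<^sup>2" by (intro abs_le_square_iff[THEN iffD1]) simp
  hence "\<mu>\<^sup>2 * nq (g j) <= 1 / 4 * nq (g j)" using gp[of j] j by (intro mult_right_mono) (auto simp: power2_eq_square)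
  moreover have "0 <= \<mu>\<^sup>2 * nq (g j)" using gp[of j] j by (intro mult_nonneg_nonneg) auto
  \<comment> \<open>\<open>3 / 4 = 1 / 2 + 1 / 4\<close>: the failed test bounds the contribution of
    \<open>g (Suc j)\<close>, size reduction that of \<open>g j\<close>.\<close>
  ultimately have h1: "nq h <= 3 / 4 * nq (g j)" and h2: "nq (g (Suc j)) <= nq h" using W(2) v by linarith+
  have hp: "0 < nq h" using h2 gp[of "Suc j"] j by linarith
  have g'j: "g' j = h" by (simp add: g'_def)
  have g'o: "g' k = g k" if "k ~= j" "k ~= Suc j" for k using that by (simp add: g'_def)
  have "nq (g' (Suc j)) * nq h <= nq (g j) * nq h" unfolding W(3) using h2 gp[of j] j by (intro mult_left_mono) auto
  hence g's: "nq (g' (Suc j)) <= nq (g j)" using hp by (rule mult_right_le_imp_le)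
  have "pot g' <= 3 / 4 * pot g" unfolding pot_def
   by (rule pot_drop[where f="%k. nq (g k)" and f'="%k. nq (g' k)", OF j(2,3) gp])
    (use g'o g'j W(3) h1 hp in "auto simp: mult.commute")
  moreover have "linv ?B' g'" unfolding linv_def proof (intro conjI allI impI)
   have "vv ?B' = (%k. vv ?B (trp (Suc j) k))" by (simp add: B' j(1))
   thus "gsys q (vv ?B') g' n" using W(1) by simp
   have t: "trp (Suc j) k < m \<longleftrightarrow> k < m" "trp (Suc j) k < n \<longleftrightarrow> k < n" "trp (Suc j) (trp (Suc j) k) = k" "k < m ==> trp (Suc j) k = k" for k
    using j by (auto simp: trp_def)
   have bB: "bas n m ?B" using S(1) by (simp add: linv_def)
   have rr: "inZ n m ?B' (?B k)" if "m <= k" "k < n" for k proof -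
    have "inZ n m ?B' (?B' (trp (Suc j) k))" using that t(1,2)[of k] by (intro inZ_row) auto
    thus ?thesis by (simp add: B' j(1) t(3))
   qed
   show "bas n m ?B'" unfolding bas_def proof (intro conjI allI impI)
    fix k l assume "k < m"
    thus "?B' k l = (if l = n - m + k then 1 else 0)" using bB t(4)[of k] by (simp add: B' j(1) bas_def)
   next
    fix k l assume "m <= k" "k < n" "n - m <= l"
    thus "?B' k l = 0" using bB t(1,2)[of k] by (simp add: B' j(1) bas_def not_less[symmetric])
   next
    fix z show "inZ n m ?B' z" by (rule inZ_trans[of n m ?B]) (use bB rr in "auto simp: bas_def")
   qed
   fix k assume k: "m <= k" "k < n"
   consider "k = j" | "k = Suc j" | "k ~= j" "k ~= Suc j" by blast
   thus "nq (g' k) <= a" proof cases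
    case 1
    thus ?thesis using h1 gp[of j] ga[of j] j g'j by simp
   next
    case 2
    thus ?thesis using g's ga[of j] j by simp
   next
    case 3
    thus ?thesis using g'o ga k by simp
   qed
  qed
  moreover have "(?B' i l)\<^sup>2 <= ebd" if "i < n" for i l proof -
   have "trp ?r i < n" using that j by (auto simp: trp_def)
   thus ?thesis unfolding B' by (rule S(2))
  qed
  moreover have "~ siegel g" using v j by (auto simp: siegel_def not_le)
  ultimately show ?thesis by auto
 qed
qed

text \<open>A Gram-Schmidt vector is no longer than its basis vector, here a unit vector, whose
  squared norm is a diagonal entry of \<open>Q\<close>.\<close>

lemma lll_init: "EX g. linv (lll n m Q c 0) g & pot g <= of_int a ^ (n * n)"
proof -
 let ?B = "lll n m Q c 0" let ?f = "%i. if i < m then n - m + i else i - m"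
 have f: "?f i < n" if "i < n" for i using that mn by auto
 have fi: "?f i = ?f k \<longleftrightarrow> i = k" if "i < n" "k < n" for i k using mn that by auto
 have B: "?B i l = (if l = ?f i then 1 else 0)" for i l by simp
 have ind: "c' i = 0" if "(\<Sum>i<n. c' i *R vv ?B i) = 0" "i < n" for c' i proof -
  have vB: "vv ?B k (?f i) = (if k = i then 1 else 0)" if "k < n" for k
   unfolding vn_def B using f[OF \<open>i < n\<close>] fi[OF \<open>i < n\<close> that] by (simp only: if_True) auto
  have "0 = (\<Sum>k<n. c' k *R vv ?B k) (?f i)" unfolding that(1) by (simp only: zero_fun_def)
  also have "... = (\<Sum>k<n. c' k * vv ?B k (?f i))" by (simp only: fun_sum_apply fun_scaleR_apply real_scaleR_def)
  also have "... = (\<Sum>k<n. if k = i then c' i else 0)" by (rule sum.cong[OF refl]) (simp only: vB lessThan_iff, simp)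
  finally show ?thesis using that(2) by simp
 qed
 have p: "posdef (GG ?B) n" proof (rule gram_posdef[where v="vv ?B" and G="GG ?B" and q=q, OF sq])
  show "u \<in> sp (vv ?B) n ==> u ~= 0 ==> 0 < q u u" for u using nq_pos sp_Vn by blast
  show "of_int (GG ?B i j) = q (vv ?B i) (vv ?B j)" if "i < n" "j < n" for i j using that by (rule GG)
 qed (rule ind)
 define g where "g = gv (GG ?B) (vv ?B)"
 have gs: "gsys q (vv ?B) g n" unfolding g_def by (rule gsys_gv(1)[where v="vv ?B" and G="GG ?B", OF sq p GG])
 have ga: "nq (g k) <= a" if k: "k < n" for k proof -
  let ?w = "g k - vv ?B k"
  have w: "?w \<in> sp (vv ?B) k" by (rule gsD(1)[OF sq gs k])
  have o: "q (g k) ?w = 0" by (rule gsD(2)[OF sq gs k w])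
  have "nq (vv ?B k) = nq (g k - ?w)" by simp
  also have "... = nq (g k) - q (g k) ?w - q ?w (g k) + nq ?w" by (simp only: sform_simps(5,6)[OF sq])
  also have "... = nq (g k) + nq ?w" using o sform_sym[OF sq, of ?w "g k"] by simp
  finally have "nq (g k) <= nq (vv ?B k)" using nq_nonneg[of ?w] w sp_Vn by fastforce
  also have "... = of_int (Q (?f k) (?f k))" proof -
   have dl: "gram n Q (%l. if l = u then 1 else 0) (%l. if l = u then 1 else 0) = Q u u" if "u < n" for u
    using that by (simp add: gram_def if_distrib[of "%x. _ * x"] if_distrib[of "%x. x * _"] cong: if_cong)
   have "?B k = (%l. if l = ?f k then 1 else 0)" by (rule ext) (rule B)
   hence "gram n Q (?B k) (?B k) = Q (?f k) (?f k)" by (simp only: dl[OF f[OF k]])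
   thus ?thesis unfolding bf_vn by (simp only:)
  qed
  also have "... <= a" using aQ[OF f[OF k] f[OF k]] by linarith
  finally show ?thesis .
 qed
 have "inZ n m ?B z" for z unfolding inZ_def proof (intro exI[of _ "%k. z (k - m)"] allI impI)
  fix l assume l: "l < n - m"
  have "(\<Sum>k\<in>{m..<n}. z (k - m) * ?B k l) = (\<Sum>k\<in>{m..<n}. if k = l + m then z l else 0)"
   unfolding B by (rule sum.cong[OF refl]) auto
  thus "z l = (\<Sum>k\<in>{m..<n}. z (k - m) * ?B k l)" using l by simp
 qed
 moreover have "ALL k<m. ALL l. ?B k l = (if l = n - m + k then 1 else 0)" unfolding B by auto
 moreover have "ALL k. m <= k --> k < n --> (ALL l. n - m <= l --> ?B k l = 0)" unfolding B by auto
 ultimately have "bas n m ?B" unfolding bas_def by blast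
 hence "linv ?B g" using gs ga by (simp add: linv_def)
 moreover have "pot g <= of_int a ^ (n * n)" proof -
  have p0: "0 <= nq (g l)" if "l < n" for l using gsD(3)[OF sq gs that] by simp
  have a1': "1 <= real_of_int a" using a1 by simp
  have "(\<Prod>l<k. nq (g l)) <= of_int a ^ n" if "k < n" for k proof -
   have "(\<Prod>l<k. nq (g l)) <= (\<Prod>l<k. of_int a)" using that p0 ga by (intro prod_mono) auto
   also have "... <= of_int a ^ n" using a1' that by (simp add: power_increasing)
   finally show ?thesis .
  qed
  moreover have "0 <= (\<Prod>l<k. nq (g l))" if "k < n" for k using that p0 by (intro prod_nonneg) auto
  ultimately have "pot g <= (\<Prod>k\<in>{Suc m..<n}. of_int a ^ n)" unfolding pot_def by (intro prod_mono) auto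
  also have "... = of_int a ^ (n * (n - Suc m))" by (simp add: power_mult)
  also have "... <= of_int a ^ (n * n)" using a1' by (intro power_increasing mult_le_mono2) auto
  finally show ?thesis .
 qed
 ultimately show ?thesis by blast
qed

text \<open>Once the Siegel condition holds it persists, because from then on only size reduction
  takes place and \<open>g\<close> is unchanged. Otherwise all \<open>T\<close> rounds have reduced
  the potential, which would then be smaller than 1.\<close>

theorem lll_spec:
 obtains g where "linv (lll n m Q c T) g" "!!i l. i < n ==> (lll n m Q c T i l)\<^sup>2 <= ebd"
  "(3 / 4) ^ T * of_int a ^ (n * n) < (1::real) ==> siegel g"
proof -
 have "EX g. linv (lll n m Q c T) g & (ALL i<n. ALL l. (lll n m Q c T i l)\<^sup>2 <= ebd) &
  (siegel g \<or> pot g <= (3 / 4) ^ T * of_int a ^ (n * n))"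
 proof (induction T)
  case 0
  have "(lll n m Q c 0 i l)\<^sup>2 <= ebd" for i l using ebd1 by simp
  thus ?case using lll_init by fastforce
 next
  case (Suc T)
  then obtain g where g: "linv (lll n m Q c T) g" "siegel g \<or> pot g <= (3 / 4) ^ T * of_int a ^ (n * n)" by blast
  obtain g' where "linv (lll n m Q c (Suc T)) g'" "ALL i<n. ALL l. (lll n m Q c (Suc T) i l)\<^sup>2 <= ebd"
   "if siegel g then g' = g else pot g' <= 3 / 4 * pot g" using lstep_inv[OF g(1)] by auto
  moreover have "siegel g' \<or> pot g' <= (3 / 4) ^ Suc T * of_int a ^ (n * n)"
   using calculation(3) g(2) by (auto split: if_splits)
  ultimately show ?case by blast
 qed
 then obtain g where g: "linv (lll n m Q c T) g" "ALL i<n. ALL l. (lll n m Q c T i l)\<^sup>2 <= ebd"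
  "siegel g \<or> pot g <= (3 / 4) ^ T * of_int a ^ (n * n)" by blast
 have gs: "gsys q (vv (lll n m Q c T)) g n" using g(1) by (simp add: linv_def)
 have "1 <= pot g" unfolding pot_def proof (rule prod_ge_1)
  fix k assume "k \<in> {Suc m..<n}"
  hence "(\<Prod>l<k. nq (g l)) = of_int (dlt (GG (lll n m Q c T)) k)" "0 < dlt (GG (lll n m Q c T)) k"
   using gs_dlt_prod[OF gs, of k] gs_dlt_pos[OF gs, of k] by auto
  thus "1 <= (\<Prod>l<k. nq (g l))" by simp
 qed
 thus thesis using that[OF g(1)] g(2,3) by force
qed

end

section \<open>Candidate points\<close>

definition lin :: "nat => ivec => ivec => int" where
 "lin n h z = (\<Sum>l<n. h l * z l)"

text \<open>Basis coordinates of the centre \<open>c / P\<close>: column \<open>n\<close> of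
  \<open>gc\<close> is the right-hand side of the normal equations. The entry with index
  \<open>n\<close> is the common denominator.\<close>

definition cen :: "nat => int => imat => nat => int" where
 "cen n P G l = (if l = n then dlt G n * P else bst G n n l n)"

text \<open>The point closest to the centre on the slice where coordinates
  \<open>N, ..., n - 1\<close> are fixed to rounded values plus offsets: it is reached from the
  centre along Gram-Schmidt vectors orthogonal to the slice.\<close>

definition zst :: "nat => int => imat => ivec => imat" where
 "zst n P G s N = bab n G n s (cen n P G) (n - N)"

text \<open>The stationarity equations of the Lagrangian on a slice in basis coordinates, multiplied
  by \<open>2 ^ E\<close>. The multiplier is \<open>l * 2 ^ k' / 2 ^ E\<close>; the perturbation is
  \<open>sg * 2 ^ k / 2 ^ E\<close> times the pairing with the \<open>i\<close>-th Gram-Schmidt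
  vector scaled by \<open>dlt G i\<close>. Column \<open>N\<close>, the right-hand side, carries the
  further factor \<open>Z n\<close>.\<close>

definition tmat :: "nat => imat => ivec => imat => imat => ivec =>
  nat => nat => int => nat => nat => nat => nat => imat" where
 "tmat n Hm hv B G Z N E sg i k l k' r j =
  (if j < N then 2 ^ E * gram n Hm (B r) (B j) + int l * 2 ^ k' * G r j
  else - (2 ^ E * (2 * (\<Sum>j<n. Z j * gram n Hm (B r) (B j)) + Z n * lin n hv (B r))
    + sg * Z n * 2 ^ k * (\<Sum>l<n. gn G i l * G l r)))"

text \<open>\<open>sg = 0\<close> encodes the guess that the objective is constant on the slice,
  where nothing has to be minimised. A failed elimination also falls back to the zero vector with
  denominator 1, so that every guess yields a point.\<close>

definition ysol :: "imat => nat => int => nat => int" where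
 "ysol M N sg l = (if sg = 0 \<or> dlt M N <= 0 then (if l = N then 1 else 0)
  else if l = N then dlt M N else bst M N N l N)"

text \<open>The point \<open>z + (1 - 1 / KK) * y\<close>. The factor 2 in the denominator stems
  from the right-hand side \<open>- b / 2\<close> of stationarity, the factor \<open>Z n\<close> of
  the denominator of \<open>y\<close> from the scaling of \<open>tmat\<close>.\<close>

definition x1 :: "nat => nat => int => ivec => ivec => nat => int" where
 "x1 n N KK Z Y l = (if l = n then Z n * (2 * Y N * KK)
  else Z l * (2 * Y N * KK) + (if l < N then (KK - 1) * Y l else 0))"

definition xout :: "nat => imat => ivec => nat => int" where
 "xout n B X l = (if l = n then X n else \<Sum>k<n. X k * B k l)"

section \<open>Slices of the ellipsoid in a reduced basis\<close>

locale core = lattice +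
 fixes B :: imat and g :: "nat => nat => real"
  and Hm :: imat and hv :: ivec and P K :: int
 assumes inv: "linv B g" and sie: "siegel g" and sH: "symn n Hm" and P1: "1 <= P" and K1: "1 <= K"
begin

abbreviation v :: "nat => nat => real" where "v == vv B"
abbreviation G :: imat where "G == GG B"

definition ctr :: "nat => real" where "ctr = (1 / of_int P) *R vn n c"

text \<open>All data carry a common factor \<open>P\<close>; hence the right-hand side
  \<open>P\<close> of the constraint and the centre \<open>c / P\<close>.\<close>

definition F :: "(nat => real) set" where
 "F = {x \<in> Vn n. (ALL l<n - m. x l \<in> \<int>) & nq (x - ctr) <= of_int P}"

definition hl :: "(nat => real) => real" where "hl x = (\<Sum>l<n. of_int (hv l) * x l)"

definition fo :: "(nat => real) => real" where "fo x = bf n Hm x x + hl x"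

lemma basB: "bas n m B" and gs: "gsys q v g n" and ga: "m <= k ==> k < n ==> nq (g k) <= a"
 using inv by (auto simp: linv_def)

lemma dpos: "k <= n ==> 0 < dlt G k" by (rule gs_dlt_pos[OF gs])

lemma dpos': "ALL j<n. 0 < dlt G j" using dpos by simp

lemma gp: "k < n ==> 0 < nq (g k)" by (rule gsD(3)[OF sq gs])

lemma v_low: "k < m ==> l < n - m ==> v k l = 0" using bas_low[OF basB] by (simp add: vn_def)

text \<open>Coefficients for the lattice rows come from expressing the unit vectors by them. Those
  of the rows below \<open>m\<close> are read off the continuous coordinates, in which the lattice
  rows vanish.\<close>

lemma coords:
 assumes x: "x \<in> Vn n"
 shows "EX \<xi>. x = (\<Sum>k<n. \<xi> k *R v k) & ((ALL l<n - m. x l \<in> \<int>) --> (ALL k. m <= k --> k < n --> \<xi> k \<in> \<int>))"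
proof -
 have ex: "EX t. ALL l<n - m. (if l = u then 1 else 0) = (\<Sum>k\<in>{m..<n}. t k * B k l)" for u proof -
  have "ALL z. inZ n m B z" using basB unfolding bas_def by (elim conjE)
  hence "inZ n m B (%l. if l = u then 1 else 0)" by (rule spec)
  thus ?thesis unfolding inZ_def .
 qed
 define t where "t u = (SOME t. ALL l<n - m. (if l = u then 1 else 0) = (\<Sum>k\<in>{m..<n}. t k * B k l))" for u
 have "ALL l<n - m. (if l = u then 1 else 0) = (\<Sum>k\<in>{m..<n}. t u k * B k l)" for u
  unfolding t_def by (rule someI_ex[OF ex])
 hence t: "(\<Sum>k\<in>{m..<n}. t u k * B k l) = (if l = u then 1 else 0)" if "l < n - m" for u l using that by simp
 define \<xi> where "\<xi> k = (if k < m then x (n - m + k) else \<Sum>u<n - m. x u * of_int (t u k))" for k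
 have split: "(\<Sum>k<n. f k) = (\<Sum>k<m. f k) + (\<Sum>k\<in>{m..<n}. f k)" for f :: "nat => real"
  using sum.atLeastLessThan_concat[of 0 m n f] mn by (simp add: lessThan_atLeast0)
 have "(\<Sum>k<n. \<xi> k *R v k) l = x l" for l proof -
  consider "n <= l" | "l < n - m" | "n - m <= l" "l < n" by linarith
  thus ?thesis proof cases
   case 1
   thus ?thesis using x by (simp add: fun_sum_apply vn_def Vn_def)
  next
   case 2
   have "(\<Sum>k<n. \<xi> k * v k l) = (\<Sum>k\<in>{m..<n}. \<xi> k * v k l)" unfolding split using v_low[OF _ 2] by simp
   also have "... = (\<Sum>k\<in>{m..<n}. \<Sum>u<n - m. x u * of_int (t u k) * of_int (B k l))"
    by (rule sum.cong[OF refl]) (use 2 mn in "auto simp: \<xi>_def vn_def sum_distrib_right")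
   also have "... = (\<Sum>u<n - m. x u * of_int (\<Sum>k\<in>{m..<n}. t u k * B k l))"
    by (simp add: sum_distrib_left mult.assoc) (rule sum.swap)
   also have "... = (\<Sum>u<n - m. if u = l then x l else 0)" by (rule sum.cong[OF refl]) (simp only: t[OF 2], simp)
   also have "... = x l" using 2 by simp
   finally show ?thesis by (simp add: fun_sum_apply)
  next
   case 3
   have "(\<Sum>k<n. \<xi> k * v k l) = (\<Sum>k<n. if k = l - (n - m) then x l else 0)" proof (rule sum.cong[OF refl])
    fix k assume "k \<in> {..<n}"
    have lo: "k < m ==> B k l = (if l = n - m + k then 1 else 0)" and hi: "m <= k ==> B k l = 0"
     using basB 3 \<open>k \<in> {..<n}\<close> unfolding bas_def by auto
    show "\<xi> k * v k l = (if k = l - (n - m) then x l else 0)" proof (cases "k < m")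
     case True
     thus ?thesis using 3 lo mn by (auto simp: vn_def \<xi>_def)
    next
     case False
     thus ?thesis using 3 hi mn by (auto simp: vn_def)
    qed
   qed
   also have "... = x l" using 3 by auto
   finally show ?thesis by (simp add: fun_sum_apply)
  qed
 qed
 hence "x = (\<Sum>k<n. \<xi> k *R v k)" by (intro ext) (rule sym)
 moreover have "\<xi> k \<in> \<int>" if "ALL l<n - m. x l \<in> \<int>" "m <= k" for k using that by (auto simp: \<xi>_def)
 ultimately show ?thesis by blast
qed

lemma Vn_sp: "Vn n = sp v n"
proof
 show "Vn n \<subseteq> sp v n" using coords sp_sum[of n n _ v] by force
 show "sp v n \<subseteq> Vn n" by (rule sp_Vn)
qed

lemma int_coords:
 assumes "!!k. m <= k ==> k < n ==> \<xi> k \<in> \<int>" and l: "l < n - m"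
 shows "(\<Sum>k<n. \<xi> k *R v k) l \<in> \<int>"
proof -
 have "\<xi> k * v k l \<in> \<int>" if "k < n" for k using assms that v_low[OF _ l, of k] by (cases "k < m") (auto simp: vn_def)
 thus ?thesis unfolding fun_sum_apply by (auto intro!: Ints_sum)
qed

lemma ctr_Vn: "ctr \<in> Vn n" by (simp add: ctr_def Vn_subspace subspace_scale)

lemma cen_pos: "0 < cen n P G n" using dpos[of n] P1 by (simp add: cen_def)

text \<open>Both points have the same products with all basis vectors, so their difference has norm
  0.\<close>

lemma cen_ctr: "xv n v (cen n P G) = ctr"
proof -
 let ?x = "xv n v (cen n P G)" let ?w = "?x - ctr"
 have xV: "?x \<in> sp v n" unfolding xv_def by (rule sp_sum) simp
 hence w: "?w \<in> sp v n" using ctr_Vn Vn_sp subspace_diff[OF sp_subspace] by blast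
 have d: "0 < dlt G n" using dpos by simp
 have e: "q (v i) ?w = 0" if i: "i < n" for i proof -
  have "q (v i) ?x = (\<Sum>l<n. co n (cen n P G) l * of_int (G i l))"
   unfolding xv_def using i by (simp add: sform_sum2[OF sq] sform_simps[OF sq] GG)
  also have "... = of_int (\<Sum>l<n. G i l * bst G n n l n) / of_int (dlt G n * P)"
   by (simp add: co_def cen_def sum_divide_distrib mult.commute)
  also have "... = of_int (G i n) / of_int P" using bst_sol[OF d i, of n] d by simp
  also have "... = q (v i) ctr" by (simp add: ctr_def sform_simps[OF sq] gc_def bf_vn)
  finally show ?thesis by (simp add: sform_simps[OF sq])
 qed
 obtain \<xi> where xi: "?w = (\<Sum>i<n. \<xi> i *R v i)" using sp_ex[OF w] by blast
 have "nq ?w = q (\<Sum>i<n. \<xi> i *R v i) ?w" using arg_cong[OF xi, of "%y. q y ?w"] .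
 also have "... = (\<Sum>i<n. \<xi> i * q (v i) ?w)" by (simp only: sform_sum[OF sq] sform_simps(3)[OF sq])
 also have "... = 0" using e by simp
 finally have "?w = 0" using gs_pd[OF sq gs, of n ?w] w by fastforce
 thus ?thesis by simp
qed

context
 fixes s :: ivec and N :: nat
 assumes N: "N <= n"
begin

abbreviation zt :: ivec where "zt == zst n P G s N"
abbreviation z :: "nat => real" where "z == xv n v (zst n P G s N)"

lemma zt_pos: "0 < zt n"
 unfolding zst_def by (rule bab_pos[where X="cen n P G" and n=n, OF cen_pos dpos' le_refl]) simp

text \<open>The displacement from the centre is a combination of Gram-Schmidt vectors of index at
  least \<open>N\<close>.\<close>

lemma z_orth: "u \<in> sp v N ==> q (z - ctr) u = 0"
proof -
 assume u: "u \<in> sp v N"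
 have ex: "EX ta. xv n v (bab n G n s (cen n P G) (n - N)) = xv n v (cen n P G) +
  (\<Sum>j\<in>{n - (n - N)..<n}. ta j *R gv G v j) & (s = (%_. 0) --> (ALL j. \<bar>ta j\<bar> <= 1 / 2))"
  by (rule bab_xv[where X="cen n P G" and n=n, OF cen_pos dpos' le_refl]) simp
 then obtain ta where "z = ctr + (\<Sum>j\<in>{n - (n - N)..<n}. ta j *R gv G v j)" unfolding zst_def cen_ctr by blast
 hence "z - ctr = (\<Sum>j\<in>{N..<n}. ta j *R gv G v j)" using N by simp
 also have "... = (\<Sum>j\<in>{N..<n}. ta j *R g j)" by (rule sum.cong[OF refl]) (simp add: gs_gv[OF gs])
 finally have e: "z - ctr = (\<Sum>j\<in>{N..<n}. ta j *R g j)" .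
 have "q (g j) u = 0" if "N <= j" "j < n" for j using gsD(2)[OF sq gs that(2)] u sp_mono[OF that(1)] by blast
 thus ?thesis unfolding e by (simp add: sform_sum[OF sq] sform_simps[OF sq])
qed

lemma z_split: "u \<in> sp v N ==> nq (z + u - ctr) = nq (z - ctr) + nq u"
proof -
 assume u: "u \<in> sp v N"
 have "z + u - ctr = (z - ctr) + u" by (simp add: algebra_simps)
 hence "nq (z + u - ctr) = nq ((z - ctr) + u)" by (simp only:)
 also have "... = nq (z - ctr) + nq u"
  using z_orth[OF u] sform_sym[OF sq, of u "z - ctr"] by (simp only: sform_simps(1,2)[OF sq])
 finally show ?thesis .
qed

lemma z_int: "N <= l ==> l < n ==> co n zt l \<in> \<int>"
proof -
 assume l: "N <= l" "l < n"
 show ?thesis unfolding zst_def by (rule bab_int[where X="cen n P G" and n=n, OF cen_pos dpos' le_refl]) (use l N in auto)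
qed

end

lemma siegel_iter: "m <= i ==> i + d < n ==> nq (g i) <= 2 ^ d * nq (g (i + d))"
proof (induction d)
 case (Suc d)
 hence "nq (g (i + d)) <= 2 * nq (g (Suc (i + d)))" using sie by (simp add: siegel_def)
 hence "2 ^ d * nq (g (i + d)) <= 2 ^ d * (2 * nq (g (Suc (i + d))))" by (intro mult_left_mono) auto
 moreover have "nq (g i) <= 2 ^ d * nq (g (i + d))" using Suc by simp
 ultimately show ?case by (simp only: power_Suc add_Suc_right)
qed simp

text \<open>Shrinking and rounding on a slice have relative size \<open>1 / KK\<close>. By
  \<open>phi_lipschitz\<close> they change the objective by at most \<open>5 / KK\<close>, that is
  \<open>1 / (8 * K)\<close>, of its scale.\<close>

definition KK :: int where "KK = 40 * K"
text \<open>The bound of \<open>leaf_exists\<close> on the distance between a coordinate of the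
  target and that of the slice point, plus 1 for the rounding from which offsets are
  counted.\<close>

definition KO :: int where "KO = 2 ^ (n - m) * (int (n - m) + 1) * KK + 1"

lemma KK40: "40 <= KK" using K1 by (simp add: KK_def)

text \<open>The precise meaning of short: rounding the at most \<open>n - m\<close> free lattice
  coordinates then moves a point by at most \<open>1 / KK\<close> times the radius of the
  slice.\<close>

definition leaf :: "ivec => nat => bool" where
 "leaf s N \<longleftrightarrow> (ALL i. m <= i --> i < N -->
  nq (g i) * (of_int ((int (n - m) + 1) * KK))\<^sup>2 <= of_int P - nq (xv n v (zst n P G s N) - ctr))"

lemma slice_sp:
 assumes x: "x = (\<Sum>k<n. \<xi> k *R v k)" and N: "N <= n"
  and sl: "!!l. N <= l ==> l < n ==> co n (zst n P G s N) l = \<xi> l"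
 shows "x - xv n v (zst n P G s N) = (\<Sum>l<N. (\<xi> l - co n (zst n P G s N) l) *R v l)"
proof -
 have "x - xv n v (zst n P G s N) = (\<Sum>l<n. (\<xi> l - co n (zst n P G s N) l) *R v l)"
  unfolding x xv_def by (simp add: sum_subtractf scaleR_diff_left)
 also have "... = (\<Sum>l<N. (\<xi> l - co n (zst n P G s N) l) *R v l)" by (rule sum.mono_neutral_right) (use N sl in auto)
 finally show ?thesis .
qed

text \<open>
 Descend through the slices containing \<open>x\<close> until the free lattice directions are short compared to
 the radius of the slice; on the way every offset is bounded because the basis is reduced.
\<close>

lemma leaf_exists:
 assumes x: "x \<in> F"
 shows "EX s N. m <= N & N <= n & (ALL j. \<bar>s j\<bar> <= KO) & leaf s N & x - xv n v (zst n P G s N) \<in> sp v N"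
proof -
 have xV: "x \<in> Vn n" and xi: "ALL l<n - m. x l \<in> \<int>" and xP: "nq (x - ctr) <= of_int P" using x by (auto simp: F_def)
 obtain \<xi> where x\<xi>: "x = (\<Sum>k<n. \<xi> k *R v k)" and \<xi>i: "ALL k. m <= k --> k < n --> \<xi> k \<in> \<int>"
  using coords[OF xV] xi by blast
 have KO0: "0 <= KO" using KK40 by (simp add: KO_def)
 have main: "EX s N. m <= N & N <= n & (ALL j. \<bar>s j\<bar> <= KO) & leaf s N & x - xv n v (zst n P G s N) \<in> sp v N"
  if "m <= N" "N <= n" "ALL j. \<bar>s j\<bar> <= KO" "ALL l. N <= l --> l < n --> co n (zst n P G s N) l = \<xi> l" for s N using that
 proof (induction "N - m" arbitrary: s N)
  case 0
  hence "N = m" by simp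
  hence "leaf s N" by (simp add: leaf_def)
  moreover have "x - xv n v (zst n P G s N) \<in> sp v N"
   using slice_sp[OF x\<xi> "0.prems"(2), of s] "0.prems"(4) sp_sum[of N N _ v] by auto
  ultimately show ?case using 0 by blast
 next
  case (Suc d)
  let ?Z = "zst n P G s N" let ?u = "x - xv n v ?Z"
  have u: "?u = (\<Sum>l<N. (\<xi> l - co n ?Z l) *R v l)" using slice_sp[OF x\<xi> Suc.prems(2), of s] Suc.prems(4) by auto
  have uN: "?u \<in> sp v N" unfolding u by (rule sp_sum) simp
  show ?case proof (cases "leaf s N")
   case True
   thus ?thesis using Suc.prems uN by blast
  next
   case False
   then obtain i where i: "m <= i" "i < N"
    "of_int P - nq (xv n v ?Z - ctr) < nq (g i) * (of_int ((int (n - m) + 1) * KK))\<^sup>2" by (auto simp: leaf_def not_le)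
   define j where "j = N - 1"
   have j: "N = Suc j" "m <= j" "j < n" using Suc.hyps(2) Suc.prems by (auto simp: j_def)
   let ?D = "real_of_int ((int (n - m) + 1) * KK)"
   have D1: "1 <= ?D" proof -
    have "1 * 1 <= (int (n - m) + 1) * KK" using KK40 by (intro mult_mono) auto
    thus ?thesis by linarith
   qed
   let ?dl = "\<xi> j - co n ?Z j"
   have ur: "nq ?u <= of_int P - nq (xv n v ?Z - ctr)" proof -
    have "xv n v ?Z + ?u - ctr = x - ctr" by simp
    thus ?thesis using z_split[where s=s, OF Suc.prems(2) uN] xP by simp
   qed
   have uj: "?u - ?dl *R v j \<in> sp v j" proof -
    have "(\<Sum>l<N. f l) = (\<Sum>l<j. f l) + f j" for f :: "nat => nat => real" using j(1) by simp
    hence "?u - ?dl *R v j = (\<Sum>l<j. (\<xi> l - co n ?Z l) *R v l)"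
     unfolding u by (simp only: add_diff_cancel_right')
    thus ?thesis using sp_sum[of j j _ v] by simp
   qed
   \<comment> \<open>Projection to \<open>g j\<close> bounds the coordinate difference
     \<open>?dl\<close> times the length of \<open>g j\<close> by the radius of the slice. The
     radius is small compared with the long vector \<open>g i\<close>, and by the Siegel condition
     \<open>g j\<close> is not much shorter than \<open>g i\<close>; so \<open>?dl\<close> is
     bounded.\<close>
   have "q (g j) ?u = ?dl * nq (g j)" by (rule gs_coeff[OF sq gs j(3) uj])
   moreover have "(q (g j) ?u)\<^sup>2 <= nq (g j) * nq ?u" proof (rule sform_cauchy[OF sq Vn_subspace nq_nonneg])
    show "g j \<in> Vn n" using gs_in'[OF sq gs j(3) le_refl] Vn_sp by simp
    show "?u \<in> Vn n" using uN sp_mono[OF Suc.prems(2), of v] Vn_sp by auto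
   qed
   ultimately have "?dl\<^sup>2 * nq (g j) * nq (g j) <= nq ?u * nq (g j)" by (simp add: power2_eq_square mult_ac)
   hence dj: "?dl\<^sup>2 * nq (g j) <= nq ?u" using gp[OF j(3)] by (rule mult_right_le_imp_le)
   have "?dl\<^sup>2 <= (2 ^ (n - m) * ?D)\<^sup>2" proof (rule ccontr)
    assume "~ ?thesis"
    hence "(2 ^ (n - m) * ?D)\<^sup>2 * nq (g j) < ?dl\<^sup>2 * nq (g j)" using gp[OF j(3)] by (intro mult_strict_right_mono) auto
    moreover have "nq (g i) * ?D\<^sup>2 <= (2 ^ (n - m) * ?D)\<^sup>2 * nq (g j)" proof -
     have "nq (g i) <= 2 ^ (j - i) * nq (g j)" using siegel_iter[of i "j - i"] i j by simp
     also have "... <= 2 ^ (n - m) * nq (g j)" using i j gp[OF j(3)] by (intro mult_right_mono power_increasing) auto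
     also have "... <= (2 ^ (n - m))\<^sup>2 * nq (g j)"
      using gp[OF j(3)] by (intro mult_right_mono) (auto simp: power2_eq_square)
     finally have "nq (g i) * ?D\<^sup>2 <= (2 ^ (n - m))\<^sup>2 * nq (g j) * ?D\<^sup>2" by (intro mult_right_mono) auto
     thus ?thesis by (simp add: power_mult_distrib mult_ac)
    qed
    ultimately show False using dj ur i(3) by linarith
   qed
   hence dl: "\<bar>?dl\<bar> <= 2 ^ (n - m) * ?D" using D1 abs_le_square_iff[of ?dl "2 ^ (n - m) * ?D"] by simp
   obtain t where t: "\<xi> j = of_int t" using \<xi>i j by (auto elim: Ints_cases)
   \<comment> \<open>Rounding plus this offset hits the coordinate of \<open>x\<close> exactly; the
     steps before it do not read the entry.\<close>
   define s' where "s' = s(j := t - rnd n ?Z j)"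
   have nj: "n - j = Suc (n - N)" "n - Suc (n - N) = j" using j Suc.prems by auto
   have cong: "bab n G n s' (cen n P G) (n - N) = bab n G n s (cen n P G) (n - N)"
    by (rule bab_cong) (use j Suc.prems in "auto simp: s'_def")
   have tN: "n - N < n" using j by simp
   have hi: "co n (zst n P G s' j) l = \<xi> l" if l: "j <= l" "l < n" for l proof (cases "l = j")
    case True
    have "co n (zst n P G s' j) j = of_int (rnd n ?Z j + s' j)"
     using  bab_step_coords(2)[where X="cen n P G" and n=n, OF cen_pos dpos' le_refl tN, of s'] unfolding zst_def nj cong .
    thus ?thesis using True t by (simp add: s'_def)
   next
    case False
    have "co n (zst n P G s' j) l = co n ?Z l"
     using  bab_step_coords(1)[where X="cen n P G" and n=n, OF cen_pos dpos' le_refl tN, of l s'] l False unfolding zst_def nj cong by auto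
    thus ?thesis using Suc.prems(4) False l j by auto
   qed
   have Zp: "0 < ?Z n" by (rule zt_pos[OF Suc.prems(2)])
   have "\<bar>s' l\<bar> <= KO" for l proof (cases "l = j")
    case True
    have "\<bar>real_of_int (t - rnd n ?Z j)\<bar> <= 2 ^ (n - m) * ?D + 1"
     using dl rnd_co[where S="?Z" and n=n and j=j, OF Zp] unfolding t of_int_diff by linarith
    also have "... = of_int KO" by (simp add: KO_def mult_ac)
    finally show ?thesis using True unfolding s'_def by (simp only: fun_upd_same)
   next
    case False
    thus ?thesis using Suc.prems(3) by (simp add: s'_def)
   qed
   thus ?thesis using Suc.hyps(1)[of j s'] Suc.hyps(2) j hi by simp
  qed
 qed
 show ?thesis by (rule main[of n "%_. 0"]) (use mn KO0 in auto)
qed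

end

section \<open>Minimising over a slice\<close>

text \<open>Solvability of the stationarity equations by induction over the generators: the new
  generator is made orthogonal to the old span, and the solution is corrected along it. If it
  already lies in the old span, \<open>h = 0\<close> and no correction takes place.\<close>

lemma riesz:
 fixes v :: "nat => 'v::real_vector" and b :: "'v => 'v => real" and f :: "'v => real"
 assumes sb: "sform b" and f: "linear f" and pd: "!!u. u \<in> sp v N ==> u ~= 0 ==> 0 < b u u"
 shows "EX y:sp v N. ALL u:sp v N. b y u = f u" using pd f
proof (induction N arbitrary: f)
 case 0
 thus ?case using sb by (simp add: linear_0 sform_simps)
next
 case (Suc N)
 have fs: "f (x + c *R y) = f x + c * f y" for x y c using Suc.prems(2) by (simp add: linear_add linear_cmul)
 have mono: "u \<in> sp v (Suc N)" if "u \<in> sp v N" for u using that sp_mono[of N "Suc N" v] by auto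
 have pd: "0 < b u u" if "u \<in> sp v N" "u ~= 0" for u using Suc.prems(1) that mono by auto
 obtain y where y: "y \<in> sp v N" "!!u. u \<in> sp v N ==> b y u = f u" using Suc.IH[OF pd Suc.prems(2)] by auto
 have "linear (b (v N))" using sb by (intro linearI) (auto simp: sform_simps)
 from Suc.IH[OF pd this] obtain w where w: "w \<in> sp v N" "!!u. u \<in> sp v N ==> b w u = b (v N) u" by auto
 define h where "h = v N - w"
 have h0: "b h u = 0" if "u \<in> sp v N" for u using w(2)[OF that] by (simp add: h_def sform_simps[OF sb])
 have hS: "h \<in> sp v (Suc N)" unfolding h_def by (rule subspace_diff[OF sp_subspace sp_base mono[OF w(1)]]) simp
 define c where "c = f h / b h h"
 have ch: "c * b h h = f h" proof (cases "h = 0")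
  case True
  thus ?thesis using Suc.prems(2) by (simp add: c_def linear_0 sform_simps[OF sb])
 next
  case False
  thus ?thesis using Suc.prems(1)[OF hS] by (simp add: c_def)
 qed
 let ?y = "y + c *R h"
 have "b ?y u = f u" if u: "u \<in> sp v (Suc N)" for u proof -
  obtain t where t: "u - t *R v N \<in> sp v N" using u by (auto simp: sp_Suc)
  define u0 where "u0 = u - t *R h"
  have "u0 = (u - t *R v N) + t *R w" by (simp add: u0_def h_def algebra_simps)
  hence u0: "u0 \<in> sp v N" using subspace_add[OF sp_subspace t subspace_scale[OF sp_subspace w(1), of t]] by simp
  have ue: "u = u0 + t *R h" by (simp add: u0_def)
  have "b y h = 0" using h0[OF y(1)] sform_sym[OF sb, of y h] by simp
  hence "b ?y u = b y u0 + t * (c * b h h)" unfolding ue by (simp add: sform_simps[OF sb] h0[OF u0])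
  also have "... = f u" unfolding ch y(2)[OF u0] ue fs ..
  finally show ?thesis .
 qed
 moreover have "?y \<in> sp v (Suc N)"
  by (rule subspace_add[OF sp_subspace mono[OF y(1)] subspace_scale[OF sp_subspace hS]])
 ultimately show ?case by blast
qed

lemma pow2_between:
 fixes x :: real
 assumes "1 <= x" shows "EX k. 2 ^ k <= x & x < 2 * 2 ^ k"
proof -
 define k where "k = (LEAST k. x < 2 ^ Suc k)"
 obtain j where j: "x < 2 ^ j" using real_arch_pow[of 2 x] by auto
 have "2 ^ j <= (2 ^ Suc j :: real)" by simp
 hence "x < 2 ^ Suc j" using j by linarith
 hence k: "x < 2 ^ Suc k" unfolding k_def by (rule LeastI)
 have "2 ^ k <= x" proof (cases k)
  case 0
  thus ?thesis using assms by simp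
 next
  case (Suc i)
  hence "~ x < 2 ^ Suc i" using not_less_Least[of i "%k. x < 2 ^ Suc k"] by (simp add: k_def)
  thus ?thesis using Suc by simp
 qed
 thus ?thesis using k by auto
qed

text \<open>\<open>om * r^2\<close> is a common scale for the quadratic and the linear part of the
  objective on the ball of radius \<open>r\<close>, in the form in which \<open>trust_region\<close>
  wants it.\<close>

definition dominates :: "('v::real_vector => 'v => real) => ('v => 'v => real) => ('v => real) => 'v set => real => real => bool" where
 "dominates a q bt V r om \<longleftrightarrow> 0 <= om & (ALL u:V. ALL w:V. \<bar>a u w\<bar> <= om * (sqrt (q u u) * sqrt (q w w))) &
  (ALL u:V. \<bar>bt u\<bar> <= om * r / 2 * sqrt (q u u))"

context
 fixes a q :: "'v::real_vector => 'v => real" and bt :: "'v => real" and V :: "'v set" and r :: real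
 assumes V: "subspace V" and sa: "sform a" and sq: "sform q" and lb: "linear bt"
  and pd: "!!u. u \<in> V ==> u ~= 0 ==> 0 < q u u" and r: "0 < r"
begin

abbreviation phi :: "'v => real" where "phi u == a u u + bt u"

lemma q_nonneg: "u \<in> V ==> 0 <= q u u" using pd[of u] by (cases "u = 0") (auto simp: sform_simps[OF sq])

text \<open>\<open>om * r^2\<close> is the oscillation of the objective on the ball. As the ball is
  symmetric, comparing \<open>u\<close> with \<open>- u\<close> separates the quadratic from the
  linear part, and polarisation passes to mixed terms. Two points that realise 7/8 of the
  oscillation stand in for a maximiser and a minimiser.\<close>

lemma osc_dominates:
 assumes D: "!!u. u \<in> V ==> q u u <= r\<^sup>2 ==> \<bar>phi u\<bar> <= D"
 shows "EX om. dominates a q bt V r om & om * r\<^sup>2 <= 2 * D & (ALL u:V. q u u <= r\<^sup>2 --> \<bar>phi u\<bar> <= om * r\<^sup>2) &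
  (EX u:V. EX w:V. q u u <= r\<^sup>2 & q w w <= r\<^sup>2 & 7 / 8 * (om * r\<^sup>2) <= phi u - phi w)"
proof -
 define U where "U = {u \<in> V. q u u <= r\<^sup>2}"
 define S where "S = (%p. phi (fst p) - phi (snd p)) ` (U \<times> U)"
 define W where "W = Sup S"
 have U0: "0 \<in> U" using V by (simp add: U_def subspace_0 sform_simps[OF sq])
 have lb': "bt 0 = 0" "bt (- x) = - bt x" "bt (c *R x) = c * bt x" for x c
  using lb by (simp_all add: linear_0 linear_neg linear_cmul)
 have SD: "x <= 2 * D" if xS: "x \<in> S" for x proof -
  obtain u w where "u \<in> U" "w \<in> U" "x = phi u - phi w" using xS by (auto simp: S_def)
  thus ?thesis using D[of u] D[of w] unfolding U_def by fastforce
 qed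
 have bdd: "bdd_above S" using SD by (auto simp: bdd_above_def)
 have up: "phi u - phi w <= W" if "u \<in> U" "w \<in> U" for u w
  unfolding W_def by (rule cSup_upper[OF _ bdd]) (use that in \<open>auto simp: S_def intro!: image_eqI[of _ _ "(u, w)"]\<close>)
 have S0: "0 \<in> S" using U0 by (auto simp: S_def intro!: image_eqI[of _ _ "(0, 0)"])
 have W0: "0 <= W" using up[OF U0 U0] by simp
 have WD: "W <= 2 * D" unfolding W_def by (rule cSup_least) (use S0 SD in auto)
 have neg: "- u \<in> U" if "u \<in> U" for u using that V by (auto simp: U_def subspace_neg sform_simps[OF sq])
 have ab: "\<bar>phi u\<bar> <= W" if "u \<in> U" for u using up[OF that U0] up[OF U0 that] by (simp add: sform_simps[OF sa] lb')
 have aW: "\<bar>a u u\<bar> <= W" if "u \<in> U" for u using ab[OF that] ab[OF neg[OF that]] by (simp add: sform_simps[OF sa] lb')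
 have bW: "\<bar>bt u\<bar> <= W / 2" if "u \<in> U" for u
  using up[OF that neg[OF that]] up[OF neg[OF that] that] by (simp add: sform_simps[OF sa] lb')
 define om where "om = W / r\<^sup>2"
 have wr: "om * r\<^sup>2 = W" using r by (simp add: om_def)
 have om0: "0 <= om" using W0 by (simp add: om_def)
 have sc: "(r / sqrt (q u u)) *R u \<in> U" "0 < sqrt (q u u)" "sqrt (q u u) * sqrt (q u u) = q u u" if "u \<in> V" "u ~= 0" for u
 proof -
  show p: "0 < sqrt (q u u)" using pd[OF that] by simp
  show s: "sqrt (q u u) * sqrt (q u u) = q u u" using q_nonneg[OF that(1)] by simp
  have "r / sqrt (q u u) * (r / sqrt (q u u) * q u u) = r\<^sup>2" using p s by (simp add: power2_eq_square)
  thus "(r / sqrt (q u u)) *R u \<in> U" using that V by (simp add: U_def subspace_scale sform_simps[OF sq])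
 qed
 have bb: "\<bar>bt u\<bar> <= om * r / 2 * sqrt (q u u)" if u: "u \<in> V" for u proof (cases "u = 0")
  case True
  thus ?thesis using sq by (simp add: lb' sform_simps)
 next
  case False
  have p: "0 < sqrt (q u u)" by (rule sc(2)[OF u False])
  have "\<bar>r / sqrt (q u u) * bt u\<bar> <= W / 2" using bW[OF sc(1)[OF u False]] by (simp only: lb')
  hence "r / sqrt (q u u) * \<bar>bt u\<bar> <= W / 2" using p r by (simp add: abs_mult)
  moreover have "0 < r / sqrt (q u u)" using p r by (rule divide_pos_pos[rotated])
  ultimately have "\<bar>bt u\<bar> <= W / 2 / (r / sqrt (q u u))" by (subst pos_le_divide_eq) (simp_all only: mult.commute)
  also have "... = om * r / 2 * sqrt (q u u)" using r by (simp add: om_def power2_eq_square)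
  finally show ?thesis .
 qed
 have aa: "\<bar>a u u\<bar> <= om * q u u" if u: "u \<in> V" for u proof (cases "u = 0")
  case True
  thus ?thesis using sq sa by (simp add: sform_simps)
 next
  case False
  have p: "0 < sqrt (q u u)" by (rule sc(2)[OF u False])
  let ?t = "r / sqrt (q u u)"
  have "\<bar>?t * (?t * a u u)\<bar> <= W" using aW[OF sc(1)[OF u False]] by (simp only: sform_simps[OF sa])
  hence "?t * ?t * \<bar>a u u\<bar> <= W" using p r by (simp add: abs_mult)
  moreover have "0 < ?t * ?t" by (rule mult_pos_pos; rule divide_pos_pos[OF r p])
  ultimately have "\<bar>a u u\<bar> <= W / (?t * ?t)" by (subst pos_le_divide_eq) (simp_all only: mult.commute)
  also have "... = om * (sqrt (q u u) * sqrt (q u u))" using r by (simp add: om_def power2_eq_square)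
  finally show ?thesis using sc(3)[OF u False] by simp
 qed
 have ba: "\<bar>a u w\<bar> <= om * (sqrt (q u u) * sqrt (q w w))" if u: "u \<in> V" and w: "w \<in> V" for u w
 proof (cases "u = 0 \<or> w = 0")
  case True
  thus ?thesis using sq sa by (auto simp: sform_simps)
 next
  case False
  hence p: "0 < sqrt (q u u)" "0 < sqrt (q w w)" using sc(2) u w by auto
  define x where "x = (1 / sqrt (q u u)) *R u"
  define y where "y = (1 / sqrt (q w w)) *R w"
  have xy: "x \<in> V" "y \<in> V" using V u w by (auto simp: x_def y_def subspace_scale)
  have q1: "q x x = 1" "q y y = 1"
   using p q_nonneg[OF u] q_nonneg[OF w] by (auto simp: x_def y_def sform_simps[OF sq])
  have pol: "4 * a x y = a (x + y) (x + y) - a (x - y) (x - y)"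
   using sform_sym[OF sa, of y x] by (simp add: sform_simps[OF sa])
  have "q (x + y) (x + y) + q (x - y) (x - y) = 4" using q1 by (simp add: sform_simps[OF sq])
  hence "om * q (x + y) (x + y) + om * q (x - y) (x - y) = 4 * om" by (metis distrib_left mult.commute)
  hence "\<bar>a x y\<bar> <= om" using pol aa[OF subspace_add[OF V xy]] aa[OF subspace_diff[OF V xy]] by linarith
  moreover have "a u w = a x y * (sqrt (q u u) * sqrt (q w w))" using p by (simp add: x_def y_def sform_simps[OF sa])
  ultimately show ?thesis using p by (simp add: abs_mult)
 qed
 have "EX u:V. EX w:V. q u u <= r\<^sup>2 & q w w <= r\<^sup>2 & 7 / 8 * W <= phi u - phi w" proof (cases "W = 0")
  case True
  thus ?thesis using U0 by (auto simp: U_def intro!: bexI[of _ 0])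
 next
  case False
  hence "7 / 8 * W < Sup S" using W0 by (simp add: W_def[symmetric])
  then obtain x where "x \<in> S" "7 / 8 * W < x" using less_cSupD[of S "7 / 8 * W"] S0 by auto
  thus ?thesis unfolding S_def U_def by fastforce
 qed
 thus ?thesis using om0 aa ba bb WD ab unfolding dominates_def by (intro exI[of _ om]) (simp add: wr U_def)
qed

text \<open>The difference of the quadratic parts is \<open>a (u - w) (u + w)\<close>, and
  \<open>u + w\<close> has norm at most \<open>2 * r\<close>.\<close>

lemma phi_lipschitz:
 assumes d: "dominates a q bt V r om" and u: "u \<in> V" "q u u <= r\<^sup>2" and w: "w \<in> V" "q w w <= r\<^sup>2"
 shows "\<bar>phi u - phi w\<bar> <= 5 / 2 * (om * r) * sqrt (q (u - w) (u - w))"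
proof -
 have uw: "u - w \<in> V" "u + w \<in> V" using V u w by (auto simp: subspace_diff subspace_add)
 have "phi u - phi w = a (u - w) (u + w) + bt (u - w)"
  using sform_sym[OF sa, of w u] lb by (simp add: sform_simps[OF sa] linear_diff)
 hence "\<bar>phi u - phi w\<bar> <= \<bar>a (u - w) (u + w)\<bar> + \<bar>bt (u - w)\<bar>" by linarith
 also have "... <= om * (sqrt (q (u - w) (u - w)) * sqrt (q (u + w) (u + w))) + om * r / 2 * sqrt (q (u - w) (u - w))"
  using d uw unfolding dominates_def by (intro add_mono) auto
 also have "sqrt (q (u + w) (u + w)) <= sqrt (q u u) + sqrt (q w w)"
  by (rule sform_triangle[OF sq V q_nonneg u(1) w(1)])
 also have "... <= 2 * r" using real_le_lsqrt[OF _ u(2)] real_le_lsqrt[OF _ w(2)] r by simp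
 also have "om * (sqrt (q (u - w) (u - w)) * (2 * r)) + om * r / 2 * sqrt (q (u - w) (u - w)) =
   5 / 2 * (om * r) * sqrt (q (u - w) (u - w))" by simp
 finally show ?thesis using d q_nonneg[OF uw(1)] by (simp add: dominates_def mult_left_mono)
qed

text \<open>Pulling \<open>y\<close> towards the centre by the factor \<open>1 - \<eta>\<close>
  makes room for a displacement of length \<open>\<eta> * r\<close>.\<close>

lemma shrink:
 assumes y: "y \<in> V" "q y y <= r\<^sup>2" and d: "d \<in> V" "q d d <= (\<eta> * r)\<^sup>2" and \<eta>: "0 <= \<eta>" "\<eta> <= 1"
 defines "x == (1 - \<eta>) *R y + d"
 shows "x \<in> V" and "q x x <= r\<^sup>2" and "sqrt (q (x - y) (x - y)) <= 2 * \<eta> * r"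
proof -
 let ?n = "%u. sqrt (q u u)"
 have ny: "?n y <= r" using y r by (intro real_le_lsqrt) auto
 have nd: "?n d <= \<eta> * r" using d r \<eta> by (intro real_le_lsqrt) auto
 have ns: "?n (c *R y) = \<bar>c\<bar> * ?n y" for c by (simp add: sform_simps[OF sq] mult.assoc[symmetric] real_sqrt_mult)
 have tri: "?n (c *R y + d) <= \<bar>c\<bar> * r + \<eta> * r" for c
  using sform_triangle[OF sq V q_nonneg subspace_scale[OF V y(1)] d(1), of c] ns[of c] nd
   mult_left_mono[OF ny, of "\<bar>c\<bar>"] by simp
 show xV: "x \<in> V" unfolding x_def using V y d by (simp add: subspace_add subspace_scale)
 have "?n x <= \<bar>1 - \<eta>\<bar> * r + \<eta> * r" unfolding x_def by (rule tri)
 hence "?n x <= r" using \<eta> by (simp add: algebra_simps)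
 thus "q x x <= r\<^sup>2" using sqrt_le_D by blast
 have "x - y = (- \<eta>) *R y + d" by (simp add: x_def algebra_simps)
 thus "?n (x - y) <= 2 * \<eta> * r" using tri[of "- \<eta>"] \<eta> by simp
qed

text \<open>\<open>trust_region\<close> with its real parameters replaced by powers of two over
  \<open>2 ^ E\<close>. The choice \<open>ka = 1 / (12 * K)\<close> turns the error
  \<open>3 * ka\<close> into \<open>1 / (4 * K)\<close>. The index \<open>l\<close> stays polynomial
  because the unknown scale \<open>om\<close> cancels between the range \<open>3 * om\<close> of the
  multipliers and their spacing.\<close>

lemma slice_minimum:
 fixes g :: "nat => 'v" and K :: nat and T :: real
 assumes d: "dominates a q bt V r om" and g: "!!i. i < N ==> g i \<in> V & 1 <= q (g i) (g i) & q (g i) (g i) <= T\<^sup>2"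
  and par: "!!u. u \<in> V ==> q u u <= (\<Sum>i<N. (q (g i) u)\<^sup>2 / q (g i) (g i))"
  and nz: "EX u:V. u ~= 0"
  and solv: "!!lam bt'. linear bt' ==> (!!u. u \<in> V ==> u ~= 0 ==> 0 < a u u + lam * q u u) ==>
    EX y:V. ALL v:V. a y v + lam * q y v = - bt' v / 2"
  and K: "1 <= K" "real K <= T" and N: "real N <= T" and T: "1 <= T"
  and rT: "1 / T ^ 2 <= r" "r <= T" and wT: "1 / T ^ 3 <= om" "om <= 24 * T ^ 9"
  and E: "(10 * T) ^ 10 <= 2 ^ E"
 shows "EX i k l k'. EX \<sigma>:{1, - 1}. i < N & k <= 2 * E & k' <= 2 * E & l <= 995328 * N * K ^ 3 &
  posq V a q (real l * (2 ^ k' / 2 ^ E)) &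
  opts V a q bt (real l * (2 ^ k' / 2 ^ E)) (%v. bt v + \<sigma> * (2 ^ k / 2 ^ E) * q (g i) v) r (om * r\<^sup>2 / (4 * real K))"
proof -
 have T0: "0 < T" using T by simp
 have om: "0 < om"  proof -
  have "0 < 1 / T ^ 3" using T0 by simp
  thus ?thesis using wT(1) by linarith
 qed
 have dm: "!!u v. u \<in> V ==> v \<in> V ==> \<bar>a u v\<bar> <= om * (sqrt (q u u) * sqrt (q v v))"
  "!!u. u \<in> V ==> \<bar>bt u\<bar> <= om * r / 2 * sqrt (q u u)" using d by (auto simp: dominates_def)
 have gV: "g i \<in> V & g i ~= 0" if "i < N" for i using g[OF that] by (auto simp: sform_simps[OF sq])
 define ka where "ka = 1 / (12 * real K)"
 have ka: "0 < ka" "ka <= 1 / 4" using K by (auto simp: ka_def field_simps)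
 obtain u1 where u1: "u1 \<in> V" "u1 ~= 0" using nz by blast
 have N0: "0 < N" proof (rule ccontr)
  assume "~ ?thesis" hence "q u1 u1 <= 0" using par[OF u1(1)] by simp
  thus False using pd[OF u1] by simp
 qed
 have E2: "1 <= (2::real) ^ E" by simp
 have pw: "T ^ i <= T ^ 10" if "i <= 10" for i using T that by (intro power_increasing) auto
 \<comment> \<open>\<open>165888 = 12^3 * 96\<close>, from the lower bound on the spacing at
   \<open>ka >= 1 / (12 * T)\<close>.\<close>
 have E': "165888 * T ^ 10 <= 2 ^ E" proof -
  have "0 <= T ^ 10" using T0 by simp
  moreover have "10000000000 * T ^ 10 <= 2 ^ E" using E by (simp add: power_mult_distrib)
  ultimately show ?thesis by linarith
 qed
 have gi: "1 <= sqrt (q (g i) (g i))" "sqrt (q (g i) (g i)) <= T" if "i < N" for i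
  using g[OF that] T0 by (auto intro: real_le_lsqrt)
 obtain i where i: "i < N" and tr1: "ALL ta0>0. ka * om * r / 2 <= ta0 * sqrt (q (g i) (g i)) & ta0 * sqrt (q (g i) (g i)) <= ka * om * r -->
  (EX ta:{ta0, - ta0}. trs V a q bt (%v. bt v + ta * q (g i) v) r ka om N)" (is "?P i")
 proof -
  assume t: thesis if "i < N" "?P i" for i
  have "EX i<N. ?P i" by (rule trust_region[where a=a and q=q and bt=bt and V=V and g=g and N=N and ka=ka and r=r and om=om,
      OF V sa sq lb _ _ _ om r _ _ nz _ ka]) (fact pd dm gV par solv)+
  thus thesis using t by (elim exE conjE)
 qed
 let ?G = "sqrt (q (g i) (g i))"
 have G: "1 <= ?G" "?G <= T" using gi[OF i] by auto
 define A where "A = ka * om * r * 2 ^ E / ?G"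
 define S where "S = ka ^ 3 * om / (96 * real N) * 2 ^ E"
 have A1: "1 <= A" proof -
  have h: "1 / (12 * T) * (1 / T ^ 3) * (1 / T ^ 2) <= ka * om * r"
   unfolding ka_def using K T0 wT rT om r by (intro mult_mono divide_left_mono) auto
  have "1 / (12 * T) * (1 / T ^ 3) * (1 / T ^ 2) * (165888 * T ^ 10) <= ka * om * r * 2 ^ E"
   by (rule mult_mono[OF h E']) (use T0 ka om r in auto)
  moreover have "1 / (12 * T) * (1 / T ^ 3) * (1 / T ^ 2) * (165888 * T ^ 10) = 13824 * T ^ 4" proof -
   show ?thesis using T0 by (simp add: divide_simps flip: power_add power_Suc power_Suc2)
  qed
  moreover have "T <= T ^ 4" using power_increasing[of 1 4 T] T by simp
  ultimately have "?G <= ka * om * r * 2 ^ E" using G(2) T0 by linarith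
  thus ?thesis using G(1) by (simp add: A_def)
 qed
 have S1: "1 <= S" proof -
  have h: "(1 / (12 * T)) ^ 3 * (1 / T ^ 3) / (96 * T) <= ka ^ 3 * om / (96 * real N)"
   unfolding ka_def using K T0 wT N N0 om by (intro frac_le mult_mono power_mono divide_left_mono) auto
  have "(1 / (12 * T)) ^ 3 * (1 / T ^ 3) / (96 * T) * (165888 * T ^ 10) <= S"
   unfolding S_def by (rule mult_mono[OF h E']) (use T0 ka om in auto)
  moreover have "(1 / (12 * T)) ^ 3 * (1 / T ^ 3) / (96 * T) * (165888 * T ^ 10) = T ^ 3" proof -
   show ?thesis using T0 by (simp add: divide_simps power_divide power_mult_distrib flip: power_add power_Suc power_Suc2)
  qed
  moreover have "1 <= T ^ 3" using T by simp
  ultimately show ?thesis by linarith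
 qed
 have up: "24 * T ^ 10 <= 2 ^ E"  proof -
  have "0 <= T ^ 10" using T0 by simp
  thus ?thesis using E' by linarith
 qed
 have wr: "om * r <= 24 * T ^ 10" proof -
  have "om * r <= 24 * T ^ 9 * T" using wT rT r T0 by (intro mult_mono) auto
  also have "... = 24 * T ^ 10" by (simp add: power_numeral_reduce)
  finally show ?thesis .
 qed
 have A2: "A <= 2 ^ (2 * E)" proof -
  have "ka * (om * r) <= 1 * 2 ^ E" using wr up ka om r by (intro mult_mono) auto
  hence "ka * om * r * 2 ^ E <= 2 ^ E * 2 ^ E" by (simp add: mult.assoc)
  moreover have "ka * om * r * 2 ^ E / ?G <= ka * om * r * 2 ^ E / 1" using G ka om r by (intro divide_left_mono) auto
  ultimately have "A <= 2 ^ E * 2 ^ E" unfolding A_def by linarith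
  thus ?thesis by (simp add: mult_2 power_add)
 qed
 have S2: "S <= 2 ^ (2 * E)" proof -
  have "T ^ 9 <= T ^ 10" by (rule pw) simp
  hence w: "om <= 2 ^ E" using wT(2) up by linarith
  have "ka ^ 3 <= 1" using ka by (intro power_le_one) auto
  hence "ka ^ 3 * om <= 1 * 2 ^ E" using w om ka by (intro mult_mono) auto
  moreover have "ka ^ 3 * om / (96 * real N) <= ka ^ 3 * om / 1" using N0 ka om by (intro divide_left_mono) auto
  ultimately have "ka ^ 3 * om / (96 * real N) <= 2 ^ E" by linarith
  hence "S <= 2 ^ E * 2 ^ E" unfolding S_def by (intro mult_right_mono) auto
  thus ?thesis by (simp add: mult_2 power_add)
 qed
 obtain k where k: "2 ^ k <= A" "A < 2 * 2 ^ k" using pow2_between[OF A1] by blast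
 obtain k' where k': "2 ^ k' <= S" "S < 2 * 2 ^ k'" using pow2_between[OF S1] by blast
 have "(2::real) ^ k <= 2 ^ (2 * E)" "(2::real) ^ k' <= 2 ^ (2 * E)" using k(1) A2 k'(1) S2 by linarith+
 hence kE: "k <= 2 * E" "k' <= 2 * E" by (simp_all add: power_le_imp_le_exp[of "2::real"])
 let ?t = "2 ^ k / 2 ^ E :: real" let ?s = "2 ^ k' / 2 ^ E :: real"
 have G0: "0 < ?G" using G by linarith
 have AG: "A * ?G = ka * om * r * 2 ^ E" using G0 by (simp add: A_def)
 have t1: "?t * ?G <= ka * om * r" proof -
  have "2 ^ k * ?G <= ka * om * r * 2 ^ E" using mult_right_mono[OF k(1), of ?G] G0 AG by linarith
  thus ?thesis by (simp add: pos_divide_le_eq)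
 qed
 have t2: "ka * om * r / 2 <= ?t * ?G" proof -
  have "A * ?G <= 2 * 2 ^ k * ?G" using k(2) G0 by (intro mult_right_mono) auto
  hence "A * ?G / 2 <= 2 ^ k * ?G" by simp
  hence "ka * om * r / 2 * 2 ^ E <= 2 ^ k * ?G" unfolding AG by simp
  thus ?thesis by (simp add: pos_le_divide_eq)
 qed
 have "EX ta:{?t, - ?t}. trs V a q bt (%v. bt v + ta * q (g i) v) r ka om N"
  by (rule tr1[rule_format]) (use t1 t2 in auto)
 then obtain ta where ta: "ta \<in> {?t, - ?t}" and ts: "trs V a q bt (%v. bt v + ta * q (g i) v) r ka om N" by (rule bexE)
 have s1: "?s <= ka ^ 3 * om / (96 * real N)" using k'(1) by (simp add: S_def pos_divide_le_eq)
 have s2: "ka ^ 3 * om / (96 * real N) <= 2 * ?s" proof -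
  have "ka ^ 3 * om / (96 * real N) * 2 ^ E <= 2 * 2 ^ k'" using k'(2) by (simp only: S_def)
  thus ?thesis by (simp add: pos_le_divide_eq)
 qed
 have "EX l::nat. real l * ?s <= 3 * om & posq V a q (real l * ?s) &
    (opts V a q bt (real l * ?s) (%v. bt v + ta * q (g i) v) r (3 * ka * (om * r\<^sup>2)))"
  by (rule ts[rule_format]) (use s1 in auto)
 then obtain l :: nat where l: "real l * ?s <= 3 * om" "posq V a q (real l * ?s)"
  "opts V a q bt (real l * ?s) (%v. bt v + ta * q (g i) v) r (3 * ka * (om * r\<^sup>2))" by (elim exE conjE)
 \<comment> \<open>\<open>995328 = 6 * 96 * 12^3\<close>: the 6 is twice the multiplier range, since
   \<open>?s\<close> may be half the permitted spacing.\<close>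
 have ll: "l <= 995328 * N * K ^ 3" proof -
  have "real l * (ka ^ 3 * om / (96 * real N)) <= real l * (2 * ?s)" by (rule mult_left_mono[OF s2]) simp
  hence "real l * (ka ^ 3 * om / (96 * real N)) <= 6 * om" using l(1) by linarith
  hence "(real l * (ka ^ 3 / (96 * real N))) * om <= 6 * om" by (simp add: mult_ac)
  hence "real l * (ka ^ 3 / (96 * real N)) <= 6" using om by (rule mult_right_le_imp_le)
  hence "real l * ka ^ 3 <= 6 * (96 * real N)" using N0 by (simp add: pos_divide_le_eq)
  moreover have "real l * ka ^ 3 = real l / (1728 * real K ^ 3)" by (simp add: ka_def power_divide power_mult_distrib)
  ultimately have "real l <= 6 * (96 * real N) * (1728 * real K ^ 3)" using K by (simp add: pos_divide_le_eq)
  hence "real l <= real (995328 * N * K ^ 3)" by simp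
  thus ?thesis by (simp only: of_nat_le_iff)
 qed
 have k3: "3 * ka * (om * r\<^sup>2) = om * r\<^sup>2 / (4 * real K)" by (simp add: ka_def)
 obtain \<sigma> :: real where \<sigma>: "\<sigma> \<in> {1, - 1}" "ta = \<sigma> * ?t" proof (cases "ta = ?t")
  case True
  thus ?thesis using that[of 1] by simp
 next
  case False
  thus ?thesis using that[of "- 1"] ta by simp
 qed
 show ?thesis
  by (rule exI[of _ i], rule exI[of _ k], rule exI[of _ l], rule exI[of _ k'], rule bexI[OF _ \<sigma>(1)], intro conjI i kE ll l(2) l(3)[unfolded k3 \<sigma>(2)])
qed

end

text \<open>The point for one tuple of guesses: the closest point of the slice plus the stationary
  point shrunk by \<open>1 - 1 / KK\<close>, with the free lattice coordinates
  \<open>m, ..., N - 1\<close> rounded at the end.\<close>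

definition cand :: "nat => nat => imat => ivec => imat => imat =>
  int => ivec => nat => nat => int => nat => nat => nat => imat" where
 "cand n m Hm hv B G KK Z N E sg i k l k' =
  bab n G N (%_. 0) (x1 n N KK Z (ysol (tmat n Hm hv B G Z N E sg i k l k') N sg)) (N - m)"

lemma ysol_pos: "0 < ysol M N sg N" by (simp add: ysol_def)

lemma x1_pos: "0 < Z n ==> 0 < KK ==> 0 < Y N ==> 0 < x1 n N KK Z Y n" by (simp add: x1_def)

lemma x1_co:
 assumes "0 < Z n" "0 < KK" "0 < Y N" "l < n"
 shows "co n (x1 n N KK Z Y) l = co n Z l + (if l < N then (1 - 1 / of_int KK) * (of_int (Y l) / (2 * of_int (Z n) * of_int (Y N))) else 0)"
 using assms by (simp add: co_def x1_def field_simps)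

lemma x1_xv:
 assumes p: "0 < Z n" "0 < KK" "0 < Y N" and N: "N <= n"
 shows "xv n v (x1 n N KK Z Y) = xv n v Z +
  (1 - 1 / of_int KK) *R (\<Sum>l<N. (of_int (Y l) / (2 * of_int (Z n) * of_int (Y N))) *R v l)"
proof -
 let ?y = "%l. of_int (Y l) / (2 * of_int (Z n) * of_int (Y N)) :: real"
 let ?k = "1 - 1 / of_int KK :: real"
 have "xv n v (x1 n N KK Z Y) = (\<Sum>l<n. co n Z l *R v l + (if l < N then (?k * ?y l) *R v l else 0))"
  unfolding xv_def by (rule sum.cong[OF refl]) (simp add: x1_co[where Z=Z and Y=Y and N=N and n=n and KK=KK, OF p] scaleR_add_left)
 also have "... = xv n v Z + (\<Sum>l<n. if l < N then (?k * ?y l) *R v l else 0)" by (simp only: sum.distrib xv_def)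
 also have "(\<Sum>l<n. if l < N then (?k * ?y l) *R v l else 0) = (\<Sum>l<N. (?k * ?y l) *R v l)"
  by (rule sum.mono_neutral_cong_right) (use N in auto)
 also have "... = ?k *R (\<Sum>l<N. ?y l *R v l)" by (simp add: scaleR_sum_right)
 finally show ?thesis .
qed

lemma xout_xv: "xv n (%k. vn n (B k)) X = (1 / of_int (X n)) *R vn n (xout n B X)"
proof
 fix l
 show "xv n (%k. vn n (B k)) X l = ((1 / of_int (X n)) *R vn n (xout n B X)) l"
  by (simp add: xv_def fun_sum_apply vn_def xout_def co_def sum_divide_distrib)
qed

section \<open>Candidates on a slice\<close>

context core
begin

lemma sa: "sform (bf n Hm)" by (rule sform_bf[OF sH])

lemma hl_linear: "linear hl"
 by (rule linearI) (simp_all add: hl_def distrib_left sum.distrib sum_distrib_left mult_ac)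

text \<open>The linear part of the objective in the expansion around the base point of the
  slice.\<close>

definition beta :: "ivec => nat => (nat => real) => real" where
 "beta s N u = 2 * bf n Hm (z s N) u + hl u"

lemma beta_linear: "linear (beta s N)"
 using hl_linear by (intro linearI) (simp_all add: beta_def sform_simps[OF sa] linear_add linear_cmul algebra_simps)

lemma fo_split: "fo (z s N + u) = fo (z s N) + (bf n Hm u u + beta s N u)"
 using sform_sym[OF sa, of u "z s N"] hl_linear by (simp add: fo_def beta_def sform_simps[OF sa] linear_add)

text \<open>By Pythagoras (\<open>z_split\<close>) the slice meets the ellipsoid in a ball of this
  squared radius around its base point.\<close>

definition rr :: "ivec => nat => real" where
 "rr s N = of_int P - nq (z s N - ctr)"

abbreviation cnd :: "ivec => nat => nat => int => nat => nat => nat => imat" where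
 "cnd s N == cand n m Hm hv B G KK (zt s N) N"

lemma gsN: "N <= n ==> gsys q v g N" using gs by (simp add: gsys_def)

lemma xv_Vn: "xv n v X \<in> Vn n" unfolding Vn_sp xv_def by (rule sp_sum) simp

text \<open>These facts hold for every guess, even a meaningless one; this is why integrality is not
  among the properties that the program tests.\<close>

lemma cand_facts:
 fixes s :: ivec and sg :: int and N E i k l k' :: nat
 assumes N: "m <= N" "N <= n"
 defines "Y == ysol (tmat n Hm hv B G (zt s N) N E sg i k l k') N sg"
 shows "0 < cnd s N E sg i k l k' n"
  and "l' < n - m ==> xv n v (cnd s N E sg i k l k') l' \<in> \<int>"
  and "EX ta. (ALL j. \<bar>ta j\<bar> <= 1 / 2) & xv n v (cnd s N E sg i k l k') = z s N +
   ((1 - 1 / of_int KK) *R (\<Sum>l<N. (of_int (Y l) / (2 * of_int (zt s N n) * of_int (Y N))) *R v l)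
    + (\<Sum>j\<in>{m..<N}. ta j *R g j))"
proof -
 let ?X1 = "x1 n N KK (zt s N) Y" let ?X = "cnd s N E sg i k l k'"
 have KKp: "0 < KK" using KK40 by simp
 have Yp: "0 < Y N" unfolding Y_def by (rule ysol_pos)
 note Zp = zt_pos[OF N(2), of s]
 have X1: "0 < ?X1 n" by (rule x1_pos[where Z="zt s N" and n=n and Y=Y and N=N and KK=KK, OF Zp KKp Yp])
 have X: "?X = bab n G N (%_. 0) ?X1 (N - m)" by (simp add: cand_def Y_def)
 have t: "N - m <= N" by simp
 show "0 < ?X n" unfolding X by (rule bab_pos[where X="?X1" and n=n, OF X1 dpos' N(2) t])
 have "co n ?X k \<in> \<int>" if k: "m <= k" "k < n" for k proof (cases "k < N")
  case True
  thus ?thesis unfolding X using k N by (intro bab_int[where X="?X1" and n=n, OF X1 dpos' N(2) t]) auto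
 next
  case False
  hence "co n ?X k = co n ?X1 k"
   unfolding X using k by (intro bab_high[where X="?X1" and n=n, OF X1 dpos' N(2) t]) auto
  also have "... = co n (zt s N) k" using x1_co[where Z="zt s N" and n=n and Y=Y and N=N and KK=KK, OF Zp KKp Yp k(2)] False by simp
  also have "... \<in> \<int>" using z_int[OF N(2), of k s] False k by simp
  finally show ?thesis .
 qed
 thus "l' < n - m ==> xv n v ?X l' \<in> \<int>" unfolding xv_def by (rule int_coords)
 have ex: "EX ta. xv n v ?X = xv n v ?X1 + (\<Sum>j\<in>{N - (N - m)..<N}. ta j *R gv G v j) &
  ((%_::nat. 0::int) = (%_. 0) --> (ALL j. \<bar>ta j\<bar> <= 1 / 2))"
  unfolding X by (rule bab_xv[where X="?X1" and n=n, OF X1 dpos' N(2) t])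
 then obtain ta where ta: "xv n v ?X = xv n v ?X1 + (\<Sum>j\<in>{m..<N}. ta j *R gv G v j)" "ALL j. \<bar>ta j\<bar> <= 1 / 2" using N by auto
 have "(\<Sum>j\<in>{m..<N}. ta j *R gv G v j) = (\<Sum>j\<in>{m..<N}. ta j *R g j)"
  by (rule sum.cong[OF refl]) (use N gs_gv[OF gs] in auto)
 thus "EX ta. (ALL j. \<bar>ta j\<bar> <= 1 / 2) & xv n v ?X = z s N +
   ((1 - 1 / of_int KK) *R (\<Sum>l<N. (of_int (Y l) / (2 * of_int (zt s N n) * of_int (Y N))) *R v l)
    + (\<Sum>j\<in>{m..<N}. ta j *R g j))"
  using ta x1_xv[where Z="zt s N" and n=n and Y=Y and N=N and KK=KK and v=v, OF Zp KKp Yp N(2)] by (intro exI[of _ ta]) (simp add: add.assoc)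
qed

text \<open>There are at most \<open>n - m\<close> orthogonal terms, each of squared norm at most
  \<open>rr s N\<close> over the square of \<open>(n - m + 1) * KK\<close>.\<close>

lemma leaf_shift:
 assumes N: "m <= N" "N <= n" and lf: "leaf s N" and r: "0 <= rr s N" and ta: "ALL j. \<bar>ta j\<bar> <= 1 / 2"
 shows "(\<Sum>j\<in>{m..<N}. ta j *R g j) \<in> sp v N"
  and "nq (\<Sum>j\<in>{m..<N}. ta j *R g j) <= (1 / of_int KK * sqrt (rr s N))\<^sup>2"
proof -
 show "(\<Sum>j\<in>{m..<N}. ta j *R g j) \<in> sp v N"
  using N by (intro subspace_sum sp_subspace subspace_scale gs_in'[OF sq gs]) auto
 let ?p = "real (n - m) + 1"
 have KKp: "0 < real_of_int KK" using KK40 by simp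
 have "nq (\<Sum>j\<in>{m..<N}. ta j *R g j) = (\<Sum>j\<in>{m..<N}. (ta j)\<^sup>2 * nq (g j))" using N by (intro gs_norm_comb[OF sq gs]) auto
 also have "... <= (\<Sum>j\<in>{m..<N}. 1 * (rr s N / (?p * of_int KK)\<^sup>2))" proof (rule sum_mono)
  fix j assume j: "j \<in> {m..<N}"
  have "(ta j)\<^sup>2 <= 1" using ta[rule_format, of j] by (simp add: abs_square_le_1)
  moreover have "nq (g j) <= rr s N / (?p * of_int KK)\<^sup>2"
   using lf j KKp by (simp add: leaf_def rr_def pos_le_divide_eq)
  ultimately show "(ta j)\<^sup>2 * nq (g j) <= 1 * (rr s N / (?p * of_int KK)\<^sup>2)"
   using gp[of j] j N by (intro mult_mono) auto
 qed
 also have "... = real (N - m) * rr s N / (?p\<^sup>2 * (of_int KK)\<^sup>2)" by (simp add: power_mult_distrib)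
 also have "... <= ?p\<^sup>2 * rr s N / (?p\<^sup>2 * (of_int KK)\<^sup>2)" proof -
  have "real (N - m) <= ?p" using N by simp
  also have "... <= ?p\<^sup>2" by (simp add: power2_eq_square)
  finally show ?thesis using r by (intro divide_right_mono mult_right_mono) auto
 qed
 also have "... = (1 / of_int KK * sqrt (rr s N))\<^sup>2" using r by (simp add: power_divide power_mult_distrib)
 finally show "nq (\<Sum>j\<in>{m..<N}. ta j *R g j) <= (1 / of_int KK * sqrt (rr s N))\<^sup>2" .
qed

lemma tmat_left:
 assumes "r < N" "j < N" "N <= n"
 shows "of_int (tmat n Hm hv B G Z N E sg i k l k' r j) =
  2 ^ E * (bf n Hm (v r) (v j) + real l * (2 ^ k' / 2 ^ E) * q (v r) (v j))"
 using assms by (simp add: tmat_def bf_vn GG distrib_left)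

lemma gn_gv: "i < n ==> (\<Sum>l<n. of_int (gn G i l) *R v l) = of_int (dlt G i) *R g i"
proof -
 assume i: "i < n"
 have "of_int (dlt G i) *R gv G v i = (\<Sum>l<n. of_int (gn G i l) *R v l)"
  using dpos[of i] i by (simp add: gv_extend[OF i] scaleR_sum_right)
 thus ?thesis using gs_gv[OF gs i] by simp
qed

lemma hl_v: "hl (v r) = of_int (lin n hv (B r))" by (simp add: hl_def lin_def vn_def)

text \<open>Clears the denominator of the base point. The integer on the left occurs in
  \<open>tmat\<close>, and its integrality later keeps the scale of the objective away from
  0.\<close>

lemma beta_v:
 assumes "N <= n"
 shows "of_int (2 * (\<Sum>j<n. zt s N j * gram n Hm (B r) (B j)) + zt s N n * lin n hv (B r)) = of_int (zt s N n) * beta s N (v r)"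
proof -
 have "bf n Hm (z s N) (v r) = (\<Sum>j<n. co n (zt s N) j * bf n Hm (v r) (v j))" proof -
  have "bf n Hm (z s N) (v r) = (\<Sum>j<n. co n (zt s N) j * bf n Hm (v j) (v r))"
   unfolding xv_def by (simp only: sform_sum[OF sa] sform_simps[OF sa])
  also have "... = (\<Sum>j<n. co n (zt s N) j * bf n Hm (v r) (v j))"
   by (rule sum.cong[OF refl]) (simp only: sform_sym[OF sa, of "v _" "v r"])
  finally show ?thesis .
 qed
 also have "... = (\<Sum>j<n. of_int (zt s N j) * of_int (gram n Hm (B r) (B j))) / of_int (zt s N n)"
  by (simp add: bf_vn co_def sum_divide_distrib)
 finally have e: "bf n Hm (z s N) (v r) * of_int (zt s N n) = (\<Sum>j<n. of_int (zt s N j) * of_int (gram n Hm (B r) (B j)))"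
  using zt_pos[OF assms, of s] by simp
 have "of_int (zt s N n) * beta s N (v r) = 2 * (bf n Hm (z s N) (v r) * of_int (zt s N n)) + of_int (zt s N n) * hl (v r)"
  by (simp add: beta_def algebra_simps)
 thus ?thesis unfolding e hl_v by simp
qed

lemma tmat_right:
 assumes r: "r < n" and N: "N <= n" and i: "i < n"
 shows "of_int (tmat n Hm hv B G (zt s N) N E sg i k l k' r N) =
  - (2 ^ E * of_int (zt s N n) * (beta s N (v r) + of_int sg * (2 ^ k / 2 ^ E) * q (of_int (dlt G i) *R g i) (v r)))"
proof -
 have "q (of_int (dlt G i) *R g i) (v r) = of_int (\<Sum>l<n. gn G i l * G l r)"
  unfolding gn_gv[OF i, symmetric] using r by (simp add: sform_sum[OF sq] sform_simps[OF sq] GG)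
 hence q: "of_int (\<Sum>l<n. gn G i l * G l r) = q (of_int (dlt G i) *R g i) (v r)" ..
 have "of_int (tmat n Hm hv B G (zt s N) N E sg i k l k' r N) =
  - (2 ^ E * of_int (2 * (\<Sum>j<n. zt s N j * gram n Hm (B r) (B j)) + zt s N n * lin n hv (B r))
   + of_int sg * of_int (zt s N n) * 2 ^ k * of_int (\<Sum>l<n. gn G i l * G l r))"
  by (simp add: tmat_def)
 also have "... = - (2 ^ E * (of_int (zt s N n) * beta s N (v r)) + of_int sg * of_int (zt s N n) * 2 ^ k * q (of_int (dlt G i) *R g i) (v r))"
  unfolding beta_v[OF N] q ..
 also have "... = - (2 ^ E * of_int (zt s N n) * (beta s N (v r) + of_int sg * (2 ^ k / 2 ^ E) * q (of_int (dlt G i) *R g i) (v r)))"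
  by (simp add: algebra_simps)
 finally show ?thesis .
qed

text \<open>The left block of \<open>tmat\<close> is \<open>2 ^ E\<close> times the Gram matrix of
  the Lagrangian, so the elimination succeeds for a convex guess. The equations for the basis
  vectors extend to the span by linearity.\<close>

lemma ysol_stationary:
 fixes s :: ivec and sg :: int and N E i k l k' :: nat
 defines "A == %l k' E u w. bf n Hm u w + real l * (2 ^ k' / 2 ^ E) * q u w"
 assumes N: "N <= n" and i: "i < n" and sg: "sg ~= 0"
  and pd: "!!u. u \<in> sp v N ==> u ~= 0 ==> 0 < A l k' E u u"
 defines "M == tmat n Hm hv B G (zt s N) N E sg i k l k'"
 defines "Y == ysol M N sg"
 defines "y == \<Sum>l<N. (of_int (Y l) / (2 * of_int (zt s N n) * of_int (Y N))) *R v l"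
 shows "y \<in> sp v N"
  and "w \<in> sp v N ==> A l k' E y w = - (beta s N w + of_int sg * (2 ^ k / 2 ^ E) * q (of_int (dlt G i) *R g i) w) / 2"
proof -
 let ?A = "A l k' E"
 have sA: "sform ?A" unfolding A_def by (rule sform_plus[OF sa sq])
 let ?b = "%u w. 2 ^ E * ?A u w"
 have sb: "sform ?b" using sA by (auto simp: sform_def algebra_simps)
 have Mb: "of_int (M r j) = ?b (v r) (v j)" if "r < N" "j < N" for r j
  unfolding M_def A_def using tmat_left[OF that N] by simp
 have "posdef M N" proof (rule gram_posdef[where q="?b" and v=v, OF sb _ _ Mb])
  show "u \<in> sp v N ==> u ~= 0 ==> 0 < ?b u u" for u using pd by simp
  show "(\<Sum>i<N. c i *R v i) = 0 ==> i < N ==> c i = 0" for c i by (rule gs_indep[OF sq gsN[OF N]])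
 qed
 hence d: "0 < dlt M N" by (rule dlt_posdef)
 have Yl: "Y l = bst M N N l N" if "l < N" for l using d sg that by (simp add: Y_def ysol_def)
 have YN: "Y N = dlt M N" using d sg by (simp add: Y_def ysol_def)
 have Zp: "0 < zt s N n" by (rule zt_pos[OF N])
 show "y \<in> sp v N" unfolding y_def by (rule sp_sum) simp
 let ?R = "%w. - (beta s N w + of_int sg * (2 ^ k / 2 ^ E) * q (of_int (dlt G i) *R g i) w) / 2"
 have r: "?A y (v r) = ?R (v r)" if r: "r < N" for r proof -
  have "?b y (v r) = (\<Sum>l<N. of_int (Y l) / (2 * of_int (zt s N n) * of_int (Y N)) * ?b (v l) (v r))"
   unfolding y_def by (simp only: sform_sum[OF sb] sform_simps[OF sb])
  also have "... = (\<Sum>l<N. of_int (Y l) / (2 * of_int (zt s N n) * of_int (Y N)) * ?b (v r) (v l))"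
   by (rule sum.cong[OF refl]) (simp only: sform_sym[OF sb, of "v _" "v r"])
  also have "... = of_int (\<Sum>l<N. M r l * bst M N N l N) / (2 * of_int (zt s N n) * of_int (Y N))"
   using Mb[OF r] Yl by (simp add: sum_divide_distrib mult.commute)
  also have "... = of_int (M r N) / (2 * of_int (zt s N n))" unfolding bst_sol[OF d r] YN using d by simp
  also have "... = 2 ^ E * ?R (v r)"
   unfolding M_def using tmat_right[OF less_le_trans[OF r N] N i] Zp by (simp add: field_simps)
  finally show ?thesis by simp
 qed
 have lin: "linear ?R"
  using beta_linear[of s N] by (intro linearI) (simp_all add: sform_simps[OF sq] linear_add linear_cmul field_simps)
 show "?A y w = ?R w" if w: "w \<in> sp v N" proof -
  obtain t where t: "w = (\<Sum>i<N. t i *R v i)" using sp_ex[OF w] by blast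
  have "?A y w = (\<Sum>i<N. t i * ?A y (v i))" unfolding t by (simp only: sform_sum2[OF sA] sform_simps[OF sA])
  also have "... = (\<Sum>i<N. t i * ?R (v i))" by (rule sum.cong[OF refl]) (simp only: lessThan_iff r)
  also have "... = ?R w" unfolding t linear_sum[OF lin] by (simp only: linear_cmul[OF lin] real_scaleR_def)
  finally show ?thesis .
 qed
qed

text \<open>Nearest-plane rounding for real coordinates. It is applied to points known only to the
  proof, whereas \<open>bab\<close> works on rational points given by integer tables.\<close>

lemma real_round:
 assumes "N <= n" "m <= N" "ALL k. N <= k --> k < n --> \<xi> k \<in> \<int>"
 shows "EX \<xi>' ta. (ALL k. m <= k --> k < n --> \<xi>' k \<in> \<int>) & (ALL j. \<bar>ta j\<bar> <= 1 / 2) &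
  (\<Sum>k<n. \<xi>' k *R v k) = (\<Sum>k<n. \<xi> k *R v k) + (\<Sum>j\<in>{m..<N}. ta j *R g j)"
 using assms
proof (induction "N - m" arbitrary: N \<xi>)
 case 0
 thus ?case by (intro exI[of _ \<xi>] exI[of _ "%_. 0"]) simp
next
 case (Suc d)
 define j where "j = N - 1"
 have j: "N = Suc j" "m <= j" "j < n" using Suc by (auto simp: j_def)
 let ?c = "of_int (round (\<xi> j)) - \<xi> j"
 obtain t where t: "g j - v j = (\<Sum>i<j. t i *R v i)" using sp_ex[OF gsD(1)[OF sq gs j(3)]] by blast
 have t': "(\<Sum>i<j. t i *R v i) = (\<Sum>i<n. (if i < j then t i else 0) *R v i)"
  by (rule sum.mono_neutral_cong_left) (use j in auto)
 have vj: "v j = (\<Sum>i<n. (if i = j then 1 else 0) *R v i)" using j by (simp add: if_distrib[of "%x. x *R _"] cong: if_cong)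
 have gj: "g j = (\<Sum>i<n. ((if i < j then t i else 0) + (if i = j then 1 else 0)) *R v i)" proof -
  have "g j = (g j - v j) + v j" by simp
  also have "... = (\<Sum>i<n. (if i < j then t i else 0) *R v i) + (\<Sum>i<n. (if i = j then 1 else 0) *R v i)"
   by (simp only: t t' vj[symmetric])
  finally show ?thesis by (simp only: scaleR_add_left sum.distrib)
 qed
 define \<xi>1 where "\<xi>1 i = \<xi> i + ?c * ((if i < j then t i else 0) + (if i = j then 1 else 0))" for i
 have s1: "(\<Sum>k<n. \<xi>1 k *R v k) = (\<Sum>k<n. \<xi> k *R v k) + ?c *R g j" proof -
  have "?c *R g j = (\<Sum>i<n. (?c * ((if i < j then t i else 0) + (if i = j then 1 else 0))) *R v i)"
   by (subst gj) (simp only: scaleR_sum_right scaleR_scaleR)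
  moreover have "(\<Sum>i<n. \<xi>1 i *R v i) = (\<Sum>k<n. \<xi> k *R v k) +
    (\<Sum>i<n. (?c * ((if i < j then t i else 0) + (if i = j then 1 else 0))) *R v i)"
   unfolding \<xi>1_def scaleR_add_left[of "\<xi> _"] by (rule sum.distrib)
  ultimately show ?thesis by (simp only:)
 qed
 have "ALL k. j <= k --> k < n --> \<xi>1 k \<in> \<int>" using Suc.prems(3) j(1) by (auto simp: \<xi>1_def)
 moreover have "d = j - m" "j <= n" using Suc.hyps(2) j by auto
 ultimately obtain \<xi>' ta where *: "ALL k. m <= k --> k < n --> \<xi>' k \<in> \<int>" "ALL j. \<bar>ta j\<bar> <= 1 / 2"
  "(\<Sum>k<n. \<xi>' k *R v k) = (\<Sum>k<n. \<xi>1 k *R v k) + (\<Sum>j\<in>{m..<j}. ta j *R g j)" using Suc.hyps(1)[of j \<xi>1] j(2) by auto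
 have c: "\<bar>?c\<bar> <= 1 / 2" using of_int_round_abs_le[of "\<xi> j"] .
 have "(\<Sum>i\<in>{m..<N}. (ta(j := ?c)) i *R g i) = (\<Sum>i\<in>{m..<j}. ta i *R g i) + ?c *R g j"
  unfolding j(1) using j(2) by (simp add: sum.atLeastLessThan_Suc)
 hence "(\<Sum>k<n. \<xi>' k *R v k) = (\<Sum>k<n. \<xi> k *R v k) + (\<Sum>i\<in>{m..<N}. (ta(j := ?c)) i *R g i)"
  using *(3) s1 by (simp only: ac_simps)
 moreover have "ALL i. \<bar>(ta(j := ?c)) i\<bar> <= 1 / 2" using *(2) c by simp
 ultimately show ?case using *(1) by blast
qed

text \<open>One number for all data. The denominators of slice points can be bounded uniformly in
  the offsets, because \<open>babstep\<close> changes them only by minors.\<close>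

definition bounded_by :: "real => bool" where
 "bounded_by T \<longleftrightarrow> 1 <= T & real n <= T & of_int K <= T & of_int P <= T & of_int (dq n a) <= T &
  (ALL i<n. ALL j<n. \<bar>of_int (Hm i j)\<bar> <= T) & (ALL i<n. \<bar>of_int (hv i)\<bar> <= T & \<bar>of_int (c i)\<bar> <= T & of_int (G i i) <= T) &
  (ALL i<=n. of_int (dlt G i) <= T) & (ALL s. ALL N<=n. of_int (zt s N n) <= T)"

section \<open>Quantitative bounds and existence of a good candidate\<close>

context
 fixes T :: real
 assumes T: "bounded_by T"
begin

lemma T1: "1 <= T" "0 < T" using T by (auto simp: bounded_by_def)

lemma coord_le:
 assumes x: "x \<in> Vn n" "nq (x - ctr) <= of_int P" and l: "l < n"
 shows "\<bar>x l\<bar> <= 2 * T"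
proof -
 have V: "x - ctr \<in> Vn n" by (rule subspace_diff[OF Vn_subspace x(1) ctr_Vn])
 have "((x - ctr) l)\<^sup>2 <= of_int (dq n a) * nq (x - ctr)" by (rule coord_bound[OF sy pdQ aQ a1 V l])
 also have "... <= T * T" using T x(2) nq_nonneg[OF V] T1 by (intro mult_mono) (auto simp: bounded_by_def)
 finally have "\<bar>(x - ctr) l\<bar> <= T" using T1 abs_le_square_iff[of "(x - ctr) l" T] by (simp add: power2_eq_square)
 moreover have "\<bar>ctr l\<bar> <= T" proof -
  have "\<bar>ctr l\<bar> = \<bar>of_int (c l)\<bar> / of_int P" using l P1 by (simp add: ctr_def vn_def)
  also have "... <= \<bar>of_int (c l)\<bar> / 1" using P1 by (intro divide_left_mono) auto
  finally show ?thesis using T l by (auto simp: bounded_by_def)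
 qed
 ultimately show ?thesis by simp
qed

lemma fo_le:
 assumes x: "x \<in> Vn n" "nq (x - ctr) <= of_int P"
 shows "\<bar>fo x\<bar> <= 6 * T ^ 5"
proof -
 note xl = coord_le[OF x]
 have nT: "real n <= T" "!!i j. i < n ==> j < n ==> \<bar>of_int (Hm i j)\<bar> <= T" "!!i. i < n ==> \<bar>of_int (hv i)\<bar> <= T"
  using T by (auto simp: bounded_by_def)
 have "\<bar>bf n Hm x x\<bar> <= (\<Sum>i<n. \<Sum>j<n. T * (2 * T) * (2 * T))" unfolding bf_def
 proof (intro order.trans[OF sum_abs] sum_mono)
  fix i j assume ij: "i \<in> {..<n}" "j \<in> {..<n}"
  show "\<bar>of_int (Hm i j) * x i * x j\<bar> <= T * (2 * T) * (2 * T)"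
   unfolding abs_mult using ij xl nT T1 by (intro mult_mono) auto
 qed
 also have "... = real n * (real n * (4 * T ^ 3))" by (simp add: power_numeral_reduce)
 also have "... <= T * (T * (4 * T ^ 3))" using nT(1) T1 by (intro mult_mono) auto
 also have "... = 4 * T ^ 5" by (simp add: power_numeral_reduce)
 finally have 1: "\<bar>bf n Hm x x\<bar> <= 4 * T ^ 5" .
 have "\<bar>hl x\<bar> <= (\<Sum>i<n. T * (2 * T))" unfolding hl_def proof (intro order.trans[OF sum_abs] sum_mono)
  fix i assume i: "i \<in> {..<n}"
  show "\<bar>of_int (hv i) * x i\<bar> <= T * (2 * T)" unfolding abs_mult using i xl nT T1 by (intro mult_mono) auto
 qed
 also have "... = real n * (2 * T ^ 2)" by (simp add: power2_eq_square)
 also have "... <= T * (2 * T ^ 2)" using nT(1) T1 by (intro mult_right_mono) auto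
 also have "... = 2 * T ^ 3" by (simp add: power_numeral_reduce)
 also have "... <= 2 * T ^ 5" using T1 power_increasing[of 3 5 T] by simp
 finally show ?thesis using 1 unfolding fo_def by linarith
qed

text \<open>Times the square of \<open>zt s N n * P\<close> the squared radius is an integer, so if
  it is positive it is at least 1.\<close>

lemma rr_lower:
 assumes N: "N <= n" and r: "0 < rr s N"
 shows "1 / T ^ 4 <= rr s N"
proof -
 let ?Z = "zt s N" let ?dz = "zt s N n"
 let ?w = "%l. P * xout n B ?Z l - ?dz * c l"
 have dz: "0 < ?dz" by (rule zt_pos[OF N])
 have "z s N - ctr = (1 / of_int (?dz * P)) *R vn n ?w" proof
  fix l show "(z s N - ctr) l = ((1 / of_int (?dz * P)) *R vn n ?w) l"
   using dz P1 unfolding xout_xv by (simp add: ctr_def vn_def field_simps)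
 qed
 hence "nq (z s N - ctr) = (1 / of_int (?dz * P))\<^sup>2 * of_int (gram n Q ?w ?w)"
  by (simp only: sform_simps[OF sq] bf_vn power2_eq_square mult.assoc)
 hence e: "rr s N * (of_int (?dz * P))\<^sup>2 = of_int (P * (?dz * P)\<^sup>2 - gram n Q ?w ?w)"
  using dz P1 by (simp add: rr_def power_divide field_simps)
 have "0 < rr s N * (of_int (?dz * P))\<^sup>2" using r dz P1 by simp
 hence "0 < P * (?dz * P)\<^sup>2 - gram n Q ?w ?w" unfolding e by (simp only: of_int_0_less_iff)
 hence 1: "1 <= rr s N * (of_int (?dz * P))\<^sup>2" unfolding e by (simp only: of_int_1_le_iff)
 have "of_int (?dz * P) <= T * T"
  unfolding of_int_mult using T dz P1 N T1 by (intro mult_mono) (auto simp: bounded_by_def)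
 hence "(of_int (?dz * P))\<^sup>2 <= (T * T)\<^sup>2" using dz P1 by (intro power_mono) auto
 also have "... = T ^ 4" by (simp add: power_numeral_reduce)
 finally have "rr s N * (of_int (?dz * P))\<^sup>2 <= rr s N * T ^ 4" using r by (intro mult_left_mono) auto
 thus ?thesis using 1 T1 by (simp add: pos_divide_le_eq)
qed

text \<open>If the objective is not constant on the slice, some integer
  \<open>gram n Hm (B i) (B j)\<close> or some numerator of \<open>beta s N (v i)\<close> is
  nonzero. It has absolute value at least 1, and \<open>om\<close> times known quantities bounds it
  from above.\<close>

lemma omega_lower:
 assumes N: "N <= n" and r: "0 < rr s N"
  and d: "dominates (bf n Hm) q (beta s N) (sp v N) (sqrt (rr s N)) om"
  and u: "u \<in> sp v N" "bf n Hm u u + beta s N u ~= 0"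
 shows "1 / T ^ 3 <= om"
proof -
 have d: "0 <= om" "!!u w. u \<in> sp v N ==> w \<in> sp v N ==> \<bar>bf n Hm u w\<bar> <= om * (sqrt (nq u) * sqrt (nq w))"
  "!!u. u \<in> sp v N ==> \<bar>beta s N u\<bar> <= om * sqrt (rr s N) / 2 * sqrt (nq u)" using d by (auto simp: dominates_def)
 have vT: "sqrt (nq (v i)) <= T" "0 <= nq (v i)" if "i < N" for i proof -
  have "nq (v i) = of_int (G i i)" using GG[of i i B] that N by simp
  also have "... <= T" using T that N by (simp add: bounded_by_def)
  finally have "nq (v i) <= T" .
  also have "... <= T\<^sup>2" using T1 by (simp add: power2_eq_square)
  finally show "sqrt (nq (v i)) <= T" using T1 by (intro real_le_lsqrt) auto
  show "0 <= nq (v i)" by (rule nq_nonneg) simp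
 qed
 have vN: "v i \<in> sp v N" if "i < N" for i by (rule sp_base[OF that])
 have dz: "0 < zt s N n" "of_int (zt s N n) <= T" using zt_pos[OF N, of s] T N by (auto simp: bounded_by_def)
 have rT: "sqrt (rr s N) <= T" proof -
  have "0 <= nq (z s N - ctr)" by (intro nq_nonneg subspace_diff[OF Vn_subspace] xv_Vn ctr_Vn)
  hence "rr s N <= of_int P" by (simp add: rr_def)
  also have "... <= T * 1" using T by (simp add: bounded_by_def)
  also have "... <= T * T" using T1 by (intro mult_left_mono) auto
  finally show ?thesis using T1 by (intro real_le_lsqrt) (auto simp: power2_eq_square)
 qed
 consider i j where "i < N" "j < N" "gram n Hm (B i) (B j) ~= 0" | i where "i < N" "beta s N (v i) ~= 0"
 proof (cases "EX i<N. EX j<N. gram n Hm (B i) (B j) ~= 0")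
  case False
  obtain t where t: "u = (\<Sum>i<N. t i *R v i)" using sp_ex[OF u(1)] by blast
  have "bf n Hm u u = (\<Sum>i<N. \<Sum>j<N. t i * (t j * bf n Hm (v j) (v i)))"
   unfolding t by (simp add: sform_sum[OF sa] sform_sum2[OF sa] sform_simps[OF sa] sum_distrib_left)
  also have "... = 0" using False by (simp add: bf_vn)
  finally have "beta s N u ~= 0" using u(2) by simp
  moreover have "beta s N u = (\<Sum>i<N. t i * beta s N (v i))"
   unfolding t linear_sum[OF beta_linear] by (simp only: linear_cmul[OF beta_linear] real_scaleR_def)
  ultimately obtain i where "i < N" "beta s N (v i) ~= 0" by (metis (no_types, lifting) lessThan_iff mult_zero_right sum.neutral)
  thus ?thesis by (rule that(2))
 qed (use that(1) in blast)
 thus ?thesis proof cases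
  case 1
  have "1 <= \<bar>gram n Hm (B i) (B j)\<bar>" using 1(3) by linarith
  hence "1 <= \<bar>bf n Hm (v i) (v j)\<bar>" unfolding bf_vn by linarith
  also have "... <= om * (sqrt (nq (v i)) * sqrt (nq (v j)))" by (rule d(2)[OF vN[OF 1(1)] vN[OF 1(2)]])
  also have "... <= om * (T * T)" using vT[OF 1(1)] vT[OF 1(2)] d(1) T1 by (intro mult_left_mono mult_mono) auto
  also have "... <= om * T ^ 3"
   using d(1) T1 power_increasing[of 2 3 T] by (intro mult_left_mono) (auto simp: power2_eq_square)
  finally show ?thesis using T1 by (simp add: pos_divide_le_eq)
 next
  case 2
  let ?k = "2 * (\<Sum>j<n. zt s N j * gram n Hm (B i) (B j)) + zt s N n * lin n hv (B i)"
  have e: "of_int ?k = of_int (zt s N n) * beta s N (v i)" by (rule beta_v[OF N])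
  have "real_of_int ?k ~= 0" unfolding e using 2(2) dz(1) by simp
  hence "1 <= \<bar>?k\<bar>" by (simp only: of_int_eq_0_iff)
  hence "1 <= \<bar>real_of_int ?k\<bar>" by linarith
  hence "1 <= of_int (zt s N n) * \<bar>beta s N (v i)\<bar>" unfolding e using dz(1) by (simp add: abs_mult)
  also have "... <= T * \<bar>beta s N (v i)\<bar>" using dz by (intro mult_right_mono) auto
  also have "... <= T * (om * sqrt (rr s N) / 2 * sqrt (nq (v i)))"
   using d(3)[OF vN[OF 2(1)]] T1 by (intro mult_left_mono) auto
  also have "... <= T * (om * T / 1 * T)"
   using vT[OF 2(1)] rT d(1) T1 r by (intro mult_left_mono mult_mono frac_le) auto
  also have "... = om * T ^ 3" by (simp add: power_numeral_reduce)
  finally show ?thesis using T1 by (simp add: pos_divide_le_eq)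
 qed
qed

lemma slice_shift:
 assumes N: "m <= N" "N <= n" and lf: "leaf s N" and r: "0 < rr s N"
  and y: "y \<in> sp v N" "nq y <= rr s N" and ta: "ALL j. \<bar>ta j\<bar> <= 1 / 2"
 defines "x == (1 - 1 / of_int KK) *R y + (\<Sum>j\<in>{m..<N}. ta j *R g j)"
 shows "x \<in> sp v N" and "nq x <= rr s N"
  and "sqrt (nq (x - y)) <= 2 * (1 / of_int KK) * sqrt (rr s N)"
  and "(!!l. l < n - m ==> (z s N + x) l \<in> \<int>) ==> z s N + x \<in> F"
proof -
 have pd: "0 < nq u" if "u \<in> sp v N" "u ~= 0" for u by (rule gs_pd[OF sq gs N(2) that])
 have r': "0 < sqrt (rr s N)" "(sqrt (rr s N))\<^sup>2 = rr s N" using r by auto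
 have y': "nq y <= (sqrt (rr s N))\<^sup>2" using y r' by simp
 have k: "0 <= 1 / real_of_int KK" "1 / real_of_int KK <= 1" using KK40 by auto
 note sh = shrink[where q=q and V="sp v N" and r="sqrt (rr s N)", OF sp_subspace sa sq beta_linear[of s N] pd r'(1) y(1) y'
  leaf_shift[OF N lf less_imp_le[OF r] ta] k]
 show xV: "x \<in> sp v N" unfolding x_def by (rule sh(1))
 show nx: "nq x <= rr s N" using sh(2) r'(2) unfolding x_def by simp
 show "sqrt (nq (x - y)) <= 2 * (1 / of_int KK) * sqrt (rr s N)" unfolding x_def by (rule sh(3))
 show "z s N + x \<in> F" if "!!l. l < n - m ==> (z s N + x) l \<in> \<int>" proof -
  have "x \<in> Vn n" using xV sp_mono[OF N(2), of v] Vn_sp by auto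
  hence "z s N + x \<in> Vn n" by (rule subspace_add[OF Vn_subspace xv_Vn])
  moreover have "nq (z s N + x - ctr) <= of_int P" using z_split[where s=s, OF N(2) xV] nx by (simp add: rr_def)
  ultimately show ?thesis using that by (simp add: F_def)
 qed
qed

text \<open>The comparison point \<open>x'\<close> comes from the oscillation: a point
  \<open>w1\<close> of the slice ball with a value far above the minimum is shrunk and rounded as
  well, and becomes feasible. Thus the error is measured against a value at a feasible point and not
  merely on the continuous relaxation.\<close>

lemma candidate_exists:
 assumes x0: "x0 \<in> F" and E: "(10 * T) ^ 10 <= 2 ^ E"
 shows "EX s N sg i k l k'. m <= N & N <= n & (ALL j. \<bar>s j\<bar> <= KO) & sg \<in> {0, 1, - 1} & (i < n \<or> i = 0) & k <= 2 * E & k' <= 2 * E &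
  l <= 995328 * n * nat K ^ 3 & xv n v (cnd s N E sg i k l k') \<in> F &
  (EX x':F. of_int K * (fo (xv n v (cnd s N E sg i k l k')) - fo x0) <= fo x' - fo (xv n v (cnd s N E sg i k l k')))"
proof -
 from leaf_exists[OF x0] obtain s N where N: "m <= N" "N <= n" and s: "ALL j. \<bar>s j\<bar> <= KO" and lf: "leaf s N"
  and u0: "x0 - z s N \<in> sp v N" by (elim exE conjE)
 let ?V = "sp v N" let ?r = "sqrt (rr s N)"
 define u0' where "u0' = x0 - z s N"
 have x0e: "x0 = z s N + u0'" by (simp add: u0'_def)
 have u0V: "u0' \<in> ?V" using u0 by (simp add: u0'_def)
 have x0P: "nq (x0 - ctr) <= of_int P" using x0 by (simp add: F_def)
 have u0r: "nq u0' <= rr s N" using z_split[where s=s, OF N(2) u0V] x0P x0e by (simp add: rr_def)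
 have pd: "0 < nq u" if "u \<in> ?V" "u ~= 0" for u by (rule gs_pd[OF sq gs N(2) that])
 have nn: "0 <= nq u" if "u \<in> ?V" for u using pd[OF that] by (cases "u = 0") (auto simp: sform_simps[OF sq])
 have r0: "0 <= rr s N" using u0r nn[OF u0V] by linarith
 let ?phi = "%u. bf n Hm u u + beta s N u"
 have fo: "fo (z s N + u) = fo (z s N) + ?phi u" for u by (rule fo_split)
 have phi0: "?phi 0 = 0" using linear_0[OF beta_linear[of s N]] by (simp add: sform_simps[OF sa])
 \<comment> \<open>If the objective is constant on the slice ball, \<open>sg = 0\<close> is the
   right guess, and the rounded base point is as good as \<open>x0\<close>.\<close>
 show ?thesis proof (cases "ALL u:?V. nq u <= rr s N --> ?phi u = 0")
  case True
  let ?Y = "ysol (tmat n Hm hv B G (zt s N) N E 0 0 0 0 0) N 0"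
  let ?x = "xv n v (cnd s N E 0 0 0 0 0)"
  have "(\<Sum>l<N. (of_int (?Y l) / (2 * of_int (zt s N n) * of_int (?Y N))) *R v l) = 0"
   by (rule sum.neutral) (simp add: ysol_def)
  then obtain ta where ta: "ALL j. \<bar>ta j\<bar> <= 1 / 2" "?x = z s N + (\<Sum>j\<in>{m..<N}. ta j *R g j)"
   using cand_facts(3)[OF N, of s E 0 0 0 0 0] by auto
  let ?d = "\<Sum>j\<in>{m..<N}. ta j *R g j"
  note d = leaf_shift[OF N lf r0 ta(1)]
  have "(1 / of_int KK)\<^sup>2 <= (1::real)" using KK40 by (intro power_le_one) auto
  hence "(1 / of_int KK * ?r)\<^sup>2 <= 1 * rr s N" unfolding power_mult_distrib using r0 by (intro mult_mono) auto
  hence dr: "nq ?d <= rr s N" using d(2) by linarith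
  have dV: "?d \<in> Vn n" using d(1) sp_mono[OF N(2), of v] Vn_sp by auto
  have "?x \<in> F" unfolding F_def proof (intro CollectI conjI allI impI)
   show "?x \<in> Vn n" by (rule xv_Vn)
   show "l < n - m ==> ?x l \<in> \<int>" for l by (rule cand_facts(2)[OF N])
   show "nq (?x - ctr) <= of_int P" unfolding ta(2) using z_split[where s=s, OF N(2) d(1)] dr by (simp add: rr_def)
  qed
  moreover have "fo ?x = fo x0" unfolding ta(2) x0e fo using True d(1) dr u0V u0r by auto
  ultimately have "?x \<in> F & (EX x':F. of_int K * (fo ?x - fo x0) <= fo x' - fo ?x)" by (auto intro: bexI[OF _ x0])
  thus ?thesis using N s by (intro exI[of _ s] exI[of _ N] exI[of _ "0::int"] exI[of _ "0::nat"]) auto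
 next
  case False
  then obtain u1 where u1: "u1 \<in> ?V" "nq u1 <= rr s N" "?phi u1 ~= 0" by blast
  hence u1n: "u1 ~= 0" using phi0 by auto
  hence rp: "0 < rr s N" using pd[OF u1(1)] u1(2) by linarith
  have r': "0 < ?r" "?r\<^sup>2 = rr s N" using rp by auto
  have ball: "\<bar>?phi u\<bar> <= 12 * T ^ 5" if u: "u \<in> ?V" "nq u <= ?r\<^sup>2" for u proof -
   have zu: "\<bar>fo (z s N + w)\<bar> <= 6 * T ^ 5" if w: "w \<in> ?V" "nq w <= rr s N" for w proof (rule fo_le)
    have "w \<in> Vn n" using w sp_mono[OF N(2), of v] Vn_sp by auto
    thus "z s N + w \<in> Vn n" by (rule subspace_add[OF Vn_subspace xv_Vn])
    show "nq (z s N + w - ctr) <= of_int P" using z_split[where s=s, OF N(2) w(1)] w(2) by (simp add: rr_def)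
   qed
   have "\<bar>fo (z s N + 0)\<bar> <= 6 * T ^ 5"
    by (rule zu) (use r0 in "auto simp: sform_simps[OF sq] sp_subspace subspace_0")
   moreover have "\<bar>fo (z s N + u)\<bar> <= 6 * T ^ 5" by (rule zu) (use u r' in auto)
   ultimately show ?thesis unfolding fo phi0 by linarith
  qed
  from osc_dominates[where a="bf n Hm" and q=q and bt="beta s N" and V="?V" and r="?r" and D="12 * T ^ 5",
    OF sp_subspace sa sq beta_linear pd r'(1) ball]
  obtain om w1 w2 where d: "dominates (bf n Hm) q (beta s N) ?V ?r om" and wD: "om * ?r\<^sup>2 <= 2 * (12 * T ^ 5)"
   and w: "w1 \<in> ?V" "w2 \<in> ?V" "nq w1 <= ?r\<^sup>2" "nq w2 <= ?r\<^sup>2" "7 / 8 * (om * ?r\<^sup>2) <= ?phi w1 - ?phi w2" by auto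
  have om0: "0 <= om" using d by (simp add: dominates_def)
  have wl: "1 / T ^ 3 <= om" by (rule omega_lower[OF N(2) rp d u1(1,3)])
  have rl: "1 / T ^ 4 <= rr s N" by (rule rr_lower[OF N(2) rp])
  have wu: "om <= 24 * T ^ 9" proof -
   have "om * (1 / T ^ 4) <= om * ?r\<^sup>2" using rl om0 unfolding r'(2) by (rule mult_left_mono)
   hence "om / T ^ 4 <= 24 * T ^ 5" using wD by simp
   hence "om <= 24 * T ^ 5 * T ^ 4" using T1 by (simp add: pos_divide_le_eq)
   thus ?thesis by (simp add: power_numeral_reduce mult_ac)
  qed
  have rl': "1 / T ^ 2 <= ?r" by (rule real_le_rsqrt) (use rl in "simp add: power_divide flip: power_mult")
  have ru: "?r <= T" proof -
   have "0 <= nq (z s N - ctr)" by (intro nq_nonneg subspace_diff[OF Vn_subspace] xv_Vn ctr_Vn)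
   hence "rr s N <= of_int P" by (simp add: rr_def)
   also have "... <= T * 1" using T by (simp add: bounded_by_def)
   also have "... <= T * T" using T1 by (intro mult_left_mono) auto
   finally show ?thesis using T1 by (intro real_le_lsqrt) (auto simp: power2_eq_square)
  qed
  \<comment> \<open>Scaled to have integer basis coordinates. Their norms lie between 1 and
    \<open>T\<close>, so the strength of the perturbation can be guessed from a bounded
    range.\<close>
  let ?g = "%i. of_int (dlt G i) *R g i"
  have gg: "nq (?g i) = of_int (dlt G i) * of_int (dlt G (Suc i))" if "i < n" for i
   using gs_gamma[OF gs that] dpos[of i] that by (simp add: sform_simps[OF sq])
  have g: "?g i \<in> ?V & 1 <= nq (?g i) & nq (?g i) <= T\<^sup>2" if i: "i < N" for i proof -
   have "1 <= dlt G i" "1 <= dlt G (Suc i)" using dpos[of i] dpos[of "Suc i"] i N by auto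
   hence d: "1 <= real_of_int (dlt G i)" "1 <= real_of_int (dlt G (Suc i))" by simp_all
   have "real_of_int (dlt G i) <= T" "of_int (dlt G (Suc i)) <= T" using T i N by (auto simp: bounded_by_def)
   hence "nq (?g i) <= T * T" using gg[of i] i N d T1 by (simp add: mult_mono)
   moreover have "1 * 1 <= real_of_int (dlt G i) * of_int (dlt G (Suc i))" using d by (intro mult_mono) auto
   moreover have "?g i \<in> ?V" by (rule subspace_scale[OF sp_subspace gs_in'[OF sq gs i N(2)]])
   ultimately show ?thesis using gg[of i] i N by (simp add: power2_eq_square)
  qed
  have par: "nq u <= (\<Sum>i<N. (q (?g i) u)\<^sup>2 / nq (?g i))" if "u \<in> ?V" for u proof -
   have "(q (?g i) u)\<^sup>2 / nq (?g i) = (q (g i) u)\<^sup>2 / nq (g i)" if "i < N" for i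
    using dpos[of i] gp[of i] that N by (simp add: sform_simps[OF sq] power2_eq_square)
   thus ?thesis using gs_parseval[OF sq gs N(2) that] by simp
  qed
  have solv: "EX y:?V. ALL u:?V. bf n Hm y u + lam * q y u = - bt' u / 2"
   if l: "linear bt'" and p: "!!u. u \<in> ?V ==> u ~= 0 ==> 0 < bf n Hm u u + lam * q u u" for lam bt' proof -
   have "linear (%u. - bt' u / 2)" using l by (intro linearI) (simp_all add: linear_add linear_cmul field_simps)
   from riesz[where b="%u w. bf n Hm u w + lam * q u w", OF sform_plus[OF sa sq] this p] show ?thesis .
  qed
  have K': "1 <= nat K" "real (nat K) <= T" and NT: "real N <= T" using K1 T N by (auto simp: bounded_by_def)
  have nz: "EX u:?V. u ~= 0" using u1(1) u1n by blast
  have ex: "EX i k l k'. EX \<sigma>:{1, - 1}. i < N & k <= 2 * E & k' <= 2 * E & l <= 995328 * N * nat K ^ 3 &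
   posq ?V (bf n Hm) q (real l * (2 ^ k' / 2 ^ E)) &
   opts ?V (bf n Hm) q (beta s N) (real l * (2 ^ k' / 2 ^ E)) (%u. beta s N u + \<sigma> * (2 ^ k / 2 ^ E) * q (?g i) u) ?r (om * ?r\<^sup>2 / (4 * real (nat K)))"
   by (rule slice_minimum[where a="bf n Hm" and q=q and bt="beta s N" and V="?V" and r="?r" and g="?g" and T=T,
     OF sp_subspace sa sq beta_linear pd r'(1) d g par nz solv K' NT T1(1) rl' ru wl wu E])
  then obtain i k l k' and \<sigma> :: real where sl: "\<sigma> \<in> {1, - 1}" "i < N" "k <= 2 * E" "k' <= 2 * E" "l <= 995328 * N * nat K ^ 3"
   "posq ?V (bf n Hm) q (real l * (2 ^ k' / 2 ^ E))"
   "opts ?V (bf n Hm) q (beta s N) (real l * (2 ^ k' / 2 ^ E)) (%u. beta s N u + \<sigma> * (2 ^ k / 2 ^ E) * q (?g i) u) ?r (om * ?r\<^sup>2 / (4 * real (nat K)))"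
   by (elim exE bexE conjE)
  obtain sg :: int where sg: "sg \<in> {1, - 1}" "\<sigma> = of_int sg"
   using sl(1) by (cases "\<sigma> = 1") (auto intro: that[of 1] that[of "- 1"])
  have i: "i < n" using sl(2) N by simp
  have sg0: "sg ~= 0" using sg by auto
  let ?Y = "ysol (tmat n Hm hv B G (zt s N) N E sg i k l k') N sg"
  define y where "y = (\<Sum>l<N. (of_int (?Y l) / (2 * of_int (zt s N n) * of_int (?Y N))) *R v l)"
  have pdA: "!!u. u \<in> ?V ==> u ~= 0 ==> 0 < bf n Hm u u + real l * (2 ^ k' / 2 ^ E) * q u u" using sl(6) by blast
  have st1: "y \<in> ?V" unfolding y_def by (rule ysol_stationary(1)[OF N(2) i sg0]) (rule pdA)
  have st2: "bf n Hm y u + real l * (2 ^ k' / 2 ^ E) * q y u = - (beta s N u + of_int sg * (2 ^ k / 2 ^ E) * q (?g i) u) / 2"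
   if u: "u \<in> ?V" for u unfolding y_def by (rule ysol_stationary(2)[OF N(2) i sg0 _ u]) (rule pdA)
  have "nq y <= ?r\<^sup>2 & (ALL u:?V. nq u <= ?r\<^sup>2 --> ?phi y <= ?phi u + om * ?r\<^sup>2 / (4 * real (nat K)))"
   by (rule sl(7)[rule_format, OF st1]) (simp only: sg(2) st2)
  hence yr: "nq y <= rr s N" and ymin: "!!u. u \<in> ?V ==> nq u <= rr s N ==> ?phi y <= ?phi u + om * rr s N / (4 * of_int K)"
   unfolding r'(2) using K1 by auto
  let ?x = "xv n v (cnd s N E sg i k l k')"
  obtain ta where ta: "ALL j. \<bar>ta j\<bar> <= 1 / 2"
   "?x = z s N + ((1 - 1 / of_int KK) *R y + (\<Sum>j\<in>{m..<N}. ta j *R g j))"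
   using cand_facts(3)[OF N, of s E sg i k l k'] unfolding y_def by auto
  define xu where "xu = (1 - 1 / of_int KK) *R y + (\<Sum>j\<in>{m..<N}. ta j *R g j)"
  have xe: "?x = z s N + xu" using ta(2) by (simp only: xu_def)
  note xs = slice_shift[OF N lf rp st1 yr ta(1), folded xu_def]
  have xF: "?x \<in> F" unfolding xe by (rule xs(4)) (use cand_facts(2)[OF N, of _ s E sg i k l k'] xe in simp)
  let ?W = "om * rr s N"
  have W0: "0 <= ?W" using om0 rp by simp
  have lip: "\<bar>?phi u - ?phi w\<bar> <= ?W / (8 * of_int K)"
   if "u \<in> ?V" "nq u <= rr s N" "w \<in> ?V" "nq w <= rr s N" "sqrt (nq (u - w)) <= 2 * (1 / of_int KK) * ?r" for u w
  proof -
   have "\<bar>?phi u - ?phi w\<bar> <= 5 / 2 * (om * ?r) * sqrt (nq (u - w))"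
    by (rule phi_lipschitz[where a="bf n Hm" and q=q and bt="beta s N" and V="?V" and r="?r",
      OF sp_subspace sa sq beta_linear pd r'(1) d]) (use that r' in auto)
   also have "... <= 5 / 2 * (om * ?r) * (2 * (1 / of_int KK) * ?r)" using that(5) om0 r' by (intro mult_left_mono) auto
   also have "... = 5 * (om * ?r\<^sup>2) / of_int KK" by (simp add: power2_eq_square)
   also have "... = ?W / (8 * of_int K)" unfolding r'(2) KK_def by simp
   finally show ?thesis .
  qed
  have xy: "\<bar>?phi xu - ?phi y\<bar> <= ?W / (8 * of_int K)" by (rule lip[OF xs(1,2) st1 yr xs(3)])
  have "?phi y <= ?phi u0' + ?W / (4 * of_int K)" by (rule ymin[OF u0V u0r])
  \<comment> \<open>1/8 for shrinking and rounding, 1/4 for the minimisation on the slice.\<close>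
  hence e1: "?phi xu - ?phi u0' <= 3 / 8 * (?W / of_int K)" using xy by (simp add: field_simps)
  have zi: "co n (zt s N) j \<in> \<int>" if "N <= j" "j < n" for j by (rule z_int[OF N(2) that])
  obtain t where t: "(1 - 1 / of_int KK) *R w1 = (\<Sum>i<N. t i *R v i)"
   using sp_ex[OF subspace_scale[OF sp_subspace w(1)]] by blast
  let ?\<xi> = "%i. co n (zt s N) i + (if i < N then t i else 0)"
  have t2: "z s N + (1 - 1 / of_int KK) *R w1 = (\<Sum>i<n. ?\<xi> i *R v i)" proof -
   have "(\<Sum>i<N. t i *R v i) = (\<Sum>i<n. (if i < N then t i else 0) *R v i)"
    by (rule sum.mono_neutral_cong_left) (use N in auto)
   thus ?thesis unfolding t by (simp only: scaleR_add_left sum.distrib xv_def)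
  qed
  from real_round[OF N(2,1), of ?\<xi>] zi obtain \<xi>' ta' where rd: "ALL k. m <= k --> k < n --> \<xi>' k \<in> \<int>" "ALL j. \<bar>ta' j\<bar> <= 1 / 2"
   "(\<Sum>k<n. \<xi>' k *R v k) = (\<Sum>k<n. ?\<xi> k *R v k) + (\<Sum>j\<in>{m..<N}. ta' j *R g j)" by auto
  define xw where "xw = (1 - 1 / of_int KK) *R w1 + (\<Sum>j\<in>{m..<N}. ta' j *R g j)"
  have xwe: "z s N + xw = (\<Sum>k<n. \<xi>' k *R v k)" unfolding rd(3) t2[symmetric] xw_def by (simp only: add.assoc)
  have w1r: "nq w1 <= rr s N" "nq w2 <= rr s N" using w r' by auto
  note ws = slice_shift[OF N lf rp w(1) w1r(1) rd(2), folded xw_def]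
  have wF: "z s N + xw \<in> F" by (rule ws(4)) (unfold xwe, rule int_coords, use rd(1) in auto)
  have ww: "\<bar>?phi xw - ?phi w1\<bar> <= ?W / (8 * of_int K)" by (rule lip[OF ws(1,2) w(1) w1r(1) ws(3)])
  have "?phi y <= ?phi w2 + ?W / (4 * of_int K)" by (rule ymin[OF w(2) w1r(2)])
  hence "7 / 8 * ?W - 1 / 2 * (?W / of_int K) <= ?phi xw - ?phi xu" proof -
   have "?W / (8 * of_int K) = ?W / of_int K / 8" "?W / (4 * of_int K) = ?W / of_int K / 4" by simp_all
   moreover assume "?phi y <= ?phi w2 + ?W / (4 * of_int K)"
   ultimately show ?thesis using w(5) xy ww unfolding r'(2) by linarith
  qed
  moreover have "?W / of_int K <= ?W / 1" using K1 W0 by (intro divide_left_mono) auto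
  \<comment> \<open>Of 7/8 of the oscillation the three errors 1/8, 1/4 and 1/8 are lost, each
    divided by \<open>K >= 1\<close>. The remaining 3/8 matches \<open>e1\<close> exactly; this
    fixes the factor 40 in \<open>KK\<close>.\<close>
  ultimately have e2: "3 / 8 * ?W <= ?phi xw - ?phi xu" by linarith
  have "of_int K * (?phi xu - ?phi u0') <= of_int K * (3 / 8 * (?W / of_int K))" using e1 K1 by (intro mult_left_mono) auto
  also have "... = 3 / 8 * ?W" using K1 by simp
  finally have "of_int K * (fo ?x - fo x0) <= fo (z s N + xw) - fo ?x" using e2 unfolding xe x0e fo by simp
  hence fin: "?x \<in> F & (EX x':F. of_int K * (fo ?x - fo x0) <= fo x' - fo ?x)" using xF wF by blast
  have "l <= 995328 * n * nat K ^ 3" using sl(5) N(2) by (meson le_trans mult_le_mono order_refl)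
  thus ?thesis using N s sg(1) i sl(3,4) fin
   by - (rule exI[of _ s], rule exI[of _ N], rule exI[of _ sg], rule exI[of _ i], rule exI[of _ k], rule exI[of _ l],
    rule exI[of _ k'], elim conjE, intro conjI, simp_all)
 qed
qed

end

end

section \<open>The steps of the algorithm run in polynomial time\<close>

text \<open>Hides which tables have been added: the continuation of a binding learns only that
  whatever was available before still is.\<close>

definition ext :: "'x env => 'x env => bool" where
 "ext E E' \<longleftrightarrow> edom E' = edom E & sz E' = sz E & (ALL f. cmp E f --> cmp E' f) &
  (ALL n m S. has E n m S --> has E' n m S)"

lemma ext_edom: "ext E E' ==> edom E' = edom E" by (simp add: ext_def)
lemma cmp_ext: "ext E E' ==> cmp E f ==> cmp E' f" by (simp add: ext_def)
lemma has_ext: "ext E E' ==> has E n m S ==> has E' n m S" by (simp add: ext_def)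
lemma small_ext: "ext E E' ==> small E f ==> small E' f" by (simp add: ext_def small_def)
lemma ext_tbl: "ext E (tbl E n m S)" by (simp add: ext_def cmp_tbl has_tbl)
lemma ext_refl: "ext E E" by (simp add: ext_def)
lemma ext_trans: "ext E E' ==> ext E' E'' ==> ext E E''" by (simp add: ext_def)

abbreviation hasv :: "'x env => ('x => nat) => ('x => nat => int) => bool" where
 "hasv E d X == has E d (%_. 1) (%x i j. X x i)"

lemma cmp_hasv:
 assumes "hasv E d X" "cmpn E i" "!!x. x \<in> edom E ==> i x < d x"
 shows "cmp E (%x. X x (i x))" using cmp_has[OF assms(1,2) cmpn_const[of E 0]] assms(3) by simp

lemma cmp_let_ext:
 assumes n: "cmpn E n" "small E n" and l: "cmpn E l" "small E l"
  and S: "cmp (idx (idx E n) (%z. l (fst z))) (%z. S (fst2 z) (snd (fst z)) (snd z))"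
  and body: "!!E'. ext E E' ==> has E' n l S ==> cmp E' f"
 shows "cmp E f" by (rule cmp_let[OF n l S]) (rule body[OF ext_tbl])

lemma cmp_letv:
 assumes d: "cmpn E d" "small E d" and X: "cmp (idx E d) (%z. X (fst z) (snd z))"
  and body: "!!E'. ext E E' ==> hasv E' d X ==> cmp E' f"
 shows "cmp E f" by (rule cmp_let_ext[where S="%x i j. X x i", OF d cmpn_const[of E 1] small_const[of E 1] _ body])
  (use cmp_idx[OF X] in auto)

lemma cmp_rec_ext:
 assumes N: "cmpn E N" "small E N" and n: "cmpn E n" "small E n" and l: "cmpn E l" "small E l"
  and bnd: "sbits (idx (idx (idx E (%x. Suc (N x))) (%z. n (fst z))) (%z. l (fst2 z)))
   (%z. S (fst3 z) (snd (fst2 z)) (snd (fst z)) (snd z))"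
  and base: "cmp (idx (idx E n) (%z. l (fst z))) (%z. S (fst2 z) 0 (snd (fst z)) (snd z))"
  and step: "!!E'. ext (idx E N) E' ==> has E' (%z. n (fst z)) (%z. l (fst z)) (%z. S (fst z) (snd z)) ==>
   cmp (idx (idx E' (%z. n (fst z))) (%z. l (fst2 z)))
   (%z. S (fst3 z) (Suc (snd (fst2 z))) (snd (fst z)) (snd z))"
  and body: "!!E'. ext E E' ==> has E' n l (%x. S x (N x)) ==> cmp E' f"
 shows "cmp E f"
 by (rule cmp_rec[OF N n l bnd[unfolded sbits_def] base]; (rule step[OF ext_tbl] | rule body[OF ext_tbl]))

lemma cmp_recv:
 assumes N: "cmpn E N" "small E N" and n: "cmpn E n" "small E n"
  and bnd: "sbits (idx (idx E (%x. Suc (N x))) (%z. n (fst z))) (%z. S (fst2 z) (snd (fst z)) (snd z))"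
  and base: "cmp (idx E n) (%z. S (fst z) 0 (snd z))"
  and step: "!!E'. ext (idx E N) E' ==> hasv E' (%z. n (fst z)) (%z. S (fst z) (snd z)) ==>
   cmp (idx E' (%z. n (fst z))) (%z. S (fst2 z) (Suc (snd (fst z))) (snd z))"
  and body: "!!E'. ext E E' ==> hasv E' n (%x. S x (N x)) ==> cmp E' f"
 shows "cmp E f" by (rule cmp_rec_ext[where S="%x k i j. S x k i", OF N n cmpn_const[of E 1] small_const[of E 1]])
  (use sbits_idx[OF bnd] cmp_idx[OF base] cmp_idx[OF step] body in auto)

lemma cmp_up: "ext (idx E N) E' ==> cmp E f ==> cmp E' (%z. f (fst z))" by (rule cmp_ext[OF _ cmp_idx])
lemma small_up: "ext (idx E N) E' ==> small E f ==> small E' (%z. f (fst z))" by (rule small_ext[OF _ small_idx])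
lemma has_up: "ext (idx E N) E' ==> has E n m S ==> has E' (%z. n (fst z)) (%z. m (fst z)) (%z. S (fst z))"
 by (rule has_ext[OF _ has_idx])

section \<open>Computability of Gram matrices, rounding, reduction and candidates\<close>

lemma cmp_gram:
 assumes n: "cmpn E n" "small E n" and M: "has E n n M"
  and Y: "has E p n Y" "cmpn E r" "!!x. x \<in> edom E ==> r x < p x"
  and Z: "has E p' n Z" "cmpn E t" "!!x. x \<in> edom E ==> t x < p' x"
 shows "cmp E (%x. gram (n x) (M x) (Y x (r x)) (Z x (t x)))" unfolding gram_def
proof (rule cmp_sum[OF n], rule cmp_sum[OF cmp_idx[OF n(1)] small_idx[OF n(2)]], intro cmp_mult)
 let ?E = "idx (idx E n) (%z. n (fst z))"
 have i: "cmpn ?E (%z. snd (fst z))" by (rule cmp_idx[OF cmp_snd[OF n(2)]])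
 have j: "cmpn ?E snd" by (rule cmp_snd[OF small_idx[OF n(2)]])
 show "cmp ?E (%z. M (fst2 z) (snd (fst z)) (snd z))" by (rule cmp_has[OF has_idx[OF has_idx[OF M]] i j]) auto
 show "cmp ?E (%z. Y (fst2 z) (r (fst2 z)) (snd (fst z)))"
  by (rule cmp_has[OF has_idx[OF has_idx[OF Y(1)]] cmp_idx[OF cmp_idx[OF Y(2)]] i]) (use Y(3) in auto)
 show "cmp ?E (%z. Z (fst2 z) (t (fst2 z)) (snd z))"
  by (rule cmp_has[OF has_idx[OF has_idx[OF Z(1)]] cmp_idx[OF cmp_idx[OF Z(2)]] j]) (use Z(3) in auto)
qed

lemma cmp_gc:
 assumes n: "cmpn E n" "small E n" and Q: "has E n n Q" and B: "has E n n B" and c: "has E (%_. 1) n (%x i. c x)"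
  and i: "cmpn E i" "!!x. x \<in> edom E ==> i x < n x" and j: "cmpn E j"
 shows "cmp E (%x. gc (n x) (Q x) (c x) (B x) (i x) (j x))"
proof -
 have "cmp E (%x. if j x < n x then gram (n x) (Q x) (B x (i x)) (B x (j x)) else gram (n x) (Q x) (B x (i x)) (c x))"
 proof (rule cmp_ite[OF decn_less[OF j n(1)]])
  show "cmp (sub E (%x. j x < n x)) (%x. gram (n x) (Q x) (B x (i x)) (B x (j x)))"
   by (rule cmp_gram[OF cmp_sub[OF n(1)] small_sub[OF n(2)] has_sub[OF Q] has_sub[OF B] cmp_sub[OF i(1)] _ has_sub[OF B] cmp_sub[OF j]])
    (use i(2) in auto)
  show "cmp (sub E (%x. ~ j x < n x)) (%x. gram (n x) (Q x) (B x (i x)) (c x))"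
   by (rule cmp_gram[where Z="%x i. c x" and t="%_. 0", OF cmp_sub[OF n(1)] small_sub[OF n(2)] has_sub[OF Q] has_sub[OF B] cmp_sub[OF i(1)] _
      has_sub[OF c] cmpn_const]) (use i(2) in auto)
 qed
 thus ?thesis by (rule cmp_cong) (simp add: gc_def)
qed

lemma cmp_dlt:
 assumes n: "cmpn E n" "small E n" and G: "has E n (%x. Suc (n x)) G"
  and k: "cmpn E k" "!!x. x \<in> edom E ==> k x <= n x"
 shows "cmp E (%x. dlt (G x) (k x))" unfolding dlt_def
 by (rule cmp_bst[OF G k(1) small_mono[OF n(2) k(2)] _ k(1) cmpn_const]) (use k in "auto simp: less_Suc_eq_le")

lemma cmp_gn:
 assumes n: "cmpn E n" "small E n" and G: "has E n (%x. Suc (n x)) G"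
  and j: "cmpn E j" "!!x. x \<in> edom E ==> j x <= n x" and l: "cmpn E l"
 shows "cmp E (%x. gn (G x) (j x) (l x))" unfolding gn_def
proof (rule cmp_ite[OF decn_less[OF l j(1)]])
 let ?E = "sub E (%x. l x < j x)"
 have "cmp ?E (%x. bst (G x) (j x) (j x) (l x) (j x))"
  by (rule cmp_bst[OF has_sub[OF G] cmp_sub[OF j(1)] small_mono[OF small_sub[OF n(2)]] _ cmp_sub[OF l] cmp_sub[OF j(1)]])
   (use j in "auto simp: less_Suc_eq_le")
 thus "cmp ?E (%x. - bst (G x) (j x) (j x) (l x) (j x))" by (rule cmp_minus)
 show "cmp (sub E (%x. ~ l x < j x)) (%x. if l x = j x then dlt (G x) (j x) else 0)"
  by (rule cmp_sub, rule cmp_ite'[OF decn_eq[OF l j(1)] cmp_dlt[OF n G j] cmp_const])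
qed

lemma small_2pow:
 assumes "has E n m S"
 obtains T where "small E T" "!!x i j. x \<in> edom E ==> i < n x ==> j < m x ==> \<bar>S x i j\<bar> <= 2 ^ T x"
proof -
 obtain a where a: "!!x i j. x \<in> edom E ==> i < n x ==> j < m x ==> bits (S x i j) <= (sz E x + 2) ^ a"
  using assms unfolding has_def by blast
 show thesis by (rule that[of "%x. (sz E x + 2) ^ a"]) (use a in "auto intro: smallI less_imp_le simp: bits_le_iff")
qed

lemma small_2powv:
 assumes "hasv E d X"
 obtains T where "small E T" "!!x i. x \<in> edom E ==> i < d x ==> \<bar>X x i\<bar> <= 2 ^ T x"
 by (rule small_2pow[OF assms], rule that) auto

lemma small_2pow_idx:
 assumes "sbits (idx E N) (%z. f (fst z) (snd z))"
 obtains T where "small E T" "!!x k. x \<in> edom E ==> k < N x ==> \<bar>f x k\<bar> <= 2 ^ T x"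
proof -
 obtain T where "small E T" "!!x k. x \<in> edom E ==> k < N x ==> bits (f x k) <= T x"
  using small_idx_bound[OF assms[unfolded sbits_def]] by auto
 thus thesis by (intro that) (auto intro: less_imp_le simp: bits_le_iff)
qed

lemma small_2pow_idx2:
 assumes "sbits (idx (idx E N) (%z. l (fst z))) (%z. f (fst2 z) (snd (fst z)) (snd z))"
 obtains T where "small E T" "!!x k i. x \<in> edom E ==> k < N x ==> i < l x ==> \<bar>f x k i\<bar> <= 2 ^ T x"
proof -
 obtain T where T: "small (idx E N) T" "!!z i. z \<in> edom (idx E N) ==> i < l (fst z) ==> \<bar>f (fst z) (snd z) i\<bar> <= 2 ^ T z"
  using small_2pow_idx[where f="%z i. f (fst z) (snd z) i", OF assms] by auto
 obtain T' where T': "small E T'" "!!x k. x \<in> edom E ==> k < N x ==> T (x, k) <= T' x"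
  using small_idx_bound[OF T(1)] by blast
 show thesis proof (rule that[OF T'(1)])
  fix x k i assume "x \<in> edom E" "k < N x" "i < l x"
  hence "\<bar>f x k i\<bar> <= 2 ^ T (x, k)" "T (x, k) <= T' x" using T(2)[of "(x, k)" i] T'(2) by auto
  thus "\<bar>f x k i\<bar> <= 2 ^ T' x" by (meson order_trans power_increasing one_le_numeral)
 qed
qed

text \<open>The calculus needs size bounds for arbitrary tables, whatever the sign of the
  denominator \<open>y\<close>; hence this crude estimate besides \<open>rnd_co\<close>.\<close>

lemma rounding_error: "\<bar>y * ((2 * x + y) div (2 * y)) - x\<bar> <= 2 * \<bar>y\<bar> + \<bar>x\<bar>" for x y :: int
proof (cases "y = 0")
 case False
 let ?a = "2 * x + y"
 have "\<bar>?a mod (2 * y)\<bar> <= \<bar>2 * y\<bar>" using abs_mod_less[of "2 * y" ?a] False by linarith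
 moreover have "2 * (y * (?a div (2 * y))) + ?a mod (2 * y) = ?a" using mult_div_mod_eq[of "2 * y" ?a] by (simp add: mult.assoc)
 ultimately show ?thesis by linarith
qed simp

lemma rounding_step:
 fixes x y w m \<sigma> :: int
 assumes "\<bar>x\<bar> <= m" "\<bar>y\<bar> <= m" "\<bar>w\<bar> <= \<sigma>"
 shows "\<bar>y * ((2 * x + y) div (2 * y) + w) - x\<bar> <= m * (\<sigma> + 3)"
proof -
 define d where "d = (2 * x + y) div (2 * y)"
 have m: "0 <= m" using assms(1) by linarith
 have 1: "\<bar>y * d - x\<bar> <= 3 * m" using rounding_error[of y x] assms unfolding d_def by linarith
 have 2: "\<bar>y * w\<bar> <= m * \<sigma>" unfolding abs_mult using assms m by (intro mult_mono) auto
 have "y * (d + w) - x = (y * d - x) + y * w" by (simp add: algebra_simps)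
 hence "\<bar>y * (d + w) - x\<bar> <= 3 * m + m * \<sigma>" using 1 2 by linarith
 thus ?thesis unfolding d_def by (simp add: algebra_simps)
qed

text \<open>One step contributes a factor \<open>D\<close> through the new denominator and
  \<open>D * (\<sigma> + 3)\<close> through the displacement, together
  \<open>D * (\<sigma> + 4)\<close>.\<close>

lemma bab_bound:
 assumes X: "!!l. l <= n ==> \<bar>X l\<bar> <= M" and d: "!!j. j < n ==> \<bar>dlt G j\<bar> <= D"
  and g: "!!j l. j < n ==> l < n ==> \<bar>gn G j l\<bar> <= D" and s: "!!j. j < n ==> \<bar>s j\<bar> <= \<sigma>"
  and D: "1 <= D" "0 <= \<sigma>" and hi: "hi <= n" and t: "t <= hi" and l: "l <= n"
 shows "\<bar>bab n G hi s X t l\<bar> <= M * (D * (\<sigma> + 4)) ^ t" using t l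
proof (induction t arbitrary: l)
 case 0
 thus ?case using X by simp
next
 case (Suc t)
 let ?j = "hi - Suc t" let ?S = "bab n G hi s X t" let ?m = "M * (D * (\<sigma> + 4)) ^ t"
 have j: "?j < n" using Suc.prems hi by simp
 have S: "\<bar>?S l\<bar> <= ?m" if "l <= n" for l using Suc.IH[OF _ that] Suc.prems(1) by simp
 have m0: "0 <= ?m" using S[of 0] by linarith
 let ?r = "?S n * ((2 * ?S ?j + ?S n) div (2 * ?S n) + s ?j) - ?S ?j"
 have r: "\<bar>?r\<bar> <= ?m * (\<sigma> + 3)" by (rule rounding_step) (use S j s in auto)
 have a: "\<bar>?S l * dlt G ?j\<bar> <= ?m * D" if "l <= n" for l
  unfolding abs_mult using S[OF that] d[OF j] m0 by (intro mult_mono) auto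
 have e: "M * (D * (\<sigma> + 4)) ^ Suc t = ?m * D + ?m * (\<sigma> + 3) * D" by (simp add: algebra_simps)
 have b: "bab n G hi s X (Suc t) l = (if l = n then ?S n * dlt G ?j else ?S l * dlt G ?j + ?r * gn G ?j l)"
  by (simp only: bab.simps babstep_def)
 have m1: "0 <= ?m * (\<sigma> + 3) * D" by (rule mult_nonneg_nonneg[OF mult_nonneg_nonneg[OF m0]]) (use D in auto)
 show ?case proof (cases "l = n")
  case True
  hence "bab n G hi s X (Suc t) l = ?S n * dlt G ?j" using b by (simp only: refl if_True)
  thus ?thesis unfolding e using a[OF le_refl] m1 by linarith
 next
  case False
  hence l: "l < n" using Suc.prems by simp
  have "\<bar>?r * gn G ?j l\<bar> <= ?m * (\<sigma> + 3) * D"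
   unfolding abs_mult[of ?r] by (rule mult_mono[OF r g[OF j l]]) (use m0 D in auto)
  moreover have "bab n G hi s X (Suc t) l = ?S l * dlt G ?j + ?r * gn G ?j l" using b False by (simp only: if_False)
  ultimately show ?thesis unfolding e using a[OF Suc.prems(2)] by linarith
 qed
qed

lemma cmp_bab:
 assumes n: "cmpn E n" "small E n" and G: "has E n (%x. Suc (n x)) G"
  and hi: "cmpn E hi" "!!x. x \<in> edom E ==> hi x <= n x" and t: "cmpn E t" "!!x. x \<in> edom E ==> t x <= hi x"
  and s: "hasv E n s" and X: "hasv E (%x. Suc (n x)) X" and l: "cmpn E l" "!!x. x \<in> edom E ==> l x <= n x"
 shows "cmp E (%x. bab (n x) (G x) (hi x) (s x) (X x) (t x) (l x))"
proof (rule cmp_recv[where S="%x k i. bab (n x) (G x) (hi x) (s x) (X x) k i" and N=t and n="%x. Suc (n x)"])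
 have tn: "t x <= n x" if "x \<in> edom E" for x using hi(2)[OF that] t(2)[OF that] by simp
 show ts: "small E t" by (rule small_mono[OF n(2) tn])
 show sn: "small E (%x. Suc (n x))" by (rule small_Suc[OF n(2)])
 show "cmpn E t" "cmpn E (%x. Suc (n x))" by (rule t(1), rule cmpn_Suc[OF n(1)])
 show "cmp (idx E (%x. Suc (n x))) (%z. bab (n (fst z)) (G (fst z)) (hi (fst z)) (s (fst z)) (X (fst z)) 0 (snd z))"
  unfolding bab.simps by (rule cmp_hasv[OF has_idx[OF X] cmp_snd[OF sn]]) auto
 show "cmp E' (%x. bab (n x) (G x) (hi x) (s x) (X x) (t x) (l x))"
  if "ext E E'" "hasv E' (%x. Suc (n x)) (%x. bab (n x) (G x) (hi x) (s x) (X x) (t x))" for E'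
  by (rule cmp_hasv[OF that(2) cmp_ext[OF that(1) l(1)]]) (use l(2) ext_edom[OF that(1)] in "auto simp: less_Suc_eq_le")
 show "cmp (idx E' (%z. Suc (n (fst z)))) (%z. bab (n (fst2 z)) (G (fst2 z)) (hi (fst2 z)) (s (fst2 z))
   (X (fst2 z)) (Suc (snd (fst z))) (snd z))"
  if e: "ext (idx E t) E'" and h: "hasv E' (%z. Suc (n (fst z))) (%z. bab (n (fst z)) (G (fst z)) (hi (fst z)) (s (fst z)) (X (fst z)) (snd z))" for E'
 proof -
  let ?E = "idx E' (%z. Suc (n (fst z)))"
  have ed: "fst2 z \<in> edom E & snd (fst z) < t (fst2 z) & snd z <= n (fst2 z) & hi (fst2 z) <= n (fst2 z) & t (fst2 z) <= hi (fst2 z)"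
   if "z \<in> edom ?E" for z using that ext_edom[OF e] hi(2) t(2) by (auto simp: less_Suc_eq_le)
  note up = cmp_idx[OF cmp_up[OF e]] and hup = has_idx[OF has_up[OF e]]
  have sE: "small E' (%z. Suc (n (fst z)))" by (rule small_up[OF e sn])
  have N: "cmpn ?E (%z. n (fst2 z))" "small ?E (%z. n (fst2 z))" by (rule up[OF n(1)], rule small_idx[OF small_up[OF e n(2)]])
  have k: "cmpn ?E (%z. snd (fst z))" by (rule cmp_idx[OF cmp_ext[OF e cmp_snd[OF ts]]])
  have i: "cmpn ?E snd" by (rule cmp_snd[OF sE])
  have j: "cmpn ?E (%z. hi (fst2 z) - Suc (snd (fst z)))" by (rule cmpn_diff[OF up[OF hi(1)] cmpn_Suc[OF k]])
  have d: "cmp ?E (%z. dlt (G (fst2 z)) (hi (fst2 z) - Suc (snd (fst z))))"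
   by (rule cmp_dlt[OF N hup[OF G] j]) (use ed in force)
  have g: "cmp ?E (%z. gn (G (fst2 z)) (hi (fst2 z) - Suc (snd (fst z))) (snd z))"
   by (rule cmp_gn[OF N hup[OF G] j _ i]) (use ed in force)
  have S: "cmp ?E (%z. bab (n (fst2 z)) (G (fst2 z)) (hi (fst2 z)) (s (fst2 z)) (X (fst2 z)) (snd (fst z)) (u z))"
   if "cmpn ?E u" "!!z. z \<in> edom ?E ==> u z <= n (fst2 z)" for u
   by (rule cmp_hasv[OF has_idx[OF h] that(1)]) (use that(2) in "auto simp: less_Suc_eq_le")
  have Sn: "cmp ?E (%z. bab (n (fst2 z)) (G (fst2 z)) (hi (fst2 z)) (s (fst2 z)) (X (fst2 z)) (snd (fst z)) (n (fst2 z)))"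
   by (rule S[OF N(1)]) simp
  have Sj: "cmp ?E (%z. bab (n (fst2 z)) (G (fst2 z)) (hi (fst2 z)) (s (fst2 z)) (X (fst2 z)) (snd (fst z)) (hi (fst2 z) - Suc (snd (fst z))))"
   by (rule S[OF j]) (use ed in force)
  have Si: "cmp ?E (%z. bab (n (fst2 z)) (G (fst2 z)) (hi (fst2 z)) (s (fst2 z)) (X (fst2 z)) (snd (fst z)) (snd z))"
   by (rule S[OF i]) (use ed in blast)
  have sj: "cmp ?E (%z. s (fst2 z) (hi (fst2 z) - Suc (snd (fst z))))"
   by (rule cmp_hasv[OF hup[OF s] j]) (use ed in force)
  show ?thesis unfolding bab.simps babstep_def
   by (rule cmp_ite'[OF decn_eq[OF i N(1)] cmp_mult[OF Sn d]]) (intro cmp_add cmp_mult cmp_diff cmp_div cmp_const Sn Sj Si sj d g)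
 qed
 have "sbits (idx E n) (%z. dlt (G (fst z)) (snd z))"
  by (rule cmp_sbits, rule cmp_dlt[OF cmp_idx[OF n(1)] small_idx[OF n(2)] has_idx[OF G] cmp_snd[OF n(2)]]) auto
 then obtain T1 where T1: "small E T1" "!!x j. x \<in> edom E ==> j < n x ==> \<bar>dlt (G x) j\<bar> <= 2 ^ T1 x" by (rule small_2pow_idx) (rule that)
 have "sbits (idx (idx E n) (%z. n (fst z))) (%z. gn (G (fst2 z)) (snd (fst z)) (snd z))"
  by (rule cmp_sbits, rule cmp_gn[OF cmp_idx[OF cmp_idx[OF n(1)]] small_idx[OF small_idx[OF n(2)]] has_idx[OF has_idx[OF G]]
     cmp_idx[OF cmp_snd[OF n(2)]] _ cmp_snd[OF small_idx[OF n(2)]]]) auto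
 then obtain T2 where T2: "small E T2" "!!x j l. x \<in> edom E ==> j < n x ==> l < n x ==> \<bar>gn (G x) j l\<bar> <= 2 ^ T2 x" by (rule small_2pow_idx2) (rule that)
 obtain T3 where T3: "small E T3" "!!x i. x \<in> edom E ==> i < n x ==> \<bar>s x i\<bar> <= 2 ^ T3 x" by (rule small_2powv[OF s]) (rule that)
 obtain T4 where T4: "small E T4" "!!x i. x \<in> edom E ==> i < Suc (n x) ==> \<bar>X x i\<bar> <= 2 ^ T4 x" by (rule small_2powv[OF X]) (rule that)
 let ?b = "%x. 2 ^ T4 x * (2 ^ (T1 x + T2 x) * (2 ^ T3 x + 4)) ^ t x :: int"
 have "sbits E ?b" by (intro sbits_mult sbits_pow2 sbits_power sbits_add sbits_const small_add T1 T2 T3 T4 ts)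
 hence b: "sbits (idx (idx E (%x. Suc (t x))) (%z. Suc (n (fst z)))) (%z. ?b (fst2 z))"
  by (intro sbits_idx[OF sbits_idx])
 show "sbits (idx (idx E (%x. Suc (t x))) (%z. Suc (n (fst z))))
  (%z. bab (n (fst2 z)) (G (fst2 z)) (hi (fst2 z)) (s (fst2 z)) (X (fst2 z)) (snd (fst z)) (snd z))"
 proof (rule sbits_mono[OF b])
  fix z assume "z \<in> edom (idx (idx E (%x. Suc (t x))) (%z. Suc (n (fst z))))"
  then obtain x k i where z: "z = ((x, k), i)" and x: "x \<in> edom E" and ki: "k <= t x" "i <= n x"
   by (cases z) (auto simp: less_Suc_eq_le)
  let ?D = "2 ^ (T1 x + T2 x) :: int"
  have D: "2 ^ T1 x <= ?D" "2 ^ T2 x <= ?D" by (auto intro!: power_increasing)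
  have "\<bar>bab (n x) (G x) (hi x) (s x) (X x) k i\<bar> <= 2 ^ T4 x * (?D * (2 ^ T3 x + 4)) ^ k" proof (rule bab_bound)
   show "\<bar>dlt (G x) j\<bar> <= ?D" if "j < n x" for j using T1(2)[OF x that] D by linarith
   show "\<bar>gn (G x) j l\<bar> <= ?D" if "j < n x" "l < n x" for j l using T2(2)[OF x that] D by linarith
  qed (use T3(2)[OF x] T4(2)[OF x] hi(2)[OF x] t(2)[OF x] ki in "auto simp: less_Suc_eq_le")
  also have "... <= ?b x" proof -
   have "1 * 1 <= ?D * (2 ^ T3 x + 4)" by (intro mult_mono) (auto intro: add_increasing)
   thus ?thesis using ki by (intro mult_left_mono power_increasing) auto
  qed
  finally show "\<bar>bab (n (fst2 z)) (G (fst2 z)) (hi (fst2 z)) (s (fst2 z)) (X (fst2 z)) (snd (fst z)) (snd z)\<bar> <= \<bar>?b (fst2 z)\<bar>"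
   unfolding z by simp
 qed
qed

lemma cmp_gx:
 assumes n: "cmpn E n" "small E n" and G: "has E n (%x. Suc (n x)) G"
  and i: "cmpn E i" "!!x. x \<in> edom E ==> i x <= n x" and l: "cmpn E l"
 shows "cmp E (%x. gx (n x) (G x) (i x) (l x))"
 unfolding gx_def by (rule cmp_ite'[OF decn_eq[OF l n(1)] cmp_dlt[OF n G i] cmp_gn[OF n G i l]])

lemma cmp_srow:
 assumes n: "cmpn E n" "small E n" and m: "cmpn E m" and G: "has E n (%x. Suc (n x)) G" and B: "has E n n B"
  and i: "cmpn E i" "!!x. x \<in> edom E ==> i x < n x" and l: "cmpn E l" "!!x. x \<in> edom E ==> l x < n x"
 shows "cmp E (%x. srow (n x) (m x) (G x) (B x) (i x) (l x))" unfolding srow_def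
proof (rule cmp_ite'[OF decn_less[OF i(1) m]])
 show "cmp E (%x. B x (i x) (l x))" by (rule cmp_has[OF B i(1) l(1)]) (use i l in auto)
 let ?b = "%x k. bab (n x) (G x) (i x) (%_. 0) (gx (n x) (G x) (i x)) (i x - m x) k"
 have i': "!!x. x \<in> edom E ==> i x <= n x" using i(2) by (simp add: less_imp_le)
 have sn: "small E (%x. Suc (n x))" by (rule small_Suc[OF n(2)])
 show "cmp E (%x. \<Sum>k<n x. if m x <= k then (?b x k div ?b x (n x)) * B x k (l x) else 0)"
 proof (rule cmp_letv[where d="%x. Suc (n x)" and X="%x. gx (n x) (G x) (i x)", OF cmpn_Suc[OF n(1)] sn])
  show "cmp (idx E (%x. Suc (n x))) (%z. gx (n (fst z)) (G (fst z)) (i (fst z)) (snd z))"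
   by (rule cmp_gx[OF cmp_idx[OF n(1)] small_idx[OF n(2)] has_idx[OF G] cmp_idx[OF i(1)] _ cmp_snd[OF sn]]) (use i' in auto)
  fix E1 assume e1: "ext E E1" and X: "hasv E1 (%x. Suc (n x)) (%x. gx (n x) (G x) (i x))"
  show "cmp E1 (%x. \<Sum>k<n x. if m x <= k then (?b x k div ?b x (n x)) * B x k (l x) else 0)"
  \<comment> \<open>Even the constant offset 0 becomes a table, because \<open>cmp_bab\<close> reads
    its offsets from memory.\<close>
  proof (rule cmp_letv[where d=n and X="%_ _. 0", OF cmp_ext[OF e1 n(1)] small_ext[OF e1 n(2)] cmp_const])
   fix E2 assume e2: "ext E1 E2" and s: "hasv E2 n (%_ _. 0)"
   have ed: "edom E2 = edom E" using ext_edom[OF e1] ext_edom[OF e2] by simp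
   note c2 = cmp_ext[OF e2 cmp_ext[OF e1]] and h2 = has_ext[OF e2 has_ext[OF e1]] and s2 = small_ext[OF e2 small_ext[OF e1]]
   let ?E = "idx E2 n"
   have k: "cmpn ?E snd" by (rule cmp_snd[OF s2[OF n(2)]])
   have b: "cmp ?E (%z. ?b (fst z) (u z))" if u: "cmpn ?E u" "!!z. z \<in> edom ?E ==> u z <= n (fst z)" for u
    by (rule cmp_bab[where s="%_ _. 0", OF cmp_idx[OF c2[OF n(1)]] small_idx[OF s2[OF n(2)]] has_idx[OF h2[OF G]] cmp_idx[OF c2[OF i(1)]] _
       cmpn_diff[OF cmp_idx[OF c2[OF i(1)]] cmp_idx[OF c2[OF m]]] _ has_idx[OF s] has_idx[OF has_ext[OF e2 X]] u])
     (use ed i' in auto)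
   show "cmp E2 (%x. \<Sum>k<n x. if m x <= k then (?b x k div ?b x (n x)) * B x k (l x) else 0)"
   proof (rule cmp_sum[OF c2[OF n(1)] s2[OF n(2)]], rule cmp_ite'[OF decn_le[OF cmp_idx[OF c2[OF m]] k] _ cmp_const], intro cmp_mult cmp_div)
    show "cmp ?E (%z. ?b (fst z) (snd z))" by (rule b[OF k]) auto
    show "cmp ?E (%z. ?b (fst z) (n (fst z)))" by (rule b[OF cmp_idx[OF c2[OF n(1)]]]) auto
    show "cmp ?E (%z. B (fst z) (snd z) (l (fst z)))"
     by (rule cmp_has[OF has_idx[OF h2[OF B]] k cmp_idx[OF c2[OF l(1)]]]) (use ed l in auto)
   qed
  qed
 qed
qed

lemma lsw_le: "lsw G m k <= k" by (induction k) auto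

lemma cmp_lsw:
 assumes n: "cmpn E n" "small E n" and m: "cmpn E m" and G: "has E n (%x. Suc (n x)) G"
 shows "cmpn E (%x. lsw (G x) (m x) (n x))"
proof (rule cmp_recv[where S="%x k i. int (lsw (G x) (m x) k)" and N=n and n="%_. 1", OF n cmpn_const small_const])
 have sn: "small (idx (idx E (%x. Suc (n x))) (%z. 1)) (%z. snd (fst z))"
  by (rule small_idx[OF small_idx_var[OF small_Suc[OF n(2)]]])
 show "sbits (idx (idx E (%x. Suc (n x))) (%z. 1)) (%z. int (lsw (G (fst2 z)) (m (fst2 z)) (snd (fst z))))"
  by (rule sbits_mono[OF sbits_nat[OF sn]]) (simp add: lsw_le)
 show "cmp (idx E (%_. 1)) (%z. int (lsw (G (fst z)) (m (fst z)) 0))" by (simp add: cmp_const)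
 show "cmp E' (%x. int (lsw (G x) (m x) (n x)))" if "ext E E'" "hasv E' (%_. 1) (%x i. int (lsw (G x) (m x) (n x)))" for E'
  by (rule cmp_hasv[OF that(2) cmpn_const[of _ 0]]) simp
 fix E' assume e: "ext (idx E n) E'" and S: "hasv E' (%z. 1) (%z i. int (lsw (G (fst z)) (m (fst z)) (snd z)))"
 have w: "cmpn E' (%z. lsw (G (fst z)) (m (fst z)) (snd z))" by (rule cmp_hasv[OF S cmpn_const[of _ 0]]) simp
 have k: "cmpn E' snd" by (rule cmp_ext[OF e cmp_snd[OF n(2)]])
 have ed: "z \<in> edom E' ==> snd z < n (fst z)" for z using ext_edom[OF e] by auto
 have d: "cmp E' (%z. dlt (G (fst z)) (u z))" if "cmpn E' u" "!!z. z \<in> edom E' ==> u z <= n (fst z)" for u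
  by (rule cmp_dlt[OF cmp_up[OF e n(1)] small_up[OF e n(2)] has_up[OF e G] that])
 have d1: "cmp E' (%z. dlt (G (fst z)) (snd z))" by (rule d[OF k]) (use ed in force)
 have d2: "cmp E' (%z. dlt (G (fst z)) (Suc (snd z)))" by (rule d[OF cmpn_Suc[OF k]]) (use ed in force)
 have d3: "cmp E' (%z. dlt (G (fst z)) (snd z - 1))" by (rule d[OF cmpn_diff[OF k cmpn_const]]) (use ed in force)
 have "cmp E' (%z. int (lsw (G (fst z)) (m (fst z)) (Suc (snd z))))" unfolding lsw.simps
  by (rule cmpn_ite[OF decn_less[OF cmpn_const w] w cmpn_ite[OF dec_conj[OF decn_less[OF cmp_up[OF e m] k]
      dec_less[OF cmp_mult[OF cmp_mult[OF cmp_const d2] d3] cmp_mult[OF d1 d1]]] k cmpn_const]])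
 thus "cmp (idx E' (%z. 1)) (%z. int (lsw (G (fst2 z)) (m (fst2 z)) (Suc (snd (fst z)))))"
  by (rule cmp_idx)
qed

lemma cmp_trp: "cmpn E i ==> cmpn E k ==> cmpn E (%x. trp (i x) (k x))"
 unfolding trp_def by (intro cmpn_ite dec_conj decn_eq decn_less cmpn_diff cmpn_const cmpn_Suc)

lemma trp_less: "i < n ==> k < n ==> trp i k < n" by (auto simp: trp_def)

lemma cmp_lstep:
 assumes n: "cmpn E n" "small E n" and m: "cmpn E m" and Q: "has E n n Q" and B: "has E n n B" and c: "has E (%_. 1) n (%x i. c x)"
  and i: "cmpn E i" "!!x. x \<in> edom E ==> i x < n x" and l: "cmpn E l" "!!x. x \<in> edom E ==> l x < n x"
 shows "cmp E (%x. lstep (n x) (m x) (Q x) (c x) (B x) (i x) (l x))" unfolding lstep_def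
proof (rule cmp_let_ext[where S="%x. gc (n x) (Q x) (c x) (B x)" and n=n and l="%x. Suc (n x)", OF n cmpn_Suc[OF n(1)] small_Suc[OF n(2)]])
 show "cmp (idx (idx E n) (%z. Suc (n (fst z)))) (%z. gc (n (fst2 z)) (Q (fst2 z)) (c (fst2 z)) (B (fst2 z)) (snd (fst z)) (snd z))"
  by (rule cmp_gc[OF cmp_idx[OF cmp_idx[OF n(1)]] small_idx[OF small_idx[OF n(2)]] has_idx[OF has_idx[OF Q]] has_idx[OF has_idx[OF B]]
     has_idx[OF has_idx[OF c]] cmp_idx[OF cmp_snd[OF n(2)]] _ cmp_snd[OF small_idx[OF small_Suc[OF n(2)]]]]) auto
 fix E' assume e: "ext E E'" and G: "has E' n (%x. Suc (n x)) (%x. gc (n x) (Q x) (c x) (B x))"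
 note n' = cmp_ext[OF e n(1)] small_ext[OF e n(2)] and m' = cmp_ext[OF e m]
 have w: "cmpn E' (%x. trp (lsw (gc (n x) (Q x) (c x) (B x)) (m x) (n x)) (i x))"
  by (rule cmp_trp[OF cmp_lsw[OF n' m' G] cmp_ext[OF e i(1)]])
 show "cmp E' (%x. srow (n x) (m x) (gc (n x) (Q x) (c x) (B x)) (B x) (trp (lsw (gc (n x) (Q x) (c x) (B x)) (m x) (n x)) (i x)) (l x))"
 proof (rule cmp_srow[OF n' m' G has_ext[OF e B] w _ cmp_ext[OF e l(1)]])
  fix x assume "x \<in> edom E'"
  hence x: "x \<in> edom E" using ext_edom[OF e] by simp
  thus "l x < n x" by (rule l(2))
  show "trp (lsw (gc (n x) (Q x) (c x) (B x)) (m x) (n x)) (i x) < n x"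
   using lsw_spec[of "gc (n x) (Q x) (c x) (B x)" "m x" "n x"] i(2)[OF x] by (intro trp_less) auto
 qed
qed

lemma lll_bound:
 assumes lt: "lattice n m Q a" and i: "i < n"
 shows "\<bar>lll n m Q c T i l\<bar> <= dq n a * (int n + 1) * a"
proof -
 interpret lattice n m Q c a by (rule lt)
 obtain g where "!!i l. i < n ==> (lll n m Q c T i l)\<^sup>2 <= ebd" by (rule lll_spec[where T=T]) (rule that)
 hence "(lll n m Q c T i l)\<^sup>2 <= dq n a * (int n + 1) * a" using i by (simp add: ebd_def)
 moreover have "\<bar>x\<bar> <= x\<^sup>2" for x :: int proof (cases "x = 0")
  case False
  hence "\<bar>x\<bar> * 1 <= \<bar>x\<bar> * \<bar>x\<bar>" by (intro mult_left_mono) auto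
  thus ?thesis by (simp add: power2_eq_square)
 qed simp
 ultimately show ?thesis by (meson order_trans)
qed

text \<open>The required bound on all intermediate bases comes from the analysis of lattice
  reduction; hence the hypothesis of positive definiteness on the whole domain.\<close>

lemma cmp_lll:
 assumes n: "cmpn E n" "small E n" and m: "cmpn E m" and T: "cmpn E T" "small E T" and Q: "has E n n Q" and c: "has E (%_. 1) n (%x i. c x)"
  and lt: "!!x. x \<in> edom E ==> m x <= n x & symn (n x) (Q x) & posdef (Q x) (n x)"
  and body: "!!E'. ext E E' ==> has E' n n (%x. lll (n x) (m x) (Q x) (c x) (T x)) ==> cmp E' f"
 shows "cmp E f"
proof (rule cmp_rec_ext[where S="%x k. lll (n x) (m x) (Q x) (c x) k" and N=T, OF T n n _ _ _ body])
 have i: "cmpn (idx (idx E n) (%z. n (fst z))) (%z. snd (fst z))" by (rule cmp_idx[OF cmp_snd[OF n(2)]])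
 have j: "cmpn (idx (idx E n) (%z. n (fst z))) snd" by (rule cmp_snd[OF small_idx[OF n(2)]])
 note up = cmp_idx[OF cmp_idx]
 show "cmp (idx (idx E n) (%z. n (fst z))) (%z. lll (n (fst2 z)) (m (fst2 z)) (Q (fst2 z)) (c (fst2 z)) 0 (snd (fst z)) (snd z))"
  unfolding lll.simps
  by (rule cmp_ite'[OF decn_eq[OF j cmpn_ite[OF decn_less[OF i up[OF m]] cmpn_add[OF cmpn_diff[OF up[OF n(1)] up[OF m]] i] cmpn_diff[OF i up[OF m]]]]
     cmp_const cmp_const])
 show "cmp (idx (idx E' (%z. n (fst z))) (%z. n (fst2 z)))
  (%z. lll (n (fst3 z)) (m (fst3 z)) (Q (fst3 z)) (c (fst3 z)) (Suc (snd (fst2 z))) (snd (fst z)) (snd z))"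
  if e: "ext (idx E T) E'" and B: "has E' (%z. n (fst z)) (%z. n (fst z)) (%z. lll (n (fst z)) (m (fst z)) (Q (fst z)) (c (fst z)) (snd z))" for E'
  unfolding lll.simps
  by (rule cmp_lstep[OF cmp_idx[OF cmp_idx[OF cmp_up[OF e n(1)]]] small_idx[OF small_idx[OF small_up[OF e n(2)]]] cmp_idx[OF cmp_idx[OF cmp_up[OF e m]]]
     has_idx[OF has_idx[OF has_up[OF e Q]]] has_idx[OF has_idx[OF B]] has_idx[OF has_idx[OF has_up[OF e c]]]
     cmp_idx[OF cmp_snd[OF small_up[OF e n(2)]]] _ cmp_snd[OF small_idx[OF small_up[OF e n(2)]]]]) auto
 obtain S where S: "small E S" "!!x i j. x \<in> edom E ==> i < n x ==> j < n x ==> \<bar>Q x i j\<bar> <= 2 ^ S x" by (rule small_2pow[OF Q]) (rule that)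
 let ?b = "%x. dq (n x) (2 ^ S x) * (int (n x) + 1) * 2 ^ S x"
 have "sbits E ?b" unfolding dq_def
  by (intro sbits_mult sbits_power sbits_fact sbits_pow2 sbits_add sbits_nat sbits_const small_intros n S)
 hence b: "sbits (idx (idx (idx E (%x. Suc (T x))) (%z. n (fst z))) (%z. n (fst2 z))) (%z. ?b (fst3 z))"
  by (intro sbits_idx[OF sbits_idx[OF sbits_idx]])
 show "sbits (idx (idx (idx E (%x. Suc (T x))) (%z. n (fst z))) (%z. n (fst2 z)))
  (%z. lll (n (fst3 z)) (m (fst3 z)) (Q (fst3 z)) (c (fst3 z)) (snd (fst2 z)) (snd (fst z)) (snd z))"
 proof (rule sbits_mono[OF b])
  fix z assume "z \<in> edom (idx (idx (idx E (%x. Suc (T x))) (%z. n (fst z))) (%z. n (fst2 z)))"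
  then obtain x k i l where z: "z = (((x, k), i), l)" and x: "x \<in> edom E" and i: "i < n x" by (cases z) auto
  have "lattice (n x) (m x) (Q x) (2 ^ S x)" using lt[OF x] S(2)[OF x] by unfold_locales auto
  from lll_bound[OF this i, of "c x" k l]
  show "\<bar>lll (n (fst3 z)) (m (fst3 z)) (Q (fst3 z)) (c (fst3 z)) (snd (fst2 z)) (snd (fst z)) (snd z)\<bar>
   <= \<bar>?b (fst3 z)\<bar>" unfolding z by simp
 qed
qed

lemma cmp_lin:
 assumes n: "cmpn E n" "small E n" and h: "has E (%_. 1) n (%x i. h x)" and B: "has E p n B"
  and r: "cmpn E r" "!!x. x \<in> edom E ==> r x < p x"
 shows "cmp E (%x. lin (n x) (h x) (B x (r x)))" unfolding lin_def
proof (rule cmp_sum[OF n], rule cmp_mult)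
 have i: "cmpn (idx E n) snd" by (rule cmp_snd[OF n(2)])
 show "cmp (idx E n) (%z. h (fst z) (snd z))" by (rule cmp_has[OF has_idx[OF h] cmpn_const[of _ 0] i]) auto
 show "cmp (idx E n) (%z. B (fst z) (r (fst z)) (snd z))" by (rule cmp_has[OF has_idx[OF B] cmp_idx[OF r(1)] i]) (use r in auto)
qed

lemma let_zst:
 assumes n: "cmpn E n" "small E n" and P: "cmp E P" and G: "has E n (%x. Suc (n x)) G" and s: "hasv E n s"
  and N: "cmpn E N" "!!x. x \<in> edom E ==> N x <= n x"
  and body: "!!E'. ext E E' ==> hasv E' (%x. Suc (n x)) (%x. zst (n x) (P x) (G x) (s x) (N x)) ==> cmp E' f"
 shows "cmp E f"
proof (rule cmp_letv[where d="%x. Suc (n x)" and X="%x. cen (n x) (P x) (G x)"])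
 let ?n = "%x. Suc (n x)"
 show sn: "small E ?n" and "cmpn E ?n" by (rule small_Suc[OF n(2)], rule cmpn_Suc[OF n(1)])
 have l: "cmpn (idx E ?n) snd" by (rule cmp_snd[OF sn])
 have n': "cmpn (idx E ?n) (%z. n (fst z))" "small (idx E ?n) (%z. n (fst z))" by (rule cmp_idx[OF n(1)], rule small_idx[OF n(2)])
 show "cmp (idx E ?n) (%z. cen (n (fst z)) (P (fst z)) (G (fst z)) (snd z))" unfolding cen_def
  by (rule cmp_ite'[OF decn_eq[OF l n'(1)] cmp_mult[OF cmp_dlt[OF n' has_idx[OF G] n'(1) le_refl] cmp_idx[OF P]]
     cmp_bst[OF has_idx[OF G] n' _ l n'(1)]]) auto
 fix E1 assume e1: "ext E E1" and C: "hasv E1 ?n (%x. cen (n x) (P x) (G x))"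
 note n1 = cmp_ext[OF e1 n(1)] small_ext[OF e1 n(2)]
 show "cmp E1 f"
 proof (rule cmp_letv[where d="?n" and X="%x. zst (n x) (P x) (G x) (s x) (N x)", OF cmpn_Suc[OF n1(1)] small_Suc[OF n1(2)]])
  show "cmp (idx E1 ?n) (%z. zst (n (fst z)) (P (fst z)) (G (fst z)) (s (fst z)) (N (fst z)) (snd z))"
   unfolding zst_def
   by (rule cmp_bab[OF cmp_idx[OF n1(1)] small_idx[OF n1(2)] has_idx[OF has_ext[OF e1 G]] cmp_idx[OF n1(1)] le_refl
      cmpn_diff[OF cmp_idx[OF n1(1)] cmp_idx[OF cmp_ext[OF e1 N(1)]]] _ has_idx[OF has_ext[OF e1 s]] has_idx[OF C]
      cmp_snd[OF small_Suc[OF n1(2)]]]) auto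
  fix E2 assume "ext E1 E2" and "hasv E2 ?n (%x. zst (n x) (P x) (G x) (s x) (N x))"
  thus "cmp E2 f" using body[OF ext_trans[OF e1]] by blast
 qed
qed

lemma cmp_tmat:
 assumes n: "cmpn E n" "small E n" and H: "has E n n Hm" and h: "has E (%_. 1) n (%x i. hv x)" and B: "has E n n B"
  and G: "has E n (%x. Suc (n x)) G" and Z: "hasv E (%x. Suc (n x)) Z" and N: "cmpn E N" "!!x. x \<in> edom E ==> N x <= n x"
  and ee: "cmpn E ee" "small E ee" and sg: "cmp E sg" and i: "cmpn E i" "!!x. x \<in> edom E ==> i x <= n x"
  and k: "cmpn E k" "small E k" and l: "cmpn E l" and k': "cmpn E k'" "small E k'"
  and r: "cmpn E r" "!!x. x \<in> edom E ==> r x < n x" and j: "cmpn E j"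
 shows "cmp E (%x. tmat (n x) (Hm x) (hv x) (B x) (G x) (Z x) (N x) (ee x) (sg x) (i x) (k x) (l x) (k' x) (r x) (j x))"
 unfolding tmat_def
proof (rule cmp_ite[OF decn_less[OF j N(1)]])
 let ?E = "sub E (%x. j x < N x)"
 have jn: "j x < n x" if "x \<in> edom ?E" for x using that N(2)[of x] by auto
 have "cmp ?E (%x. gram (n x) (Hm x) (B x (r x)) (B x (j x)))"
  by (rule cmp_gram[OF cmp_sub[OF n(1)] small_sub[OF n(2)] has_sub[OF H] has_sub[OF B] cmp_sub[OF r(1)] _ has_sub[OF B] cmp_sub[OF j]])
   (use jn r in auto)
 moreover have "cmp ?E (%x. G x (r x) (j x))"
  by (rule cmp_has[OF has_sub[OF G] cmp_sub[OF r(1)] cmp_sub[OF j]]) (use jn r in "auto simp: less_SucI")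
 ultimately show "cmp ?E (%x. 2 ^ ee x * gram (n x) (Hm x) (B x (r x)) (B x (j x)) + int (l x) * 2 ^ k' x * G x (r x) (j x))"
  by (intro cmp_add cmp_mult cmp_power cmp_const cmp_sub[OF ee(1)] small_sub[OF ee(2)] cmp_sub[OF l] cmp_sub[OF k'(1)] small_sub[OF k'(2)])
 let ?E = "idx E n"
 have v: "cmpn ?E snd" by (rule cmp_snd[OF n(2)])
 have Zv: "cmp ?E (%z. Z (fst z) (snd z))" by (rule cmp_hasv[OF has_idx[OF Z] v]) auto
 have Zn: "cmp E (%x. Z x (n x))" by (rule cmp_hasv[OF Z n(1)]) auto
 have g: "cmp ?E (%z. gram (n (fst z)) (Hm (fst z)) (B (fst z) (r (fst z))) (B (fst z) (snd z)))"
  by (rule cmp_gram[OF cmp_idx[OF n(1)] small_idx[OF n(2)] has_idx[OF H] has_idx[OF B] cmp_idx[OF r(1)] _ has_idx[OF B] v])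
   (use r in auto)
 have gg: "cmp ?E (%z. gn (G (fst z)) (i (fst z)) (snd z))"
  by (rule cmp_gn[OF cmp_idx[OF n(1)] small_idx[OF n(2)] has_idx[OF G] cmp_idx[OF i(1)] _ v]) (use i in auto)
 have Gr: "cmp ?E (%z. G (fst z) (snd z) (r (fst z)))"
  by (rule cmp_has[OF has_idx[OF G] v cmp_idx[OF r(1)]]) (use r in "auto simp: less_SucI")
 have hl: "cmp E (%x. lin (n x) (hv x) (B x (r x)))" by (rule cmp_lin[OF n h B r])
 have p: "cmp E (%x. 2 ^ ee x)" "cmp E (%x. 2 ^ k x)" by (intro cmp_power cmp_const ee k)+
 show "cmp (sub E (%x. ~ j x < N x)) (%x. - (2 ^ ee x * (2 * (\<Sum>j<n x. Z x j * gram (n x) (Hm x) (B x (r x)) (B x j)) + Z x (n x) * lin (n x) (hv x) (B x (r x)))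
  + sg x * Z x (n x) * 2 ^ k x * (\<Sum>l<n x. gn (G x) (i x) l * G x l (r x))))"
  by (rule cmp_sub, rule cmp_minus,
    rule cmp_add[OF cmp_mult[OF p(1) cmp_add[OF cmp_mult[OF cmp_const cmp_sum[OF n cmp_mult[OF Zv g]]] cmp_mult[OF Zn hl]]]
     cmp_mult[OF cmp_mult[OF cmp_mult[OF sg Zn] p(2)] cmp_sum[OF n cmp_mult[OF gg Gr]]]])
qed

lemma cmp_ysol:
 assumes n: "cmpn E n" "small E n" and M: "has E n (%x. Suc (n x)) M" and N: "cmpn E N" "!!x. x \<in> edom E ==> N x <= n x"
  and sg: "cmp E sg" and l: "cmpn E l" "!!x. x \<in> edom E ==> l x <= N x"
 shows "cmp E (%x. ysol (M x) (N x) (sg x) (l x))"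
proof -
 have d: "cmp E (%x. dlt (M x) (N x))" by (rule cmp_dlt[OF n M N])
 have b: "cmp E (%x. bst (M x) (N x) (N x) (l x) (N x))"
  by (rule cmp_bst[OF M N(1) small_mono[OF n(2) N(2)] _ l(1) N(1)]) (use N l in "auto simp: less_Suc_eq_le")
 show ?thesis unfolding ysol_def
  by (rule cmp_ite'[OF dec_disj[OF dec_eq[OF sg cmp_const] dec_le[OF d cmp_const]] cmp_ite'[OF decn_eq[OF l(1) N(1)] cmp_const cmp_const]
     cmp_ite'[OF decn_eq[OF l(1) N(1)] d b]])
qed

lemma cmp_x1:
 assumes n: "cmpn E n" "small E n" and N: "cmpn E N" and KK: "cmp E KK"
  and Z: "hasv E (%x. Suc (n x)) Z" and Y: "hasv E (%x. Suc (N x)) Y" and l: "cmpn E l" "!!x. x \<in> edom E ==> l x <= n x"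
 shows "cmp E (%x. x1 (n x) (N x) (KK x) (Z x) (Y x) (l x))"
proof -
 have Zn: "cmp E (%x. Z x (n x))" by (rule cmp_hasv[OF Z n(1)]) auto
 have Zl: "cmp E (%x. Z x (l x))" by (rule cmp_hasv[OF Z l(1)]) (use l in "auto simp: less_Suc_eq_le")
 have YN: "cmp E (%x. Y x (N x))" by (rule cmp_hasv[OF Y N]) auto
 have Yl: "cmp (sub E (%x. l x < N x)) (%x. Y x (l x))" by (rule cmp_hasv[OF has_sub[OF Y] cmp_sub[OF l(1)]]) auto
 show ?thesis unfolding x1_def
  by (rule cmp_ite'[OF decn_eq[OF l(1) n(1)] cmp_mult[OF Zn cmp_mult[OF cmp_mult[OF cmp_const YN] KK]]
     cmp_add[OF cmp_mult[OF Zl cmp_mult[OF cmp_mult[OF cmp_const YN] KK]]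
      cmp_ite[OF decn_less[OF l(1) N] cmp_mult[OF cmp_sub[OF cmp_diff[OF KK cmp_const]] Yl] cmp_const]]])
qed

lemma cmp_xout:
 assumes n: "cmpn E n" "small E n" and B: "has E n n B" and X: "hasv E (%x. Suc (n x)) X"
  and l: "cmpn E l" "!!x. x \<in> edom E ==> l x <= n x"
 shows "cmp E (%x. xout (n x) (B x) (X x) (l x))" unfolding xout_def
proof (rule cmp_ite[OF decn_eq[OF l(1) n(1)]])
 show "cmp (sub E (%x. l x = n x)) (%x. X x (n x))" by (rule cmp_sub, rule cmp_hasv[OF X n(1)]) auto
 let ?E = "sub E (%x. ~ l x = n x)"
 have v: "cmpn (idx ?E n) snd" by (rule cmp_snd[OF small_sub[OF n(2)]])
 show "cmp ?E (%x. \<Sum>k<n x. X x k * B x k (l x))"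
 proof (rule cmp_sum[OF cmp_sub[OF n(1)] small_sub[OF n(2)]], rule cmp_mult)
  show "cmp (idx ?E n) (%z. X (fst z) (snd z))" by (rule cmp_hasv[OF has_idx[OF has_sub[OF X]] v]) auto
  show "cmp (idx ?E n) (%z. B (fst z) (snd z) (l (fst z)))"
  proof (rule cmp_has[OF has_idx[OF has_sub[OF B]] v cmp_idx[OF cmp_sub[OF l(1)]]])
   fix z assume "z \<in> edom (idx ?E n)"
   hence "fst z \<in> edom E" "l (fst z) ~= n (fst z)" "snd z < n (fst z)" by auto
   thus "snd z < n (fst z) & l (fst z) < n (fst z)" using l(2)[of "fst z"] by simp
  qed
 qed
qed

text \<open>Each stage reads the preceding one as a table, so the stages are bound one after the
  other in a chain of extensions.\<close>

lemma cmp_cand: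
 assumes n: "cmpn E n" "small E n" and m: "cmpn E m" and P: "cmp E P" and KK: "cmp E KK"
  and H: "has E n n Hm" and h: "has E (%_. 1) n (%x i. hv x)" and B: "has E n n B"
  and G: "has E n (%x. Suc (n x)) G" and s: "hasv E n s" and N: "cmpn E N" "!!x. x \<in> edom E ==> N x <= n x"
  and ee: "cmpn E ee" "small E ee" and sg: "cmp E sg" and i: "cmpn E i" "!!x. x \<in> edom E ==> i x <= n x"
  and k: "cmpn E k" "small E k" and l: "cmpn E l" and k': "cmpn E k'" "small E k'"
  and j: "cmpn E j" "!!x. x \<in> edom E ==> j x <= n x"
 shows "cmp E (%x. xout (n x) (B x) (cand (n x) (m x) (Hm x) (hv x) (B x) (G x) (KK x) (zst (n x) (P x) (G x) (s x) (N x)) (N x) (ee x) (sg x)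
  (i x) (k x) (l x) (k' x)) (j x))"
proof (rule let_zst[OF n P G s N])
 let ?Z = "%x. zst (n x) (P x) (G x) (s x) (N x)"
 let ?M = "%x. tmat (n x) (Hm x) (hv x) (B x) (G x) (?Z x) (N x) (ee x) (sg x) (i x) (k x) (l x) (k' x)"
 let ?Y = "%x. ysol (?M x) (N x) (sg x)"
 let ?X = "%x. x1 (n x) (N x) (KK x) (?Z x) (?Y x)"
 let ?C = "%x. bab (n x) (G x) (N x) (%_. 0) (?X x) (N x - m x)"
 let ?f = "%x. xout (n x) (B x) (cand (n x) (m x) (Hm x) (hv x) (B x) (G x) (KK x) (?Z x) (N x) (ee x) (sg x) (i x) (k x) (l x) (k' x)) (j x)"
 have sN: "small E N" by (rule small_mono[OF n(2) N(2)])
 fix E1 assume e1: "ext E E1" and Z: "hasv E1 (%x. Suc (n x)) ?Z"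
 note x1 = ext_edom[OF e1] and n1 = cmp_ext[OF e1 n(1)] small_ext[OF e1 n(2)]
 show "cmp E1 ?f"
 proof (rule cmp_let_ext[where n=n and l="%x. Suc (n x)" and S="?M", OF n1 cmpn_Suc[OF n1(1)] small_Suc[OF n1(2)]])
  note u = cmp_idx[OF cmp_idx[OF cmp_ext[OF e1]]] and us = small_idx[OF small_idx[OF small_ext[OF e1]]] and uh = has_idx[OF has_idx[OF has_ext[OF e1]]]
  show "cmp (idx (idx E1 n) (%z. Suc (n (fst z)))) (%z. ?M (fst2 z) (snd (fst z)) (snd z))"
   by (rule cmp_tmat[OF u[OF n(1)] us[OF n(2)] uh[OF H] uh[OF h] uh[OF B] uh[OF G] has_idx[OF has_idx[OF Z]] u[OF N(1)] _ u[OF ee(1)] us[OF ee(2)]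
      u[OF sg] u[OF i(1)] _ u[OF k(1)] us[OF k(2)] u[OF l] u[OF k'(1)] us[OF k'(2)] cmp_idx[OF cmp_snd[OF n1(2)]] _
      cmp_snd[OF small_idx[OF small_Suc[OF n1(2)]]]])
    (use N i x1 in auto)
  fix E2 assume e2: "ext E1 E2" and M: "has E2 n (%x. Suc (n x)) ?M"
  note e = ext_trans[OF e1 e2]
  note x2 = ext_edom[OF e] and n2 = cmp_ext[OF e n(1)] small_ext[OF e n(2)] and N2 = cmp_ext[OF e N(1)] small_ext[OF e sN]
  show "cmp E2 ?f"
  proof (rule cmp_letv[where d="%x. Suc (N x)" and X="?Y", OF cmpn_Suc[OF N2(1)] small_Suc[OF N2(2)]])
   show "cmp (idx E2 (%x. Suc (N x))) (%z. ?Y (fst z) (snd z))"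
    by (rule cmp_ysol[OF cmp_idx[OF n2(1)] small_idx[OF n2(2)] has_idx[OF M] cmp_idx[OF N2(1)] _ cmp_idx[OF cmp_ext[OF e sg]]
       cmp_snd[OF small_Suc[OF N2(2)]]]) (use N x2 in auto)
   fix E3 assume e3: "ext E2 E3" and Y: "hasv E3 (%x. Suc (N x)) ?Y"
   note e' = ext_trans[OF e e3]
   note x3 = ext_edom[OF e'] and n3 = cmp_ext[OF e' n(1)] small_ext[OF e' n(2)] and N3 = cmp_ext[OF e' N(1)] and m3 = cmp_ext[OF e' m]
   show "cmp E3 ?f"
   proof (rule cmp_letv[where d="%x. Suc (n x)" and X="?X", OF cmpn_Suc[OF n3(1)] small_Suc[OF n3(2)]])
    show "cmp (idx E3 (%x. Suc (n x))) (%z. ?X (fst z) (snd z))"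
     by (rule cmp_x1[OF cmp_idx[OF n3(1)] small_idx[OF n3(2)] cmp_idx[OF N3] cmp_idx[OF cmp_ext[OF e' KK]]
        has_idx[OF has_ext[OF e3 has_ext[OF e2 Z]]] has_idx[OF Y] cmp_snd[OF small_Suc[OF n3(2)]]]) auto
    fix E4 assume e4: "ext E3 E4" and X: "hasv E4 (%x. Suc (n x)) ?X"
    show "cmp E4 ?f"
    proof (rule cmp_letv[where d=n and X="%_ _. 0", OF cmp_ext[OF e4 n3(1)] small_ext[OF e4 n3(2)] cmp_const])
     fix E5 assume e5: "ext E4 E5" and O: "hasv E5 n (%_ _. 0)"
     note e6 = ext_trans[OF ext_trans[OF e' e4] e5]
     note x5 = ext_edom[OF e6] and n5 = cmp_ext[OF e6 n(1)] small_ext[OF e6 n(2)] and N5 = cmp_ext[OF e6 N(1)] and m5 = cmp_ext[OF e6 m]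
     show "cmp E5 ?f"
     proof (rule cmp_letv[where d="%x. Suc (n x)" and X="?C", OF cmpn_Suc[OF n5(1)] small_Suc[OF n5(2)]])
      show "cmp (idx E5 (%x. Suc (n x))) (%z. ?C (fst z) (snd z))"
       by (rule cmp_bab[where s="%_ _. 0", OF cmp_idx[OF n5(1)] small_idx[OF n5(2)] has_idx[OF has_ext[OF e6 G]] cmp_idx[OF N5] _
          cmpn_diff[OF cmp_idx[OF N5] cmp_idx[OF m5]] _ has_idx[OF O] has_idx[OF has_ext[OF e5 X]] cmp_snd[OF small_Suc[OF n5(2)]]])
        (use N x5 in auto)
      fix E7 assume e7: "ext E5 E7" and C: "hasv E7 (%x. Suc (n x)) ?C"
      note e8 = ext_trans[OF e6 e7]
      show "cmp E7 ?f" unfolding cand_def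
       by (rule cmp_xout[OF cmp_ext[OF e8 n(1)] small_ext[OF e8 n(2)] has_ext[OF e8 B] C cmp_ext[OF e8 j(1)]])
        (use j(2) ext_edom[OF e8] in auto)
     qed
    qed
   qed
  qed
 qed
qed

section \<open>Enumerating the candidates\<close>

definition dig :: "nat => nat => nat => nat" where
 "dig R w i = w div R ^ i mod R"

text \<open>For \<open>W = 2 * KO + 1\<close> the digits \<open>0, ..., W - 1\<close> are shifted to
  the symmetric range from \<open>- KO\<close> to \<open>KO\<close>.\<close>

definition offs :: "nat => nat => imat" where
 "offs m W w j = (if j < m then 0 else int (dig W w (j - m)) - int (W div 2))"

text \<open>Like \<open>dir\<close> below, replaces an illegal digit by a legal value, so that every
  value of the counter denotes a candidate.\<close>

definition lvl :: "nat => nat => nat => nat" where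
 "lvl m n d = (if m <= d & d <= n then d else n)"

definition dir :: "nat => nat => nat" where
 "dir n d = (if d < n then d else 0)"

text \<open>The counter \<open>w\<close> in mixed radix: its low part holds the offsets in base
  \<open>W\<close>, its high part the six guesses \<open>N\<close>, \<open>sg + 1\<close>,
  \<open>i\<close>, \<open>k\<close>, \<open>l\<close>, \<open>k'\<close> in base
  \<open>R\<close>.\<close>

definition acand :: "nat => nat => imat => ivec => imat => imat =>
  int => int => nat => nat => nat => imat" where
 "acand n m Hm hv B G P K E W R w =
  xout n B (cand n m Hm hv B G (40 * K)
   (zst n P G (offs m W (w mod W ^ (n - m))) (lvl m n (dig R (w div W ^ (n - m)) 0)))
   (lvl m n (dig R (w div W ^ (n - m)) 0)) E (int (dig R (w div W ^ (n - m)) 1) - 1)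
   (dir n (dig R (w div W ^ (n - m)) 2)) (dig R (w div W ^ (n - m)) 3) (dig R (w div W ^ (n - m)) 4) (dig R (w div W ^ (n - m)) 5))"

text \<open>The ellipsoid constraint for the point \<open>X / X n\<close> and the centre
  \<open>c / P\<close>, with denominators cleared.\<close>

definition feas :: "nat => imat => ivec => int => ivec => bool" where
 "feas n Q c P X \<longleftrightarrow> gram n Q (%l. P * X l - X n * c l) (%l. P * X l - X n * c l) <= P * (X n * P)\<^sup>2"

text \<open>The numerator of the objective value over the denominator
  \<open>(X n)^2\<close>.\<close>

definition objn :: "nat => imat => ivec => ivec => int" where
 "objn n Hm hv X = gram n Hm X X + X n * lin n hv X"

text \<open>The best feasible point found so far has numerators \<open>b 1, ..., b n\<close> and denominator \<open>b (n + 1)\<close>; \<open>b 0\<close> tells whether there is one.\<close>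

definition better :: "nat => imat => ivec => int => imat => ivec =>
  ivec => ivec => bool" where
 "better n Q c P Hm hv X b \<longleftrightarrow> feas n Q c P X &
  (b 0 = 0 \<or> objn n Hm hv X * (b (Suc n))\<^sup>2 < objn n Hm hv (%l. b (Suc l)) * (X n)\<^sup>2)"

primrec best :: "nat => imat => ivec => int => imat => ivec =>
  imat => imat" where
 "best n Q c P Hm hv C 0 = (%i. 0)"
| "best n Q c P Hm hv C (Suc k) = (%i. if better n Q c P Hm hv (C k) (best n Q c P Hm hv C k)
  then (if i = 0 then 1 else C k (i - 1)) else best n Q c P Hm hv C k i)"

text \<open>All coordinates share one denominator, which the output format wants repeated after each
  numerator.\<close>

definition outc :: "nat => ivec => nat => int" where
 "outc n b j = (if j = 0 then b 0 else if j mod 2 = 1 then b (Suc (j div 2)) else b (Suc n))"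

lemma best_spec:
 assumes p: "!!k. k < N ==> 0 < C k n"
 shows "best n Q c P Hm hv C N 0 = 0 & (ALL k<N. ~ feas n Q c P (C k)) \<or>
  best n Q c P Hm hv C N 0 = 1 & (EX k<N. feas n Q c P (C k) & (ALL i. best n Q c P Hm hv C N (Suc i) = C k i) &
   (ALL k'<N. feas n Q c P (C k') --> objn n Hm hv (C k) / (C k n)\<^sup>2 <= (objn n Hm hv (C k') / (C k' n)\<^sup>2 :: real)))"
 using p
proof (induction N)
 case (Suc N)
 let ?b = "best n Q c P Hm hv C N" let ?v = "%k. objn n Hm hv (C k) / (C k n)\<^sup>2 :: real"
 from Suc consider "?b 0 = 0" "ALL k<N. ~ feas n Q c P (C k)"
  | k where "?b 0 = 1" "k < N" "feas n Q c P (C k)" "ALL i. ?b (Suc i) = C k i" "ALL k'<N. feas n Q c P (C k') --> ?v k <= ?v k'"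
  by auto
 thus ?case proof cases
  case 1
  show ?thesis proof (cases "feas n Q c P (C N)")
   case True
   hence "better n Q c P Hm hv (C N) ?b" using 1 by (simp add: better_def)
   thus ?thesis using True 1 by (intro disjI2 conjI exI[of _ N]) (auto simp: less_Suc_eq)
  next
   case False
   hence "~ better n Q c P Hm hv (C N) ?b" by (simp add: better_def)
   thus ?thesis using False 1 by (auto simp: less_Suc_eq)
  qed
 next
  case 2
  have bs: "(%l. ?b (Suc l)) = C k" using 2(4) by (intro ext) simp
  have pk: "0 < C k n" "0 < C N n" using Suc.prems 2(2) by auto
  have lt: "(objn n Hm hv (C N) * (C k n)\<^sup>2 < objn n Hm hv (C k) * (C N n)\<^sup>2) = (?v N < ?v k)" proof -
   have "(?v N < ?v k) = (real_of_int (objn n Hm hv (C N)) * (of_int (C k n))\<^sup>2 < of_int (objn n Hm hv (C k)) * (of_int (C N n))\<^sup>2)"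
    using pk by (simp add: divide_less_eq less_divide_eq field_simps)
   also have "... = (real_of_int (objn n Hm hv (C N) * (C k n)\<^sup>2) < of_int (objn n Hm hv (C k) * (C N n)\<^sup>2))" by simp
   finally show ?thesis by (simp only: of_int_less_iff)
  qed
  have bt: "better n Q c P Hm hv (C N) ?b = (feas n Q c P (C N) & ?v N < ?v k)"
   unfolding better_def bs lt[symmetric] using 2(1,4) by simp
  show ?thesis proof (cases "better n Q c P Hm hv (C N) ?b")
   case True
   hence "feas n Q c P (C N)" "?v N < ?v k" using bt by auto
   thus ?thesis using True 2 by (intro disjI2 conjI exI[of _ N]) (auto simp: less_Suc_eq intro: order_trans[OF less_imp_le])
  next
   case False
   hence "feas n Q c P (C N) ==> ?v k <= ?v N" using bt by auto
   thus ?thesis using False 2 by (intro disjI2 conjI exI[of _ k]) (auto simp: less_Suc_eq)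
  qed
 qed
qed simp

lemma digits_exist:
 assumes "!!i. i < k ==> f i < R"
 shows "EX w<R ^ k. ALL i<k. dig R w i = f i" using assms
proof (induction k)
 case (Suc k)
 then obtain w where w: "w < R ^ k" "ALL i<k. dig R w i = f i" by auto
 have R: "0 < R" using Suc.prems[of 0] by simp
 let ?w = "w + f k * R ^ k"
 have "?w < R ^ k + f k * R ^ k" using w by simp
 also have "... = (f k + 1) * R ^ k" by simp
 also have "... <= R * R ^ k" using Suc.prems[of k] by (intro mult_right_mono) auto
 finally have "?w < R ^ Suc k" by simp
 moreover have "dig R ?w i = f i" if i: "i < Suc k" for i proof (cases "i = k")
  case True
  have "?w div R ^ k = f k" using w R by simp
  thus ?thesis using Suc.prems[of k] True by (simp add: dig_def)
 next
  case False
  hence ik: "i < k" using i by simp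
  have e: "R ^ k = R ^ i * (R * R ^ (k - Suc i))" using ik by (simp flip: power_Suc power_add)
  have "?w div R ^ i = w div R ^ i + f k * (R * R ^ (k - Suc i))" proof -
   have q: "?w = w + R ^ i * (f k * (R * R ^ (k - Suc i)))" unfolding e by (simp only: mult_ac)
   show ?thesis unfolding q by (subst div_mult_self2) (use R in simp_all)
  qed
  hence "dig R ?w i = (w div R ^ i + (f k * R ^ (k - Suc i)) * R) mod R" by (simp add: dig_def mult_ac)
  also have "... = dig R w i" by (simp only: mod_mult_self1 dig_def)
  finally show ?thesis using w ik by simp
 qed
 ultimately show ?case by blast
qed simp

lemma counter_exists:
 assumes s: "!!j. m <= j ==> j < n ==> \<bar>s j\<bar> <= int KO" and f: "!!i. i < 6 ==> f i < R" and W: "W = 2 * KO + 1"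
 shows "EX w<W ^ (n - m) * R ^ 6. (ALL j. m <= j --> j < n --> offs m W (w mod W ^ (n - m)) j = s j) & (ALL i<6. dig R (w div W ^ (n - m)) i = f i)"
proof -
 let ?g = "%i. nat (s (m + i) + int KO)"
 have "?g i < W" if "i < n - m" for i proof -
  have "\<bar>s (m + i)\<bar> <= int KO" by (rule s) (use that in auto)
  thus ?thesis using W by (auto simp: abs_le_iff nat_less_iff)
 qed
 from digits_exist[of "n - m" ?g W, OF this] obtain u where u: "u < W ^ (n - m)" "ALL i<n - m. dig W u i = ?g i" by auto
 from digits_exist[of 6 f R, OF f] obtain d where d: "d < R ^ 6" "ALL i<6. dig R d i = f i" by auto
 let ?w = "u + W ^ (n - m) * d"
 have "?w < W ^ (n - m) + W ^ (n - m) * d" using u by simp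
 also have "... = W ^ (n - m) * (d + 1)" by simp
 also have "... <= W ^ (n - m) * R ^ 6" using d by (intro mult_left_mono) auto
 finally have "?w < W ^ (n - m) * R ^ 6" .
 moreover have "?w mod W ^ (n - m) = u" "?w div W ^ (n - m) = d" using u W by auto
 moreover have "offs m W u j = s j" if j: "m <= j" "j < n" for j proof -
  have "dig W u (j - m) = nat (s j + int KO)" using u(2) j by simp
  moreover have "0 <= s j + int KO" using s[OF j] by linarith
  ultimately show ?thesis using j W by (simp add: offs_def)
 qed
 ultimately show ?thesis using d by metis
qed

lemma has_mono:
 assumes "has E n m S" "!!x. x \<in> edom E ==> n' x <= n x & m' x <= m x"
 shows "has E n' m' S"
proof -
 obtain a k where "ALL x:edom E. ALL i<n x. ALL j<m x. bits (S x i j) <= (sz E x + 2) ^ a"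
  "k < lev E" "ALL x:edom E. ALL i<n x. ALL j<m x. tab E x k i j = Some (S x i j)" using assms(1) unfolding has_def by blast
 thus ?thesis unfolding has_def by (intro conjI exI[of _ a] exI[of _ k]) (use assms(2) in "meson less_le_trans")+
qed

lemma cmpn_dig: "cmpn E R ==> cmpn E w ==> cmpn E i ==> small E i ==> cmpn E (%x. dig (R x) (w x) (i x))"
 unfolding dig_def by (intro cmpn_mod cmpn_div cmpn_power)

lemma small_dig: "small E R ==> (!!x. x \<in> edom E ==> 0 < R x) ==> small E (%x. dig (R x) (w x) i)"
 by (erule small_mono) (simp add: dig_def less_imp_le)

lemma lvl_le: "lvl m n d <= n" by (simp add: lvl_def)
lemma dir_le: "dir n d <= n" by (simp add: dir_def)

lemma cmp_acand:
 assumes n: "cmpn E n" "small E n" and m: "cmpn E m" and P: "cmp E P" and K: "cmp E K"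
  and H: "has E n n Hm" and h: "has E (%_. 1) n (%x i. hv x)" and B: "has E n n B"
  and G: "has E n (%x. Suc (n x)) G" and ee: "cmpn E ee" "small E ee"
  and W: "cmpn E W" and R: "cmpn E R" "small E R" "!!x. x \<in> edom E ==> 0 < R x" and w: "cmpn E w"
  and j: "cmpn E j" "!!x. x \<in> edom E ==> j x <= n x"
 shows "cmp E (%x. acand (n x) (m x) (Hm x) (hv x) (B x) (G x) (P x) (K x) (ee x) (W x) (R x) (w x) (j x))"
proof (rule cmp_letv[where d=n and X="%x. offs (m x) (W x) (w x mod W x ^ (n x - m x))", OF n])
 have e: "cmpn E (%x. n x - m x)" "small E (%x. n x - m x)" by (rule cmpn_diff[OF n(1) m], rule small_diff[OF n(2)])
 have Wp: "cmpn E (%x. W x ^ (n x - m x))" by (rule cmpn_power[OF e W])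
 have v: "cmpn (idx E n) snd" "small (idx E n) snd" by (rule cmp_snd[OF n(2)], rule small_idx_var[OF n(2)])
 have v': "cmpn (idx E n) (%z. snd z - m (fst z))" "small (idx E n) (%z. snd z - m (fst z))"
  by (rule cmpn_diff[OF v(1) cmp_idx[OF m]], rule small_diff[OF v(2)])
 show "cmp (idx E n) (%z. offs (m (fst z)) (W (fst z)) (w (fst z) mod W (fst z) ^ (n (fst z) - m (fst z))) (snd z))"
  unfolding offs_def
  by (rule cmp_ite'[OF decn_less[OF v(1) cmp_idx[OF m]] cmp_const cmp_diff[OF cmpn_dig[OF cmp_idx[OF W] cmp_idx[OF cmpn_mod[OF w Wp]] v']
      cmpn_div[OF cmp_idx[OF W] cmpn_const]]])
 fix E' assume e': "ext E E'" and s: "hasv E' n (%x. offs (m x) (W x) (w x mod W x ^ (n x - m x)))"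
 note x = ext_edom[OF e'] and c = cmp_ext[OF e'] and sm = small_ext[OF e'] and hh = has_ext[OF e']
 have d: "cmpn E' (%x. dig (R x) (w x div W x ^ (n x - m x)) i)" for i
  by (rule c, rule cmpn_dig[OF R(1) cmpn_div[OF w Wp] cmpn_const small_const])
 have sd: "small E' (%x. dig (R x) (w x div W x ^ (n x - m x)) i)" for i by (rule sm, rule small_dig[OF R(2,3)])
 have N: "cmpn E' (%x. lvl (m x) (n x) (dig (R x) (w x div W x ^ (n x - m x)) 0))"
  unfolding lvl_def by (rule cmpn_ite[OF dec_conj[OF decn_le[OF c[OF m] d] decn_le[OF d c[OF n(1)]]] d c[OF n(1)]])
 have i: "cmpn E' (%x. dir (n x) (dig (R x) (w x div W x ^ (n x - m x)) 2))"
  unfolding dir_def by (rule cmpn_ite[OF decn_less[OF d c[OF n(1)]] d cmpn_const])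
 show "cmp E' (%x. acand (n x) (m x) (Hm x) (hv x) (B x) (G x) (P x) (K x) (ee x) (W x) (R x) (w x) (j x))"
  unfolding acand_def
  by (rule cmp_cand[OF c[OF n(1)] sm[OF n(2)] c[OF m] c[OF P] cmp_mult[OF cmp_const c[OF K]] hh[OF H] hh[OF h] hh[OF B] hh[OF G] s N lvl_le
     c[OF ee(1)] sm[OF ee(2)] cmp_diff[OF d cmp_const] i dir_le d sd d d sd c[OF j(1)]]) (use j x in auto)
qed

lemma cmp_objn:
 assumes n: "cmpn E n" "small E n" and H: "has E n n Hm" and h: "has E (%_. 1) n (%x i. hv x)"
  and X: "has E (%_. 1) (%x. Suc (n x)) (%x i. X x)"
 shows "cmp E (%x. objn (n x) (Hm x) (hv x) (X x))"
proof -
 have X': "has E (%_. 1) n (%x i. X x)" by (rule has_mono[OF X]) auto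
 have "cmp E (%x. X x (n x))" by (rule cmp_has[OF X cmpn_const[of _ 0] n(1)]) auto
 thus ?thesis unfolding objn_def
  by (intro cmp_add cmp_mult cmp_gram[OF n H X' cmpn_const[of _ 0] _ X' cmpn_const[of _ 0]] cmp_lin[OF n h X' cmpn_const[of _ 0]]) auto
qed

lemma dec_feas:
 assumes n: "cmpn E n" "small E n" and P: "cmp E P" and Q: "has E n n Q" and c: "has E (%_. 1) n (%x i. c x)"
  and X: "has E (%_. 1) (%x. Suc (n x)) (%x i. X x)"
 shows "dec E (%x. feas (n x) (Q x) (c x) (P x) (X x))" unfolding dec_def
proof (rule cmp_let_ext[where n="%_. 1" and l=n and S="%x i l. P x * X x l - X x (n x) * c x l", OF cmpn_const small_const n])
 let ?E = "idx (idx E (%_. 1)) (%z. n (fst z))"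
 have v: "cmpn ?E snd" by (rule cmp_snd[OF small_idx[OF n(2)]])
 note hh = has_idx[OF has_idx] and cc = cmp_idx[OF cmp_idx]
 have "cmp ?E (%z. X (fst2 z) (snd z))" by (rule cmp_has[OF hh[OF X] cmpn_const[of _ 0] v]) auto
 moreover have "cmp ?E (%z. X (fst2 z) (n (fst2 z)))" by (rule cmp_has[OF hh[OF X] cmpn_const[of _ 0] cc[OF n(1)]]) auto
 moreover have "cmp ?E (%z. c (fst2 z) (snd z))" by (rule cmp_has[OF hh[OF c] cmpn_const[of _ 0] v]) auto
 ultimately show "cmp ?E (%z. P (fst2 z) * X (fst2 z) (snd z) - X (fst2 z) (n (fst2 z)) * c (fst2 z) (snd z))"
  by (intro cmp_diff cmp_mult cc[OF P])
 fix E' assume e: "ext E E'" and w: "has E' (%_. 1) n (%x i l. P x * X x l - X x (n x) * c x l)"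
 have g: "cmp E' (%x. gram (n x) (Q x) (%l. P x * X x l - X x (n x) * c x l) (%l. P x * X x l - X x (n x) * c x l))"
  by (rule cmp_gram[OF cmp_ext[OF e n(1)] small_ext[OF e n(2)] has_ext[OF e Q] w cmpn_const[of _ 0] _ w cmpn_const[of _ 0]]) auto
 have Xn: "cmp E' (%x. X x (n x))" by (rule cmp_has[OF has_ext[OF e X] cmpn_const[of _ 0] cmp_ext[OF e n(1)]]) auto
 show "cmp E' (%x. if feas (n x) (Q x) (c x) (P x) (X x) then 1 else 0)"
  unfolding feas_def by (fold dec_def, rule dec_le[OF g]) (intro cmp_mult cmp_powc Xn cmp_ext[OF e P])
qed

text \<open>Candidates are recomputed in each round instead of being stored for all counter values;
  hence computability of \<open>C\<close> is assumed in every extension of the loop environment. The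
  variant with \<open>snd z - 1\<close> is due to the flag in entry 0 of
  \<open>best\<close>.\<close>

lemma cmp_best:
 assumes n: "cmpn E n" "small E n" and P: "cmp E P" and Q: "has E n n Q" and c: "has E (%_. 1) n (%x i. c x)"
  and H: "has E n n Hm" and h: "has E (%_. 1) n (%x i. hv x)" and N: "cmpn E N" "small E N"
  and C: "!!E'. ext (idx E N) E' ==> cmp (idx E' (%z. Suc (n (fst z)))) (%z. C (fst2 z) (snd (fst z)) (snd z))"
  and C': "!!E'. ext (idx E N) E' ==> cmp (idx E' (%z. Suc (Suc (n (fst z))))) (%z. C (fst2 z) (snd (fst z)) (snd z - 1))"
  and j: "cmpn E j" "!!x. x \<in> edom E ==> j x <= Suc (n x)"
 shows "cmp E (%x. best (n x) (Q x) (c x) (P x) (Hm x) (hv x) (C x) (N x) (j x))"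
proof (rule cmp_recv[where S="%x k i. best (n x) (Q x) (c x) (P x) (Hm x) (hv x) (C x) k i" and n="%x. Suc (Suc (n x))", OF N])
 let ?b = "%x. best (n x) (Q x) (c x) (P x) (Hm x) (hv x) (C x)"
 show sn: "small E (%x. Suc (Suc (n x)))" and "cmpn E (%x. Suc (Suc (n x)))" by (intro small_Suc n, intro cmpn_Suc n)
 show "cmp (idx E (%x. Suc (Suc (n x)))) (%z. ?b (fst z) 0 (snd z))" by (simp add: cmp_const)
 show "cmp E' (%x. ?b x (N x) (j x))" if "ext E E'" "hasv E' (%x. Suc (Suc (n x))) (%x. ?b x (N x))" for E'
  by (rule cmp_hasv[OF that(2) cmp_ext[OF that(1) j(1)]]) (use j(2) ext_edom[OF that(1)] in "auto simp: less_Suc_eq_le")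
 obtain T where T: "small E T" "!!x k i. x \<in> edom E ==> k < N x ==> i < Suc (n x) ==> \<bar>C x k i\<bar> <= 2 ^ T x"
  by (rule small_2pow_idx2[OF cmp_sbits[OF C[OF ext_refl]]]) (rule that)
 have bb: "\<bar>?b x k i\<bar> <= 2 ^ T x" if x: "x \<in> edom E" and k: "k <= N x" and i: "i <= Suc (n x)" for x k i using k
 proof (induction k)
  case (Suc k)
  have "\<bar>C x k (i - 1)\<bar> <= 2 ^ T x" by (rule T(2)[OF x]) (use Suc i in auto)
  thus ?case using Suc by simp
 qed simp
 have b: "sbits (idx (idx E (%x. Suc (N x))) (%z. Suc (Suc (n (fst z))))) (%z. 2 ^ T (fst2 z))"
  by (intro sbits_idx[OF sbits_idx] sbits_pow2 T)
 show "sbits (idx (idx E (%x. Suc (N x))) (%z. Suc (Suc (n (fst z))))) (%z. ?b (fst2 z) (snd (fst z)) (snd z))"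
  by (rule sbits_mono[OF b]) (use bb in "auto simp: less_Suc_eq_le")
 fix E' assume e: "ext (idx E N) E'" and b: "hasv E' (%z. Suc (Suc (n (fst z)))) (%z. ?b (fst z) (snd z))"
 let ?n = "%z. n (fst z)"
 have n': "cmpn E' ?n" "small E' ?n" by (rule cmp_up[OF e n(1)], rule small_up[OF e n(2)])
 have sn': "small E' (%z. Suc (Suc (n (fst z))))" by (intro small_Suc n')
 have CE: "cmp (idx E' (%z. Suc (?n z))) (%z. C (fst2 z) (snd (fst z)) (snd z))" by (rule C[OF e])
 have r: "cmp (idx (idx E'' (%_. 1)) (%z. Suc (?n (fst z)))) (%z. f (fst2 z) (snd z))"
  if "hasv E'' (%z. Suc (?n z)) f" "small E'' ?n" for E'' f
  by (rule cmp_hasv[OF has_idx[OF has_idx[OF that(1)]] cmp_snd[OF small_idx[OF small_Suc[OF that(2)]]]]) auto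
 have D: "dec E' (%z. better (?n z) (Q (fst z)) (c (fst z)) (P (fst z)) (Hm (fst z)) (hv (fst z)) (C (fst z) (snd z)) (?b (fst z) (snd z)))"
  unfolding dec_def
 proof (rule cmp_letv[where d="%z. Suc (?n z)" and X="%z. C (fst z) (snd z)", OF cmpn_Suc[OF n'(1)] small_Suc[OF n'(2)] CE])
  fix E1 assume e1: "ext E' E1" and C1: "hasv E1 (%z. Suc (?n z)) (%z. C (fst z) (snd z))"
  note n1 = cmp_ext[OF e1 n'(1)] small_ext[OF e1 n'(2)]
  show "cmp E1 (%z. if better (?n z) (Q (fst z)) (c (fst z)) (P (fst z)) (Hm (fst z)) (hv (fst z)) (C (fst z) (snd z)) (?b (fst z) (snd z)) then 1 else 0)"
  proof (rule cmp_let_ext[where n="%_. 1" and l="%z. Suc (?n z)" and S="%z i. C (fst z) (snd z)", OF cmpn_const small_const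
     cmpn_Suc[OF n1(1)] small_Suc[OF n1(2)] r[OF C1 n1(2)]])
   fix E2 assume e2: "ext E1 E2" and C2: "has E2 (%_. 1) (%z. Suc (?n z)) (%z i. C (fst z) (snd z))"
   note x2 = ext_trans[OF e1 e2]
   note n2 = cmp_ext[OF x2 n'(1)] small_ext[OF x2 n'(2)]
   show "cmp E2 (%z. if better (?n z) (Q (fst z)) (c (fst z)) (P (fst z)) (Hm (fst z)) (hv (fst z)) (C (fst z) (snd z)) (?b (fst z) (snd z)) then 1 else 0)"
   proof (rule cmp_let_ext[where n="%_. 1" and l="%z. Suc (?n z)" and S="%z i l. ?b (fst z) (snd z) (Suc l)", OF cmpn_const small_const
      cmpn_Suc[OF n2(1)] small_Suc[OF n2(2)]])
    have v: "cmpn (idx (idx E2 (%_. 1)) (%z. Suc (?n (fst z)))) snd" by (rule cmp_snd[OF small_idx[OF small_Suc[OF n2(2)]]])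
    show "cmp (idx (idx E2 (%_. 1)) (%z. Suc (?n (fst z)))) (%z. ?b (fst3 z) (snd (fst2 z)) (Suc (snd z)))"
     by (rule cmp_hasv[OF has_idx[OF has_idx[OF has_ext[OF x2 b]]] cmpn_Suc[OF v]]) auto
    fix E3 assume e3: "ext E2 E3" and B3: "has E3 (%_. 1) (%z. Suc (?n z)) (%z i l. ?b (fst z) (snd z) (Suc l))"
    note x3 = ext_trans[OF x2 e3]
    note n3 = cmp_ext[OF x3 n'(1)] small_ext[OF x3 n'(2)]
    note hu = has_ext[OF x3 has_up[OF e]] and C3 = has_ext[OF e3 C2] and b3 = has_ext[OF x3 b]
    have b0: "cmp E3 (%z. ?b (fst z) (snd z) 0)" by (rule cmp_hasv[OF b3 cmpn_const[of _ 0]]) auto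
    have bn: "cmp E3 (%z. ?b (fst z) (snd z) (Suc (?n z)))" by (rule cmp_hasv[OF b3 cmpn_Suc[OF n3(1)]]) auto
    have Cn: "cmp E3 (%z. C (fst z) (snd z) (?n z))" by (rule cmp_has[OF C3 cmpn_const[of _ 0] n3(1)]) auto
    show "cmp E3 (%z. if better (?n z) (Q (fst z)) (c (fst z)) (P (fst z)) (Hm (fst z)) (hv (fst z)) (C (fst z) (snd z)) (?b (fst z) (snd z)) then 1 else 0)"
     unfolding better_def
     by (fold dec_def, rule dec_conj[OF dec_feas[OF n3 cmp_ext[OF x3 cmp_up[OF e P]] hu[OF Q] hu[OF c] C3]
        dec_disj[OF dec_eq[OF b0 cmp_const] dec_less[OF cmp_mult[OF cmp_objn[OF n3 hu[OF H] hu[OF h] C3] cmp_powc[OF bn]]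
          cmp_mult[OF cmp_objn[OF n3 hu[OF H] hu[OF h] B3] cmp_powc[OF Cn]]]]])
   qed
  qed
 qed
 let ?E = "idx E' (%z. Suc (Suc (n (fst z))))"
 have v: "cmpn ?E snd" by (rule cmp_snd[OF sn'])
 show "cmp ?E (%z. ?b (fst2 z) (Suc (snd (fst z))) (snd z))" unfolding best.simps
  by (rule cmp_ite'[OF cmp_idx[OF D[unfolded dec_def], folded dec_def] cmp_ite'[OF decn_eq[OF v cmpn_const] cmp_const C'[OF e]]
     cmp_hasv[OF has_idx[OF b] v]]) auto
qed

text \<open>The set \<open>F\<close> of the locale \<open>core\<close>, stated outside it so that no
  reduced basis is mentioned.\<close>

definition fset :: "nat => nat => imat => ivec => int => (nat => real) set" where
 "fset n m Q c P = {x \<in> Vn n. (ALL l<n - m. x l \<in> \<int>) &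
  bf n Q (x - (1 / of_int P) *R vn n c) (x - (1 / of_int P) *R vn n c) <= of_int P}"

definition fobj :: "nat => imat => ivec => (nat => real) => real" where
 "fobj n Hm hv x = bf n Hm x x + (\<Sum>l<n. of_int (hv l) * x l)"

definition alg :: "nat => nat => imat => ivec => int => imat => ivec => int =>
  nat => nat => nat => imat" where
 "alg n m Q c P Hm hv K T E W R = best n Q c P Hm hv
  (acand n m Hm hv (lll n m Q c T) (gc n Q c (lll n m Q c T)) P K E W R) (W ^ (n - m) * R ^ 6)"

text \<open>\<open>2 * KO + 1\<close> as a natural number: the number of offsets per
  coordinate.\<close>

definition offrange :: "nat => int => nat" where
 "offrange p K = 2 * (2 ^ p * (p + 1) * (40 * nat K) + 1) + 1"

text \<open>Exceeds all six guesses: \<open>N <= n\<close>, \<open>sg + 1 <= 2\<close>,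
  \<open>i <= n\<close>, \<open>k\<close> and \<open>k'\<close> at most \<open>2 * E\<close>, and
  \<open>l\<close> as bounded in \<open>slice_minimum\<close>.\<close>

definition radix :: "nat => nat => int => nat" where
 "radix n E K = n + 3 + 2 * E + 995328 * n * nat K ^ 3"

lemma gram_bound:
 assumes "!!i j. i < n ==> j < n ==> \<bar>M i j\<bar> <= a" "!!i. i < n ==> \<bar>y i\<bar> <= b" "!!i. i < n ==> \<bar>z i\<bar> <= b" "0 <= b" "0 <= a"
 shows "\<bar>gram n M y z\<bar> <= int n * (int n * (a * b * b))"
proof -
 have "\<bar>gram n M y z\<bar> <= (\<Sum>i<n. \<Sum>j<n. a * b * b)" unfolding gram_def proof (intro order.trans[OF sum_abs] sum_mono)
  fix i j assume ij: "i \<in> {..<n}" "j \<in> {..<n}"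
  show "\<bar>M i j * y i * z j\<bar> <= a * b * b" unfolding abs_mult using assms ij by (intro mult_mono) auto
 qed
 thus ?thesis by simp
qed

text \<open>The denominator is multiplied by one minor per step, independently of the
  offsets.\<close>

lemma bab_den_bound:
 assumes "0 <= X n" "!!j. j < n ==> 0 < dlt G j & dlt G j <= D" "hi <= n" "t <= hi" "0 <= D"
 shows "0 <= bab n G hi s X t n & bab n G hi s X t n <= X n * D ^ t" using assms(4)
proof (induction t)
 case 0
 thus ?case using assms(1) by simp
next
 case (Suc t)
 let ?b = "bab n G hi s X t n" let ?d = "dlt G (hi - Suc t)"
 have d: "0 < ?d" "?d <= D" using assms(2)[of "hi - Suc t"] assms(3) Suc.prems by auto
 have b: "0 <= ?b" "?b <= X n * D ^ t" using Suc by auto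
 have e: "bab n G hi s X (Suc t) n = ?b * ?d" by (simp add: babstep_def)
 have "?b * ?d <= (X n * D ^ t) * D" using b d assms(1,5) by (intro mult_mono) auto
 thus ?case unfolding e using b d by (simp add: mult_ac)
qed

lemma mult_2pow: "\<bar>x\<bar> <= 2 ^ i ==> \<bar>y\<bar> <= 2 ^ j ==> \<bar>x * y\<bar> <= 2 ^ (i + j)" for x y :: int
 unfolding abs_mult power_add by (intro mult_mono) auto

lemma power_2pow: "\<bar>x\<bar> <= 2 ^ i ==> k <= k' ==> \<bar>x ^ k\<bar> <= 2 ^ (i * k')" for x :: int
proof -
 assume x: "\<bar>x\<bar> <= 2 ^ i" and k: "k <= k'"
 have "\<bar>x ^ k\<bar> <= (2 ^ i) ^ k" unfolding power_abs using x by (intro power_mono) auto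
 also have "... <= (2 ^ i) ^ k'" using k by (intro power_increasing) auto
 finally show ?thesis by (simp add: power_mult)
qed

lemma of_int_2pow: "\<bar>x\<bar> <= 2 ^ i ==> i <= j ==> real_of_int x <= 2 ^ j"
proof -
 assume x: "\<bar>x\<bar> <= 2 ^ i" and ij: "i <= j"
 have "x <= 2 ^ i" using x by linarith
 also have "... <= 2 ^ j" using ij by (intro power_increasing) auto
 finally have "real_of_int x <= of_int (2 ^ j)" by (simp only: of_int_le_iff)
 thus ?thesis by simp
qed

section \<open>Choice of the precision and correctness of the enumeration\<close>

context
 fixes n m t :: nat and Q Hm :: imat and c hv :: ivec and P K :: int
 assumes mn: "m <= n" and sQ: "symn n Q" and pQ: "posdef Q n" and sH: "symn n Hm" and P1: "1 <= P" and K1: "1 <= K"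
  and nt: "n < t" and Qt: "!!i j. i < n ==> j < n ==> \<bar>Q i j\<bar> <= 2 ^ t" and Ht: "!!i j. i < n ==> j < n ==> \<bar>Hm i j\<bar> <= 2 ^ t"
  and ct: "!!i. i < n ==> \<bar>c i\<bar> <= 2 ^ t" and ht: "!!i. i < n ==> \<bar>hv i\<bar> <= 2 ^ t" and Pt: "P <= 2 ^ t" and Kt: "K <= 2 ^ t"
begin

lemma lat: "lattice n m Q (2 ^ t)" using mn sQ pQ Qt by unfold_locales auto

text \<open>The cube of 3/4 is below 1/2, so \<open>3 * (t^3 + 1)\<close> rounds reduce the
  potential below \<open>2 ^ (- t^3 - 1)\<close> times its initial bound
  \<open>2 ^ (t * n^2)\<close>, where \<open>n < t\<close>.\<close>

lemma lll_reduced: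
 obtains g where "lattice.linv n m Q (2 ^ t) (lll n m Q c (3 * t ^ 3 + 3)) g" "lattice.siegel n m Q g"
proof -
 interpret lattice n m Q c "2 ^ t" by (rule lat)
 have "t * (n * n) <= t * (t * t)" using nt by (intro mult_le_mono) auto
 hence tn: "t * (n * n) <= t ^ 3" by (simp add: power3_eq_cube)
 have e: "3 * t ^ 3 + 3 = 3 * (t ^ 3 + 1)" by simp
 have "(3 / 4 :: real) ^ (3 * t ^ 3 + 3) = ((3 / 4) ^ 3) ^ (t ^ 3 + 1)" unfolding e by (rule power_mult)
 also have "... <= (1 / 2) ^ (t ^ 3 + 1)" by (intro power_mono) (auto simp: power3_eq_cube)
 finally have "(3 / 4 :: real) ^ (3 * t ^ 3 + 3) * 2 ^ (t * (n * n)) <= (1 / 2) ^ (t ^ 3 + 1) * 2 ^ (t ^ 3)"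
  using tn by (intro mult_mono power_increasing) auto
 also have "... = 1 / 2" by (simp add: power_divide)
 finally have h: "(3 / 4 :: real) ^ (3 * t ^ 3 + 3) * of_int (2 ^ t) ^ (n * n) < 1" by (simp add: power_mult)
 show thesis by (rule lll_spec[where T="3 * t ^ 3 + 3"]) (use that h in blast)
qed

abbreviation BB :: imat where "BB == lll n m Q c (3 * t ^ 3 + 3)"

text \<open>Exponents of two that bound, in this order, \<open>dq\<close>, the basis entries, the
  Gram entries, the minors, and the denominators of slice points.\<close>

abbreviation "e1 == 2 * t + t * t + t * (t + 2)"
abbreviation "e2 == e1 + t + t"
abbreviation "e3 == t + (t + (t + e2 + e2))"
abbreviation "e4 == t * 2 + t * t + e3 * (t + 2)"
abbreviation "e5 == e4 + t + e4 * t"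

lemma n1t: "\<bar>int n + 1\<bar> <= 2 ^ t" "\<bar>int n\<bar> <= 2 ^ t"
proof -
 have "int t < 2 ^ t" by (rule of_nat_less_two_power)
 thus "\<bar>int n + 1\<bar> <= 2 ^ t" "\<bar>int n\<bar> <= 2 ^ t" using nt by linarith+
qed

lemma fact_t: "k <= n ==> \<bar>fact k\<bar> <= (2 ^ (t * t) :: int)"
proof -
 assume k: "k <= n"
 have "\<bar>fact k\<bar> <= (int k ^ k :: int)" using fact_le_power[of k, where 'a=int] by simp
 also have "... <= \<bar>int n ^ k\<bar>" using k by (simp add: power_mono)
 also have "... <= 2 ^ (t * t)" by (rule power_2pow[OF n1t(2)]) (use k nt in simp)
 finally show ?thesis .
qed

lemma dq_t: "\<bar>dq n (2 ^ t)\<bar> <= 2 ^ e1" unfolding dq_def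
 using mult_2pow[OF mult_2pow[OF power_2pow[OF n1t(1), of 2 2] fact_t[OF le_refl]] power_2pow[of "2 ^ t" t "n + 2" "t + 2"]] nt
 by (simp add: mult.commute)

lemma B_t: "i < n ==> \<bar>BB i l\<bar> <= 2 ^ e2"
proof -
 assume i: "i < n"
 have "\<bar>BB i l\<bar> <= dq n (2 ^ t) * (int n + 1) * 2 ^ t" by (rule lll_bound[OF lat i])
 also have "... <= \<bar>dq n (2 ^ t) * (int n + 1) * 2 ^ t\<bar>" by simp
 also have "... <= 2 ^ e2" by (intro mult_2pow dq_t n1t) simp
 finally show ?thesis .
qed

lemma G_t: "i < n ==> j <= n ==> \<bar>gc n Q c BB i j\<bar> <= 2 ^ e3"
proof -
 assume ij: "i < n" "j <= n"
 have "\<bar>gc n Q c BB i j\<bar> <= int n * (int n * (2 ^ t * 2 ^ e2 * 2 ^ e2))" unfolding gc_def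
 proof (rule gram_bound[OF Qt])
  show "\<bar>BB i l\<bar> <= 2 ^ e2" if "l < n" for l by (rule B_t[OF ij(1)])
  show "\<bar>(if j < n then BB j else c) l\<bar> <= 2 ^ e2" if l: "l < n" for l proof (cases "j < n")
   case False
   have "(2::int) ^ t <= 2 ^ e2" by (intro power_increasing) auto
   with ct[OF l] have "\<bar>c l\<bar> <= 2 ^ e2" by (rule order_trans)
   thus ?thesis using False by (simp only: if_False)
  qed (use B_t in simp)
 qed auto
 also have "... <= \<bar>int n * (int n * (2 ^ t * 2 ^ e2 * 2 ^ e2))\<bar>" by simp
 also have "... <= 2 ^ e3" by (intro mult_2pow n1t) auto
 finally show ?thesis .
qed

lemma dlt_t: "k <= n ==> \<bar>dlt (gc n Q c BB) k\<bar> <= 2 ^ e4"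
proof -
 assume k: "k <= n"
 have "\<bar>dlt (gc n Q c BB) k\<bar> <= (int k + 1) ^ 2 * fact k * (2 ^ e3) ^ (k + 2)"
  unfolding dlt_def by (rule bst_bound) (use k G_t in auto)
 also have "... <= \<bar>(int k + 1) ^ 2 * fact k * (2 ^ e3) ^ (k + 2)\<bar>" by simp
 also have "... <= 2 ^ (t * 2 + t * t + e3 * (t + 2))" proof (intro mult_2pow power_2pow fact_t k)
  show "\<bar>int k + 1\<bar> <= 2 ^ t" using n1t(1) k by simp
 qed (use k nt in auto)
 finally show ?thesis .
qed

lemma e5_le: "e5 <= 121 * t ^ 4" and e_mono: "t <= e5" "e1 <= e5" "e3 <= e5" "e4 <= e5"
proof -
 have t1: "1 <= t" using nt by simp
 have "t ^ 1 <= t ^ 4" "t ^ 2 <= t ^ 4" "t ^ 3 <= t ^ 4" using t1 by (intro power_increasing; simp)+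
 moreover have "e5 = 4 * t ^ 4 + 28 * t ^ 3 + 56 * t ^ 2 + 33 * t" by (simp add: algebra_simps power_numeral_reduce)
 ultimately show "e5 <= 121 * t ^ 4" by simp
 have "e3 <= e3 * (t + 2)" by simp
 thus "t <= e5" "e1 <= e5" "e3 <= e5" "e4 <= e5" by simp_all
qed

text \<open>\<open>10 <= 2^4\<close>, and ten times \<open>4 + 121 * t^4\<close> is at most
  \<open>1250 * t^4\<close>.\<close>

lemma E_t: "(10 * 2 ^ e5) ^ 10 <= (2 :: real) ^ (1250 * t ^ 4)"
proof -
 have t1: "1 <= t ^ 4" using nt by simp
 have "(10 * 2 ^ e5 :: real) <= 2 ^ 4 * 2 ^ e5" by simp
 also have "... = 2 ^ (4 + e5)" by (rule power_add[symmetric])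
 finally have "(10 * 2 ^ e5) ^ 10 <= ((2 :: real) ^ (4 + e5)) ^ 10" by (intro power_mono) auto
 also have "... = 2 ^ ((4 + e5) * 10)" by (rule power_mult[symmetric])
 also have "... <= 2 ^ (1250 * t ^ 4)" using e5_le t1 by (intro power_increasing) auto
 finally show ?thesis .
qed

text \<open>Boundedness of the objective is recorded as well: it gives meaning to the infimum and
  supremum in the specification.\<close>

theorem alg_spec:
 defines "E == 1250 * t ^ 4"
 defines "b == alg n m Q c P Hm hv K (3 * t ^ 3 + 3) E (offrange (n - m) K) (radix n E K)"
 defines "x == (%l. if l < n then of_int (b (Suc l)) / of_int (b (Suc n)) else 0 :: real)"
 shows "b 0 = 0 & fset n m Q c P = {} \<or>
  b 0 = 1 & 0 < b (Suc n) & x \<in> fset n m Q c P &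
  (ALL x0:fset n m Q c P. EX x':fset n m Q c P. of_int K * (fobj n Hm hv x - fobj n Hm hv x0) <= fobj n Hm hv x' - fobj n Hm hv x) &
  (EX M. ALL y:fset n m Q c P. \<bar>fobj n Hm hv y\<bar> <= M)"
proof -
 obtain g where g: "lattice.linv n m Q (2 ^ t) BB g" "lattice.siegel n m Q g" by (rule lll_reduced)
 have lat': "lattice n m Q (2 ^ t)" by (rule lat)
 interpret core n m Q c "2 ^ t" BB g Hm hv P K by (intro core.intro lat' core_axioms.intro) (use g sH P1 K1 in auto)
 let ?W = "offrange (n - m) K" and ?R = "radix n E K"
 let ?C = "acand n m Hm hv BB (gc n Q c BB) P K E ?W ?R"
 have Fe: "fset n m Q c P = F" unfolding fset_def F_def ctr_def ..
 have foe: "fobj n Hm hv = fo" by (intro ext) (simp add: fobj_def fo_def hl_def)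
 have KKe: "40 * K = KK" by (simp add: KK_def)
 have KOe: "KO = int (2 ^ (n - m) * (n - m + 1) * (40 * nat K) + 1)" proof -
  have "2 ^ p * (int p + 1) * (40 * K) + 1 = int (2 ^ p * (p + 1) * (40 * nat K) + 1)" for p
   using K1 by (simp add: algebra_simps)
  thus ?thesis unfolding KO_def KK_def .
 qed
 have Rp: "0 < ?R" by (simp add: radix_def)
 have bd: "bounded_by (2 ^ e5)" unfolding bounded_by_def proof (intro conjI allI impI)
  show "1 <= (2 :: real) ^ e5" by simp
  show "real n <= 2 ^ e5" using of_int_2pow[OF n1t(2) e_mono(1)] by simp
  show "real_of_int K <= 2 ^ e5" by (rule of_int_2pow[OF _ e_mono(1)]) (use K1 Kt in simp)
  show "real_of_int P <= 2 ^ e5" by (rule of_int_2pow[OF _ e_mono(1)]) (use P1 Pt in simp)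
  show "real_of_int (dq n (2 ^ t)) <= 2 ^ e5" by (rule of_int_2pow[OF dq_t e_mono(2)])
  show "\<bar>real_of_int (Hm i j)\<bar> <= 2 ^ e5" if "i < n" "j < n" for i j
   using of_int_2pow[OF _ e_mono(1), of "\<bar>Hm i j\<bar>"] Ht[OF that] by simp
  show "\<bar>real_of_int (hv i)\<bar> <= 2 ^ e5" if "i < n" for i
   using of_int_2pow[OF _ e_mono(1), of "\<bar>hv i\<bar>"] ht[OF that] by simp
  show "\<bar>real_of_int (c i)\<bar> <= 2 ^ e5" if "i < n" for i
   using of_int_2pow[OF _ e_mono(1), of "\<bar>c i\<bar>"] ct[OF that] by simp
  show "real_of_int (GG BB i i) <= 2 ^ e5" if "i < n" for i proof (rule of_int_2pow[OF _ e_mono(3)])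
   show "\<bar>gc n Q c BB i i\<bar> <= 2 ^ e3" by (rule G_t) (use that in auto)
  qed
  show "real_of_int (dlt (GG BB) i) <= 2 ^ e5" if "i <= n" for i by (rule of_int_2pow[OF dlt_t[OF that] e_mono(4)])
  show "real_of_int (zt s N n) <= 2 ^ e5" if N: "N <= n" for s N proof (rule of_int_2pow[OF _ order_refl])
   have d: "0 < dlt (GG BB) j & dlt (GG BB) j <= 2 ^ e4" if "j < n" for j using dpos[of j] dlt_t[of j] that by auto
   have "0 <= zt s N n & zt s N n <= cen n P (GG BB) n * (2 ^ e4) ^ (n - N)"
    unfolding zst_def by (rule bab_den_bound) (use d cen_pos in auto)
   moreover have "\<bar>cen n P (GG BB) n * (2 ^ e4) ^ (n - N)\<bar> <= 2 ^ e5" proof -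
    have cn: "cen n P (GG BB) n = dlt (GG BB) n * P" by (simp add: cen_def)
    have p: "\<bar>P\<bar> <= 2 ^ t" using P1 Pt by simp
    have e: "\<bar>(2 :: int) ^ i\<bar> <= 2 ^ i" for i by simp
    have nN: "n - N <= t" using nt by simp
    show ?thesis unfolding cn by (rule mult_2pow[OF mult_2pow[OF dlt_t[OF le_refl] p] power_2pow[OF e nN]])
   qed
   ultimately show "\<bar>zt s N n\<bar> <= 2 ^ e5" by linarith
  qed
 qed
 \<comment> \<open>Whatever the counter value, the candidate belongs to some tuple of guesses with a
   legal level, so \<open>cand_facts\<close> applies to it.\<close>
 have Cd: "EX s N E' sg i k l k'. ?C w = xout n BB (cnd s N E' sg i k l k') & m <= N & N <= n" for w
  unfolding acand_def KKe by (intro exI, rule conjI, rule refl) (use mn in "simp add: lvl_def")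
 define y where "y X = (1 / of_int (X n)) *R vn n X" for X :: ivec
 have Xn: "xout n BB X n = X n" for X by (simp add: xout_def)
 have yx: "y (xout n BB X) = xv n v X" for X unfolding y_def xout_xv Xn ..
 have Cp: "0 < ?C w n" for w proof -
  obtain s N E' sg i k l k' where "?C w = xout n BB (cnd s N E' sg i k l k') & m <= N & N <= n"
   using Cd[of w] by (elim exE)
  hence *: "m <= N" "N <= n" "?C w = xout n BB (cnd s N E' sg i k l k')" by simp_all
  show ?thesis unfolding *(3) Xn by (rule cand_facts(1)[OF *(1,2)])
 qed
 have Cf: "feas n Q c P (?C w) \<longleftrightarrow> y (?C w) \<in> F" for w proof -
  obtain s N E' sg i k l k' where "?C w = xout n BB (cnd s N E' sg i k l k') & m <= N & N <= n"
   using Cd[of w] by (elim exE)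
  hence *: "m <= N" "N <= n" "?C w = xout n BB (cnd s N E' sg i k l k')" by simp_all
  have I: "y (?C w) l \<in> \<int>" if "l < n - m" for l unfolding *(3) yx by (rule cand_facts(2)[OF *(1,2) that])
  let ?X = "?C w" let ?d = "?C w n"
  let ?w = "%l. P * ?X l - ?X n * c l"
  have d: "0 < ?d" by (rule Cp)
  have "y ?X - ctr = (1 / of_int (?d * P)) *R vn n ?w" proof
   fix l show "(y ?X - ctr) l = ((1 / of_int (?d * P)) *R vn n ?w) l"
    using d P1 by (simp add: y_def ctr_def vn_def field_simps)
  qed
  hence "nq (y ?X - ctr) = (1 / of_int (?d * P))\<^sup>2 * of_int (gram n Q ?w ?w)"
   by (simp only: sform_simps[OF sq] bf_vn power2_eq_square mult.assoc)
  hence "nq (y ?X - ctr) <= of_int P \<longleftrightarrow> real_of_int (gram n Q ?w ?w) <= of_int P * (of_int (?d * P))\<^sup>2"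
   using d P1 by (simp add: power_divide divide_le_eq mult_ac)
  also have "... \<longleftrightarrow> real_of_int (gram n Q ?w ?w) <= of_int (P * (?d * P)\<^sup>2)" by simp
  finally have "nq (y ?X - ctr) <= of_int P \<longleftrightarrow> feas n Q c P ?X" unfolding feas_def by (simp only: of_int_le_iff)
  moreover have "y ?X \<in> Vn n" unfolding y_def by (simp add: Vn_subspace subspace_scale)
  ultimately show ?thesis using I by (auto simp: F_def)
 qed
 have Co: "objn n Hm hv X / (X n)\<^sup>2 = fo (y X)" if "0 < X n" for X proof -
  have "hl (y X) = of_int (lin n hv X) / of_int (X n)" by (simp add: hl_def y_def vn_def lin_def sum_divide_distrib)
  moreover have "bf n Hm (y X) (y X) = of_int (gram n Hm X X) / (of_int (X n))\<^sup>2"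
   by (simp add: y_def sform_simps[OF sa] bf_vn power2_eq_square)
  ultimately show ?thesis using that by (simp add: fo_def objn_def add_divide_distrib power2_eq_square)
 qed
 \<comment> \<open>The guesses whose existence \<open>candidate_exists\<close> asserts are encoded
   in one value of the counter.\<close>
 have ex: "EX w<?W ^ (n - m) * ?R ^ 6. y (?C w) \<in> F & (EX x':F. of_int K * (fo (y (?C w)) - fo x0) <= fo x' - fo (y (?C w)))"
  if x0: "x0 \<in> F" for x0 proof -
  from candidate_exists[OF bd x0 E_t] obtain s N sg i k l k' where
   *: "m <= N" "N <= n" "ALL j. \<bar>s j\<bar> <= KO" "sg \<in> {0, 1, - 1}" "i < n \<or> i = 0" "k <= 2 * E" "k' <= 2 * E" "l <= 995328 * n * nat K ^ 3"
   and **: "xv n v (cnd s N E sg i k l k') \<in> F"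
   "EX x':F. of_int K * (fo (xv n v (cnd s N E sg i k l k')) - fo x0) <= fo x' - fo (xv n v (cnd s N E sg i k l k'))"
   unfolding E_def[symmetric] by (elim exE conjE)
  let ?f = "%d. [N, nat (sg + 1), i, k, l, k'] ! d"
  have f: "?f d < ?R" if "d < 6" for d proof -
   have "d = 0 \<or> d = 1 \<or> d = 2 \<or> d = 3 \<or> d = 4 \<or> d = 5" using that by linarith
   thus ?thesis using * by (auto simp: radix_def)
  qed
  let ?KO = "2 ^ (n - m) * (n - m + 1) * (40 * nat K) + 1"
  have "\<bar>s j\<bar> <= int ?KO" for j using *(3) unfolding KOe by blast
  from counter_exists[where s=s and m=m and n=n and KO="?KO" and f="?f" and R="?R" and W="?W", OF this f] obtain w where
   w: "w < ?W ^ (n - m) * ?R ^ 6" "ALL j. m <= j --> j < n --> offs m ?W (w mod ?W ^ (n - m)) j = s j"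
    "ALL d<6. dig ?R (w div ?W ^ (n - m)) d = ?f d" unfolding offrange_def by blast
  have dg: "dig ?R (w div ?W ^ (n - m)) 0 = N" "dig ?R (w div ?W ^ (n - m)) 1 = nat (sg + 1)"
   "dig ?R (w div ?W ^ (n - m)) 2 = i" "dig ?R (w div ?W ^ (n - m)) 3 = k" "dig ?R (w div ?W ^ (n - m)) 4 = l"
   "dig ?R (w div ?W ^ (n - m)) 5 = k'" using w(3) by simp_all
  have lv: "lvl m n N = N" "dir n i = i" "int (nat (sg + 1)) - 1 = sg" using * by (auto simp: lvl_def dir_def)
  have "zst n P (gc n Q c BB) (offs m ?W (w mod ?W ^ (n - m))) N = zst n P (gc n Q c BB) s N"
   unfolding zst_def by (rule bab_cong) (use w(2) *(1,2) in auto)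
  hence "?C w = xout n BB (cnd s N E sg i k l k')" unfolding acand_def dg lv KKe by (simp only:)
  thus ?thesis using w(1) ** yx by (intro exI[of _ w]) simp
 qed
 have bC: "b = best n Q c P Hm hv ?C (?W ^ (n - m) * ?R ^ 6)" unfolding b_def alg_def ..
 consider "b 0 = 0" "ALL w<?W ^ (n - m) * ?R ^ 6. ~ feas n Q c P (?C w)"
  | w where "b 0 = 1" "w < ?W ^ (n - m) * ?R ^ 6" "feas n Q c P (?C w)" "ALL i. b (Suc i) = ?C w i"
   "ALL w'<?W ^ (n - m) * ?R ^ 6. feas n Q c P (?C w') --> objn n Hm hv (?C w) / (?C w n)\<^sup>2 <= (objn n Hm hv (?C w') / (?C w' n)\<^sup>2 :: real)"
  using best_spec[where C="?C" and N="?W ^ (n - m) * ?R ^ 6" and n=n and Q=Q and c=c and P=P and Hm=Hm and hv=hv, OF Cp]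
  unfolding bC[symmetric] by (elim disjE conjE exE) simp_all
 thus ?thesis proof cases
  case 1
  have "F = {}" using ex 1(2) Cf by blast
  thus ?thesis using 1(1) Fe by simp
 next
  case 2
  have xy: "x = y (?C w)" by (intro ext) (use 2(4) in "simp add: x_def y_def vn_def")
  have xF: "x \<in> F" using 2(3) Cf xy by simp
  have "EX x':F. of_int K * (fo x - fo x0) <= fo x' - fo x" if x0: "x0 \<in> F" for x0 proof -
   obtain w' x' where w': "w' < ?W ^ (n - m) * ?R ^ 6" "y (?C w') \<in> F" "x' \<in> F"
    "of_int K * (fo (y (?C w')) - fo x0) <= fo x' - fo (y (?C w'))" using ex[OF x0] by blast
   have "feas n Q c P (?C w')" using w'(2) Cf by blast
   from 2(5)[rule_format, OF w'(1) this] have "fo x <= fo (y (?C w'))"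
    unfolding xy Co[of "?C w", OF Cp, symmetric] Co[of "?C w'", OF Cp, symmetric] by (simp only: of_int_power)
   hence "of_int K * (fo x - fo x0) <= of_int K * (fo (y (?C w')) - fo x0)" "fo x' - fo (y (?C w')) <= fo x' - fo x"
    using K1 by (auto intro!: mult_left_mono)
   thus ?thesis using w' by (intro bexI[of _ x']) linarith+
  qed
  moreover have "EX M. ALL y:F. \<bar>fo y\<bar> <= M" using fo_le[OF bd] unfolding F_def by blast
  moreover have "0 < b (Suc n)" using 2(4) Cp by simp
  ultimately show ?thesis using 2(1) xF unfolding Fe foe by blast
 qed
qed

end

lemma outc_eq: "outc n b j = b (if j = 0 then 0 else if j mod 2 = 1 then Suc (j div 2) else Suc n)"
 by (simp add: outc_def)

text \<open>The hypothesis \<open>cnt\<close> on the number of candidates is where the dependence on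
  the number of integer variables enters the running time.\<close>

lemma cmp_alg:
 assumes n: "cmpn E n" "small E n" and m: "cmpn E m" and P: "cmp E P" and K: "cmp E K"
  and T: "cmpn E T" "small E T" and ee: "cmpn E ee" "small E ee"
  and W: "cmpn E W" and R: "cmpn E R" "small E R" "!!x. x \<in> edom E ==> 0 < R x"
  and cnt: "small E (%x. W x ^ (n x - m x) * R x ^ 6)"
  and Q: "has E n n Q" and c: "has E (%_. 1) n (%x i. c x)" and H: "has E n n Hm" and h: "has E (%_. 1) n (%x i. hv x)"
  and lt: "!!x. x \<in> edom E ==> m x <= n x & symn (n x) (Q x) & posdef (Q x) (n x)"
  and j: "cmpn E j" "!!x. x \<in> edom E ==> j x <= 2 * n x"
 shows "cmp E (%x. outc (n x) (alg (n x) (m x) (Q x) (c x) (P x) (Hm x) (hv x) (K x) (T x) (ee x) (W x) (R x)) (j x))"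
 unfolding outc_eq alg_def
proof (rule cmp_lll[OF n m T Q c lt])
 let ?B = "%x. lll (n x) (m x) (Q x) (c x) (T x)" let ?G = "%x. gc (n x) (Q x) (c x) (?B x)"
 let ?N = "%x. W x ^ (n x - m x) * R x ^ 6"
 let ?C = "%x. acand (n x) (m x) (Hm x) (hv x) (?B x) (?G x) (P x) (K x) (ee x) (W x) (R x)"
 let ?j = "%x. if j x = 0 then 0 else if j x mod 2 = 1 then Suc (j x div 2) else Suc (n x)"
 let ?f = "%x. best (n x) (Q x) (c x) (P x) (Hm x) (hv x) (?C x) (?N x) (?j x)"
 fix E1 assume e1: "ext E E1" and B: "has E1 n n ?B"
 note n1 = cmp_ext[OF e1 n(1)] small_ext[OF e1 n(2)]
 show "cmp E1 ?f"
 proof (rule cmp_let_ext[where n=n and l="%x. Suc (n x)" and S="?G", OF n1 cmpn_Suc[OF n1(1)] small_Suc[OF n1(2)]])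
  show "cmp (idx (idx E1 n) (%z. Suc (n (fst z)))) (%z. ?G (fst2 z) (snd (fst z)) (snd z))"
   by (rule cmp_gc[OF cmp_idx[OF cmp_idx[OF n1(1)]] small_idx[OF small_idx[OF n1(2)]] has_idx[OF has_idx[OF has_ext[OF e1 Q]]] has_idx[OF has_idx[OF B]]
     has_idx[OF has_idx[OF has_ext[OF e1 c]]] cmp_idx[OF cmp_snd[OF n1(2)]] _ cmp_snd[OF small_idx[OF small_Suc[OF n1(2)]]]]) auto
  fix E2 assume e2: "ext E1 E2" and G: "has E2 n (%x. Suc (n x)) ?G"
  note e = ext_trans[OF e1 e2]
  note cc = cmp_ext[OF e] and ss = small_ext[OF e] and hh = has_ext[OF e] and x = ext_edom[OF e]
  have e': "cmpn E2 (%x. n x - m x)" "small E2 (%x. n x - m x)" by (rule cc[OF cmpn_diff[OF n(1) m]], rule ss[OF small_diff[OF n(2)]])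
  have N: "cmpn E2 ?N" by (rule cmpn_mult[OF cmpn_power[OF e' cc[OF W]] cmpn_power[OF cmpn_const small_const cc[OF R(1)]]])
  have j2: "cmpn E2 ?j" by (intro cmpn_ite decn_eq cmpn_mod cmpn_div cmpn_const cmpn_Suc cc[OF j(1)] cc[OF n(1)])
  show "cmp E2 ?f"
  proof (rule cmp_best[OF cc[OF n(1)] ss[OF n(2)] cc[OF P] hh[OF Q] hh[OF c] hh[OF H] hh[OF h] N ss[OF cnt] _ _ j2])
   fix y assume "y \<in> edom E2"
   hence "j y <= 2 * n y" using j(2) x by simp
   thus "?j y <= Suc (n y)" by auto
  next
   fix E' :: "('a \<times> nat) env" assume f: "ext (idx E2 ?N) E'"
   have xf: "fst2 z \<in> edom E" if "z \<in> edom (idx E' M)" for z M using that ext_edom[OF f] x by auto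
   have w: "cmpn (idx E' M) (%z. snd (fst z))" for M by (rule cmp_idx[OF cmp_ext[OF f cmp_snd[OF ss[OF cnt]]]])
   note u = cmp_idx[OF cmp_up[OF f]] and us = small_idx[OF small_up[OF f]] and uh = has_idx[OF has_up[OF f]]
   have ac: "cmp (idx E' M) (%z. ?C (fst2 z) (snd (fst z)) (i z))"
    if i: "cmpn (idx E' M) i" "!!z. z \<in> edom (idx E' M) ==> i z <= n (fst2 z)" for M i
    by (rule cmp_acand[OF u[OF cc[OF n(1)]] us[OF ss[OF n(2)]] u[OF cc[OF m]] u[OF cc[OF P]] u[OF cc[OF K]] uh[OF hh[OF H]] uh[OF hh[OF h]]
       uh[OF has_ext[OF e2 B]] uh[OF G] u[OF cc[OF ee(1)]] us[OF ss[OF ee(2)]] u[OF cc[OF W]] u[OF cc[OF R(1)]] us[OF ss[OF R(2)]] _ w i])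
     (use R(3) xf in auto)
   have sn: "small E' (%z. Suc (n (fst z)))" "small E' (%z. Suc (Suc (n (fst z))))"
    by (intro small_Suc small_up[OF f ss[OF n(2)]])+
   show "cmp (idx E' (%z. Suc (n (fst z)))) (%z. ?C (fst2 z) (snd (fst z)) (snd z))"
    by (rule ac[OF cmp_snd[OF sn(1)]]) auto
   show "cmp (idx E' (%z. Suc (Suc (n (fst z))))) (%z. ?C (fst2 z) (snd (fst z)) (snd z - 1))"
    by (rule ac[OF cmpn_diff[OF cmp_snd[OF sn(2)] cmpn_const]]) auto
  qed
 qed
qed

section \<open>Reading the instance\<close>

definition mentries :: "'a mat => 'a list" where
 "mentries A = concat (map list_of_vec (rows A))"

definition entries :: "emiqp => rat list" where
 "entries I = mentries (obj_mat I) @ list_of_vec (obj_vec I) @ mentries (ell_mat I) @ list_of_vec (ell_center I)"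

lemma mat_cells_mentries: "mat_cells A = concat (map rat_cells (mentries A))"
proof -
 have "concat (map vec_cells vs) = concat (map rat_cells (concat (map list_of_vec vs)))" for vs
  by (induction vs) (simp_all add: vec_cells_def)
 thus ?thesis unfolding mat_cells_def mentries_def .
qed

lemma input_cells_entries:
 "input_cells I ep = [int (nvars I), int (nints I), \<lceil>1 / ep\<rceil>] @ concat (map rat_cells (entries I))"
 by (simp add: input_cells_def entries_def mat_cells_mentries vec_cells_def)

lemma rat_cells_nth:
 assumes "r < length xs"
 shows "concat (map rat_cells xs) ! (2 * r) = fst (quotient_of (xs ! r))"
  "concat (map rat_cells xs) ! (2 * r + 1) = snd (quotient_of (xs ! r))"
proof -
 have "concat (map rat_cells xs) ! (2 * r) = fst (quotient_of (xs ! r)) &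
  concat (map rat_cells xs) ! (2 * r + 1) = snd (quotient_of (xs ! r))"
  using assms proof (induction xs arbitrary: r)
  case (Cons a xs)
  thus ?case by (cases r) (auto simp: rat_cells_def)
 qed simp
 thus "concat (map rat_cells xs) ! (2 * r) = fst (quotient_of (xs ! r))"
  "concat (map rat_cells xs) ! (2 * r + 1) = snd (quotient_of (xs ! r))" by auto
qed

lemma rat_cells_length: "length (concat (map rat_cells xs)) = 2 * length xs"
 by (induction xs) (auto simp: rat_cells_def)

definition num :: "emiqp => nat => int" where "num I r = fst (quotient_of (entries I ! r))"
definition den :: "emiqp => nat => int" where "den I r = snd (quotient_of (entries I ! r))"

lemma input_memory_nth:
 "input_memory I ep 0 = int (nvars I)" "input_memory I ep 1 = int (nints I)" "input_memory I ep 2 = \<lceil>1 / ep\<rceil>"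
 "r < length (entries I) ==> input_memory I ep (3 + 2 * int r) = num I r"
 "r < length (entries I) ==> input_memory I ep (4 + 2 * int r) = den I r"
proof -
 have e: "nat (3 + 2 * int r) = Suc (Suc (Suc (2 * r)))" "nat (4 + 2 * int r) = Suc (Suc (Suc (2 * r + 1)))" by auto
 show "input_memory I ep 0 = int (nvars I)" "input_memory I ep 1 = int (nints I)" "input_memory I ep 2 = \<lceil>1 / ep\<rceil>"
  by (simp_all add: input_memory_def input_cells_entries)
 assume r: "r < length (entries I)"
 show "input_memory I ep (3 + 2 * int r) = num I r"
  using r rat_cells_nth(1)[OF r] unfolding input_memory_def input_cells_entries e
  by (simp add: rat_cells_length num_def del: length_concat)
 show "input_memory I ep (4 + 2 * int r) = den I r"
  using r rat_cells_nth(2)[OF r] unfolding input_memory_def input_cells_entries e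
  by (simp add: rat_cells_length den_def del: length_concat)
qed

lemma concat_nth_uniform:
 "ALL xs:set xss. length xs = n ==> i < length xss ==> j < n ==> concat xss ! (i * n + j) = xss ! i ! j"
proof (induction xss arbitrary: i)
 case (Cons xs xss)
 thus ?case by (cases i) (simp_all add: nth_append add.assoc)
qed simp

lemma length_concat_uniform: "ALL xs:set xss. length xs = n ==> length (concat xss) = length xss * n"
 by (induction xss) auto

lemma mentries_nth: "A \<in> carrier_mat k n ==> i < k ==> j < n ==> mentries A ! (i * n + j) = A $$ (i, j)"
 unfolding mentries_def by (subst concat_nth_uniform) (auto simp: rows_def list_of_vec_index)

lemma mentries_length: "A \<in> carrier_mat k n ==> length (mentries A) = k * n"
 unfolding mentries_def by (subst length_concat_uniform) (auto simp: rows_def)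

lemma index_less: "i < n ==> j < n ==> i * n + j < n * n" for n :: nat
proof -
 assume "i < n" "j < n"
 hence "i * n + j < Suc i * n" by simp
 also have "... <= n * n" using \<open>i < n\<close> by (intro mult_le_mono1) simp
 finally show ?thesis .
qed

context
 fixes I :: emiqp
 assumes wf: "wf_emiqp I"
begin

abbreviation "nI == nvars I"

lemma dims: "obj_mat I \<in> carrier_mat nI nI" "ell_mat I \<in> carrier_mat nI nI" "dim_vec (obj_vec I) = nI" "dim_vec (ell_center I) = nI"
 using wf by (auto simp: wf_emiqp_def)

lemma length_entries: "length (entries I) = 2 * (nI * nI) + 2 * nI"
 by (simp add: entries_def mentries_length[OF dims(1)] mentries_length[OF dims(2)] dims)

lemma entries_nth:
 "i < nI ==> j < nI ==> entries I ! (i * nI + j) = obj_mat I $$ (i, j)"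
 "i < nI ==> entries I ! (nI * nI + i) = obj_vec I $ i"
 "i < nI ==> j < nI ==> entries I ! (nI * nI + nI + (i * nI + j)) = ell_mat I $$ (i, j)"
 "i < nI ==> entries I ! (nI * nI + nI + nI * nI + i) = ell_center I $ i"
proof -
 note l = mentries_length[OF dims(1)] mentries_length[OF dims(2)]
 have v: "length (list_of_vec (obj_vec I)) = nI" "length (list_of_vec (ell_center I)) = nI" by (simp_all add: dims)
 have app: "(xs @ ys) ! (length xs + k) = ys ! k" "k < length xs ==> (xs @ ys) ! k = xs ! k" for xs ys :: "rat list" and k
  by (simp_all add: nth_append)
 show "entries I ! (i * nI + j) = obj_mat I $$ (i, j)" if "i < nI" "j < nI"
  unfolding entries_def using app(2)[of "i * nI + j" "mentries (obj_mat I)"] index_less[OF that] mentries_nth[OF dims(1) that] l by simp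
 show "entries I ! (nI * nI + i) = obj_vec I $ i" if "i < nI"
  unfolding entries_def l(1)[symmetric] app(1) by (subst app(2)) (use that v in "simp_all add: list_of_vec_index")
 have 3: "entries I ! (nI * nI + nI + k) = (mentries (ell_mat I) @ list_of_vec (ell_center I)) ! k" for k proof -
  have "nI * nI + nI + k = length (mentries (obj_mat I)) + (length (list_of_vec (obj_vec I)) + k)" using l v by simp
  thus ?thesis unfolding entries_def by (simp only: app(1))
 qed
 show "entries I ! (nI * nI + nI + (i * nI + j)) = ell_mat I $$ (i, j)" if "i < nI" "j < nI"
  unfolding 3 by (subst app(2)) (use index_less[OF that] mentries_nth[OF dims(2) that] l in simp_all)
 show "entries I ! (nI * nI + nI + nI * nI + i) = ell_center I $ i" if "i < nI" proof -
  have "entries I ! (nI * nI + nI + (nI * nI + i)) = (mentries (ell_mat I) @ list_of_vec (ell_center I)) ! (length (mentries (ell_mat I)) + i)"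
   unfolding 3 l(2) ..
  also have "... = ell_center I $ i" unfolding app(1) using that dims by (simp add: list_of_vec_index)
  finally show ?thesis by (simp only: add.assoc)
 qed
qed

end

definition lenr :: "emiqp => nat" where
 "lenr I = 2 * (nvars I * nvars I) + 2 * nvars I"

text \<open>In the summand 2, one unit is the sign bit of \<open>rat_size\<close> and the other the
  entry count in the sizes of vectors and matrices, so the sum is exactly
  \<open>emiqp_size\<close>.\<close>

definition bitsum :: "emiqp => nat" where
 "bitsum I = (\<Sum>r<lenr I. 2 + bits (num I r) + bits (den I r))"

text \<open>The parameter \<open>t\<close> of \<open>alg_spec\<close>. The program computes it
  itself, which is why it is a sum of readily computable terms.\<close>

definition tt :: "emiqp => real => nat" where
 "tt I ep = 3 + nvars I + nat \<lceil>1 / ep\<rceil> + bitsum I"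

text \<open>All data are multiplied by the product of all denominators.\<close>

definition PP :: "emiqp => int" where
 "PP I = (\<Prod>r<lenr I. den I r)"

definition dat :: "emiqp => nat => int" where
 "dat I r = num I r * (PP I div den I r)"

definition dH :: "emiqp => imat" where "dH I i j = dat I (i * nvars I + j)"
definition dh :: "emiqp => nat => int" where "dh I i = dat I (nvars I * nvars I + i)"
definition dQ :: "emiqp => imat" where "dQ I i j = dat I (nvars I * nvars I + nvars I + (i * nvars I + j))"
definition dc :: "emiqp => nat => int" where "dc I i = dat I (nvars I * nvars I + nvars I + nvars I * nvars I + i)"

definition res :: "emiqp => real => nat => int" where
 "res I ep = alg (nvars I) (nvars I - nints I) (dQ I) (dc I) (PP I) (dH I) (dh I) \<lceil>1 / ep\<rceil> (3 * tt I ep ^ 3 + 3) (1250 * tt I ep ^ 4)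
  (offrange (nvars I - (nvars I - nints I)) \<lceil>1 / ep\<rceil>) (radix (nvars I) (1250 * tt I ep ^ 4) \<lceil>1 / ep\<rceil>)"

definition cntI :: "emiqp => real => nat" where
 "cntI I ep = offrange (nvars I - (nvars I - nints I)) \<lceil>1 / ep\<rceil> ^ (nvars I - (nvars I - nints I)) *
  radix (nvars I) (1250 * tt I ep ^ 4) \<lceil>1 / ep\<rceil> ^ 6"

lemma bits_le_tt: "r < lenr I ==> bits (num I r) <= tt I ep" "r < lenr I ==> bits (den I r) <= tt I ep"
proof -
 assume r: "r < lenr I"
 have "2 + bits (num I r) + bits (den I r) <= bitsum I" unfolding bitsum_def by (rule member_le_sum) (use r in auto)
 thus "bits (num I r) <= tt I ep" "bits (den I r) <= tt I ep" by (auto simp: tt_def)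
qed

lemma dat_index:
 "i < nvars I ==> j < nvars I ==> i * nvars I + j < lenr I"
 "i < nvars I ==> nvars I * nvars I + i < lenr I"
 "i < nvars I ==> j < nvars I ==> nvars I * nvars I + nvars I + (i * nvars I + j) < lenr I"
 "i < nvars I ==> nvars I * nvars I + nvars I + nvars I * nvars I + i < lenr I"
 using index_less[of i "nvars I" j] by (auto simp: lenr_def)

lemma den_pos: "0 < den I r" using quotient_of_denom_pos'[of "entries I ! r"] by (simp add: den_def)

lemma PP_pos: "0 < PP I" unfolding PP_def by (rule prod_pos) (simp add: den_pos)

lemma dat_real: "r < lenr I ==> real_of_int (dat I r) = of_int (PP I) * real_of_rat (entries I ! r)"
proof -
 assume r: "r < lenr I"
 have "den I r dvd PP I" unfolding PP_def by (rule dvd_prodI) (use r in auto)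
 hence e: "PP I div den I r * den I r = PP I" by simp
 have "entries I ! r = of_int (num I r) / of_int (den I r)"
  using quotient_of_div[of "entries I ! r" "num I r" "den I r"] by (simp add: num_def den_def)
 hence "real_of_rat (entries I ! r) = of_int (num I r) / of_int (den I r)" by (simp add: of_rat_divide)
 moreover have "real_of_int (PP I) = of_int (PP I div den I r) * of_int (den I r)" by (simp flip: of_int_mult add: e)
 ultimately show ?thesis using den_pos[of I r] by (simp add: dat_def)
qed

lemma PP_le: "PP I <= 2 ^ (\<Sum>r<lenr I. bits (den I r))"
proof -
 have "(\<Prod>r<lenr I. den I r) <= (\<Prod>r<lenr I. 2 ^ bits (den I r))" proof (rule prod_mono)
  fix r
  have "den I r <= 2 ^ bits (den I r)" using abs_less_bits[of "den I r"] den_pos[of I r] by linarith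
  thus "0 <= den I r & den I r <= 2 ^ bits (den I r)" using den_pos[of I r] by simp
 qed
 thus ?thesis unfolding PP_def by (simp add: power_sum)
qed

lemma dat_le: "r < lenr I ==> \<bar>dat I r\<bar> <= 2 ^ tt I ep" and PP_tt: "PP I <= 2 ^ tt I ep"
proof -
 let ?b = "\<Sum>r<lenr I. bits (den I r)"
 have s: "bits (num I r) + ?b <= tt I ep" if r: "r < lenr I" for r proof -
  have "bits (num I r) <= (\<Sum>r<lenr I. 2 + bits (num I r))"
   using member_le_sum[of r "{..<lenr I}" "%r. 2 + bits (num I r)"] r by simp
  moreover have "bitsum I = (\<Sum>r<lenr I. 2 + bits (num I r)) + ?b" unfolding bitsum_def by (simp only: sum.distrib)
  ultimately show ?thesis by (simp add: tt_def)
 qed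
 have "?b <= bitsum I" unfolding bitsum_def by (intro sum_mono) auto
 hence "(2 :: int) ^ ?b <= 2 ^ tt I ep" by (intro power_increasing) (auto simp: tt_def)
 thus "PP I <= 2 ^ tt I ep" using PP_le[of I] by linarith
 assume r: "r < lenr I"
 have "PP I div den I r <= PP I" using zdiv_mono2[of "PP I" 1 "den I r"] PP_pos[of I] den_pos[of I r] by simp
 moreover have "0 <= PP I div den I r" using PP_pos[of I] den_pos[of I r] by (simp add: pos_imp_zdiv_nonneg_iff less_imp_le)
 ultimately have "\<bar>PP I div den I r\<bar> <= 2 ^ ?b" using PP_le[of I] by linarith
 hence "\<bar>dat I r\<bar> <= 2 ^ (bits (num I r) + ?b)"
  unfolding dat_def by (intro mult_2pow) (use abs_less_bits[of "num I r"] in auto)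
 also have "... <= 2 ^ tt I ep" using s[OF r] by (intro power_increasing) auto
 finally show "\<bar>dat I r\<bar> <= 2 ^ tt I ep" .
qed

text \<open>The content of input cell \<open>3 + r\<close>, with numerators and denominators
  interleaved.\<close>

definition cell :: "emiqp => nat => int" where
 "cell I r = (if even r then num I (r div 2) else den I (r div 2))"

lemma cmp_num_den:
 assumes C: "hasv E (%y. 2 * lenr (I y)) (%y. cell (I y))" and r: "cmpn E r" "!!y. y \<in> edom E ==> r y < lenr (I y)"
 shows "cmp E (%y. num (I y) (r y))" and "cmp E (%y. den (I y) (r y))"
proof -
 have r2: "cmpn E (%y. 2 * r y)" by (rule cmpn_mult[OF cmpn_const r(1)])
 have "cmp E (%y. cell (I y) (2 * r y))" by (rule cmp_hasv[OF C r2]) (use r(2) in simp)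
 thus "cmp E (%y. num (I y) (r y))" by (simp add: cell_def)
 have "cmp E (%y. cell (I y) (Suc (2 * r y)))" by (rule cmp_hasv[OF C cmpn_Suc[OF r2]]) (use r(2) in fastforce)
 thus "cmp E (%y. den (I y) (r y))" by (simp add: cell_def)
qed

lemma cmp_dat:
 assumes C: "hasv E (%y. 2 * lenr (I y)) (%y. cell (I y))"
  and P: "cmp E (%y. PP (I y))" and r: "cmpn E r" "!!y. y \<in> edom E ==> r y < lenr (I y)"
 shows "cmp E (%y. dat (I y) (r y))"
 unfolding dat_def by (rule cmp_mult[OF cmp_num_den(1)[OF C r] cmp_div[OF P cmp_num_den(2)[OF C r]]])

text \<open>The environment is left general, because the final program uses it with the output
  position as an additional index.\<close>

lemma cmp_res:
 fixes E :: "'y env" and I :: "'y => emiqp" and ep :: "'y => real"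
 assumes inp: "!!y. y \<in> edom E ==> inp E y = input_memory (I y) (ep y) & length (entries (I y)) = lenr (I y) & 0 < ep y & nints (I y) <= nvars (I y)"
  and lt: "!!y. y \<in> edom E ==> symn (nvars (I y)) (dQ (I y)) & posdef (dQ (I y)) (nvars (I y))"
  and st: "small E (%y. tt (I y) (ep y))" and cnt: "small E (%y. cntI (I y) (ep y))"
  and j: "cmpn E j" "!!y. y \<in> edom E ==> j y <= 2 * nvars (I y)"
 shows "cmp E (%y. outc (nvars (I y)) (res (I y) (ep y)) (j y))"
proof -
 let ?n = "%y. nvars (I y)" and ?p = "%y. nints (I y)" and ?K = "%y. \<lceil>1 / ep y\<rceil>" and ?L = "%y. lenr (I y)" and ?t = "%y. tt (I y) (ep y)"
 have in0: "inp E y 0 = int (?n y)" "inp E y 1 = int (?p y)" "inp E y 2 = ?K y" if "y \<in> edom E" for y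
  using inp[OF that] input_memory_nth(1-3)[of "I y" "ep y"] by auto
 have inr: "inp E y (3 + int r) = cell (I y) r" if y: "y \<in> edom E" and r: "r < 2 * ?L y" for y r proof -
  have l: "r div 2 < length (entries (I y))" using inp[OF y] r by auto
  have "3 + int r = (if even r then 3 + 2 * int (r div 2) else 4 + 2 * int (r div 2))" by (auto elim!: evenE oddE)
  thus ?thesis using input_memory_nth(4,5)[OF l, of "ep y"] inp[OF y] by (simp add: cell_def)
 qed
 have K1: "1 <= ?K y" if "y \<in> edom E" for y proof -
  have "0 < ?K y" using inp[OF that] by simp
  thus ?thesis by linarith
 qed
 have sn: "small E ?n" by (rule small_mono[OF st]) (simp add: tt_def)
 have sp: "small E ?p" by (rule small_mono[OF sn]) (use inp in auto)
 have sK: "small E (%y. nat (?K y))" by (rule small_mono[OF st]) (unfold tt_def, linarith)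
 have n: "cmpn E ?n"
  by (rule cmp_cong[OF cmp_inp[OF cmp_const[of E 0]]]) (use in0 in "auto intro: sbits_mono[OF sbits_nat[OF sn]]")
 have p: "cmpn E ?p"
  by (rule cmp_cong[OF cmp_inp[OF cmp_const[of E 1]]]) (use in0 in "auto intro: sbits_mono[OF sbits_nat[OF sp]]")
 have K: "cmp E ?K" proof (rule cmp_cong[OF cmp_inp[OF cmp_const[of E 2]]])
  show "sbits E (%y. inp E y 2)" proof (rule sbits_mono[OF sbits_nat[OF sK]])
   fix y assume "y \<in> edom E"
   from in0(3)[OF this] K1[OF this] show "\<bar>inp E y 2\<bar> <= \<bar>int (nat (?K y))\<bar>" by linarith
  qed
 qed (use in0 in auto)
 have Kn: "cmpn E (%y. nat (?K y))"  proof (rule cmp_cong[OF K])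
  fix y assume "y \<in> edom E"
  from K1[OF this] show "int (nat (?K y)) = ?K y" by linarith
 qed
 have L: "cmpn E ?L" unfolding lenr_def by (intro cmpn_add cmpn_mult cmpn_const n)
 have sL: "small E ?L" unfolding lenr_def by (intro small_add small_mult small_const sn)
 show ?thesis
 proof (rule cmp_letv[where d="%y. 2 * ?L y" and X="%y. cell (I y)", OF cmpn_mult[OF cmpn_const L] small_mult[OF small_const sL]])
  let ?E = "idx E (%y. 2 * ?L y)"
  have v: "cmpn ?E snd" by (rule cmp_snd[OF small_mult[OF small_const sL]])
  show "cmp ?E (%z. cell (I (fst z)) (snd z))" proof (rule cmp_cong[OF cmp_inp[where g="%z. 3 + int (snd z)"]])
   show "cmp ?E (%z. 3 + int (snd z))" by (rule cmp_add[OF cmp_const v])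
   have "bits (inp E (fst z) (3 + int (snd z))) <= ?t (fst z)" if "z \<in> edom ?E" for z proof -
    have "snd z div 2 < ?L (fst z)" using that by auto
    from bits_le_tt[OF this, of "ep (fst z)"] show ?thesis using that inr[of "fst z" "snd z"] by (simp add: cell_def)
   qed
   thus "sbits ?E (%z. inp ?E z (3 + int (snd z)))"
    unfolding sbits_def by (intro small_mono[OF small_idx[OF st]]) simp
  qed (use inr in auto)
  fix E1 assume e1: "ext E E1" and C: "hasv E1 (%y. 2 * ?L y) (%y. cell (I y))"
  note c1 = cmp_ext[OF e1] and s1 = small_ext[OF e1]
  have vL: "cmpn (idx E1 ?L) snd" by (rule cmp_snd[OF s1[OF sL]])
  have N: "cmp (idx E1 ?L) (%z. num (I (fst z)) (snd z))" and D: "cmp (idx E1 ?L) (%z. den (I (fst z)) (snd z))"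
   by (rule cmp_num_den[OF has_idx[OF C] vL]; simp)+
  have P: "cmp E1 (%y. PP (I y))" unfolding PP_def by (rule cmp_prod[OF c1[OF L] s1[OF sL] D])
  have "cmp E1 (%y. \<Sum>r<?L y. int (2 + bits (num (I y) r) + bits (den (I y) r)))"
   by (rule cmp_sum[OF c1[OF L] s1[OF sL]]) (intro cmpn_add cmpn_const cmp_bits N D)
  hence bs: "cmpn E1 (%y. bitsum (I y))" unfolding bitsum_def by (simp only: of_nat_sum)
  have t: "cmpn E1 ?t" unfolding tt_def by (intro cmpn_add cmpn_const c1[OF n] c1[OF Kn] bs)
  have dt: "cmp (idx (idx E' a) (%z. b (fst z))) (%z. dat (I (fst2 z)) (r (fst2 z) (snd (fst z)) (snd z)))"
   if e: "ext E1 E'" and ab: "small E' a" "small E' b"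
    and r: "cmpn (idx (idx E' a) (%z. b (fst z))) (%z. r (fst2 z) (snd (fst z)) (snd z))"
     "!!y i j. i < a y ==> j < b y ==> r y i j < ?L y" for E' a b r
   by (rule cmp_dat[where I="%z. I (fst2 z)", OF has_idx[OF has_idx[OF has_ext[OF e C]]] cmp_idx[OF cmp_idx[OF cmp_ext[OF e P]]] r(1)]) (use r(2) in auto)
  have up: "cmpn (idx (idx E' a) (%z. b (fst z))) (%z. ?n (fst2 z))"
   "small E' a ==> cmpn (idx (idx E' a) (%z. b (fst z))) (%z. snd (fst z))"
   "small E' b ==> cmpn (idx (idx E' a) (%z. b (fst z))) (%z. snd z)" if e: "ext E1 E'" for E' a b
   by (rule cmp_idx[OF cmp_idx[OF cmp_ext[OF e c1[OF n]]]], rule cmp_idx[OF cmp_snd], assumption, rule cmp_snd[OF small_idx], assumption)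
  let ?f = "%y. outc (?n y) (res (I y) (ep y)) (j y)"
  note nn = c1[OF n] s1[OF sn]
  have dtn: "cmp (idx (idx E' ?n) (%z. ?n (fst z))) (%z. dat (I (fst2 z)) (b (fst2 z) + (snd (fst z) * ?n (fst2 z) + snd z)))"
   if e: "ext E1 E'" and b: "cmpn E1 b" "!!y i j. i < ?n y ==> j < ?n y ==> b y + (i * ?n y + j) < ?L y" for E' b
   by (rule dt[where r="%y i j. b y + (i * ?n y + j)", OF e small_ext[OF e nn(2)] small_ext[OF e nn(2)]])
    (intro cmpn_add cmpn_mult up[OF e] small_ext[OF e nn(2)] cmp_idx[OF cmp_idx[OF cmp_ext[OF e b(1)]]], use b(2) in auto)
  have dtv: "cmp (idx (idx E' (%_. 1)) (%z. ?n (fst z))) (%z. dat (I (fst2 z)) (b (fst2 z) + snd z))"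
   if e: "ext E1 E'" and b: "cmpn E1 b" "!!y j. j < ?n y ==> b y + j < ?L y" for E' b
   by (rule dt[where r="%y i j. b y + j", OF e small_const small_ext[OF e nn(2)]])
    (intro cmpn_add up[OF e] small_ext[OF e nn(2)] cmp_idx[OF cmp_idx[OF cmp_ext[OF e b(1)]]], use b(2) in auto)
  have n2: "cmpn E1 (%y. ?n y * ?n y)" by (rule cmpn_mult[OF nn(1) nn(1)])
  show "cmp E1 ?f" proof (rule cmp_let_ext[where n="?n" and l="?n" and S="%y. dH (I y)", OF nn nn])
   show "cmp (idx (idx E1 ?n) (%z. ?n (fst z))) (%z. dH (I (fst2 z)) (snd (fst z)) (snd z))"
    using dtn[OF ext_refl cmpn_const[of E1 0]] dat_index(1) unfolding dH_def by (simp only: add_0)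
   fix E2 assume e2: "ext E1 E2" and H: "has E2 ?n ?n (%y. dH (I y))"
   note n2' = cmp_ext[OF e2 nn(1)] small_ext[OF e2 nn(2)]
   show "cmp E2 ?f"
   proof (rule cmp_let_ext[where n="%_. 1" and l="?n" and S="%y i. dh (I y)", OF cmpn_const small_const n2'])
    show "cmp (idx (idx E2 (%_. 1)) (%z. ?n (fst z))) (%z. dh (I (fst2 z)) (snd z))"
     unfolding dh_def by (rule dtv[OF e2 n2]) (rule dat_index(2))
    fix E3 assume e3: "ext E2 E3" and h: "has E3 (%_. 1) ?n (%y i. dh (I y))"
    note x3 = ext_trans[OF e2 e3]
    note n3 = cmp_ext[OF x3 nn(1)] small_ext[OF x3 nn(2)]
    show "cmp E3 ?f" proof (rule cmp_let_ext[where n="?n" and l="?n" and S="%y. dQ (I y)", OF n3 n3])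
     show "cmp (idx (idx E3 ?n) (%z. ?n (fst z))) (%z. dQ (I (fst2 z)) (snd (fst z)) (snd z))"
      unfolding dQ_def by (rule dtn[OF x3 cmpn_add[OF n2 nn(1)]]) (rule dat_index(3))
     fix E4 assume e4: "ext E3 E4" and Q: "has E4 ?n ?n (%y. dQ (I y))"
     note x4 = ext_trans[OF x3 e4]
     note n4 = cmp_ext[OF x4 nn(1)] small_ext[OF x4 nn(2)]
     show "cmp E4 ?f"
     proof (rule cmp_let_ext[where n="%_. 1" and l="?n" and S="%y i. dc (I y)", OF cmpn_const small_const n4])
      show "cmp (idx (idx E4 (%_. 1)) (%z. ?n (fst z))) (%z. dc (I (fst2 z)) (snd z))"
       unfolding dc_def by (rule dtv[OF x4 cmpn_add[OF cmpn_add[OF n2 nn(1)] n2]]) (rule dat_index(4))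
      fix E5 assume e5: "ext E4 E5" and c: "has E5 (%_. 1) ?n (%y i. dc (I y))"
      note x5 = ext_trans[OF x4 e5]
      note x = ext_trans[OF e1 x5]
      note cc = cmp_ext[OF x] and ss = small_ext[OF x] and ed = ext_edom[OF x]
      note n5 = cc[OF n] ss[OF sn] and t5 = cmp_ext[OF x5 t] and K5 = cc[OF Kn] and st5 = ss[OF st]
      let ?m = "%y. ?n y - ?p y"
      have m: "cmpn E5 ?m" by (rule cmpn_diff[OF n5(1) cc[OF p]])
      have q: "cmpn E5 (%y. ?n y - ?m y)" "small E5 (%y. ?n y - ?m y)" by (rule cmpn_diff[OF n5(1) m], rule small_diff[OF n5(2)])
      have T: "cmpn E5 (%y. 3 * ?t y ^ 3 + 3)" "small E5 (%y. 3 * ?t y ^ 3 + 3)"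
       by (intro cmpn_add cmpn_mult cmpn_power cmpn_const small_const t5) (intro small_add small_mult small_power small_const st5)
      have ee: "cmpn E5 (%y. 1250 * ?t y ^ 4)" "small E5 (%y. 1250 * ?t y ^ 4)"
       by (intro cmpn_add cmpn_mult cmpn_power cmpn_const small_const t5) (intro small_add small_mult small_power small_const st5)
      have W: "cmpn E5 (%y. offrange (?n y - ?m y) (?K y))"
       unfolding offrange_def by (intro cmpn_add cmpn_mult cmpn_power cmpn_const q K5)
      have R: "cmpn E5 (%y. radix (?n y) (1250 * ?t y ^ 4) (?K y))" "small E5 (%y. radix (?n y) (1250 * ?t y ^ 4) (?K y))"
       unfolding radix_def by (intro cmpn_add cmpn_mult cmpn_power cmpn_const small_const n5 ee K5)
        (intro small_add small_mult small_power small_const n5 st5 ss[OF sK])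
      show "cmp E5 ?f" unfolding res_def
       by (rule cmp_alg[OF n5 m cmp_ext[OF x5 P] cc[OF K] T ee W R _ ss[OF cnt[unfolded cntI_def]] has_ext[OF e5 Q] c
          has_ext[OF ext_trans[OF e3 ext_trans[OF e4 e5]] H] has_ext[OF ext_trans[OF e4 e5] h] _ cc[OF j(1)]])
        (use lt j(2) ed in "auto simp: radix_def")
     qed
    qed
   qed
  qed
 qed
qed

section \<open>The main theorem\<close>

lemma quad_sum:
 fixes A :: "real mat"
 assumes "A \<in> carrier_mat n n" "x \<in> carrier_vec n"
 shows "x \<bullet> (A *\<^sub>v x) = (\<Sum>i<n. \<Sum>j<n. A $$ (i, j) * x $ i * x $ j)"
proof -
 have "x \<bullet> (A *\<^sub>v x) = (\<Sum>i<n. x $ i * (\<Sum>j<n. A $$ (i, j) * x $ j))"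
  using assms by (simp add: scalar_prod_def lessThan_atLeast0)
 thus ?thesis by (simp add: sum_distrib_left mult_ac)
qed

lemma dat_cong: "entries I ! r = entries I ! r' ==> dat I r = dat I r'" by (simp add: dat_def num_def den_def)

text \<open>Every difference of two values on \<open>S\<close> is at most supremum minus infimum, so
  \<open>f x - f y\<close> is at most \<open>ep\<close> times that for each \<open>y\<close>; the
  infimum over \<open>y\<close> follows.\<close>

lemma approx_solutionI:
 fixes f :: "'a => real"
 assumes x: "x \<in> S" and b: "!!y. y \<in> S ==> \<bar>f y\<bar> <= M" and K: "1 / ep <= K" and ep: "0 < ep"
  and opt: "!!y. y \<in> S ==> EX z:S. K * (f x - f y) <= f z - f x"
 shows "approx_solution ep f S x"
proof -
 have ba: "bdd_above (f ` S)" and bb: "bdd_below (f ` S)" proof -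
  have h: "f y <= M" "- M <= f y" if "y \<in> S" for y using b[OF that] by linarith+
  show "bdd_above (f ` S)" by (rule bdd_aboveI2[where M=M], rule h(1))
  show "bdd_below (f ` S)" by (rule bdd_belowI2[where m="- M"], rule h(2))
 qed
 have K0: "0 < K"  proof -
  have "0 < 1 / ep" using ep by simp
  thus ?thesis using K by linarith
 qed
 let ?i = "INF y\<in>S. f y" and ?s = "SUP y\<in>S. f y"
 have lo: "?i <= f y" if "y \<in> S" for y by (rule cINF_lower[OF bb that])
 have hi: "f y <= ?s" if "y \<in> S" for y by (rule cSUP_upper[OF that ba])
 have "f x - ep * (?s - ?i) <= f y" if y: "y \<in> S" for y proof -
  obtain z where z: "z \<in> S" "K * (f x - f y) <= f z - f x" using opt[OF y] by blast
  have "K * (f x - f y) <= ?s - ?i" using z(2) hi[OF z(1)] lo[OF x] by linarith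
  hence "f x - f y <= (?s - ?i) / K" using K0 by (simp add: pos_le_divide_eq mult.commute)
  also have "... <= ep * (?s - ?i)" proof -
   have "1 / K <= ep" using K K0 ep by (simp add: divide_le_eq mult.commute)
   hence "1 / K * (?s - ?i) <= ep * (?s - ?i)" using lo[OF x] hi[OF x] by (intro mult_right_mono) auto
   thus ?thesis by simp
  qed
  finally show ?thesis by linarith
 qed
 hence "f x - ep * (?s - ?i) <= ?i" using x by (intro cINF_greatest) auto
 thus ?thesis using x by (simp add: approx_solution_def)
qed

context
 fixes I :: emiqp
 assumes wf: "wf_emiqp I"
begin

abbreviation "n == nvars I"
abbreviation "m == nvars I - nints I"
abbreviation "QQ == real_mat (ell_mat I)"
abbreviation "HH == real_mat (obj_mat I)"

lemma len: "length (entries I) = lenr I" by (simp add: length_entries[OF wf] lenr_def)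

lemma real_data:
 "i < n ==> j < n ==> real_of_int (dH I i j) = of_int (PP I) * HH $$ (i, j)"
 "i < n ==> real_of_int (dh I i) = of_int (PP I) * real_vec (obj_vec I) $ i"
 "i < n ==> j < n ==> real_of_int (dQ I i j) = of_int (PP I) * QQ $$ (i, j)"
 "i < n ==> real_of_int (dc I i) = of_int (PP I) * real_vec (ell_center I) $ i" unfolding dH_def dh_def dQ_def dc_def
 using dims[OF wf] entries_nth[OF wf] by (simp_all add: dat_real dat_index)

lemma sym_data: "symn n (dH I)" "symn n (dQ I)"
proof -
 have *: "A $$ (i, j) = A $$ (j, i)" if "symmetric_mat A" "A \<in> carrier_mat n n" "i < n" "j < n" for A :: "rat mat" and i j
  using that index_transpose_mat(1)[of j A i] unfolding symmetric_mat_def by auto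
 show "symn n (dH I)" unfolding symn_def dH_def
  using entries_nth(1)[OF wf] *[of "obj_mat I"] wf by (auto simp: wf_emiqp_def intro!: dat_cong)
 show "symn n (dQ I)" unfolding symn_def dQ_def
  using entries_nth(3)[OF wf] *[of "ell_mat I"] wf by (auto simp: wf_emiqp_def intro!: dat_cong)
qed

lemma PPr: "0 < real_of_int (PP I)" using PP_pos[of I] by simp

lemma bf_data:
 "bf n (dH I) u u = of_int (PP I) * (\<Sum>i<n. \<Sum>j<n. HH $$ (i, j) * u i * u j)"
 "bf n (dQ I) u u = of_int (PP I) * (\<Sum>i<n. \<Sum>j<n. QQ $$ (i, j) * u i * u j)"
 unfolding bf_def sum_distrib_left by (intro sum.cong refl; simp add: real_data)+

lemma pos_data: "posdef (dQ I) n" unfolding posdef_def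
proof (intro allI impI)
 fix u :: "nat => real" assume "EX i<n. u i ~= 0"
 then obtain i where i: "i < n" "u i ~= 0" by blast
 let ?x = "vec n u"
 have "?x ~= 0\<^sub>v n" using i by (auto simp: vec_eq_iff)
 moreover have Q: "QQ \<in> carrier_mat n n" using dims[OF wf] by simp
 ultimately have "0 < ?x \<bullet> (QQ *\<^sub>v ?x)" using wf by (simp add: wf_emiqp_def pos_def_mat_def)
 also have "... = (\<Sum>i<n. \<Sum>j<n. QQ $$ (i, j) * u i * u j)" by (simp add: quad_sum[OF Q])
 finally have "0 < bf n (dQ I) u u" unfolding bf_data using PPr by simp
 thus "0 < (\<Sum>i<n. u i * (\<Sum>j<n. of_int (dQ I i j) * u j))" by (simp add: bf_def sum_distrib_left mult_ac)
qed

text \<open>Translates vectors that carry a dimension into functions that vanish from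
  \<open>n\<close> on.\<close>

definition fn :: "real vec => nat => real" where
 "fn x l = (if l < n then x $ l else 0)"

abbreviation "FS == fset n m (dQ I) (dc I) (PP I)"
abbreviation "fo == fobj n (dH I) (dh I)"

lemma fn_feasible:
 assumes x: "x \<in> carrier_vec n" shows "fn x \<in> FS \<longleftrightarrow> x \<in> feasible_set I"
proof -
 let ?c = "real_vec (ell_center I)"
 have c: "?c \<in> carrier_vec n" using wf by (simp add: wf_emiqp_def)
 have Q: "QQ \<in> carrier_mat n n" using dims[OF wf] by simp
 have w: "(fn x - (1 / of_int (PP I)) *R vn n (dc I)) l = (x - ?c) $ l" if "l < n" for l
  using that PPr x c by (simp add: fn_def vn_def real_data(4))
 have "bf n (dQ I) (fn x - (1 / of_int (PP I)) *R vn n (dc I)) (fn x - (1 / of_int (PP I)) *R vn n (dc I)) =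
   of_int (PP I) * ((x - ?c) \<bullet> (QQ *\<^sub>v (x - ?c)))"
  unfolding bf_data quad_sum[OF Q minus_carrier_vec[OF x c]]
 proof (rule arg_cong[where f="(*) (real_of_int (PP I))"], rule sum.cong[OF refl], rule sum.cong[OF refl])
  fix i j assume "i \<in> {..<n}" "j \<in> {..<n}"
  thus "QQ $$ (i, j) * (fn x - (1 / of_int (PP I)) *R vn n (dc I)) i * (fn x - (1 / of_int (PP I)) *R vn n (dc I)) j =
    QQ $$ (i, j) * (x - ?c) $ i * (x - ?c) $ j" by (simp only: w lessThan_iff)
 qed
 hence "bf n (dQ I) (fn x - (1 / of_int (PP I)) *R vn n (dc I)) (fn x - (1 / of_int (PP I)) *R vn n (dc I)) <= of_int (PP I)
   \<longleftrightarrow> (x - ?c) \<bullet> (QQ *\<^sub>v (x - ?c)) <= 1"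
  using PPr by (simp add: mult_le_cancel_left1)
 moreover have "fn x \<in> Vn n" by (simp add: Vn_def fn_def)
 moreover have "n - m = nints I" using wf by (simp add: wf_emiqp_def)
 moreover have "nints I <= n" using wf by (simp add: wf_emiqp_def)
 ultimately show ?thesis unfolding fset_def feasible_set_def using x by (auto simp: fn_def)
qed

lemma fn_objective: "x \<in> carrier_vec n ==> fo (fn x) = of_int (PP I) * objective I x"
proof -
 assume x: "x \<in> carrier_vec n"
 have H: "HH \<in> carrier_mat n n" using dims[OF wf] by simp
 have "bf n (dH I) (fn x) (fn x) = of_int (PP I) * (x \<bullet> (HH *\<^sub>v x))" unfolding bf_data quad_sum[OF H x]
  by (rule arg_cong[where f="(*) (real_of_int (PP I))"], rule sum.cong[OF refl], rule sum.cong[OF refl]) (simp add: fn_def)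
 moreover have "(\<Sum>l<n. of_int (dh I l) * fn x l) = of_int (PP I) * (real_vec (obj_vec I) \<bullet> x)" proof -
  have "real_vec (obj_vec I) \<bullet> x = (\<Sum>l<n. real_vec (obj_vec I) $ l * x $ l)"
   using x by (simp add: scalar_prod_def lessThan_atLeast0)
  thus ?thesis by (simp only: sum_distrib_left) (rule sum.cong, auto simp: fn_def real_data(2))
 qed
 ultimately show ?thesis by (simp add: fobj_def objective_def distrib_left)
qed

lemma fn_surj: "y \<in> Vn n ==> fn (vec n y) = y" by (intro ext) (auto simp: fn_def Vn_def)

lemma correct:
 assumes ep: "0 < ep" "ep <= 1" and out: "ALL j<2 * n + 1. M (int j) = outc n (res I ep) j"
 shows "correct_output I ep M"
proof -
 let ?K = "\<lceil>1 / ep\<rceil>" let ?t = "tt I ep" let ?b = "res I ep"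
 have K1: "1 <= ?K" proof -
  have "0 < ?K" using ep by simp
  thus ?thesis by linarith
 qed
 have nt: "n < ?t" by (simp add: tt_def)
 have Kt: "?K <= 2 ^ ?t" proof -
  have "?K <= int ?t" unfolding tt_def by linarith
  also have "... <= 2 ^ ?t" by (rule less_imp_le[OF of_nat_less_two_power])
  finally show ?thesis .
 qed
 have P1: "1 <= PP I" using PP_pos[of I] by linarith
 let ?x = "%l. if l < n then of_int (?b (Suc l)) / of_int (?b (Suc n)) else 0 :: real"
 have spec: "?b 0 = 0 & FS = {} \<or> ?b 0 = 1 & 0 < ?b (Suc n) & ?x \<in> FS &
  (ALL x0:FS. EX x':FS. of_int ?K * (fo ?x - fo x0) <= fo x' - fo ?x) & (EX M. ALL y:FS. \<bar>fo y\<bar> <= M)"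
  unfolding res_def by (rule alg_spec[OF _ sym_data(2) pos_data sym_data(1) P1 K1 nt _ _ _ _ PP_tt Kt])
   (auto simp: dQ_def dH_def dc_def dh_def intro!: dat_le dat_index)
 have o: "M 0 = ?b 0" using out[rule_format, of 0] by (simp add: outc_def)
 have oc: "M (2 * int i + 1) = ?b (Suc i)" "M (2 * int i + 2) = ?b (Suc n)" if i: "i < n" for i proof -
  have "2 * int i + 1 = int (2 * i + 1)" "2 * int i + 2 = int (2 * i + 2)" by simp_all
  moreover have "M (int (2 * i + 1)) = outc n ?b (2 * i + 1)" "M (int (2 * i + 2)) = outc n ?b (2 * i + 2)"
   by (rule out[rule_format], use i in simp)+
  moreover have "outc n ?b (2 * i + 1) = ?b (Suc i)" "outc n ?b (2 * i + 2) = ?b (Suc n)" by (simp_all add: outc_def)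
  ultimately show "M (2 * int i + 1) = ?b (Suc i)" "M (2 * int i + 2) = ?b (Suc n)" by (simp_all only:)
 qed
 from spec show ?thesis proof (elim disjE conjE)
  assume 0: "?b 0 = 0" "FS = {}"
  have "feasible_set I = {}" proof (rule ccontr)
   assume "feasible_set I ~= {}"
   then obtain x where "x \<in> feasible_set I" by blast
   hence "fn x \<in> FS" using fn_feasible[of x] by (simp add: feasible_set_def)
   thus False using 0 by simp
  qed
  thus ?thesis using o 0 by (simp add: correct_output_def)
 next
  assume 1: "?b 0 = 1" "0 < ?b (Suc n)" "?x \<in> FS" and opt: "ALL x0:FS. EX x':FS. of_int ?K * (fo ?x - fo x0) <= fo x' - fo ?x"
   and "EX M. ALL y:FS. \<bar>fo y\<bar> <= M"
  then obtain B where B: "ALL y:FS. \<bar>fo y\<bar> <= B" by blast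
  let ?y = "output_point n M"
  have y: "?y \<in> carrier_vec n" by (simp add: output_point_def)
  have fy: "fn ?y = ?x" by (intro ext) (simp add: fn_def output_point_def oc)
  have fs: "fn x \<in> FS" "x \<in> carrier_vec n" if "x \<in> feasible_set I" for x
   using that fn_feasible[of x] by (auto simp: feasible_set_def)
  have "approx_solution ep (objective I) (feasible_set I) ?y"
  proof (rule approx_solutionI[where K="of_int ?K" and M="B / of_int (PP I)"])
   show "?y \<in> feasible_set I" using fn_feasible[OF y] 1(3) unfolding fy by simp
   show "\<bar>objective I x\<bar> <= B / of_int (PP I)" if "x \<in> feasible_set I" for x
    using bspec[OF B fs(1)[OF that]] fn_objective[OF fs(2)[OF that]] PPr by (simp add: pos_le_divide_eq abs_mult mult.commute)
   show "1 / ep <= of_int ?K" by simp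
   show "EX z:feasible_set I. of_int ?K * (objective I ?y - objective I x) <= objective I z - objective I ?y"
    if x: "x \<in> feasible_set I" for x proof -
    obtain x' where x': "x' \<in> FS" "of_int ?K * (fo ?x - fo (fn x)) <= fo x' - fo ?x" using bspec[OF opt fs(1)[OF x]] by blast
    have V: "x' \<in> Vn n" using x' by (simp add: fset_def)
    let ?z = "vec n x'"
    have z: "?z \<in> feasible_set I" using fn_feasible[of ?z] fn_surj[OF V] x'(1) by simp
    have e: "fo ?x = of_int (PP I) * objective I ?y" "fo (fn x) = of_int (PP I) * objective I x" "fo x' = of_int (PP I) * objective I ?z"
     using fn_objective[OF y] fn_objective[OF fs(2)[OF x]] fn_objective[of ?z] fy fn_surj[OF V] by simp_all
    have "of_int (PP I) * (of_int ?K * (objective I ?y - objective I x)) <= of_int (PP I) * (objective I ?z - objective I ?y)"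
     using x'(2) unfolding e by (simp add: algebra_simps)
    thus ?thesis using z PPr by (auto intro!: bexI[of _ ?z] simp: mult_le_cancel_left_pos)
   qed
  qed (use ep in auto)
  thus ?thesis using o oc 1 by (simp add: correct_output_def)
 qed
qed

end

section \<open>Accounting of the running time\<close>

lemma sum_list_vec: "sum_list (map f (list_of_vec v)) = (\<Sum>i<dim_vec v. f (v $ i))"
 by (simp add: sum_list_sum_nth list_of_vec_index lessThan_atLeast0)

lemma sum_list_mentries:
 fixes f :: "'a => nat"
 shows "sum_list (map f (mentries A)) = (\<Sum>i<dim_row A. \<Sum>j<dim_col A. f (A $$ (i, j)))"
proof -
 have c: "sum_list (map f (concat xss)) = sum_list (map (%xs. sum_list (map f xs)) xss)" for xss
  by (induction xss) auto
 have "sum_list (map f (mentries A)) = sum_list (map (%v. sum_list (map f (list_of_vec v))) (rows A))"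
  unfolding mentries_def c by (simp add: comp_def)
 also have "... = (\<Sum>i<dim_row A. \<Sum>j<dim_col A. f (A $$ (i, j)))"
  by (simp add: sum_list_vec sum_list_sum_nth rows_def lessThan_atLeast0)
 finally show ?thesis .
qed

lemma bitsum_size:
 assumes wf: "wf_emiqp I" shows "bitsum I = emiqp_size I"
proof -
 let ?f = "%x. 1 + rat_size x"
 have "bitsum I = (\<Sum>r<length (entries I). ?f (entries I ! r))"
  unfolding bitsum_def len[OF wf] by (simp add: num_def den_def rat_size_def)
 also have "... = sum_list (map ?f (entries I))" by (simp add: sum_list_sum_nth lessThan_atLeast0)
 also have "... = emiqp_size I" by (simp only: entries_def map_append sum_list_append sum_list_vec sum_list_mentries)
   (simp add: emiqp_size_def mat_size_def vec_size_def sum.distrib sum_Suc)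
 finally show ?thesis .
qed

text \<open>The sum \<open>3 + n + (1 / ep + 1) + size\<close> is at most
  \<open>4 + 2 * size + 1 / ep\<close>, and the 4 is absorbed by \<open>1 <= 1 / ep\<close>.\<close>

lemma tt_size:
 assumes wf: "wf_emiqp I" and ep: "0 < ep" "ep <= 1"
 shows "real (tt I ep) <= 6 * (real (emiqp_size I) + 1 / ep)"
proof -
 have "nvars I <= emiqp_size I" using dims[OF wf] by (simp add: emiqp_size_def vec_size_def)
 hence "real (nvars I) <= real (emiqp_size I)" by (rule of_nat_mono)
 moreover have "real (nat \<lceil>1 / ep\<rceil>) <= 1 / ep + 1" using ep by (simp add: of_nat_nat)
 moreover have "1 <= 1 / ep" using ep by simp
 moreover have "0 <= real (emiqp_size I)" by simp
 ultimately show ?thesis unfolding tt_def bitsum_size[OF wf] of_nat_add of_nat_numeral distrib_left by linarith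
qed

text \<open>The measure absorbs what is exponential in the number of integer variables, so that one
  program for all instances fits a calculus of polynomial bounds. The exponent is dictated by the
  number of offset tuples in \<open>offrange_power_le\<close>.\<close>

definition env0 :: "(emiqp \<times> real) env" where
 "env0 = \<lparr>edom = {z. wf_emiqp (fst z) & 0 < snd z & snd z <= 1},
  sz = (%z. (2 ^ nints (fst z) * tt (fst z) (snd z)) ^ (nints (fst z) + 2)),
  inp = (%z. input_memory (fst z) (snd z)), lev = 0, tab = (%_ _ _ _. None)\<rparr>"

lemma small_tt: "small env0 (%z. tt (fst z) (snd z))"
proof (rule smallI[of _ _ 1])
 fix z :: "emiqp \<times> real"
 let ?p = "nints (fst z)" let ?t = "tt (fst z) (snd z)"
 have "?t <= 2 ^ ?p * ?t" by simp
 also have "... <= (2 ^ ?p * ?t) ^ (?p + 2)" by (rule self_le_power) (auto simp: tt_def)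
 finally have "?t <= sz env0 z" by (simp only: env0_def env.simps)
 thus "?t <= (sz env0 z + 2) ^ 1" by simp
qed

text \<open>The range is at most \<open>128 * (2 ^ p * t)^2\<close>, and \<open>128 ^ p\<close> is
  the seventh power of \<open>2 ^ p\<close>. Altogether the exponent of \<open>2 ^ p * t\<close> is
  \<open>7 + 2 * p\<close>, at most \<open>9 * (p + 2)\<close>.\<close>

lemma offrange_power_le:
 assumes t: "p + 1 <= t" "nat K <= t"
 shows "offrange p K ^ p <= ((2 ^ p * t) ^ (p + 2)) ^ 9"
proof -
 let ?B = "2 ^ p * t"
 have B: "1 <= ?B" using t by simp
 have "(p + 1) * nat K <= t * t" using t by (rule mult_le_mono)
 hence "2 ^ p * ((p + 1) * nat K) <= 2 ^ p * (t * t)" by simp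
 also have "... <= 2 ^ p * 2 ^ p * (t * t)" by simp
 also have "... = ?B\<^sup>2" by (simp add: power2_eq_square)
 finally have "2 ^ p * ((p + 1) * nat K) <= ?B\<^sup>2" .
 moreover have "1 <= ?B\<^sup>2" using B by (rule one_le_power)
 moreover have "offrange p K = 80 * (2 ^ p * ((p + 1) * nat K)) + 3" by (simp add: offrange_def algebra_simps)
 ultimately have "offrange p K <= 128 * ?B\<^sup>2" by linarith
 hence "offrange p K ^ p <= (128 * ?B\<^sup>2) ^ p" by (rule power_mono) simp
 also have "... = (2 ^ 7) ^ p * ?B ^ (2 * p)" by (simp add: power_mult_distrib power_mult)
 also have "(2 ^ 7) ^ p = ((2 :: nat) ^ p) ^ 7" by (simp only: power_mult[symmetric] mult.commute)
 also have "... * ?B ^ (2 * p) <= ?B ^ 7 * ?B ^ (2 * p)" using t by (intro mult_right_mono power_mono) auto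
 also have "... = ?B ^ (7 + 2 * p)" by (rule power_add[symmetric])
 also have "... <= ?B ^ ((p + 2) * 9)" using B by (intro power_increasing) auto
 also have "... = (?B ^ (p + 2)) ^ 9" by (rule power_mult)
 finally show ?thesis .
qed

lemma small_cnt: "small env0 (%z. cntI (fst z) (snd z))" unfolding cntI_def
proof (rule small_mult)
 show "small env0 (%z. offrange (nvars (fst z) - (nvars (fst z) - nints (fst z))) \<lceil>1 / snd z\<rceil> ^ (nvars (fst z) - (nvars (fst z) - nints (fst z))))"
 proof (rule smallI[of _ _ 9])
  fix z assume "z \<in> edom env0"
  hence z: "nints (fst z) <= nvars (fst z)" by (simp add: env0_def wf_emiqp_def)
  hence e: "nvars (fst z) - (nvars (fst z) - nints (fst z)) = nints (fst z)" by simp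
  have "offrange (nints (fst z)) \<lceil>1 / snd z\<rceil> ^ nints (fst z) <= sz env0 z ^ 9"
   unfolding env0_def using z by (simp only: env.simps) (rule offrange_power_le; unfold tt_def, use z in linarith)
  also have "... <= (sz env0 z + 2) ^ 9" by (rule power_mono) auto
  finally show "offrange (nvars (fst z) - (nvars (fst z) - nints (fst z))) \<lceil>1 / snd z\<rceil> ^ (nvars (fst z) - (nvars (fst z) - nints (fst z)))
    <= (sz env0 z + 2) ^ 9" unfolding e .
 qed
 have s: "small env0 (%z. nvars (fst z))" by (rule small_mono[OF small_tt]) (simp add: tt_def)
 have k: "small env0 (%z. nat \<lceil>1 / snd z\<rceil>)" by (rule small_mono[OF small_tt]) (unfold tt_def, linarith)
 show "small env0 (%z. radix (nvars (fst z)) (1250 * tt (fst z) (snd z) ^ 4) \<lceil>1 / snd z\<rceil> ^ 6)"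
  unfolding radix_def by (intro small_power small_add small_mult small_const s k small_tt)
qed

theorem theorem1:
  shows "\<exists>A :: prog. \<forall>p :: nat. \<exists>C d :: nat. \<forall>(I :: emiqp) (\<epsilon> :: real).
    wf_emiqp I \<and> nints I = p \<and> 0 < \<epsilon> \<and> \<epsilon> \<le> 1 \<longrightarrow>
    (\<exists>t m. exec A (input_memory I \<epsilon>) t m \<and>
           correct_output I \<epsilon> m \<and>
           real t \<le> real C * (real (emiqp_size I) + 1 / \<epsilon>) ^ d)"
proof -
 let ?n = "%z. nvars (fst z)" let ?N = "%z :: emiqp \<times> real. 2 * ?n z + 1"
 let ?R = "%z. outc (?n z) (res (fst z) (snd z))"
 have ed: "z \<in> edom env0 \<longleftrightarrow> wf_emiqp (fst z) & 0 < snd z & snd z <= 1" for z by (simp add: env0_def)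
 have inp0: "inp env0 z = input_memory (fst z) (snd z)" for z by (simp add: env0_def)
 have sn: "small env0 ?n" by (rule small_mono[OF small_tt]) (simp add: tt_def)
 have n: "cmpn env0 ?n" by (rule cmp_cong[OF cmp_inp[OF cmp_const[of env0 0]]])
   (auto simp: inp0 input_memory_nth(1) intro: sbits_nat[OF sn])
 have N: "cmpn env0 ?N" "small env0 ?N"
  by (intro cmpn_add cmpn_mult cmpn_const n, intro small_add small_mult small_const sn)
 have "cmp (idx env0 ?N) (%z. ?R (fst z) (snd z))"
 proof (rule cmp_res[where I="%z. fst2 z" and ep="%z. snd (fst z)"])
  fix z assume "z \<in> edom (idx env0 ?N)"
  hence z: "wf_emiqp (fst2 z)" "0 < snd (fst z)" "snd z <= 2 * ?n (fst z)" by (auto simp: ed)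
  show "inp (idx env0 ?N) z = input_memory (fst2 z) (snd (fst z)) & length (entries (fst2 z)) = lenr (fst2 z) &
    0 < snd (fst z) & nints (fst2 z) <= nvars (fst2 z)"
   using z len[OF z(1)] by (simp add: inp0 wf_emiqp_def)
  show "symn (nvars (fst2 z)) (dQ (fst2 z)) & posdef (dQ (fst2 z)) (nvars (fst2 z))"
   using sym_data(2)[OF z(1)] pos_data[OF z(1)] by simp
  show "snd z <= 2 * nvars (fst2 z)" by (rule z(3))
 next
  show "small (idx env0 ?N) (%z. tt (fst2 z) (snd (fst z)))" by (rule small_idx[OF small_tt])
  show "small (idx env0 ?N) (%z. cntI (fst2 z) (snd (fst z)))" by (rule small_idx[OF small_cnt])
  show "cmpn (idx env0 ?N) snd" by (rule cmp_snd[OF N(2)])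
 qed
 hence "EX c T. small env0 T & (ALL x:edom env0. EX t m. exec c (inp env0 x) t m & (ALL j<?N x. m (int j) = ?R x j) & t <= T x)"
  by (intro cmp_top N) (simp add: env0_def)
 then obtain A T where T: "small env0 T"
  and A: "ALL x:edom env0. EX t m. exec A (inp env0 x) t m & (ALL j<?N x. m (int j) = ?R x j) & t <= T x" by (elim exE conjE)
 obtain a where a: "ALL x:edom env0. T x <= (sz env0 x + 2) ^ a" using T unfolding small_def by (rule exE)
 show ?thesis proof (intro exI[of _ A] allI)
  fix p
  \<comment> \<open>Only here is \<open>p\<close> a constant; the program has been fixed before. The
    factor 3 comes from \<open>?s + 2 <= 3 * ?s\<close>, the 6 from \<open>tt_size\<close>.\<close>
  let ?C = "3 ^ a * (6 * 2 ^ p) ^ ((p + 2) * a)" let ?d = "(p + 2) * a"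
  show "EX C d :: nat. ALL (I :: emiqp) (ep :: real). wf_emiqp I & nints I = p & 0 < ep & ep <= 1 -->
   (EX t m. exec A (input_memory I ep) t m & correct_output I ep m & real t <= real C * (real (emiqp_size I) + 1 / ep) ^ d)"
  proof (rule exI[of _ ?C], rule exI[of _ ?d], intro allI impI)
   fix I :: emiqp and ep :: real
   assume h: "wf_emiqp I & nints I = p & 0 < ep & ep <= 1"
   hence x: "(I, ep) \<in> edom env0" by (simp add: ed)
   obtain t m where tm: "exec A (input_memory I ep) t m" "ALL j<2 * nvars I + 1. m (int j) = outc (nvars I) (res I ep) j" "t <= T (I, ep)"
    using bspec[OF A x] by (auto simp: inp0)
   have "correct_output I ep m" using correct[of I ep m] h tm(2) by blast
   moreover have "real t <= real ?C * (real (emiqp_size I) + 1 / ep) ^ ?d" proof -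
    let ?u = "real (emiqp_size I) + 1 / ep" let ?s = "(2 ^ p * tt I ep) ^ (p + 2)"
    have s: "sz env0 (I, ep) = ?s" using h by (simp add: env0_def)
    have "1 <= ?s" by (rule one_le_power) (simp add: tt_def)
    hence s3: "?s + 2 <= 3 * ?s" by linarith
    have "T (I, ep) <= (?s + 2) ^ a" using bspec[OF a x] unfolding s .
    with tm(3) have "t <= (?s + 2) ^ a" by (rule le_trans)
    also have "... <= (3 * ?s) ^ a" using s3 by (rule power_mono) simp
    finally have "real t <= real ((3 * ?s) ^ a)" by (simp only: of_nat_le_iff)
    also have "... = 3 ^ a * ((2 ^ p * real (tt I ep)) ^ (p + 2)) ^ a" by (simp add: power_mult_distrib)
    also have "... <= 3 ^ a * ((2 ^ p * (6 * ?u)) ^ (p + 2)) ^ a"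
     using tt_size[of I ep] h by (intro mult_left_mono power_mono) auto
    also have "2 ^ p * (6 * ?u) = 6 * 2 ^ p * ?u" by simp
    also have "3 ^ a * ((6 * 2 ^ p * ?u) ^ (p + 2)) ^ a = 3 ^ a * (6 * 2 ^ p * ?u) ^ ?d" by (simp only: power_mult)
    also have "... = real ?C * ?u ^ ?d" by (simp add: power_mult_distrib)
    finally show ?thesis .
   qed
   ultimately show "EX t m. exec A (input_memory I ep) t m & correct_output I ep m & real t <= real ?C * (real (emiqp_size I) + 1 / ep) ^ ?d"
    using tm(1) by blast
  qed
 qed
qed

end
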